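(* Let $\varphi=\varphi(X,Y)$ be a Drinfeld associator and let $\beta:0\to1$ be a convolution-invertible morphism of $\widehat{\mathbf A}$. Put $\varphi=\varphi(c_{12},c_{23}):0\to3$, $R=\exp_*(c/2):0\to2$, $\mathbf r=\exp_*(\mu c/2):0\to1$, $\nu=\big(\mu^{[3]}(\mathrm{id}\otimes S\otimes\mathrm{id})\varphi\big)^{-1}:0\to1$ (convolution inverse) and $\alpha=\nu*\beta^{-1}$. Then $$H_{\varphi,\beta}=(1,\mu,\eta,\Delta,\epsilon,\varphi,S,\alpha,\beta,R,\mathbf r)$$ is a (triangular, cocommutative, special) ribbon quasi-Hopf algebra in $\widehat{\mathbf A}$. In particular, for $\beta=\eta$ one obtains a canonical ribbon quasi-Hopf algebra $H_\varphi=H_{\varphi,\eta}$ in $\widehat{\mathbf A}$ associated to the Drinfeld associator $\varphi$.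
   Context: $\mathbb K$ is a field of characteristic $0$. Category $\mathbf A$. A Jacobi diagram on a compact oriented $1$-manifold $X$ is a unitrivalent graph $D$ (dashed) with oriented trivalent vertices, univalent vertices embedded in $\mathrm{int}(X)$, each component of $D$ having a univalent vertex; up to homeomorphism of $(X\cup D,X)$ preserving orientations and components of $X$ and vertex-orientations. Degree is half the number of vertices. A chord is a component of $D$ without trivalent vertices. STU relation: $D_S=D_T-D_U$, where $D_S$ has a trivalent vertex joined by an edge to a univalent vertex on $X$, and $D_T,D_U$ arise by deleting this edge and attaching the two other edges to consecutive points of $X$ (with $X$ drawn horizontally, oriented left to right, $D$ above, vertices counterclockwise: uncrossed in $D_T$, crossed in $D_U$). For a group $\pi$, a restricted $\pi$-colored Jacobi diagram has in addition finitely many beads colored by $\pi$ in $\mathrm{int}(X)$ away from the univalent vertices; $\mathcal A(X,\pi)$ is the $\mathbb K$-space spanned by these modulo STU (no beads in the local picture) and the moves: consecutive beads $x,y$ along the orientation merge to $xy$; beads $1$ can be deleted; for a connected component $D_0$ of $D$ and $x\in\pi$, one may insert a bead $x$ just before and a bead $x^{-1}$ just after every univalent vertex of $D_0$. Objects of $\mathbf A$: $0,1,2,\dots$. $\mathbf A(m,n)=\mathcal A(X_n,F_m)$, where $X_n$ consists of $n$ cap-shaped arcs, each oriented from its right end to its left end, and $F_m$ is free on $x_1,\dots,x_m$. Composition $D'\circ D$ ($D:m\to n$, $D':n\to p$): write the beads of $D'$ as letters $x_j^{\pm1}$; replace the $j$-th arc of $D$ by as many parallel copies as there are letters $x_j^{\pm1}$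 in $D'$ (each univalent vertex on the arc is replaced by the sum over all copies of attaching it there—$0$ if there is a vertex and no copy—and beads are repeated on every copy); reverse each copy corresponding to a letter $x_j^{-1}$ (sign $-1$ per univalent vertex on it, beads inverted); insert the copies, respecting orientations, in place of the corresponding beads of $D'$. The identity of $n$ has bead $x_i$ on the $i$-th arc. The tensor product is addition on objects and juxtaposition (with renumbering) on morphisms; symmetry $P_{m,n}:m+n\to n+m$: no dashed part, bead $x_{m+j}$ on arc $j\le n$, bead $x_i$ on arc $n+i$. $\widehat{\mathbf A}$ is the degree-completion; it is a linear symmetric strict monoidal category. Morphisms: $\eta:0\to1$ (one arc, no bead); $\mu:2\to1$ (one arc with beads $x_2$ then $x_1$ met along the orientation, i.e. $x_1,x_2$ read from left to right); $\epsilon:1\to0$ (empty); $\Delta:1\to2$ (two arcs, each with bead $x_1$); $S:1\to1$ (bead $x_1^{-1}$); $c:0\to2$ (two arcs joined by one chord). These form a Casimir Hopf algebra in $\mathbf A$ (a cocommutative Hopf algebra with a primitive, symmetric, ad-invariant $2$-tensor $c$). $c_{ij}:0\to n$ denotes $n$ arcs with one chord joining arcs $i$ and $j$. $\mu^{[3]}=\mu(\mu\otimes\mathrm{id})$. Convolution. For an algebra $(H,\mu,\eta)$ in a symmetric strict monoidal category with unit $I$, let $\mu_n:H^{\otimes n}\otimes H^{\otimes n}\to H^{\otimes n}$ be the componentwise multiplication; $f*g=\mu_n(f\otimes g)$ for $f:X\to H^{\otimes n}$, $g:Y\to H^{\otimes n}$ with $X=I$ or $Y=I$. $\exp_*$ and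 inverses of morphisms $I\to H^{\otimes n}$ are with respect to $*$. Drinfeld associators. $\mathfrak t_n$ is the Lie algebra generated by $t_{ij}$ ($1\le i\ne j\le n$) with $t_{ij}=t_{ji}$, $[t_{ij},t_{ik}+t_{jk}]=0$, $[t_{ij},t_{kl}]=0$ (distinct indices). A Drinfeld associator is a group-like $\varphi(X,Y)\in\mathbb K\langle\langle X,Y\rangle\rangle$ ($X,Y$ primitive) such that $\varphi(t_{12},t_{23}+t_{24})\varphi(t_{13}+t_{23},t_{34})=\varphi(t_{23},t_{34})\varphi(t_{12}+t_{13},t_{24}+t_{34})\varphi(t_{12},t_{23})$, $e^{(t_{13}+t_{23})/2}=\varphi(t_{13},t_{12})e^{t_{13}/2}\varphi(t_{13},t_{23})^{-1}e^{t_{23}/2}\varphi(t_{12},t_{23})$, $e^{(t_{12}+t_{13})/2}=\varphi(t_{23},t_{13})^{-1}e^{t_{13}/2}\varphi(t_{12},t_{13})e^{t_{12}/2}\varphi(t_{12},t_{23})^{-1}$. Ribbon quasi-Hopf algebras in a symmetric strict monoidal category (unit $I$, symmetry $P$). A quasi-bialgebra is an algebra $(H,\mu,\eta)$ with algebra morphisms $\Delta:H\to H\otimes H$, $\epsilon:H\to I$ and a convolution-invertible $\varphi:I\to H^{\otimes3}$ such that $(\epsilon\otimes\mathrm{id})\Delta=\mathrm{id}=(\mathrm{id}\otimes\epsilon)\Delta$; $(\mathrm{id}\otimes\Delta)\Delta=\varphi*(\Delta\otimes\mathrm{id})\Delta*\varphi^{-1}$; $(\eta\otimes\varphi)*(\mathrm{id}\otimes\Delta\otimes\mathrm{id})\varphi*(\varphi\otimes\eta)=(\mathrm{id}\otimes\mathrm{id}\otimes\Delta)\varphi*(\Delta\otimes\mathrm{id}\otimes\mathrm{id})\varphi$;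 $(\mathrm{id}\otimes\epsilon\otimes\mathrm{id})\varphi=\eta\otimes\eta$. It is cocommutative if $P\Delta=\Delta$, and special if $\mu(\mathrm{id}\otimes x)=\mu(x\otimes\mathrm{id})$ for every $x:I\to H$. It is a quasi-Hopf algebra if equipped with an algebra anti-automorphism $S$ and convolution-invertible $\alpha,\beta:I\to H$ such that $\mu^{[3]}(S\otimes\alpha\otimes\mathrm{id})\Delta=\alpha\epsilon$, $\mu^{[3]}(\mathrm{id}\otimes\beta\otimes S)\Delta=\beta\epsilon$, $\mu^{[5]}(\mathrm{id}\otimes\beta\otimes S\otimes\alpha\otimes\mathrm{id})\varphi=\eta$, $\mu^{[5]}(S\otimes\alpha\otimes\mathrm{id}\otimes\beta\otimes S)\varphi^{-1}=\eta$. It is quasi-triangular if equipped with a convolution-invertible $R:I\to H\otimes H$ such that $R*\Delta*R^{-1}=P\Delta$, $(\Delta\otimes\mathrm{id})R=\varphi_{312}*R_{13}*\varphi_{132}^{-1}*R_{23}*\varphi_{123}$, $(\mathrm{id}\otimes\Delta)R=\varphi_{231}^{-1}*R_{13}*\varphi_{213}*R_{12}*\varphi_{123}^{-1}$, where $R_{12}=R\otimes\eta$, $R_{13}=(\mathrm{id}\otimes\eta\otimes\mathrm{id})R$, $R_{23}=\eta\otimes R$, and $\varphi_{ijk}$ is $\varphi$ with its first, second, third tensor factors placed in positions $i,j,k$. It is triangular if $R_{21}:=PR$ equals $R$. It is ribbon if equipped with a convolution-invertible $\mathbf r:I\to H$ with $S\mathbf r=\mathbf r$ and $\Delta\mathbf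 r=R_{21}*R*(\mathbf r\otimes\mathbf r)$. *)

theory Defs
  imports
    Complex_Main
    "HOL-Library.Multiset"
    "HOL-Library.FuncSet"
    "HOL-Library.Function_Algebras"
    "HOL-Algebra.Group"
begin

section \<open>Degreewise quotients of spaces of formal series\<close>

text \<open>
  A formal linear combination of elements of \<open>'b\<close> is its coefficient function.  For a set
  \<open>R\<close> of homogeneous finite combinations, \<open>deg_cong deg R\<close> is the congruence whose quotient is
  the degree-completion of (span of \<open>'b\<close>) modulo (span of \<open>R\<close>), that is, the product over all
  degrees \<open>d\<close> of the quotients of the degree \<open>d\<close> parts.
\<close>

interpretation coeff_fun: vector_space "\<lambda>(c :: 'k::field) (f :: 'b \<Rightarrow> 'k) x. c * f x"
  by unfold_locales (auto simp: algebra_simps)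

definition single :: "'b \<Rightarrow> 'b \<Rightarrow> 'k::field" where
  "single b = (\<lambda>x. if x = b then 1 else 0)"

definition homog_part :: "('b \<Rightarrow> nat) \<Rightarrow> nat \<Rightarrow> ('b \<Rightarrow> 'k::field) \<Rightarrow> ('b \<Rightarrow> 'k)" where
  "homog_part deg d f = (\<lambda>x. if deg x = d then f x else 0)"

definition deg_cong ::
    "('b \<Rightarrow> nat) \<Rightarrow> ('b \<Rightarrow> 'k::field) set \<Rightarrow> ('b \<Rightarrow> 'k) \<Rightarrow> ('b \<Rightarrow> 'k) \<Rightarrow> bool" where
  "deg_cong deg R f g \<longleftrightarrow> (\<forall>d. homog_part deg d (f - g) \<in> coeff_fun.span R)"


section \<open>Noncommutative power series and Drinfeld associators\<close>

text \<open>The algebra \<open>\<bbbK>\<langle>\<langle>'x\<rangle>\<rangle>\<close>: coefficients indexed by words.\<close>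

type_synonym ('x, 'k) ncps = "'x list \<Rightarrow> 'k"

definition nc_mult :: "('x, 'k::field) ncps \<Rightarrow> ('x, 'k) ncps \<Rightarrow> ('x, 'k) ncps"
    (infixl "\<star>" 70) where
  "f \<star> g = (\<lambda>w. \<Sum>i\<le>length w. f (take i w) * g (drop i w))"

abbreviation nc_one :: "('x, 'k::field) ncps" where
  "nc_one \<equiv> single []"

primrec nc_power :: "('x, 'k::field) ncps \<Rightarrow> nat \<Rightarrow> ('x, 'k) ncps" where
  "nc_power f 0 = nc_one"
| "nc_power f (Suc k) = f \<star> nc_power f k"

definition nc_inverse :: "('x, 'k::field) ncps \<Rightarrow> ('x, 'k) ncps" where
  "nc_inverse f = (THE g. f \<star> g = nc_one \<and> g \<star> f = nc_one)"

text \<open>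
  Exponential and substitution are used for series without constant term only; then the
  omitted summands (those with more factors than \<open>w\<close> has letters) have coefficient 0 at \<open>w\<close>.
\<close>

definition nc_exp :: "('x, 'k::field_char_0) ncps \<Rightarrow> ('x, 'k) ncps" where
  "nc_exp f = (\<lambda>w. \<Sum>k\<le>length w. nc_power f k w / fact k)"

datatype xy = X_gen | Y_gen

primrec nc_word :: "(xy \<Rightarrow> ('x, 'k::field) ncps) \<Rightarrow> xy list \<Rightarrow> ('x, 'k) ncps" where
  "nc_word \<theta> [] = nc_one"
| "nc_word \<theta> (x # u) = \<theta> x \<star> nc_word \<theta> u"

definition nc_subst ::
    "(xy, 'k::field) ncps \<Rightarrow> ('x, 'k) ncps \<Rightarrow> ('x, 'k) ncps \<Rightarrow> ('x, 'k) ncps" where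
  "nc_subst \<phi> A B =
     (\<lambda>w. \<Sum>u\<in>{u. length u \<le> length w}. \<phi> u * nc_word (case_xy A B) u w)"

text \<open>
  \<open>word_coproduct w u v\<close> is the coefficient of \<open>u \<otimes> v\<close> in the product, over the letters \<open>x\<close> of
  \<open>w\<close>, of the elements \<open>x \<otimes> 1 + 1 \<otimes> x\<close>.
\<close>

fun word_coproduct :: "xy list \<Rightarrow> xy list \<Rightarrow> xy list \<Rightarrow> 'k::field" where
  "word_coproduct [] u v = (if u = [] \<and> v = [] then 1 else 0)"
| "word_coproduct (x # w) u v =
     (if u \<noteq> [] \<and> hd u = x then word_coproduct w (tl u) v else 0) +
     (if v \<noteq> [] \<and> hd v = x then word_coproduct w u (tl v) else 0)"

definition nc_coproduct :: "(xy, 'k::field) ncps \<Rightarrow> xy list \<Rightarrow> xy list \<Rightarrow> 'k" where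
  "nc_coproduct \<phi> u v = (\<Sum>w\<in>{w. length w = length u + length v}. \<phi> w * word_coproduct w u v)"

definition group_like :: "(xy, 'k::field) ncps \<Rightarrow> bool" where
  "group_like \<phi> \<longleftrightarrow> \<phi> [] = 1 \<and> (\<forall>u v. nc_coproduct \<phi> u v = \<phi> u * \<phi> v)"

text \<open>
  The completed universal enveloping algebra of the Lie algebra \<open>\<tt>\<^sub>n\<close>.  The enveloping algebra
  of a Lie algebra presented by generators and relations is the associative algebra with the
  same presentation, brackets being read as commutators; so it is the quotient of the free
  algebra on the letters \<open>(i,j)\<close>, \<open>1 \<le> i \<noteq> j \<le> n\<close>, by the two-sided ideal spanned by
  \<open>t_ideal n\<close>.
\<close>

abbreviation t_gen :: "nat \<Rightarrow> nat \<Rightarrow> (nat \<times> nat, 'k::field) ncps" where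
  "t_gen i j \<equiv> single [(i, j)]"

definition nc_bracket :: "('x, 'k::field) ncps \<Rightarrow> ('x, 'k) ncps \<Rightarrow> ('x, 'k) ncps" where
  "nc_bracket f g = f \<star> g - g \<star> f"

inductive_set t_rel :: "nat \<Rightarrow> ((nat \<times> nat, 'k::field) ncps) set" for n where
  symm: "\<lbrakk>{i, j} \<subseteq> {1..n}; i \<noteq> j\<rbrakk> \<Longrightarrow> t_gen i j - t_gen j i \<in> t_rel n"
| four_term: "\<lbrakk>{i, j, k} \<subseteq> {1..n}; distinct [i, j, k]\<rbrakk>
    \<Longrightarrow> nc_bracket (t_gen i j) (t_gen i k + t_gen j k) \<in> t_rel n"
| locality: "\<lbrakk>{i, j, k, l} \<subseteq> {1..n}; distinct [i, j, k, l]\<rbrakk>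
    \<Longrightarrow> nc_bracket (t_gen i j) (t_gen k l) \<in> t_rel n"

definition t_words :: "nat \<Rightarrow> (nat \<times> nat) list set" where
  "t_words n = lists {(i, j). i \<in> {1..n} \<and> j \<in> {1..n} \<and> i \<noteq> j}"

definition t_ideal :: "nat \<Rightarrow> ((nat \<times> nat, 'k::field) ncps) set" where
  "t_ideal n = {single u \<star> r \<star> single v | u r v. u \<in> t_words n \<and> v \<in> t_words n \<and> r \<in> t_rel n}"

definition t_eq :: "nat \<Rightarrow> (nat \<times> nat, 'k::field) ncps \<Rightarrow> (nat \<times> nat, 'k) ncps \<Rightarrow> bool" where
  "t_eq n = deg_cong length (t_ideal n)"

definition drinfeld_associator :: "(xy, 'k::field_char_0) ncps \<Rightarrow> bool" where
  "drinfeld_associator \<phi> \<longleftrightarrow>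
     (let t = t_gen; \<Phi> = nc_subst \<phi>; \<Phi>_inv = nc_subst (nc_inverse \<phi>);
          exp_half = (\<lambda>f. nc_exp (\<lambda>w. f w / 2))
      in group_like \<phi> \<and>
         t_eq 4 (\<Phi> (t 1 2) (t 2 3 + t 2 4) \<star> \<Phi> (t 1 3 + t 2 3) (t 3 4))
                (\<Phi> (t 2 3) (t 3 4) \<star> \<Phi> (t 1 2 + t 1 3) (t 2 4 + t 3 4) \<star> \<Phi> (t 1 2) (t 2 3)) \<and>
         t_eq 3 (exp_half (t 1 3 + t 2 3))
                (\<Phi> (t 1 3) (t 1 2) \<star> exp_half (t 1 3) \<star> \<Phi>_inv (t 1 3) (t 2 3)
                   \<star> exp_half (t 2 3) \<star> \<Phi> (t 1 2) (t 2 3)) \<and>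
         t_eq 3 (exp_half (t 1 2 + t 1 3))
                (\<Phi>_inv (t 2 3) (t 1 3) \<star> exp_half (t 1 3) \<star> \<Phi> (t 1 2) (t 1 3)
                   \<star> exp_half (t 1 2) \<star> \<Phi>_inv (t 1 2) (t 2 3)))"


section \<open>Quasi-Hopf algebras in symmetric strict monoidal categories\<close>

record ('o, 'm) smc =
  Ob :: "'o set"
  Hom :: "'o \<Rightarrow> 'o \<Rightarrow> 'm set"
  Ident :: "'o \<Rightarrow> 'm"
  Comp :: "'m \<Rightarrow> 'm \<Rightarrow> 'm" (infixl "\<cdot>\<index>" 70)
  TObj :: "'o \<Rightarrow> 'o \<Rightarrow> 'o" (infixl "\<boxplus>\<index>" 75)
  UnitOb :: "'o" ("\<^bold>I\<index>")
  Tens :: "'m \<Rightarrow> 'm \<Rightarrow> 'm" (infixl "\<boxtimes>\<index>" 75)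
  Symm :: "'o \<Rightarrow> 'o \<Rightarrow> 'm" ("\<^bold>P\<index>")

locale symmetric_strict_monoidal_category =
  fixes C :: "('o, 'm, 'z) smc_scheme" (structure)
  assumes hom_objects: "f \<in> Hom C X Y \<Longrightarrow> X \<in> Ob C \<and> Y \<in> Ob C"
    and hom_disjoint: "\<lbrakk>f \<in> Hom C X Y; f \<in> Hom C X' Y'\<rbrakk> \<Longrightarrow> X = X' \<and> Y = Y'"
    and ident_closed: "X \<in> Ob C \<Longrightarrow> Ident C X \<in> Hom C X X"
    and comp_closed: "\<lbrakk>f \<in> Hom C X Y; g \<in> Hom C Y Z\<rbrakk> \<Longrightarrow> g \<cdot> f \<in> Hom C X Z"
    and comp_ident: "f \<in> Hom C X Y \<Longrightarrow> f \<cdot> Ident C X = f \<and> Ident C Y \<cdot> f = f"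
    and comp_assoc: "\<lbrakk>f \<in> Hom C W X; g \<in> Hom C X Y; h \<in> Hom C Y Z\<rbrakk>
          \<Longrightarrow> h \<cdot> g \<cdot> f = h \<cdot> (g \<cdot> f)"
    and unit_closed: "\<^bold>I \<in> Ob C"
    and tobj_closed: "\<lbrakk>X \<in> Ob C; Y \<in> Ob C\<rbrakk> \<Longrightarrow> X \<boxplus> Y \<in> Ob C"
    and tobj_unit: "X \<in> Ob C \<Longrightarrow> \<^bold>I \<boxplus> X = X \<and> X \<boxplus> \<^bold>I = X"
    and tobj_assoc: "\<lbrakk>X \<in> Ob C; Y \<in> Ob C; Z \<in> Ob C\<rbrakk> \<Longrightarrow> X \<boxplus> Y \<boxplus> Z = X \<boxplus> (Y \<boxplus> Z)"
    and tens_closed: "\<lbrakk>f \<in> Hom C X Y; g \<in> Hom C X' Y'\<rbrakk>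
          \<Longrightarrow> f \<boxtimes> g \<in> Hom C (X \<boxplus> X') (Y \<boxplus> Y')"
    and tens_ident: "\<lbrakk>X \<in> Ob C; Y \<in> Ob C\<rbrakk> \<Longrightarrow> Ident C X \<boxtimes> Ident C Y = Ident C (X \<boxplus> Y)"
    and tens_comp: "\<lbrakk>f \<in> Hom C X Y; g \<in> Hom C Y Z; f' \<in> Hom C X' Y'; g' \<in> Hom C Y' Z'\<rbrakk>
          \<Longrightarrow> (g \<cdot> f) \<boxtimes> (g' \<cdot> f') = (g \<boxtimes> g') \<cdot> (f \<boxtimes> f')"
    and tens_unit: "f \<in> Hom C X Y \<Longrightarrow> Ident C \<^bold>I \<boxtimes> f = f \<and> f \<boxtimes> Ident C \<^bold>I = f"
    and tens_assoc: "\<lbrakk>f \<in> Hom C X Y; g \<in> Hom C X' Y'; h \<in> Hom C X'' Y''\<rbrakk>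
          \<Longrightarrow> f \<boxtimes> g \<boxtimes> h = f \<boxtimes> (g \<boxtimes> h)"
    and symm_closed: "\<lbrakk>X \<in> Ob C; Y \<in> Ob C\<rbrakk> \<Longrightarrow> \<^bold>P X Y \<in> Hom C (X \<boxplus> Y) (Y \<boxplus> X)"
    and symm_natural: "\<lbrakk>f \<in> Hom C X Y; g \<in> Hom C X' Y'\<rbrakk>
          \<Longrightarrow> \<^bold>P Y Y' \<cdot> (f \<boxtimes> g) = (g \<boxtimes> f) \<cdot> \<^bold>P X X'"
    and symm_inverse: "\<lbrakk>X \<in> Ob C; Y \<in> Ob C\<rbrakk> \<Longrightarrow> \<^bold>P Y X \<cdot> \<^bold>P X Y = Ident C (X \<boxplus> Y)"
    and symm_hexagon: "\<lbrakk>X \<in> Ob C; Y \<in> Ob C; Z \<in> Ob C\<rbrakk>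
          \<Longrightarrow> \<^bold>P (X \<boxplus> Y) Z = (\<^bold>P X Z \<boxtimes> Ident C Y) \<cdot> (Ident C X \<boxtimes> \<^bold>P Y Z)"

record ('o, 'm) algebra_data =
  Car :: 'o
  Mu :: 'm
  Eta :: 'm

primrec tpow_ob :: "('o, 'm, 'z) smc_scheme \<Rightarrow> 'o \<Rightarrow> nat \<Rightarrow> 'o" where
  "tpow_ob C X 0 = \<^bold>I\<^bsub>C\<^esub>"
| "tpow_ob C X (Suc n) = X \<boxplus>\<^bsub>C\<^esub> tpow_ob C X n"

primrec eta_pow :: "('o, 'm, 'z) smc_scheme \<Rightarrow> ('o, 'm, 'y) algebra_data_scheme \<Rightarrow> nat \<Rightarrow> 'm" where
  "eta_pow C A 0 = Ident C \<^bold>I\<^bsub>C\<^esub>"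
| "eta_pow C A (Suc n) = Eta A \<boxtimes>\<^bsub>C\<^esub> eta_pow C A n"

text \<open>The componentwise multiplication \<open>\<mu>\<^sub>n\<close>.\<close>

primrec mu_pow :: "('o, 'm, 'z) smc_scheme \<Rightarrow> ('o, 'm, 'y) algebra_data_scheme \<Rightarrow> nat \<Rightarrow> 'm" where
  "mu_pow C A 0 = Ident C \<^bold>I\<^bsub>C\<^esub>"
| "mu_pow C A (Suc n) =
     (Mu A \<boxtimes>\<^bsub>C\<^esub> mu_pow C A n) \<cdot>\<^bsub>C\<^esub>
     (Ident C (Car A) \<boxtimes>\<^bsub>C\<^esub> \<^bold>P\<^bsub>C\<^esub> (tpow_ob C (Car A) n) (Car A)
        \<boxtimes>\<^bsub>C\<^esub> Ident C (tpow_ob C (Car A) n))"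

text \<open>\<open>f * g\<close> for morphisms \<open>f\<close>, \<open>g\<close> to the \<open>n\<close>-th tensor power (at least one of them from the unit object).\<close>

definition conv ::
    "('o, 'm, 'z) smc_scheme \<Rightarrow> ('o, 'm, 'y) algebra_data_scheme \<Rightarrow> nat \<Rightarrow> 'm \<Rightarrow> 'm \<Rightarrow> 'm" where
  "conv C A n f g = mu_pow C A n \<cdot>\<^bsub>C\<^esub> (f \<boxtimes>\<^bsub>C\<^esub> g)"

primrec conv_power ::
    "('o, 'm, 'z) smc_scheme \<Rightarrow> ('o, 'm, 'y) algebra_data_scheme \<Rightarrow> nat \<Rightarrow> 'm \<Rightarrow> nat \<Rightarrow> 'm" where
  "conv_power C A n f 0 = eta_pow C A n"
| "conv_power C A n f (Suc k) = conv C A n f (conv_power C A n f k)"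

definition is_conv_inverse ::
    "('o, 'm, 'z) smc_scheme \<Rightarrow> ('o, 'm, 'y) algebra_data_scheme \<Rightarrow> nat \<Rightarrow> 'm \<Rightarrow> 'm \<Rightarrow> bool" where
  "is_conv_inverse C A n f g \<longleftrightarrow>
     g \<in> Hom C \<^bold>I\<^bsub>C\<^esub> (tpow_ob C (Car A) n) \<and>
     conv C A n f g = eta_pow C A n \<and> conv C A n g f = eta_pow C A n"

definition conv_invertible ::
    "('o, 'm, 'z) smc_scheme \<Rightarrow> ('o, 'm, 'y) algebra_data_scheme \<Rightarrow> nat \<Rightarrow> 'm \<Rightarrow> bool" where
  "conv_invertible C A n f \<longleftrightarrow>
     f \<in> Hom C \<^bold>I\<^bsub>C\<^esub> (tpow_ob C (Car A) n) \<and> (\<exists>g. is_conv_inverse C A n f g)"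

definition conv_inverse ::
    "('o, 'm, 'z) smc_scheme \<Rightarrow> ('o, 'm, 'y) algebra_data_scheme \<Rightarrow> nat \<Rightarrow> 'm \<Rightarrow> 'm" where
  "conv_inverse C A n f = (THE g. is_conv_inverse C A n f g)"

text \<open>The iterated multiplications \<open>\<mu>\<^sup>[\<^sup>3\<^sup>]\<close> and \<open>\<mu>\<^sup>[\<^sup>5\<^sup>]\<close>.\<close>

definition mu3 :: "('o, 'm, 'z) smc_scheme \<Rightarrow> ('o, 'm, 'y) algebra_data_scheme \<Rightarrow> 'm" where
  "mu3 C A = Mu A \<cdot>\<^bsub>C\<^esub> (Mu A \<boxtimes>\<^bsub>C\<^esub> Ident C (Car A))"

definition mu5 :: "('o, 'm, 'z) smc_scheme \<Rightarrow> ('o, 'm, 'y) algebra_data_scheme \<Rightarrow> 'm" where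
  "mu5 C A = Mu A \<cdot>\<^bsub>C\<^esub>
     ((Mu A \<cdot>\<^bsub>C\<^esub> (mu3 C A \<boxtimes>\<^bsub>C\<^esub> Ident C (Car A))) \<boxtimes>\<^bsub>C\<^esub> Ident C (Car A))"

record ('o, 'm) qbialg_data = "('o, 'm) algebra_data" +
  Delta :: 'm
  Counit :: 'm
  Phi :: 'm

record ('o, 'm) qhopf_data = "('o, 'm) qbialg_data" +
  Antip :: 'm
  Alpha :: 'm
  Beta :: 'm

record ('o, 'm) qtri_data = "('o, 'm) qhopf_data" +
  Rmat :: 'm

record ('o, 'm) ribbon_data = "('o, 'm) qtri_data" +
  Rib :: 'm

locale algebra_in = symmetric_strict_monoidal_category C
  for C :: "('o, 'm, 'z) smc_scheme" (structure) +
  fixes H :: "('o, 'm, 'y) algebra_data_scheme"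
  assumes car_object: "Car H \<in> Ob C"
    and mu_closed: "Mu H \<in> Hom C (Car H \<boxplus> Car H) (Car H)"
    and eta_closed: "Eta H \<in> Hom C \<^bold>I (Car H)"
    and mu_assoc: "Mu H \<cdot> (Mu H \<boxtimes> Ident C (Car H)) = Mu H \<cdot> (Ident C (Car H) \<boxtimes> Mu H)"
    and mu_unit_left: "Mu H \<cdot> (Eta H \<boxtimes> Ident C (Car H)) = Ident C (Car H)"
    and mu_unit_right: "Mu H \<cdot> (Ident C (Car H) \<boxtimes> Eta H) = Ident C (Car H)"
begin

abbreviation idH :: 'm where "idH \<equiv> Ident C (Car H)"

abbreviation conv1 (infixl "\<star>\<^sub>1" 65) where "f \<star>\<^sub>1 g \<equiv> conv C H 1 f g"
abbreviation conv2 (infixl "\<star>\<^sub>2" 65) where "f \<star>\<^sub>2 g \<equiv> conv C H 2 f g"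
abbreviation conv3 (infixl "\<star>\<^sub>3" 65) where "f \<star>\<^sub>3 g \<equiv> conv C H 3 f g"
abbreviation conv4 (infixl "\<star>\<^sub>4" 65) where "f \<star>\<^sub>4 g \<equiv> conv C H 4 f g"

end

locale quasi_bialgebra = algebra_in C H
  for C :: "('o, 'm, 'z) smc_scheme" (structure)
    and H :: "('o, 'm, 'y) qbialg_data_scheme" +
  assumes delta_closed: "Delta H \<in> Hom C (Car H) (Car H \<boxplus> Car H)"
    and delta_mu: "Delta H \<cdot> Mu H = mu_pow C H 2 \<cdot> (Delta H \<boxtimes> Delta H)"
    and delta_eta: "Delta H \<cdot> Eta H = Eta H \<boxtimes> Eta H"
    and eps_closed: "Counit H \<in> Hom C (Car H) \<^bold>I"
    and eps_mu: "Counit H \<cdot> Mu H = Counit H \<boxtimes> Counit H"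
    and eps_eta: "Counit H \<cdot> Eta H = Ident C \<^bold>I"
    and phi_invertible: "conv_invertible C H 3 (Phi H)"
    and counit_left: "(Counit H \<boxtimes> idH) \<cdot> Delta H = idH"
    and counit_right: "(idH \<boxtimes> Counit H) \<cdot> Delta H = idH"
    and quasi_coassoc: "(idH \<boxtimes> Delta H) \<cdot> Delta H =
          Phi H \<star>\<^sub>3 (Delta H \<boxtimes> idH) \<cdot> Delta H \<star>\<^sub>3 conv_inverse C H 3 (Phi H)"
    and pentagon:
          "(Eta H \<boxtimes> Phi H) \<star>\<^sub>4 (idH \<boxtimes> Delta H \<boxtimes> idH) \<cdot> Phi H \<star>\<^sub>4 (Phi H \<boxtimes> Eta H) =
           (idH \<boxtimes> idH \<boxtimes> Delta H) \<cdot> Phi H \<star>\<^sub>4 (Delta H \<boxtimes> idH \<boxtimes> idH) \<cdot> Phi H"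
    and phi_counit: "(idH \<boxtimes> Counit H \<boxtimes> idH) \<cdot> Phi H = Eta H \<boxtimes> Eta H"
begin

definition cocommutative :: bool where
  "cocommutative \<longleftrightarrow> \<^bold>P (Car H) (Car H) \<cdot> Delta H = Delta H"

definition special :: bool where
  "special \<longleftrightarrow> (\<forall>x\<in>Hom C \<^bold>I (Car H). Mu H \<cdot> (idH \<boxtimes> x) = Mu H \<cdot> (x \<boxtimes> idH))"

end

locale quasi_Hopf_algebra = quasi_bialgebra C H
  for C :: "('o, 'm, 'z) smc_scheme" (structure)
    and H :: "('o, 'm, 'y) qhopf_data_scheme" +
  assumes antip_closed: "Antip H \<in> Hom C (Car H) (Car H)"
    and antip_bij: "\<exists>T\<in>Hom C (Car H) (Car H). T \<cdot> Antip H = idH \<and> Antip H \<cdot> T = idH"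
    and antip_mu: "Antip H \<cdot> Mu H = Mu H \<cdot> \<^bold>P (Car H) (Car H) \<cdot> (Antip H \<boxtimes> Antip H)"
    and antip_eta: "Antip H \<cdot> Eta H = Eta H"
    and alpha_invertible: "conv_invertible C H 1 (Alpha H)"
    and beta_invertible: "conv_invertible C H 1 (Beta H)"
    and antip_alpha: "mu3 C H \<cdot> (Antip H \<boxtimes> Alpha H \<boxtimes> idH) \<cdot> Delta H = Alpha H \<cdot> Counit H"
    and antip_beta: "mu3 C H \<cdot> (idH \<boxtimes> Beta H \<boxtimes> Antip H) \<cdot> Delta H = Beta H \<cdot> Counit H"
    and antip_phi: "mu5 C H \<cdot> (idH \<boxtimes> Beta H \<boxtimes> Antip H \<boxtimes> Alpha H \<boxtimes> idH) \<cdot> Phi H = Eta H"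
    and antip_phi_inverse:
          "mu5 C H \<cdot> (Antip H \<boxtimes> Alpha H \<boxtimes> idH \<boxtimes> Beta H \<boxtimes> Antip H)
             \<cdot> conv_inverse C H 3 (Phi H) = Eta H"

context quasi_bialgebra
begin

text \<open>
  In \<open>phi_ijk\<close> the first, second, third tensor factor of \<open>\<phi>\<close> is placed in position
  \<open>i\<close>, \<open>j\<close>, \<open>k\<close>.
\<close>

abbreviation "phi_132 \<equiv> (idH \<boxtimes> \<^bold>P (Car H) (Car H)) \<cdot> Phi H"
abbreviation "phi_213 \<equiv> (\<^bold>P (Car H) (Car H) \<boxtimes> idH) \<cdot> Phi H"
abbreviation "phi_231 \<equiv> \<^bold>P (Car H \<boxplus> Car H) (Car H) \<cdot> Phi H"
abbreviation "phi_312 \<equiv> \<^bold>P (Car H) (Car H \<boxplus> Car H) \<cdot> Phi H"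

abbreviation "pos_12 \<rho> \<equiv> \<rho> \<boxtimes> Eta H"
abbreviation "pos_13 \<rho> \<equiv> (idH \<boxtimes> Eta H \<boxtimes> idH) \<cdot> \<rho>"
abbreviation "pos_23 \<rho> \<equiv> Eta H \<boxtimes> \<rho>"
abbreviation "pos_21 \<rho> \<equiv> \<^bold>P (Car H) (Car H) \<cdot> \<rho>"

end

locale quasi_triangular_quasi_Hopf_algebra = quasi_Hopf_algebra C H
  for C :: "('o, 'm, 'z) smc_scheme" (structure)
    and H :: "('o, 'm, 'y) qtri_data_scheme" +
  assumes R_invertible: "conv_invertible C H 2 (Rmat H)"
    and R_delta: "Rmat H \<star>\<^sub>2 Delta H \<star>\<^sub>2 conv_inverse C H 2 (Rmat H) =
          \<^bold>P (Car H) (Car H) \<cdot> Delta H"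
    and hexagon_left: "(Delta H \<boxtimes> idH) \<cdot> Rmat H =
          phi_312 \<star>\<^sub>3 pos_13 (Rmat H) \<star>\<^sub>3 conv_inverse C H 3 phi_132
            \<star>\<^sub>3 pos_23 (Rmat H) \<star>\<^sub>3 Phi H"
    and hexagon_right: "(idH \<boxtimes> Delta H) \<cdot> Rmat H =
          conv_inverse C H 3 phi_231 \<star>\<^sub>3 pos_13 (Rmat H) \<star>\<^sub>3 phi_213
            \<star>\<^sub>3 pos_12 (Rmat H) \<star>\<^sub>3 conv_inverse C H 3 (Phi H)"
begin

definition triangular :: bool where
  "triangular \<longleftrightarrow> pos_21 (Rmat H) = Rmat H"

end

locale ribbon_quasi_Hopf_algebra = quasi_triangular_quasi_Hopf_algebra C H
  for C :: "('o, 'm, 'z) smc_scheme" (structure)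
    and H :: "('o, 'm, 'y) ribbon_data_scheme" +
  assumes rib_invertible: "conv_invertible C H 1 (Rib H)"
    and antip_rib: "Antip H \<cdot> Rib H = Rib H"
    and delta_rib: "Delta H \<cdot> Rib H =
          pos_21 (Rmat H) \<star>\<^sub>2 Rmat H \<star>\<^sub>2 (Rib H \<boxtimes> Rib H)"


section \<open>Free groups\<close>

text \<open>
  The letter \<open>(i, True)\<close> is the generator \<open>x\<^sub>i\<close> and \<open>(i, False)\<close> its inverse.  The index \<open>i\<close>
  runs over \<open>1, \<dots>, m\<close>; group elements are reduced words.
\<close>

type_synonym letter = "nat \<times> bool"
type_synonym fword = "letter list"

definition letter_inv :: "letter \<Rightarrow> letter" where
  "letter_inv l = (fst l, \<not> snd l)"

definition word_inv :: "fword \<Rightarrow> fword" where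
  "word_inv w = rev (map letter_inv w)"

definition reduced :: "fword \<Rightarrow> bool" where
  "reduced w \<longleftrightarrow> successively (\<lambda>a b. b \<noteq> letter_inv a) w"

fun reduce_cons :: "letter \<Rightarrow> fword \<Rightarrow> fword" where
  "reduce_cons a [] = [a]"
| "reduce_cons a (b # w) = (if b = letter_inv a then w else a # b # w)"

definition free_group :: "nat \<Rightarrow> fword monoid" where
  "free_group m =
     \<lparr>carrier = {w. reduced w \<and> fst ` set w \<subseteq> {1..m}},
      monoid.mult = (\<lambda>u v. foldr reduce_cons u v),
      one = []\<rparr>"

definition word_shift :: "nat \<Rightarrow> fword \<Rightarrow> fword" where
  "word_shift m = map (map_prod ((+) m) id)"


section \<open>Restricted colored Jacobi diagrams on \<open>n\<close> oriented arcs\<close>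

text \<open>
  The dashed edges carry labels (natural numbers).  An arc is the list of the univalent
  vertices and beads met along its orientation, a univalent vertex being represented by the
  label of its edge; a trivalent vertex is the triple of labels of its half-edges in their
  cyclic order.  Each label occurs exactly twice, at the two ends of its edge.  Diagrams with
  the same underlying homeomorphism class differ by renaming labels and rotating triples; both are
  imposed as relations below.  Reversing an edge that is a loop at a trivalent vertex fixes the
  labelled data, as it should.
\<close>

datatype 'g item = Leg nat | Bead 'g

datatype 'g jdiag = JD (arcs: "'g item list list") (verts: "(nat \<times> nat \<times> nat) multiset")

fun item_labels :: "'g item \<Rightarrow> nat list" where
  "item_labels (Leg e) = [e]"
| "item_labels (Bead g) = []"

fun item_beads :: "'g item \<Rightarrow> 'g list" where
  "item_beads (Leg e) = []"
| "item_beads (Bead g) = [g]"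

definition leg_labels :: "'g jdiag \<Rightarrow> nat list" where
  "leg_labels D = concat (map item_labels (concat (arcs D)))"

definition beads :: "'g jdiag \<Rightarrow> 'g list" where
  "beads D = concat (map item_beads (concat (arcs D)))"

fun vert_labels :: "nat \<times> nat \<times> nat \<Rightarrow> nat multiset" where
  "vert_labels (a, b, c) = {#a, b, c#}"

definition half_edges :: "'g jdiag \<Rightarrow> nat multiset" where
  "half_edges D = mset (leg_labels D) + \<Sum>\<^sub># (image_mset vert_labels (verts D))"

text \<open>Two edges are in the same connected component iff they are related by \<open>(edge_adj D)\<^sup>*\<close>.\<close>

definition edge_adj :: "'g jdiag \<Rightarrow> nat rel" where
  "edge_adj D = {(a, b). \<exists>v\<in>#verts D. a \<in># vert_labels v \<and> b \<in># vert_labels v}"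

definition jdiags :: "('g, 'z) monoid_scheme \<Rightarrow> nat \<Rightarrow> 'g jdiag set" where
  "jdiags G n = {D.
     length (arcs D) = n \<and>
     set (beads D) \<subseteq> carrier G \<and>
     (\<forall>e\<in>#half_edges D. count (half_edges D) e = 2) \<and>
     (\<forall>e\<in>#half_edges D. \<exists>e'\<in>set (leg_labels D). (e, e') \<in> (edge_adj D)\<^sup>*)}"

definition jdeg :: "'g jdiag \<Rightarrow> nat" where
  "jdeg D = (length (leg_labels D) + size (verts D)) div 2"

fun relabel_item :: "(nat \<Rightarrow> nat) \<Rightarrow> 'g item \<Rightarrow> 'g item" where
  "relabel_item \<sigma> (Leg e) = Leg (\<sigma> e)"
| "relabel_item \<sigma> (Bead g) = Bead g"

definition relabel_vert :: "(nat \<Rightarrow> nat) \<Rightarrow> nat \<times> nat \<times> nat \<Rightarrow> nat \<times> nat \<times> nat" where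
  "relabel_vert \<sigma> = (\<lambda>(a, b, c). (\<sigma> a, \<sigma> b, \<sigma> c))"

definition relabel :: "(nat \<Rightarrow> nat) \<Rightarrow> 'g jdiag \<Rightarrow> 'g jdiag" where
  "relabel \<sigma> D = JD (map (map (relabel_item \<sigma>)) (arcs D)) (image_mset (relabel_vert \<sigma>) (verts D))"

text \<open>Inserting \<open>x\<close> before and \<open>x\<^sup>-\<^sup>1\<close> after each univalent vertex of the component of the edge \<open>e\<close>.\<close>

definition conj_component ::
    "('g, 'z) monoid_scheme \<Rightarrow> nat \<Rightarrow> 'g \<Rightarrow> 'g jdiag \<Rightarrow> 'g jdiag" where
  "conj_component G e x D =
     JD (map (\<lambda>L. concat (map (\<lambda>t. case t of
             Leg a \<Rightarrow> if (e, a) \<in> (edge_adj D)\<^sup>* then [Bead x, Leg a, Bead (inv\<^bsub>G\<^esub> x)] else [Leg a]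
           | Bead g \<Rightarrow> [Bead g]) L)) (arcs D))
        (verts D)"

text \<open>
  The relators of \<open>\<A>(X\<^sub>n, G)\<close>.  In \<open>stu\<close>, seen from an arc drawn from left to right with the
  vertex above it, the counterclockwise order at the vertex is: edge \<open>e\<close> going down to the arc,
  right edge \<open>a\<close>, left edge \<open>b\<close>.  Uncrossed attachment therefore meets \<open>b\<close> first.
\<close>

inductive_set jrel :: "('g, 'z) monoid_scheme \<Rightarrow> nat \<Rightarrow> ('g jdiag \<Rightarrow> 'k::field) set"
  for G n where
  relabel: "\<lbrakk>D \<in> jdiags G n; inj \<sigma>\<rbrakk> \<Longrightarrow> single D - single (relabel \<sigma> D) \<in> jrel G n"
| rotate: "JD A (add_mset (a, b, c) V) \<in> jdiags G n \<Longrightarrow>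
     single (JD A (add_mset (a, b, c) V)) - single (JD A (add_mset (b, c, a) V)) \<in> jrel G n"
| stu: "JD (A @ (L @ [Leg e] @ M) # B) (add_mset (e, a, b) V) \<in> jdiags G n \<Longrightarrow>
     single (JD (A @ (L @ [Leg e] @ M) # B) (add_mset (e, a, b) V))
     - (single (JD (A @ (L @ [Leg b, Leg a] @ M) # B) V)
        - single (JD (A @ (L @ [Leg a, Leg b] @ M) # B) V)) \<in> jrel G n"
| merge: "JD (A @ (L @ [Bead x, Bead y] @ M) # B) V \<in> jdiags G n \<Longrightarrow>
     single (JD (A @ (L @ [Bead x, Bead y] @ M) # B) V)
     - single (JD (A @ (L @ [Bead (x \<otimes>\<^bsub>G\<^esub> y)] @ M) # B) V) \<in> jrel G n"
| unit: "JD (A @ (L @ [Bead \<one>\<^bsub>G\<^esub>] @ M) # B) V \<in> jdiags G n \<Longrightarrow>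
     single (JD (A @ (L @ [Bead \<one>\<^bsub>G\<^esub>] @ M) # B) V)
     - single (JD (A @ (L @ M) # B) V) \<in> jrel G n"
| conj: "\<lbrakk>D \<in> jdiags G n; e \<in># half_edges D; x \<in> carrier G\<rbrakk> \<Longrightarrow>
     single D - single (conj_component G e x D) \<in> jrel G n"


section \<open>The category \<open>\<A>\<close>: composition and tensor product of diagrams\<close>

text \<open>
  For the composition of \<open>D'\<close> with \<open>D\<close>, the beads of \<open>D'\<close> are spelled out as letters:
  \<open>spell\<close> turns an arc into a list of univalent vertices (\<open>Inl\<close>) and letters (\<open>Inr\<close>).
  The copies of the \<open>j\<close>-th arc of \<open>D\<close> are indexed by the occurrences \<open>(a, q)\<close> (arc number,
  position in the spelled arc) of letters \<open>x\<^sub>j\<^sup>\<plusminus>\<^sup>1\<close>.  A distribution \<open>\<kappa>\<close> chooses for each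
  univalent vertex of \<open>D\<close> the copy it is attached to.
\<close>

fun spell_item :: "fword item \<Rightarrow> (nat + letter) list" where
  "spell_item (Leg e) = [Inl e]"
| "spell_item (Bead w) = map Inr w"

definition spell :: "fword item list \<Rightarrow> (nat + letter) list" where
  "spell L = concat (map spell_item L)"

definition leg_positions :: "'g jdiag \<Rightarrow> (nat \<times> nat) set" where
  "leg_positions D = {(j, i). j < length (arcs D) \<and> i < length (arcs D ! j) \<and>
                              (\<exists>e. arcs D ! j ! i = Leg e)}"

text \<open>Arcs are listed from position 0 on, whereas generators are numbered from 1 on.\<close>

definition occurrences :: "fword jdiag \<Rightarrow> nat \<Rightarrow> (nat \<times> nat) set" where
  "occurrences D' j = {(a, q). a < length (arcs D') \<and> q < length (spell (arcs D' ! a)) \<and>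
                               (\<exists>s. spell (arcs D' ! a) ! q = Inr (Suc j, s))}"

definition distributions :: "fword jdiag \<Rightarrow> 'g jdiag \<Rightarrow> (nat \<times> nat \<Rightarrow> nat \<times> nat) set" where
  "distributions D' D = (\<Pi>\<^sub>E p\<in>leg_positions D. occurrences D' (fst p))"

definition is_negative :: "fword jdiag \<Rightarrow> nat \<times> nat \<Rightarrow> bool" where
  "is_negative D' p \<longleftrightarrow> (\<exists>j. spell (arcs D' ! fst p) ! snd p = Inr (j, False))"

fun invert_item :: "fword item \<Rightarrow> fword item" where
  "invert_item (Leg e) = Leg e"
| "invert_item (Bead w) = Bead (word_inv w)"

definition arc_copy ::
    "fword jdiag \<Rightarrow> (nat \<times> nat \<Rightarrow> nat \<times> nat) \<Rightarrow> nat \<Rightarrow> nat \<times> nat \<Rightarrow> fword item list" where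
  "arc_copy D \<kappa> j p =
     concat (map (\<lambda>(i, t). case t of
         Leg e \<Rightarrow> if \<kappa> (j, i) = p then [Leg e] else []
       | Bead w \<Rightarrow> [Bead w]) (List.enumerate 0 (arcs D ! j)))"

text \<open>\<open>D'\<close> and \<open>D\<close> are assumed here to have no edge labels in common.\<close>

definition glue ::
    "fword jdiag \<Rightarrow> fword jdiag \<Rightarrow> (nat \<times> nat \<Rightarrow> nat \<times> nat) \<Rightarrow> fword jdiag" where
  "glue D' D \<kappa> =
     JD (map (\<lambda>(a, L). concat (map (\<lambda>(q, t). case t of
             Inl e \<Rightarrow> [Leg e]
           | Inr (j, s) \<Rightarrow>
               (if s then arc_copy D \<kappa> (j - 1) (a, q)
                else rev (map invert_item (arc_copy D \<kappa> (j - 1) (a, q)))))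
             (List.enumerate 0 (spell L)))) (List.enumerate 0 (arcs D')))
        (verts D' + verts D)"

abbreviation even_labels :: "'g jdiag \<Rightarrow> 'g jdiag" where
  "even_labels \<equiv> relabel (\<lambda>e. 2 * e)"

abbreviation odd_labels :: "'g jdiag \<Rightarrow> 'g jdiag" where
  "odd_labels \<equiv> relabel (\<lambda>e. 2 * e + 1)"

definition comp_diag :: "fword jdiag \<Rightarrow> fword jdiag \<Rightarrow> (fword jdiag \<Rightarrow> 'k::field)" where
  "comp_diag D' D = (\<lambda>E. \<Sum>\<kappa>\<in>distributions D' D.
     (- 1) ^ card {p \<in> leg_positions D. is_negative D' (\<kappa> p)}
     * single (glue (even_labels D') (odd_labels D) \<kappa>) E)"

fun shift_item :: "nat \<Rightarrow> fword item \<Rightarrow> fword item" where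
  "shift_item m (Leg e) = Leg e"
| "shift_item m (Bead w) = Bead (word_shift m w)"

definition tens_diag :: "nat \<Rightarrow> fword jdiag \<Rightarrow> fword jdiag \<Rightarrow> (fword jdiag \<Rightarrow> 'k::field)" where
  "tens_diag m D D' = single
     (JD (arcs (even_labels D) @ map (map (shift_item m)) (arcs (odd_labels D')))
         (verts (even_labels D) + verts (odd_labels D')))"

text \<open>
  Bilinear extension of an operation on diagrams under which degrees add up; for series with
  finitely many terms in each degree the sum is finite.
\<close>

definition bilinear_ext ::
    "('d jdiag \<Rightarrow> 'd jdiag \<Rightarrow> 'd jdiag \<Rightarrow> 'k::field) \<Rightarrow>
     ('d jdiag \<Rightarrow> 'k) \<Rightarrow> ('d jdiag \<Rightarrow> 'k) \<Rightarrow> ('d jdiag \<Rightarrow> 'k)" where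
  "bilinear_ext b f g = (\<lambda>E. \<Sum>(D, D')\<in>{(D, D'). f D \<noteq> 0 \<and> g D' \<noteq> 0 \<and> jdeg D + jdeg D' = jdeg E}.
     f D * g D' * b D D' E)"


section \<open>The degree-completed category\<close>

text \<open>
  A morphism consists of source, target and a congruence class of series of diagrams with
  finitely many terms in each degree.
\<close>

datatype 'k jmor = Jmor (src: nat) (tgt: nat) (jclass: "(fword jdiag \<Rightarrow> 'k) set")

definition jseries :: "nat \<Rightarrow> nat \<Rightarrow> (fword jdiag \<Rightarrow> 'k::field) set" where
  "jseries m n = {f. (\<forall>D. f D \<noteq> 0 \<longrightarrow> D \<in> jdiags (free_group m) n) \<and>
                     (\<forall>d. finite {D. f D \<noteq> 0 \<and> jdeg D = d})}"

definition jcoset :: "nat \<Rightarrow> nat \<Rightarrow> (fword jdiag \<Rightarrow> 'k::field) \<Rightarrow> (fword jdiag \<Rightarrow> 'k) set" where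
  "jcoset m n f = {g \<in> jseries m n. deg_cong jdeg (jrel (free_group m) n) f g}"

definition jmor_of :: "nat \<Rightarrow> nat \<Rightarrow> (fword jdiag \<Rightarrow> 'k::field) \<Rightarrow> 'k jmor" where
  "jmor_of m n f = Jmor m n (jcoset m n f)"

definition jhom :: "nat \<Rightarrow> nat \<Rightarrow> 'k::field jmor set" where
  "jhom m n = jmor_of m n ` jseries m n"

text \<open>
  As for cosets of subgroups, operations on classes are the union of the classes of the results
  over all representatives.
\<close>

definition jcomp :: "'k::field jmor \<Rightarrow> 'k jmor \<Rightarrow> 'k jmor" where
  "jcomp G F = Jmor (src F) (tgt G)
     (\<Union>g\<in>jclass G. \<Union>f\<in>jclass F. jcoset (src F) (tgt G) (bilinear_ext comp_diag g f))"

definition jtens :: "'k::field jmor \<Rightarrow> 'k jmor \<Rightarrow> 'k jmor" where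
  "jtens F G = Jmor (src F + src G) (tgt F + tgt G)
     (\<Union>f\<in>jclass F. \<Union>g\<in>jclass G.
        jcoset (src F + src G) (tgt F + tgt G) (bilinear_ext (tens_diag (src F)) f g))"

definition jscale :: "'k::field \<Rightarrow> 'k jmor \<Rightarrow> 'k jmor" where
  "jscale a F = Jmor (src F) (tgt F) (\<Union>f\<in>jclass F. jcoset (src F) (tgt F) (\<lambda>D. a * f D))"

text \<open>
  The sum of a family of morphisms \<open>m \<rightarrow> n\<close> that converges in the degree topology, i.e. of which
  only finitely many members are nonzero in each given degree: it is computed from
  representatives with that property.
\<close>

definition jsum :: "nat \<Rightarrow> nat \<Rightarrow> ('i \<Rightarrow> 'k::field jmor) \<Rightarrow> 'k jmor" where
  "jsum m n F = Jmor m n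
     (\<Union>f\<in>{f. (\<forall>i. f i \<in> jclass (F i)) \<and>
              (\<forall>d. finite {i. \<exists>D. f i D \<noteq> 0 \<and> jdeg D = d})}.
        jcoset m n (\<lambda>D. \<Sum>i\<in>{i. f i D \<noteq> 0}. f i D))"

definition jdiag_mor :: "nat \<Rightarrow> nat \<Rightarrow> fword item list list \<Rightarrow> 'k::field jmor" where
  "jdiag_mor m n A = jmor_of m n (single (JD A {#}))"

abbreviation gen_bead :: "nat \<Rightarrow> fword item" where
  "gen_bead i \<equiv> Bead [(i, True)]"

definition A_hat :: "(nat, 'k::field jmor) smc" where
  "A_hat = \<lparr>
     Ob = UNIV,
     Hom = jhom,
     Ident = (\<lambda>n. jdiag_mor n n (map (\<lambda>i. [gen_bead i]) [1..<n+1])),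
     Comp = jcomp,
     TObj = (+),
     UnitOb = 0,
     Tens = jtens,
     Symm = (\<lambda>m n. jdiag_mor (m + n) (n + m)
       (map (\<lambda>j. [gen_bead (m + j)]) [1..<n+1] @ map (\<lambda>i. [gen_bead i]) [1..<m+1]))\<rparr>"


section \<open>The ribbon quasi-Hopf algebra of a Drinfeld associator\<close>

definition eta_A :: "'k::field jmor" where
  "eta_A = jdiag_mor 0 1 [[]]"

definition mu_A :: "'k::field jmor" where
  "mu_A = jdiag_mor 2 1 [[gen_bead 2, gen_bead 1]]"

definition eps_A :: "'k::field jmor" where
  "eps_A = jdiag_mor 1 0 []"

definition Delta_A :: "'k::field jmor" where
  "Delta_A = jdiag_mor 1 2 [[gen_bead 1], [gen_bead 1]]"

definition S_A :: "'k::field jmor" where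
  "S_A = jdiag_mor 1 1 [[Bead [(1, False)]]]"

text \<open>\<open>n\<close> arcs with one chord joining the (distinct) arcs \<open>i\<close> and \<open>j\<close>.\<close>

definition chord_A :: "nat \<Rightarrow> nat \<Rightarrow> nat \<Rightarrow> 'k::field jmor" where
  "chord_A n i j = jdiag_mor 0 n (map (\<lambda>k. if k = i \<or> k = j then [Leg 0] else []) [1..<n+1])"

definition c_A :: "'k::field jmor" where
  "c_A = chord_A 2 1 2"

definition alg_A :: "(nat, 'k::field jmor) algebra_data" where
  "alg_A = \<lparr>Car = 1, Mu = mu_A, Eta = eta_A\<rparr>"

definition exp_conv :: "nat \<Rightarrow> 'k::field_char_0 jmor \<Rightarrow> 'k jmor" where
  "exp_conv n x = jsum 0 n (\<lambda>k::nat. jscale (1 / fact k) (conv_power A_hat alg_A n x k))"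

primrec conv_word :: "nat \<Rightarrow> (xy \<Rightarrow> 'k::field jmor) \<Rightarrow> xy list \<Rightarrow> 'k jmor" where
  "conv_word n \<theta> [] = eta_pow A_hat alg_A n"
| "conv_word n \<theta> (x # u) = conv A_hat alg_A n (\<theta> x) (conv_word n \<theta> u)"

definition conv_subst :: "nat \<Rightarrow> (xy, 'k::field) ncps \<Rightarrow> 'k jmor \<Rightarrow> 'k jmor \<Rightarrow> 'k jmor" where
  "conv_subst n \<phi> a b = jsum 0 n (\<lambda>u. jscale (\<phi> u) (conv_word n (case_xy a b) u))"

definition phi_A :: "(xy, 'k::field) ncps \<Rightarrow> 'k jmor" where
  "phi_A \<phi> = conv_subst 3 \<phi> (chord_A 3 1 2) (chord_A 3 2 3)"

definition R_A :: "'k::field_char_0 jmor" where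
  "R_A = exp_conv 2 (jscale (1 / 2) c_A)"

definition r_A :: "'k::field_char_0 jmor" where
  "r_A = exp_conv 1 (jscale (1 / 2) (jcomp mu_A c_A))"

definition nu_A :: "(xy, 'k::field) ncps \<Rightarrow> 'k jmor" where
  "nu_A \<phi> = conv_inverse A_hat alg_A 1
     (jcomp (jcomp (mu3 A_hat alg_A)
               (jtens (jtens (Ident A_hat 1) S_A) (Ident A_hat 1)))
            (phi_A \<phi>))"

definition H_assoc_beta ::
    "(xy, 'k::field_char_0) ncps \<Rightarrow> 'k jmor \<Rightarrow> (nat, 'k jmor) ribbon_data" where
  "H_assoc_beta \<phi> \<beta> = \<lparr>
     Car = 1,
     Mu = mu_A,
     Eta = eta_A,
     Delta = Delta_A,
     Counit = eps_A,
     Phi = phi_A \<phi>,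
     Antip = S_A,
     Alpha = conv A_hat alg_A 1 (nu_A \<phi>) (conv_inverse A_hat alg_A 1 \<beta>),
     Beta = \<beta>,
     Rmat = R_A,
     Rib = r_A\<rparr>"

definition H_assoc :: "(xy, 'k::field_char_0) ncps \<Rightarrow> (nat, 'k jmor) ribbon_data" where
  "H_assoc \<phi> = H_assoc_beta \<phi> eta_A"

text \<open>A triangular, cocommutative, special ribbon quasi-Hopf algebra in \<open>C\<close>.\<close>

definition tcs_ribbon_quasi_Hopf_algebra ::
    "('o, 'm, 'z) smc_scheme \<Rightarrow> ('o, 'm, 'y) ribbon_data_scheme \<Rightarrow> bool" where
  "tcs_ribbon_quasi_Hopf_algebra C H \<longleftrightarrow>
     ribbon_quasi_Hopf_algebra C H \<and>
     quasi_triangular_quasi_Hopf_algebra.triangular C H \<and>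
     quasi_bialgebra.cocommutative C H \<and>
     quasi_bialgebra.special C H"

end

theory Submission
 imports Defs
begin

text \<open>The quotient by the relations is handled by duality. A vector lies outside the span of
  the relators exactly when some linear functional kills the relators but not the vector
  (\<open>not_in_span_functional\<close>). When a diagram is written as a word, with beads spelled
  out in letters and arcs ended by a stop symbol, the functionals that kill the relators become the
  \<open>jac\<close> functions: they are invariant under relabelling, rotation and free reduction,
  satisfy STU, and allow the conjugation of chords by letters. Conjugation of arbitrary components
  then follows by STU (\<open>jac_cz\<close>). Two series represent the same morphism if and only if
  all \<open>jac\<close> functions of bounded weight agree on them (\<open>span_jrel_iff\<close>,
  \<open>deg_cong_iff\<close>); a morphism \<open>F\<close> is therefore determined by its values
  \<open>EV F g\<close> (\<open>jhom_ext\<close>).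

  Composition is dual to an operation on functions. \<open>vs\<close> moves the symbols of the inner
  diagram one at a time to the letters of the outer one: a bead by substitution, a leg by a signed
  sum over the letters for its arc, as for a derivation. The sum over distributions in the
  definition of composition is this iterated sum (\<open>sum_glue\<close>). It respects the
  relations in the outer diagram because a leg inserted around a conjugated chord only produces a
  four-term relation (\<open>jac_four_term\<close>, \<open>jac_vs\<close>), and in the inner diagram
  because STU becomes the commutator of two insertions (\<open>jac_vs_right\<close>). Associativity
  rests on a Leibniz rule (\<open>vs_insb\<close>, \<open>vs_assoc\<close>). With this, the axioms
  of a symmetric strict monoidal category follow.

  Diagrams made of beads only compose by substitution in free groups, so the Hopf algebra identities
  between multiplication, coproduct, unit, counit and antipode are identities between reduced words
  (\<open>isb_unique_red\<close>). Diagrams with one chord satisfy the relations of the Lie algebra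
  of infinitesimal braids, again by STU (\<open>chord_four_term\<close>,
  \<open>chord_locality\<close>); hence convolution gives a homomorphism from the completed
  enveloping algebra to the morphisms from 0 to n (\<open>isT_mult\<close>,
  \<open>isT_t_eq\<close>). As the coproduct sends a chord to a sum of chords, this homomorphism
  turns the equations of a Drinfeld associator into the pentagon and the two hexagons
  (\<open>phi_pentagon\<close>, \<open>R_hexagon_left\<close>, \<open>R_hexagon_right\<close>).

  Every morphism from 0 to n commutes under convolution with the iterated coproduct, because
  conjugation of all its legs carries a bead from one end of the arcs to the other
  (\<open>invariance\<close>). So conjugation of the coproduct by \<phi> or R is trivial, and the
  morphisms from 0 to 1 are central; the antipode equations for \<alpha> and \<beta> thereby reduce
  to those of S. What remains is that the product of \<alpha>, \<beta> and
  \<open>zig oo phi_A \<phi>\<close> is the unit, which is the choice of \<alpha>, and the same for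
  \<open>zag oo phi' \<phi>\<close>. These two elements are equal by the pentagon
  (\<open>zag_eq_zig\<close>).

  For the ribbon element, the coproduct sends the loop (the product of the two ends of c) to the two
  loops on the strands plus twice c. These summands commute, and exponentiation gives the ribbon
  equation (\<open>delta_rib\<close>).\<close>

abbreviation iff_infix (infixr "<->" 25) where "A <-> B == (A :: bool) = B"

section \<open>Flattened diagrams and the functions on them that satisfy the relations\<close>

section \<open>Flat words and Jacobi functions\<close>

text \<open>
 The arcs of a diagram are written as one word, every arc being terminated by \<open>Sp\<close>.  Beads are
 spelled out as letters of the free group.
\<close>

datatype 'a sym = Lg nat | Lt 'a bool | Sp

type_synonym vset = "(nat * nat * nat) multiset"
type_synonym dword = "nat sym list * vset"
type_synonym 'k jfn = "dword => 'k"

primrec rl :: "(nat => nat) => 'a sym => 'a sym" where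
 "rl sg (Lg e) = Lg (sg e)"
| "rl sg (Lt a s) = Lt a s"
| "rl sg Sp = Sp"

abbreviation rv :: "(nat => nat) => vset => vset" where
 "rv sg V == image_mset (relabel_vert sg) V"

fun legs :: "'a sym list => nat list" where
 "legs [] = []"
| "legs (Lg e # u) = e # legs u"
| "legs (_ # u) = legs u"

lemma legs_append [simp]: "legs (u @ v) = legs u @ legs v" by (induction u rule: legs.induct) auto

definition vlabs :: "vset => nat multiset" where
 "vlabs V = \<Sum>\<^sub># (image_mset vert_labels V)"

lemma vlabs_simps [simp]:
 "vlabs {#} = {#}" "vlabs (add_mset (a, b, c) V) = {#a, b, c#} + vlabs V"
 "vlabs (V + W) = vlabs V + vlabs W" by (auto simp: vlabs_def)

lemma vlabs_rv [simp]: "vlabs (rv sg V) = image_mset sg (vlabs V)" by (induction V) (auto simp: relabel_vert_def)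

lemma relabel_vert_simp [simp]: "relabel_vert sg (a, b, c) = (sg a, sg b, sg c)" by (simp add: relabel_vert_def)

lemma legs_rl [simp]: "legs (map (rl sg) u) = map sg (legs u)" by (induction u rule: legs.induct) auto

text \<open>The number of vertices, that is, twice the degree. It is not halved, so that it is
  additive on arbitrary words, including those that do not come from a diagram.\<close>

definition wt :: "'a sym list * vset => nat" where
 "wt x = length (legs (fst x)) + size (snd x)"

definition cancel :: "('a sym list => 'k) => bool" where
 "cancel k <-> (ALL u v a s. k (u @ Lt a s # Lt a (~ s) # v) = k (u @ v))"

text \<open>
 Functions on diagrams that satisfy the relations of \<open>\<A>\<close>; the labels in "N" are those of
 half-edges that are kept outside of the diagram.
\<close>

definition jac :: "nat set => ('a sym list * vset => 'k::field) => bool" where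
 "jac N g <-> finite N &
  (ALL sg u V. inj sg & (ALL e:N. sg e = e) --> g (map (rl sg) u, rv sg V) = g (u, V)) &
  (ALL u a b c V. g (u, add_mset (a, b, c) V) = g (u, add_mset (b, c, a) V)) &
  (ALL u v e a b V. e ~: N Un set (legs u) Un set (legs v) Un set_mset (vlabs V) Un {a, b} -->
   g (u @ Lg e # v, add_mset (e, a, b) V) =
   g (u @ Lg b # Lg a # v, V) - g (u @ Lg a # Lg b # v, V)) &
  (ALL V. cancel (%u. g (u, V))) &
  (ALL u v w e j s V. e ~: N Un set (legs u) Un set (legs v) Un set (legs w) Un set_mset (vlabs V) -->
   g (u @ [Lt j s, Lg e, Lt j (~ s)] @ v @ [Lt j s, Lg e, Lt j (~ s)] @ w, V) =
   g (u @ [Lg e] @ v @ [Lg e] @ w, V))"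

lemma jac_finite: "jac N g ==> finite N" by (simp add: jac_def)

lemma jac_relabel:
 assumes "jac N g" "inj sg" "!!e. e : N ==> sg e = e"
 shows "g (map (rl sg) u, rv sg V) = g (u, V)" using assms(1) assms(2,3) by (simp add: jac_def)

lemma jac_rotate:
 assumes "jac N g"
 shows "g (u, add_mset (a, b, c) V) = g (u, add_mset (b, c, a) V)"
proof -
 have "ALL u a b c V. g (u, add_mset (a, b, c) V) = g (u, add_mset (b, c, a) V)" using assms(1) unfolding jac_def by (elim conjE)
 thus ?thesis by (elim allE)
qed

lemma jac_stu:
 assumes "jac N g" "e ~: N" "e ~: set (legs u)" "e ~: set (legs v)" "e ~:# vlabs V" "e ~= a" "e ~= b"
 shows "g (u @ Lg e # v, add_mset (e, a, b) V) =
  g (u @ Lg b # Lg a # v, V) - g (u @ Lg a # Lg b # v, V)"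
proof -
 have "ALL u v e a b V. e ~: N Un set (legs u) Un set (legs v) Un set_mset (vlabs V) Un {a, b} -->
   g (u @ Lg e # v, add_mset (e, a, b) V) =
   g (u @ Lg b # Lg a # v, V) - g (u @ Lg a # Lg b # v, V)" using assms(1) unfolding jac_def by (elim conjE)
 thus ?thesis using assms(2-) by simp
qed

lemma jac_cancelling:
 assumes "jac N g"
 shows "cancel (%u. g (u, V))"
proof -
 have "ALL V. cancel (%u. g (u, V))" using assms(1) unfolding jac_def by (elim conjE)
 thus ?thesis by (elim allE)
qed

lemma jac_cancel: "jac N g ==> g (u @ Lt a s # Lt a (~ s) # v, V) = g (u @ v, V)" using jac_cancelling[of N g V] unfolding cancel_def by simp

lemma jac_conj:
 assumes "jac N g" "e ~: N" "e ~: set (legs u)" "e ~: set (legs v)" "e ~: set (legs w)" "e ~:# vlabs V"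
 shows "g (u @ [Lt j s, Lg e, Lt j (~ s)] @ v @ [Lt j s, Lg e, Lt j (~ s)] @ w, V) =
  g (u @ [Lg e] @ v @ [Lg e] @ w, V)" using assms(1) assms(2-) by (simp add: jac_def)

lemma jacI:
 assumes "finite N"
  and "!!sg u V. inj sg ==> (!!e. e : N ==> sg e = e) ==> g (map (rl sg) u, rv sg V) = g (u, V)"
  and "!!u a b c V. g (u, add_mset (a, b, c) V) = g (u, add_mset (b, c, a) V)"
  and "!!u v e a b V. e ~: N ==> e ~: set (legs u) ==> e ~: set (legs v) ==> e ~:# vlabs V ==> e ~= a ==> e ~= b ==>
   g (u @ Lg e # v, add_mset (e, a, b) V) =
   g (u @ Lg b # Lg a # v, V) - g (u @ Lg a # Lg b # v, V)"
  and "!!V. cancel (%u. g (u, V))"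
  and "!!u v w e j s V. e ~: N ==> e ~: set (legs u) ==> e ~: set (legs v) ==> e ~: set (legs w) ==> e ~:# vlabs V ==>
   g (u @ [Lt j s, Lg e, Lt j (~ s)] @ v @ [Lt j s, Lg e, Lt j (~ s)] @ w, V) =
   g (u @ [Lg e] @ v @ [Lg e] @ w, V)"
 shows "jac N g" unfolding jac_def
 apply (intro conjI allI impI)
 subgoal by (rule assms(1))
 subgoal by (rule assms(2)) auto
 subgoal by (rule assms(3))
 subgoal by (rule assms(4)) auto
 subgoal by (rule assms(5))
 subgoal by (rule assms(6)) auto
 done

text \<open>The four-term relation, from two applications of STU.\<close>

lemma jac_four_term:
 assumes g: "jac N g" and e: "e ~: N" "e ~: set (legs u)" "e ~: set (legs v)" "e ~: set (legs w)"
  "e ~:# vlabs V" "e ~= l"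
 shows "g (u @ Lg l # Lg e # v @ Lg e # w, V) - g (u @ Lg e # Lg l # v @ Lg e # w, V)
   + g (u @ Lg e # v @ Lg l # Lg e # w, V) - g (u @ Lg e # v @ Lg e # Lg l # w, V) = 0"
proof -
 have "finite (N Un set (legs u) Un set (legs v) Un set (legs w) Un set_mset (vlabs V) Un {e, l})" using jac_finite[OF g] by simp
 then obtain f where f: "f ~: N Un set (legs u) Un set (legs v) Un set (legs w) Un set_mset (vlabs V) Un {e, l}"
  by (rule exE[OF ex_new_if_finite[OF infinite_UNIV_nat]])
 \<comment> \<open>The transposition of the chord label \<open>e\<close> and a fresh label
   \<open>f\<close>. A vertex with edges \<open>f\<close>, \<open>e\<close>, \<open>l\<close> can be
   attached at either end of the chord; the transposition and a rotation carry one attachment to the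
   other with two edges of the vertex exchanged, hence with the opposite sign. Resolving both by STU
   gives the four terms.\<close>
 define sg where "sg x = (if x = e then f else if x = f then e else x)" for x
 have id: "sg x = x" if "x ~= e" "x ~= f" for x using that by (simp add: sg_def)
 have fixu: "map (rl sg) x = x" if "e ~: set (legs x)" "f ~: set (legs x)" for x :: "'a sym list" using that by (induction x rule: legs.induct) (auto simp: id)
 have fixV: "rv sg V = V"
 proof -
  have "e ~:# vlabs V" "f ~:# vlabs V" using e f by auto
  thus ?thesis by (induction V) (auto simp: id)
 qed
 have ef: "sg e = f" "sg f = e" by (auto simp: sg_def)
 have 1: "g (u @ Lg f # (v @ Lg e # w), add_mset (f, e, l) V)
  = g (u @ Lg l # Lg e # v @ Lg e # w, V) - g (u @ Lg e # Lg l # v @ Lg e # w, V)" by (rule jac_stu[OF g]) (use f e in auto)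
 have 2: "g ((u @ Lg e # v) @ Lg f # w, add_mset (f, e, l) V)
  = g ((u @ Lg e # v) @ Lg l # Lg e # w, V) - g ((u @ Lg e # v) @ Lg e # Lg l # w, V)" by (rule jac_stu[OF g]) (use f e in auto)
 have 3: "g (u @ Lg f # (v @ Lg e # w), add_mset (f, l, e) V)
  = g (u @ Lg e # Lg l # v @ Lg e # w, V) - g (u @ Lg l # Lg e # v @ Lg e # w, V)" by (rule jac_stu[OF g]) (use f e in auto)
 have "g ((u @ Lg e # v) @ Lg f # w, add_mset (f, e, l) V)
  = g (map (rl sg) ((u @ Lg e # v) @ Lg f # w), rv sg (add_mset (f, e, l) V))"
  by (rule jac_relabel[OF g, symmetric]) (use f e in "auto simp: sg_def inj_def split: if_splits")
 also have "... = g (u @ Lg f # (v @ Lg e # w), add_mset (e, f, l) V)"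
 proof -
  have "map (rl sg) ((u @ Lg e # v) @ Lg f # w) = u @ Lg f # (v @ Lg e # w)" using f e by (simp add: fixu ef)
  moreover have "rv sg (add_mset (f, e, l) V) = add_mset (e, f, l) V" using f e by (simp add: fixV id ef)
  ultimately show ?thesis by simp
 qed
 also have "... = g (u @ Lg f # (v @ Lg e # w), add_mset (f, l, e) V)" by (rule jac_rotate[OF g])
 finally have "g (u @ Lg e # v @ Lg l # Lg e # w, V) - g (u @ Lg e # v @ Lg e # Lg l # w, V)
   = g (u @ Lg e # Lg l # v @ Lg e # w, V) - g (u @ Lg l # Lg e # v @ Lg e # w, V)" using 2 3 by simp
 moreover have "w - z + x - y = 0" if "x - y = z - w" for x y z w :: 'b using that by (simp add: algebra_simps)
 ultimately show ?thesis by blast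
qed

section \<open>Stability of the relations under substitution, contexts and relabelling\<close>

section \<open>Substitution of words for letters\<close>

definition lts :: "('a * bool) list => 'a sym list" where
 "lts w = map (%(a, s). Lt a s) w"

definition winv :: "('a * bool) list => ('a * bool) list" where
 "winv w = rev (map (%(a, s). (a, ~ s)) w)"

definition spow :: "bool => ('a * bool) list => ('a * bool) list" where
 "spow s w = (if s then w else winv w)"

fun lmap1 :: "('a => ('b * bool) list) => 'a sym => 'b sym list" where
 "lmap1 f (Lg e) = [Lg e]"
| "lmap1 f (Lt a s) = lts (spow s (f a))"
| "lmap1 f Sp = [Sp]"

definition lmap :: "('a => ('b * bool) list) => 'a sym list => 'b sym list" where
 "lmap f u = concat (map (lmap1 f) u)"

lemma lts_simps [simp]: "lts [] = []" "lts ((a, s) # w) = Lt a s # lts w" "lts (v @ w) = lts v @ lts w" by (auto simp: lts_def)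

lemma legs_lts [simp]: "legs (lts w) = []" by (induction w) auto

lemma winv_simps [simp]: "winv [] = []" "winv ((a, s) # w) = winv w @ [(a, ~ s)]"
 "winv (v @ w) = winv w @ winv v" "winv (winv w) = w" by (auto simp: winv_def rev_map comp_def case_prod_beta)

lemma spow_simps [simp]: "spow True w = w" "spow False w = winv w" by (auto simp: spow_def)

lemma spow_single [simp]: "spow s [(a, True)] = [(a, s)]" by (simp add: spow_def)

lemma spow_not: "spow (~ s) w = winv (spow s w)" by (cases s) auto

lemma lmap_simps [simp]: "lmap f [] = []" "lmap f (x # u) = lmap1 f x @ lmap f u"
 "lmap f (u @ v) = lmap f u @ lmap f v" by (auto simp: lmap_def)

lemma legs_lmap1 [simp]: "legs (lmap1 f x) = legs [x]" by (cases x) auto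

lemma legs_lmap [simp]: "legs (lmap f u) = legs u" by (induction u rule: legs.induct) auto

lemma map_rl_lts [simp]: "map (rl sg) (lts w) = lts w" by (induction w) auto

lemma map_rl_lmap: "map (rl sg) (lmap f u) = lmap f (map (rl sg) u)" by (induction u rule: legs.induct) auto

lemma cancelling_word: "cancel k ==> k (u @ lts w @ lts (winv w) @ v) = k (u @ v)"
proof (induction w arbitrary: u v rule: rev_induct)
 case (snoc x w)
 obtain a s where x: "x = (a, s)" by fastforce
 have "k (u @ lts (w @ [x]) @ lts (winv (w @ [x])) @ v)
   = k ((u @ lts w) @ Lt a s # Lt a (~ s) # (lts (winv w) @ v))" by (simp add: x)
 also have "... = k ((u @ lts w) @ (lts (winv w) @ v))" using snoc.prems unfolding cancel_def by blast
 finally show ?case using snoc by simp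
qed simp

lemma cancelling_word': "cancel k ==> k (u @ lts (winv w) @ lts w @ v) = k (u @ v)" using cancelling_word[of k u "winv w" v] by simp

lemma cancelling_prefix: "cancel k ==> cancel (%v. k (u @ v))" unfolding cancel_def by (metis append.assoc)

lemma cancelling_Cons: "cancel k ==> cancel (%v. k (x # v))" using cancelling_prefix[of k "[x]"] by simp

lemma cancelling_spow:
 assumes "cancel k"
 shows "k (u @ lts (spow s w) @ lts (spow (~ s) w) @ v) = k (u @ v)" unfolding spow_not by (rule cancelling_word[OF assms])

lemma cancelling_lmap: "cancel k ==> cancel (%u. k (lmap f u))" unfolding cancel_def[of "%u. k (lmap f u)"]
 using cancelling_spow[of k "lmap f u" s "f a" "lmap f v" for u v a s] by simp

lemma jac_conj_word:
 assumes g: "jac N g" and e: "e ~: N" "e ~: set (legs u)" "e ~: set (legs v)" "e ~: set (legs w)" "e ~:# vlabs V"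
 shows "g (u @ lts x @ Lg e # lts (winv x) @ v @ lts x @ Lg e # lts (winv x) @ w, V) =
   g (u @ Lg e # v @ Lg e # w, V)" using e
proof (induction x arbitrary: u v w rule: rev_induct)
 case (snoc y x)
 obtain a s where y: "y = (a, s)" by fastforce
 show ?case using jac_conj[OF g, of e "u @ lts x" "lts (winv x) @ v @ lts x" "lts (winv x) @ w" V a s] snoc by (simp add: y)
qed simp

text \<open>A homomorphism of free groups respects the relations: a cancelling pair of letters
  becomes a cancelling pair of words, and conjugation of a chord by a letter becomes conjugation by
  a word.\<close>

lemma jac_lmap:
 assumes g: "jac N g"
 shows "jac N (%(u, V). g (lmap f u, V))"
 apply (rule jacI)
 subgoal using g by (rule jac_finite)
 subgoal for sg u V using jac_relabel[OF g, of sg "lmap f u" V] by (simp add: map_rl_lmap)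
 subgoal for u a b c V using jac_rotate[OF g, of "lmap f u" a b c V] by simp
 subgoal for u v e a b V using jac_stu[OF g, of e "lmap f u" "lmap f v" V a b] by simp
 subgoal using cancelling_lmap[OF jac_cancelling[OF g]] by simp
 subgoal for u v w e j s V using jac_conj_word[OF g, of e "lmap f u" "lmap f v" "lmap f w" V "spow s (f j)"] by (simp add: spow_not)
 done

lemma map_rl_id: "(!!e. e : set (legs u) ==> sg e = e) ==> map (rl sg) u = u" by (induction u rule: legs.induct) auto

lemma rv_id: "(!!e. e \<in># vlabs V ==> sg e = e) ==> rv sg V = V" by (induction V) (auto simp: relabel_vert_def)

text \<open>This is the purpose of the label set of \<open>jac\<close>. The edges of the vertices
  put aside may continue inside the diagram, so their labels must be fixed by relabellings and must
  not serve as the edge contracted by STU or as the label of a conjugated chord.\<close>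

lemma jac_verts:
 assumes g: "jac N g"
 shows "jac (N Un set_mset (vlabs W)) (%(u, V). g (u, V + W))"
 apply (rule jacI)
 subgoal using g by (simp add: jac_finite)
 subgoal for sg u V using jac_relabel[OF g, of sg u "V + W"] rv_id[of W sg] by simp
 subgoal for u a b c V using jac_rotate[OF g, of u a b c "V + W"] by simp
 subgoal for u v e a b V using jac_stu[OF g, of e u v "V + W" a b] by simp
 subgoal using jac_cancelling[OF g] by simp
 subgoal for u v w e j s V using jac_conj[OF g, of e u v w "V + W" j s] by simp
 done

lemma jac_context:
 assumes g: "jac N g"
 shows "jac (N Un set (legs p) Un set (legs q)) (%(u, V). g (p @ u @ q, V))"
 apply (rule jacI)
 subgoal using g by (simp add: jac_finite)
 subgoal for sg u V using jac_relabel[OF g, of sg "p @ u @ q" "V"] map_rl_id[of p sg] map_rl_id[of q sg] by simp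
 subgoal for u a b c V using jac_rotate[OF g, of "p @ u @ q" a b c V] by simp
 subgoal for u v e a b V using jac_stu[OF g, of e "p @ u" "v @ q" V a b] by simp
 subgoal using jac_cancel[OF g, of "p @ u" for u] unfolding cancel_def by simp
 subgoal for u v w e j s V using jac_conj[OF g, of e "p @ u" v "w @ q" V j s] by simp
 done

lemma jac_pullback:
 assumes g: "jac N g" and t: "inj ta"
 shows "jac (ta -` N) (%(u, V). g (map (rl ta) u, rv ta V))"
 apply (rule jacI)
 subgoal using jac_finite[OF g] t by (simp add: finite_vimageI)
 subgoal premises s for sg u V
 proof -
  \<comment> \<open>An extension to all labels of \<open>sg\<close> transported along
    \<open>ta\<close>: it acts as \<open>sg\<close> on the image of \<open>ta\<close> and as the
    identity elsewhere, so it is injective and fixes \<open>N\<close>.\<close>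
  define \<rho> where "\<rho> y = (if y : range ta then ta (sg (inv_into UNIV ta y)) else y)" for y
  have rt: "\<rho> (ta x) = ta (sg x)" for x using t by (simp add: \<rho>_def)
  have "inj \<rho>"
  proof (rule injI)
   fix x y assume "\<rho> x = \<rho> y"
   thus "x = y" using t s(1) by (auto simp: \<rho>_def inj_eq split: if_splits)
  qed
  moreover have "\<rho> e = e" if "e : N" for e using that s(2) t by (auto simp: \<rho>_def)
  ultimately have "g (map (rl \<rho>) (map (rl ta) u), rv \<rho> (rv ta V)) = g (map (rl ta) u, rv ta V)" by (rule jac_relabel[OF g])
  moreover have "rl \<rho> (rl ta x) = rl ta (rl sg x)" for x :: "'a sym" by (cases x) (auto simp: rt)
  hence "map (rl \<rho>) (map (rl ta) u) = map (rl ta) (map (rl sg) u)" by simp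
  moreover have "rv \<rho> (rv ta V) = rv ta (rv sg V)" by (induction V) (auto simp: rt relabel_vert_def)
  ultimately show ?thesis by (simp del: map_map)
 qed
 subgoal for u a b c V using jac_rotate[OF g, of "map (rl ta) u" "ta a" "ta b" "ta c" "rv ta V"] by simp
 subgoal for u v e a b V using jac_stu[OF g, of "ta e" "map (rl ta) u" "map (rl ta) v" "rv ta V" "ta a" "ta b"] t by (auto simp: inj_eq inj_image_mem_iff)
 subgoal using jac_cancel[OF g] unfolding cancel_def by simp
 subgoal for u v w e j s V using jac_conj[OF g, of "ta e" "map (rl ta) u" "map (rl ta) v" "map (rl ta) w" "rv ta V" j s] t by (auto simp: inj_eq inj_image_mem_iff)
 done

lemma jac_lin:
 assumes j: "!!i. i : I ==> jac N (g i)" and N: "finite N"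
 shows "jac N (%x. SUM i:I. c i * g i x)"
 apply (rule jacI)
 subgoal by (rule N)
 subgoal by (intro sum.cong refl arg_cong2[where f = "(*)"] jac_relabel[OF j])
 subgoal by (intro sum.cong refl arg_cong2[where f = "(*)"] jac_rotate[OF j])
 subgoal unfolding sum_subtractf[symmetric] by (intro sum.cong refl) (simp add: jac_stu[OF j] algebra_simps)
 subgoal unfolding cancel_def by (intro allI sum.cong refl arg_cong2[where f = "(*)"] jac_cancel[OF j])
 subgoal by (intro sum.cong refl arg_cong2[where f = "(*)"] jac_conj[OF j])
 done

section \<open>Leg insertion and composition as operations on functions\<close>

section \<open>Insertion of legs and composition\<close>

text \<open>
 Sum over the occurrences of the letter \<open>x\<close> in a word: the block \<open>B\<close> is inserted before \<open>x\<close>,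
 respectively, with a sign, after \<open>x\<^sup>-\<^sup>1\<close>.
\<close>

fun insb :: "'a => 'a sym list => ('a sym list => 'k::field) => 'a sym list => 'k" where
 "insb x B g [] = 0"
| "insb x B g (y # u) = insb x B (%v. g (y # v)) u +
  (if y = Lt x True then g (B @ y # u) else if y = Lt x False then - g (y # B @ u) else 0)"

lemma insb_append:
 "insb x B g (u @ v) = insb x B (%u'. g (u' @ v)) u + insb x B (%v'. g (u @ v')) v" by (induction u arbitrary: g) auto

lemma insb_cong:
 assumes "!!v. mset (legs v) = mset (legs B) + mset (legs u) ==> g v = h v"
 shows "insb x B g u = insb x B h u" using assms
proof (induction u arbitrary: g h)
 case (Cons y u)
 have "insb x B (%v. g (y # v)) u = insb x B (%v. h (y # v)) u" by (rule Cons.IH, rule Cons.prems) (cases y; simp)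
 moreover have "g (B @ y # u) = h (B @ y # u)" by (rule Cons.prems) simp
 moreover have "g (y # B @ u) = h (y # B @ u)" by (rule Cons.prems) (cases y; simp)
 ultimately show ?case by auto
qed simp

lemma insb_zero [simp]: "insb x B (%v. 0) u = 0" by (induction u) auto

lemma insb_uminus: "insb x B (%v. - g v) u = - insb x B g u" by (induction u arbitrary: g) auto

lemma insb_add: "insb x B (%v. g v + h v) u = insb x B g u + insb x B h u" by (induction u arbitrary: g h) auto

lemma insb_sum: "insb x B (%v. SUM i:I. c i * g i v) u = (SUM i:I. c i * insb x B (g i) u)" by (induction u arbitrary: g)
  (auto simp: sum.distrib algebra_simps sum_negf)

lemma insb_diff: "insb x B (%v. g v - h v) u = insb x B g u - insb x B h u" by (induction u arbitrary: g h) auto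

lemma insb_rl:
 "insb x (map (rl sg) B) g (map (rl sg) u) = insb x B (%v. g (map (rl sg) v)) u"
proof (induction u arbitrary: g)
 case (Cons y u)
 thus ?case by (cases y) auto
qed simp

text \<open>A letter and its inverse contribute the block at the same place with opposite signs, up
  to cancelling letters. This is the reason for inserting before a letter but after an inverse
  letter.\<close>

lemma cancelling_insb:
 assumes k: "cancel k"
 shows "cancel (insb x B k)" unfolding cancel_def
proof (intro allI)
 fix u v a s
 have c: "k (u @ Lt a s # Lt a (~ s) # v) = k (u @ v)" for u v using k unfolding cancel_def by simp
 have c': "k (u @ B @ Lt a s # Lt a (~ s) # v) = k (u @ B @ v)" for u v using c[of "u @ B" v] by simp
 have c'': "k (u @ Lt a s # Lt a (~ s) # B @ v) = k (u @ B @ v)" for u v using c[of u "B @ v"] by simp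
 show "insb x B k (u @ Lt a s # Lt a (~ s) # v) = insb x B k (u @ v)" using c c' c'' by (cases s) (auto simp: insb_append)
qed

text \<open>The relation that needs an argument is the conjugation of a chord. The conjugating
  letters at the two ends of the chord offer four additional places for the new leg, and the signs
  make the four contributions a four-term relation. The label \<open>l\<close> becomes external,
  since its other end is not part of the word.\<close>

lemma jac_ins:
 assumes g: "jac N g"
 shows "jac (insert l N) (%(u, V). insb x [Lg l] (%v. g (v, V)) u)"
 apply (rule jacI)
 subgoal using g by (simp add: jac_finite)
 subgoal for sg u V using insb_rl[of x sg "[Lg l]" "%v. g (v, rv sg V)" u] jac_relabel[OF g, of sg] by simp
 subgoal for u a b c V by (simp only: prod.case) (rule arg_cong[where f = "%f. insb x [Lg l] f u"], rule ext, rule jac_rotate[OF g])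
 subgoal premises p for u v e a b V
 proof -
  have 1: "insb x [Lg l] (%w. g (w @ Lg e # v, add_mset (e, a, b) V)) u =
   insb x [Lg l] (%w. g (w @ Lg b # Lg a # v, V) - g (w @ Lg a # Lg b # v, V)) u"
  proof (rule insb_cong)
   fix w :: "'a sym list" assume "mset (legs w) = mset (legs [Lg l]) + mset (legs u)"
   hence "set (legs w) = insert l (set (legs u))" by (drule_tac arg_cong[of _ _ set_mset]) simp
   thus "g (w @ Lg e # v, add_mset (e, a, b) V) = g (w @ Lg b # Lg a # v, V) - g (w @ Lg a # Lg b # v, V)" using p by (intro jac_stu[OF g]) auto
  qed
  have 2: "insb x [Lg l] (%w. g (u @ Lg e # w, add_mset (e, a, b) V)) v =
   insb x [Lg l] (%w. g (u @ Lg b # Lg a # w, V) - g (u @ Lg a # Lg b # w, V)) v"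
  proof (rule insb_cong)
   fix w :: "'a sym list" assume "mset (legs w) = mset (legs [Lg l]) + mset (legs v)"
   hence "set (legs w) = insert l (set (legs v))" by (drule_tac arg_cong[of _ _ set_mset]) simp
   thus "g (u @ Lg e # w, add_mset (e, a, b) V) = g (u @ Lg b # Lg a # w, V) - g (u @ Lg a # Lg b # w, V)" using p by (intro jac_stu[OF g]) auto
  qed
  show ?thesis using 1 2 by (simp add: insb_append insb_diff)
 qed
 subgoal for V using cancelling_insb[OF jac_cancelling[OF g]] by simp
 subgoal premises p for u v w e j s V
 proof -
  let ?C = "[Lt j s, Lg e, Lt j (~ s)]"
  have 0: "g (u @ ?C @ v @ ?C @ w, V) = g (u @ Lg e # v @ Lg e # w, V)"
   if "e ~: set (legs u)" "e ~: set (legs v)" "e ~: set (legs w)" for u v w using jac_conj[OF g, of e u v w V j s] that p by simp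
  have set: "set (legs w) = insert l (set (legs u))"
   if "mset (legs w) = mset (legs [Lg l]) + mset (legs u)" for u w :: "'a sym list" using arg_cong[OF that, of set_mset] by simp
  have 1: "insb x [Lg l] (%z. g (z @ ?C @ v @ ?C @ w, V)) u = insb x [Lg l] (%z. g (z @ Lg e # v @ Lg e # w, V)) u"
   by (rule insb_cong, rule 0) (use p in "simp_all add: set")
  have 2: "insb x [Lg l] (%z. g (u @ ?C @ z @ ?C @ w, V)) v = insb x [Lg l] (%z. g (u @ Lg e # z @ Lg e # w, V)) v"
   by (rule insb_cong, rule 0) (use p in "simp_all add: set")
  have 3: "insb x [Lg l] (%z. g (u @ ?C @ v @ ?C @ z, V)) w = insb x [Lg l] (%z. g (u @ Lg e # v @ Lg e # z, V)) w"
   by (rule insb_cong, rule 0) (use p in "simp_all add: set")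
  have 4: "g (u @ Lg l # Lg e # v @ Lg e # w, V) - g (u @ Lg e # Lg l # v @ Lg e # w, V)
   + g (u @ Lg e # v @ Lg l # Lg e # w, V) - g (u @ Lg e # v @ Lg e # Lg l # w, V) = 0" using p by (intro jac_four_term[OF g]) auto
  have l: "l ~= e" using p by auto
  have 5: "g (u @ Lg l # ?C @ v @ ?C @ w, V) = g (u @ Lg l # Lg e # v @ Lg e # w, V)" using 0[of "u @ [Lg l]" v w] p l by simp
  have 6: "g (u @ ?C @ Lg l # v @ ?C @ w, V) = g (u @ Lg e # Lg l # v @ Lg e # w, V)" using 0[of u "Lg l # v" w] p l by simp
  have 7: "g (u @ ?C @ v @ Lg l # ?C @ w, V) = g (u @ Lg e # v @ Lg l # Lg e # w, V)" using 0[of u "v @ [Lg l]" w] p l by simp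
  have 8: "g (u @ ?C @ v @ ?C @ Lg l # w, V) = g (u @ Lg e # v @ Lg e # Lg l # w, V)" using 0[of u v "Lg l # w"] p l by simp
  \<comment> \<open>For a conjugation that begins with the inverse letter, the additional places lie
    between the conjugating letters and the chord ends, so the four-term relation is needed in this
    inner context. Otherwise they lie outside, and \<open>4\<close> applies.\<close>
  have 9: "g ((u @ [Lt j s]) @ Lg l # Lg e # (Lt j (~ s) # v @ [Lt j s]) @ Lg e # (Lt j (~ s) # w), V)
   - g ((u @ [Lt j s]) @ Lg e # Lg l # (Lt j (~ s) # v @ [Lt j s]) @ Lg e # (Lt j (~ s) # w), V)
   + g ((u @ [Lt j s]) @ Lg e # (Lt j (~ s) # v @ [Lt j s]) @ Lg l # Lg e # (Lt j (~ s) # w), V)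
   - g ((u @ [Lt j s]) @ Lg e # (Lt j (~ s) # v @ [Lt j s]) @ Lg e # Lg l # (Lt j (~ s) # w), V) = 0" using p by (intro jac_four_term[OF g]) auto
  show ?thesis
  proof (cases "j = x")
   case False
   thus ?thesis using 1 2 3 by (simp add: insb_append)
  next
   case True
   show ?thesis
   proof (cases s)
   case T: True
   have "insb x [Lg l] (%u. g (u, V)) (u @ ?C @ v @ ?C @ w)
   = insb x [Lg l] (%u. g (u, V)) (u @ [Lg e] @ v @ [Lg e] @ w)
   + (g (u @ Lg l # Lg e # v @ Lg e # w, V) - g (u @ Lg e # Lg l # v @ Lg e # w, V)
   + g (u @ Lg e # v @ Lg l # Lg e # w, V) - g (u @ Lg e # v @ Lg e # Lg l # w, V))" using 1 2 3 5 6 7 8 T True by (simp add: insb_append)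
   thus ?thesis using 4 by simp
   next
   case F: False
   have "insb x [Lg l] (%u. g (u, V)) (u @ ?C @ v @ ?C @ w)
   = insb x [Lg l] (%u. g (u, V)) (u @ [Lg e] @ v @ [Lg e] @ w)
   - (g ((u @ [Lt j s]) @ Lg l # Lg e # (Lt j (~ s) # v @ [Lt j s]) @ Lg e # (Lt j (~ s) # w), V)
   - g ((u @ [Lt j s]) @ Lg e # Lg l # (Lt j (~ s) # v @ [Lt j s]) @ Lg e # (Lt j (~ s) # w), V)
   + g ((u @ [Lt j s]) @ Lg e # (Lt j (~ s) # v @ [Lt j s]) @ Lg l # Lg e # (Lt j (~ s) # w), V)
   - g ((u @ [Lt j s]) @ Lg e # (Lt j (~ s) # v @ [Lt j s]) @ Lg e # Lg l # (Lt j (~ s) # w), V))" using 1 2 3 F True by (simp add: insb_append)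
   thus ?thesis using 9 by simp
   qed
  qed
 qed
 done

text \<open>
 The value of \<open>g\<close> on the composite of the diagram \<open>u\<close> with the diagram \<open>A\<close>.  The symbols on the arc
 \<open>j\<close> of \<open>A\<close> are moved one by one to the left of the letters \<open>Inl j\<close> of \<open>u\<close>, which are deleted
 in the end.
\<close>

definition lstrip :: "nat + 'a => ('a * bool) list" where
 "lstrip = case_sum (%_. []) (%a. [(a, True)])"

definition lsub :: "nat => 'a => bool => nat + 'a => ((nat + 'a) * bool) list" where
 "lsub j a s z = (if z = Inl j then [(Inr a, s), (Inl j, True)] else [(z, True)])"

fun vs :: "nat => 'a sym list => ('a sym list => 'k::field) => (nat + 'a) sym list => 'k" where
 "vs j [] g u = g (lmap lstrip u)"
| "vs j (Sp # A) g u = vs (Suc j) A g u"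
| "vs j (Lt a s # A) g u = vs j A g (lmap (lsub j a s) u)"
| "vs j (Lg e # A) g u = insb (Inl j) [Lg e] (vs j A g) u"

lemma vs_fun_simps [simp]:
 "vs j (Sp # A) g = vs (Suc j) A g"
 "vs j (Lt a s # A) g = (%u. vs j A g (lmap (lsub j a s) u))"
 "vs j (Lg e # A) g = insb (Inl j) [Lg e] (vs j A g)" by (rule ext, simp)+

lemma lstrip_simps [simp]: "lstrip (Inl j) = []" "lstrip (Inr a) = [(a, True)]" by (auto simp: lstrip_def)

lemma lsub_simps [simp]: "lsub j a s (Inl j) = [(Inr a, s), (Inl j, True)]"
 "lsub j a s (Inr b) = [(Inr b, True)]" "i ~= j ==> lsub j a s (Inl i) = [(Inl i, True)]" by (auto simp: lsub_def)

lemma lmap1_lsub_other: "z ~= Inl j ==> lmap1 (lsub j a s) (Lt z t) = [Lt z t]" by (cases t) (auto simp: lsub_def)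

lemma cancelling_vs: "cancel g ==> cancel (vs j A g)"
proof (induction A arbitrary: j)
 case Nil
 thus ?case using cancelling_lmap[of g lstrip] by (simp add: cancel_def)
next
 case (Cons y A)
 show ?case
 proof (cases y)
  case (Lg e)
  thus ?thesis using cancelling_insb[OF Cons.IH[OF Cons.prems]] by (simp add: cancel_def)
 next
  case (Lt a s)
  thus ?thesis using cancelling_lmap[OF Cons.IH[OF Cons.prems]] by (simp add: cancel_def)
 next
  case Sp
  thus ?thesis using Cons.IH[OF Cons.prems] by (simp add: cancel_def)
 qed
qed

text \<open>Composition respects the relations in the outer diagram \<open>u\<close>: a leg of the
  inner diagram \<open>A\<close> acts by an insertion and a bead by a substitution, and both
  preserve the relations. The legs of \<open>A\<close> become external labels.\<close>

lemma jac_vs: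
 assumes g: "jac N g"
 shows "jac (N Un set (legs A)) (%(u, V). vs j A (%v. g (v, V)) u)"
proof (induction A arbitrary: j)
 case Nil
 thus ?case using jac_lmap[OF g, of lstrip] by simp
next
 case (Cons y A)
 show ?case
 proof (cases y)
  case (Lg e)
  thus ?thesis using jac_ins[OF Cons.IH[of j], of e "Inl j"] by simp
 next
  case (Lt a s)
  thus ?thesis using jac_lmap[OF Cons.IH[of j], of "lsub j a s"] by simp
 next
  case Sp
  thus ?thesis using Cons.IH[of "Suc j"] by simp
 qed
qed

lemma vs_cong:
 assumes "!!v. mset (legs v) = mset (legs A) + mset (legs u) ==> g v = h v"
 shows "vs j A g u = vs j A h u" using assms
proof (induction A arbitrary: j u)
 case (Cons y A)
 show ?case
 proof (cases y)
  case (Lg e)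
  have "insb (Inl j) [Lg e] (vs j A g) u = insb (Inl j) [Lg e] (vs j A h) u" by (rule insb_cong, rule Cons.IH, rule Cons.prems) (simp add: Lg)
  thus ?thesis by (simp add: Lg)
 qed (use Cons in auto)
qed simp

lemma vs_sum: "vs j A (%v. SUM i:I. c i * g i v) u = (SUM i:I. c i * vs j A (g i) u)"
proof (induction A arbitrary: j u)
 case (Cons y A)
 show ?case
 proof (cases y)
  case (Lg e)
  have "vs j A (%v. SUM i:I. c i * g i v) = (%u. SUM i:I. c i * vs j A (g i) u)" using Cons.IH by blast
  thus ?thesis by (simp add: Lg insb_sum)
 qed (use Cons in auto)
qed simp

lemma vs_rl: "vs j (map (rl sg) A) g (map (rl sg) u) = vs j A (%v. g (map (rl sg) v)) u"
proof (induction A arbitrary: j u)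
 case Nil
 thus ?case by (simp add: map_rl_lmap)
next
 case (Cons y A)
 show ?case
 proof (cases y)
  case (Lg e)
  thus ?thesis by (simp add: insb_rl[of _ _ "[Lg e]", simplified] Cons.IH)
 qed (use Cons in "auto simp: map_rl_lmap[symmetric]")
qed

text \<open>In the commutator of two insertions the terms that use different letters cancel. Those
  that put both legs at one letter are the two sides of STU; at an inverse letter the order of the
  two legs and the sign are both reversed, in agreement with the insertion of the single leg
  \<open>e\<close>.\<close>

lemma insb_commutator:
 assumes "!!u v. e ~: set (legs u) ==> e ~: set (legs v) ==>
   K' (u @ Lg e # v) = K (u @ Lg b # Lg a # v) - K (u @ Lg a # Lg b # v)"
  and "e ~: set (legs w)"
 shows "insb x [Lg e] K' w = insb x [Lg b] (insb x [Lg a] K) w - insb x [Lg a] (insb x [Lg b] K) w" using assms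
proof (induction w arbitrary: K K')
 case (Cons y w)
 have ey: "e ~: set (legs [y])" "e ~: set (legs w)" using Cons.prems(2) by (cases y; simp)+
 have IH: "insb x [Lg e] (%v. K' (y # v)) w
   = insb x [Lg b] (insb x [Lg a] (%v. K (y # v))) w - insb x [Lg a] (insb x [Lg b] (%v. K (y # v))) w"
 proof (rule Cons.IH)
  fix u v :: "'a sym list"
  assume "e ~: set (legs u)" "e ~: set (legs v)"
  thus "K' (y # u @ Lg e # v) = K (y # u @ Lg b # Lg a # v) - K (y # u @ Lg a # Lg b # v)" using Cons.prems(1)[of "y # u" v] ey by (cases y; simp)
 qed (fact ey)
 have 1: "K' (Lg e # y # w) = K (Lg b # Lg a # y # w) - K (Lg a # Lg b # y # w)" using Cons.prems(1)[of "[]" "y # w"] Cons.prems(2) by simp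
 have 2: "K' (y # Lg e # w) = K (y # Lg b # Lg a # w) - K (y # Lg a # Lg b # w)" using Cons.prems(1)[of "[y]" "w"] ey by simp
 show ?case using IH 1 2 by (auto simp: insb_add insb_uminus insb_diff)
qed simp

definition cj :: "nat => 'a => bool => 'a sym list => 'a sym list" where
 "cj e z s u = concat (map (%x. if x = Lg e then [Lt z s, Lg e, Lt z (~ s)] else [x]) u)"

lemma cj_simps [simp]: "cj e z s [] = []"
 "cj e z s (x # u) = (if x = Lg e then [Lt z s, Lg e, Lt z (~ s)] else [x]) @ cj e z s u"
 "cj e z s (u @ v) = cj e z s u @ cj e z s v" by (auto simp: cj_def)

lemma cj_id: "e ~: set (legs u) ==> cj e z s u = u" by (induction u rule: legs.induct) auto

lemma insb_cj:
 "x ~= z ==> insb x (cj e z s B) k (cj e z s u) = insb x B (%v. k (cj e z s v)) u" by (induction u arbitrary: k) auto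

lemma cancelling_lsub:
 assumes "cancel k"
 shows "k (lmap (lsub j a (~ s)) (lmap (lsub j a s) u)) = k u" using assms
proof (induction u arbitrary: k)
 case (Cons y u)
 note c = cancelling_Cons[OF Cons.prems]
 have ca: "k (Lt a s # Lt a (~ s) # v) = k v" "k (Lt a (~ s) # Lt a s # v) = k v" for v a s using Cons.prems[unfolded cancel_def, rule_format, of "[]" a s v]
   Cons.prems[unfolded cancel_def, rule_format, of "[]" a "~ s" v] by auto
 have ca': "k (x # Lt a s # Lt a (~ s) # v) = k (x # v)" "k (x # Lt a (~ s) # Lt a s # v) = k (x # v)" for v a s x using Cons.prems[unfolded cancel_def, rule_format, of "[x]" a s v]
   Cons.prems[unfolded cancel_def, rule_format, of "[x]" a "~ s" v] by auto
 show ?case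
 proof (cases y)
  case (Lg e)
  thus ?thesis using Cons.IH[OF c[of y]] by simp
 next
  case (Lt z t)
  show ?thesis
  proof (cases "z = Inl j")
   case True
   thus ?thesis using Lt Cons.IH[OF c[of y]] by (cases t) (auto simp: ca ca')
  next
   case False
   thus ?thesis using Lt Cons.IH[OF c[of y]] by (simp add: lmap1_lsub_other del: lmap1.simps)
  qed
 next
  case Sp
  thus ?thesis using Cons.IH[OF c[of y]] by simp
 qed
qed simp

text \<open>The symbols \<open>Lt a s\<close>, \<open>Lg e\<close>, \<open>Lt a (~ s)\<close> of an
  arc, moved one after the other, arrive as one block at the letter that receives the leg; at all
  other letters the two substituted letters cancel.\<close>

lemma insb_lsub:
 assumes "cancel k"
 shows "insb (Inl j) [Lg e] (%v. k (lmap (lsub j a (~ s)) v)) (lmap (lsub j a s) w)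
   = insb (Inl j) [Lt (Inr a) s, Lg e, Lt (Inr a) (~ s)] k w" using assms
proof (induction w arbitrary: k)
 case (Cons y w)
 note c = cancelling_Cons[OF Cons.prems]
 note IH = Cons.IH[OF c[of y]]
 have ca: "k (Lt a s # Lt a (~ s) # v) = k v" "k (Lt a (~ s) # Lt a s # v) = k v" for v a s using Cons.prems[unfolded cancel_def, rule_format, of "[]" a s v]
   Cons.prems[unfolded cancel_def, rule_format, of "[]" a "~ s" v] by auto
 have ca': "k (x # Lt a s # Lt a (~ s) # v) = k (x # v)" "k (x # Lt a (~ s) # Lt a s # v) = k (x # v)" for v a s x using Cons.prems[unfolded cancel_def, rule_format, of "[x]" a s v]
   Cons.prems[unfolded cancel_def, rule_format, of "[x]" a "~ s" v] by auto
 show ?case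
 proof (cases "EX t. y = Lt (Inl j) t")
  case True
  then obtain t where y: "y = Lt (Inl j) t" by blast
  have 1: "k (v @ lmap (lsub j a (~ s)) (lmap (lsub j a s) w)) = k (v @ w)" for v using cancelling_lsub[OF cancelling_prefix[OF Cons.prems]] .
  show ?thesis using IH 1[of "[Lt (Inr a) s, Lg e, Lt (Inr a) (~ s), y]"] 1[of "[y, Lt (Inr a) s, Lg e, Lt (Inr a) (~ s)]"] by (cases t) (simp_all add: y ca ca')
 next
  case False
  have "lmap1 (lsub j a t) y = [y]" for t using False by (cases y) (auto simp: lmap1_lsub_other simp del: lmap1.simps(2))
  thus ?thesis using IH False by auto
 qed
qed simp

lemma cj_lsub: "cj e (Inr z) s (lmap (lsub j a t) u) = lmap (lsub j a t) (cj e (Inr z) s u)"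
proof (induction u)
 case (Cons y u)
 have c: "cj e (Inr z) s (lts w) = lts w" for w by (rule cj_id) simp
 thus ?case using Cons by (cases y) (auto simp: c)
qed simp

lemma cj_lstrip: "cj e z s (lmap lstrip u) = lmap lstrip (cj e (Inr z) s u)"
proof (induction u)
 case (Cons y u)
 have c: "cj e z s (lts w) = lts w" for w by (rule cj_id) simp
 thus ?case using Cons by (cases y) (auto simp: c)
qed simp

text \<open>The legs labelled \<open>e\<close> in the result are those of \<open>A\<close> and those
  of \<open>u\<close>. Conjugating both kinds beforehand is therefore the same as conjugating in the
  result; for the legs of \<open>A\<close> this is \<open>insb_lsub\<close>.\<close>

lemma vs_cj:
 assumes g: "cancel g"
 shows "vs j (cj e z s A) g (cj e (Inr z) s u) = vs j A (%v. g (cj e z s v)) u"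
proof (induction A arbitrary: j u)
 case Nil
 thus ?case by (simp add: cj_lstrip)
next
 case (Cons y A)
 show ?case
 proof (cases "y = Lg e")
  case True
  have "vs j (cj e z s (y # A)) g (cj e (Inr z) s u)
   = insb (Inl j) [Lg e] (%v. vs j (cj e z s A) g (lmap (lsub j z (~ s)) v)) (lmap (lsub j z s) (cj e (Inr z) s u))" by (simp add: True)
  also have "... = insb (Inl j) (cj e (Inr z) s [Lg e]) (vs j (cj e z s A) g) (cj e (Inr z) s u)" using insb_lsub[OF cancelling_vs[OF g]] by simp
  also have "... = insb (Inl j) [Lg e] (%v. vs j (cj e z s A) g (cj e (Inr z) s v)) u" by (rule insb_cj) simp
  finally show ?thesis using Cons.IH by (simp add: True)
 next
  case False
  show ?thesis
  proof (cases y)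
   case (Lg l)
   hence "vs j (cj e z s (y # A)) g (cj e (Inr z) s u)
   = insb (Inl j) (cj e (Inr z) s [Lg l]) (vs j (cj e z s A) g) (cj e (Inr z) s u)" using False by simp
   also have "... = insb (Inl j) [Lg l] (%v. vs j (cj e z s A) g (cj e (Inr z) s v)) u" by (rule insb_cj) simp
   finally show ?thesis using Cons.IH by (simp add: Lg)
  qed (use Cons in "auto simp: cj_lsub[symmetric]")
 qed
qed

lemma split_leg:
 "e : set (legs v) ==> EX v1 v2. v = v1 @ Lg e # v2 & e ~: set (legs v1)"
proof (induction v rule: legs.induct)
 case (2 l u)
 show ?case
 proof (cases "l = e")
  case True
  thus ?thesis by (intro exI[of _ "[]"] exI[of _ u]) simp
 next
  case False
  then obtain v1 v2 where "u = v1 @ Lg e # v2" "e ~: set (legs v1)" using 2 by auto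
  thus ?thesis using False by (intro exI[of _ "Lg l # v1"] exI[of _ v2]) simp
 qed
next
 case ("3_1" a s u)
 then obtain v1 v2 where "u = v1 @ Lg e # v2" "e ~: set (legs v1)" by auto
 thus ?case by (intro exI[of _ "Lt a s # v1"] exI[of _ v2]) simp
next
 case ("3_2" u)
 then obtain v1 v2 where "u = v1 @ Lg e # v2" "e ~: set (legs v1)" by auto
 thus ?case by (intro exI[of _ "Sp # v1"] exI[of _ v2]) simp
qed simp

lemma jac_cj:
 assumes g: "jac N g" and "e ~: N" "e ~:# vlabs V" "count (mset (legs v)) e = 2"
 shows "g (cj e z s v, V) = g (v, V)"
proof -
 have "e : set (legs v)" using assms(4) by (metis count_greater_zero_iff pos2 set_mset_mset)
 then obtain v1 v' where 1: "v = v1 @ Lg e # v'" "e ~: set (legs v1)" using split_leg by blast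
 hence "count (mset (legs v')) e = 1" using assms(4) by (simp add: count_eq_zero_iff[THEN iffD2] not_in_iff)
 hence "e : set (legs v')" by (metis count_greater_zero_iff less_numeral_extra(1) set_mset_mset)
 then obtain v2 v3 where 2: "v' = v2 @ Lg e # v3" "e ~: set (legs v2)" using split_leg by blast
 hence "count (mset (legs v3)) e = 0" using \<open>count (mset (legs v')) e = 1\<close> by simp
 hence 3: "e ~: set (legs v3)" by (simp add: count_eq_zero_iff)
 show ?thesis using jac_conj[OF g, of e v1 v2 v3 V z s] 1 2 3 assms by (simp add: cj_id)
qed

text \<open>Composition respects the relations in the inner diagram \<open>A\<close>. STU is a
  commutator of insertions, applied after the preceding symbols have been moved; a cancelling pair
  of beads gives two inverse substitutions; conjugation of a chord passes to the result by
  \<open>vs_cj\<close> and is removed there.\<close>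

lemma jac_vs_right:
 assumes g: "jac N g"
 shows "jac (N Un set (legs u)) (%(A, V). vs j A (%v. g (v, V)) u)"
 apply (rule jacI)
 subgoal using g by (simp add: jac_finite)
 subgoal for sg A V using vs_rl[of j sg A "%v. g (v, rv sg V)" u] jac_relabel[OF g, of sg _ V] map_rl_id[of u sg] by simp
 subgoal for A a b c V by (simp only: prod.case) (rule arg_cong[where f = "%f. vs j A f u"], rule ext, rule jac_rotate[OF g])
 subgoal premises p for A1 A2 e a b V
 proof -
  have "vs j (A1 @ Lg e # A2) (%v. g (v, add_mset (e, a, b) V)) u
   = vs j (A1 @ Lg b # Lg a # A2) (%v. g (v, V)) u - vs j (A1 @ Lg a # Lg b # A2) (%v. g (v, V)) u"
   if "e ~: set (legs A1)" "e ~: set (legs u)" for j u using that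
  proof (induction A1 arbitrary: j u)
   case Nil
   have "insb (Inl j) [Lg e] (vs j A2 (%v. g (v, add_mset (e, a, b) V))) u
   = insb (Inl j) [Lg b] (insb (Inl j) [Lg a] (vs j A2 (%v. g (v, V)))) u
   - insb (Inl j) [Lg a] (insb (Inl j) [Lg b] (vs j A2 (%v. g (v, V)))) u"
   proof (rule insb_commutator)
   fix u v :: "(nat + 'a) sym list"
   assume "e ~: set (legs u)" "e ~: set (legs v)"
   thus "vs j A2 (%v. g (v, add_mset (e, a, b) V)) (u @ Lg e # v) =
   vs j A2 (%v. g (v, V)) (u @ Lg b # Lg a # v) - vs j A2 (%v. g (v, V)) (u @ Lg a # Lg b # v)" using jac_stu[OF jac_vs[OF g, of A2 j], of e u v V a b] p by simp
   qed (use Nil in simp)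
   moreover have "(%u. insb x B h u) = insb x B h" for x B and h :: "(nat + 'a) sym list => 'b" ..
   moreover have "vs j (Lg l # A) h = insb (Inl j) [Lg l] (vs j A h)" for l A and h :: "'a sym list => 'b" by (rule ext) simp
   ultimately show ?case by simp
  next
   case (Cons y A1)
   show ?case
   proof (cases y)
   case (Lg l)
   have "insb (Inl j) [Lg l] (vs j (A1 @ Lg e # A2) (%v. g (v, add_mset (e, a, b) V))) u
   = insb (Inl j) [Lg l] (%u. vs j (A1 @ Lg b # Lg a # A2) (%v. g (v, V)) u - vs j (A1 @ Lg a # Lg b # A2) (%v. g (v, V)) u) u"
   proof (rule insb_cong)
   fix v :: "(nat + 'a) sym list"
   assume m: "mset (legs v) = mset (legs [Lg l]) + mset (legs u)"
   have "set (legs v) = insert l (set (legs u))" using arg_cong[OF m, of set_mset] by simp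
   thus "vs j (A1 @ Lg e # A2) (%v. g (v, add_mset (e, a, b) V)) v
   = vs j (A1 @ Lg b # Lg a # A2) (%v. g (v, V)) v - vs j (A1 @ Lg a # Lg b # A2) (%v. g (v, V)) v" using Cons.prems Lg by (intro Cons.IH) auto
   qed
   thus ?thesis using Lg by (simp add: insb_diff)
   qed (use Cons in auto)
  qed
  thus ?thesis using p by simp
 qed
 subgoal for V
 proof -
  have "vs j (A1 @ Lt a s # Lt a (~ s) # A2) h u = vs j (A1 @ A2) h u"
   if h: "cancel h" for A1 A2 a s j u and h :: "'a sym list => 'b"
  proof (induction A1 arbitrary: j u)
   case Nil
   thus ?case using cancelling_lsub[OF cancelling_vs[OF h]] by simp
  next
   case (Cons y A1)
   hence "vs j (A1 @ Lt a s # Lt a (~ s) # A2) h = vs j (A1 @ A2) h" for j by blast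
   with Cons show ?case by (cases y) auto
  qed
  thus ?thesis using jac_cancelling[OF g] by (simp add: cancel_def[of "%A. vs j A _ u"])
 qed
 subgoal premises p for A B C e z s V
 proof -
  let ?A = "A @ [Lg e] @ B @ [Lg e] @ C"
  have "vs j (cj e z s ?A) (%v. g (v, V)) (cj e (Inr z) s u) = vs j ?A (%v. g (cj e z s v, V)) u" by (rule vs_cj[OF jac_cancelling[OF g]])
  also have "... = vs j ?A (%v. g (v, V)) u"
  proof (rule vs_cong)
   fix v :: "'a sym list" assume m: "mset (legs v) = mset (legs ?A) + mset (legs u)"
   have "count (mset (legs v)) e = 2" unfolding m using p by (simp add: count_eq_zero_iff[THEN iffD2])
   thus "g (cj e z s v, V) = g (v, V)" using p by (intro jac_cj[OF g]) auto
  qed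
  finally show ?thesis using p by (simp add: cj_id)
 qed
 done

section \<open>Associativity of composition on words\<close>

definition emb :: "('a => ('b * bool) list) => nat + 'a => ((nat + 'b) * bool) list" where
 "emb f = case_sum (%i. [(Inl i, True)]) (%a. map (%(b, s). (Inr b, s)) (f a))"

lemma emb_simps [simp]: "emb f (Inl i) = [(Inl i, True)]" "emb f (Inr a) = map (%(b, s). (Inr b, s)) (f a)" by (auto simp: emb_def)

lemma lts_append_map [simp]: "lts (map (%(b, s). (h b, s)) w) = map (%x. case x of Lg e => Lg e | Lt b s => Lt (h b) s | Sp => Sp) (lts w)"
 by (induction w) auto

definition wsub :: "nat => ('a * bool) list => nat + 'a => ((nat + 'a) * bool) list" where
 "wsub j w z = (if z = Inl j then map (%(b, s). (Inr b, s)) w @ [(Inl j, True)] else [(z, True)])"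

lemma lmap_ident: "(!!z. f z = [(z, True)]) ==> lmap f u = u" by (induction u rule: legs.induct) auto

lemma lmap_cong: "(!!z s. Lt z s : set u ==> f z = h z) ==> lmap f u = lmap h u"
proof (induction u)
 case (Cons y u)
 have "lmap f u = lmap h u" by (rule Cons.IH) (auto intro: Cons.prems)
 moreover have "f z = h z" if "y = Lt z s" for z s using Cons.prems[of z s] that by simp
 hence "lmap1 f y = lmap1 h y" by (cases y) auto
 ultimately show ?case by simp
qed simp

lemma lmap_lts: "lmap f (lts w) = lts (concat (map (%(z, s). spow s (f z)) w))" by (induction w) auto

lemma concat_spow_winv:
 "concat (map (%(z, s). spow s (f z)) (winv w)) = winv (concat (map (%(z, s). spow s (f z)) w))"
proof (induction w)
 case (Cons y w)
 thus ?case by (cases y) (auto simp: spow_not)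
qed simp

lemma concat_spow_spow:
 "concat (map (%(z, s). spow s (f z)) (spow t w)) = spow t (concat (map (%(z, s). spow s (f z)) w))" by (cases t) (auto simp: concat_spow_winv)

lemma lmap_lmap: "lmap f (lmap h u) = lmap (%z. concat (map (%(z, s). spow s (f z)) (h z))) u" by (induction u rule: legs.induct) (auto simp: lmap_lts concat_spow_spow)

lemma vs_lts: "vs j (lts w @ A) g u = vs j A g (lmap (wsub j w) u)"
proof (induction w arbitrary: u)
 case Nil
 thus ?case by (simp add: lmap_ident wsub_def)
next
 case (Cons y w)
 obtain a s where y: "y = (a, s)" by fastforce
 have "lmap (wsub j w) (lmap (lsub j a s) u) = lmap (wsub j (y # w)) u" unfolding lmap_lmap by (rule lmap_cong) (auto simp: lsub_def wsub_def y)
 thus ?case using Cons by (simp add: y)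
qed

lemma insb_lmap:
 assumes "!!z. z ~= x' ==> (x, True) ~: set (f z) & (x, False) ~: set (f z)" "f x' = [(x, True)]"
  and that: "lmap f B' = B"
 shows "insb x B g (lmap f u) = insb x' B' (%v. g (lmap f v)) u"
proof (induction u arbitrary: g)
 case (Cons y u)
 have n: "insb x B g (lts w @ v) = insb x B (%v. g (lts w @ v)) v"
  if "(x, True) ~: set w" "(x, False) ~: set w" for w v g using that
 proof (induction w arbitrary: g)
  case (Cons p w)
  thus ?case by (cases p) auto
 qed simp
 have set: "(a, s) : set (winv w) <-> (a, ~ s) : set w" for a s w by (induction w) auto
 show ?case
 proof (cases y)
  case (Lt z s)
  show ?thesis
  proof (cases "z = x'")
   case True
   thus ?thesis using Lt Cons assms that by (cases s) auto
  next
   case False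
   hence "insb x B g (lts (spow s (f z)) @ lmap f u) = insb x B (%v. g (lts (spow s (f z)) @ v)) (lmap f u)" using assms(1)[of z] by (intro n) (cases s; auto simp: set)+
   thus ?thesis using Lt False Cons by auto
  qed
 qed (use Cons in auto)
qed simp

lemma concat_lstrip: "concat (map (%(z, s). spow s (lstrip z)) (map (%(b, s). (Inr b, s)) w)) = w" by (induction w) auto

lemma concat_wsub:
 "concat (map (%(z, s). spow s (wsub i w' z)) (map (%(b, s). (Inr b, s)) w)) = map (%(b, s). (Inr b, s)) w" by (induction w) (auto simp: wsub_def spow_def)

lemma spow_map: "spow s (map (%(b, s). (h b, s)) w) = map (%(b, s). (h b, s)) (spow s w)" by (cases s) (auto simp: winv_def rev_map comp_def case_prod_beta)

text \<open>Naturality in the letters of the inner diagram: substituting for them in the result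
  amounts to substituting in the inner diagram and in the letters that have already been moved to
  \<open>u\<close>, the slots \<open>Inl i\<close> being left alone.\<close>

lemma vs_lmap: "vs i B (%v. g (lmap f v)) u = vs i (lmap f B) g (lmap (emb f) u)"
proof (induction B arbitrary: i u)
 case Nil
 have "lmap f (lmap lstrip u) = lmap lstrip (lmap (emb f) u)" unfolding lmap_lmap
 proof (rule lmap_cong)
  fix z :: "nat + 'b"
  show "concat (map (%(z, s). spow s (f z)) (lstrip z)) = concat (map (%(z, s). spow s (lstrip z)) (emb f z))" by (cases z) (simp_all add: concat_lstrip del: map_map)
 qed
 thus ?case by simp
next
 case (Cons y B)
 show ?case
 proof (cases y)
  case (Lg e)
  have "insb (Inl i) [Lg e] (%v. vs i (lmap f B) g (lmap (emb f) v)) u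
   = insb (Inl i) [Lg e] (vs i (lmap f B) g) (lmap (emb f) u)"
  proof (rule insb_lmap[symmetric])
   fix z :: "nat + 'b"
   assume "z ~= Inl i"
   thus "(Inl i, True) ~: set (emb f z) & (Inl i, False) ~: set (emb f z)" by (cases z) auto
  qed auto
  moreover have "vs i B (%v. g (lmap f v)) = (%u. vs i (lmap f B) g (lmap (emb f) u))" using Cons.IH by blast
  ultimately show ?thesis by (simp add: Lg)
 next
  case (Lt a s)
  have "lmap (emb f) (lmap (lsub i a s) u) = lmap (wsub i (spow s (f a))) (lmap (emb f) u)" unfolding lmap_lmap
  proof (rule lmap_cong)
   fix z :: "nat + 'b"
   show "concat (map (%(z, s). spow s (emb f z)) (lsub i a s z)) =
   concat (map (%(z, t). spow t (wsub i (spow s (f a)) z)) (emb f z))"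
   proof (cases z)
   case (Inl k)
   thus ?thesis by (auto simp: lsub_def wsub_def spow_map)
   next
   case (Inr b)
   thus ?thesis by (simp add: concat_wsub lsub_def del: map_map)
   qed
  qed
  thus ?thesis using Cons.IH by (simp add: Lt vs_lts)
 next
  case Sp
  thus ?thesis using Cons.IH by simp
 qed
qed

text \<open>After the substitution the letter \<open>Inr x\<close> occurs at its old places and next
  to every slot \<open>Inl i\<close>. For a positive \<open>x\<close> a leg at a new occurrence is a
  leg put at the slot before substituting; for an inverse letter it comes to lie between that letter
  and the slot, with the opposite sign.\<close>

lemma insb_lsub_Leibniz:
 "insb (Inr x) [Lg e] k (lmap (lsub i x s) u) =
  insb (Inr x) [Lg e] (%v. k (lmap (lsub i x s) v)) u +
  (if s then insb (Inl i) [Lg e] (%v. k (lmap (lsub i x s) v)) u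
   else - insb (Inl i) [Lg e] k (lmap (lsub i x s) u))"
proof (induction u arbitrary: k)
 case (Cons y u)
 show ?case
 proof (cases y)
  case (Lt z t)
  consider "z = Inl i" | "z ~= Inl i" by blast
  thus ?thesis
  proof cases
   case 1
   thus ?thesis using Lt Cons by (cases t; cases s) auto
  next
   case 2
   thus ?thesis using Lt Cons by (auto simp: lmap1_lsub_other simp del: lmap1.simps(2))
  qed
 qed (use Cons in auto)
qed simp

lemma insb_lsub_other:
 "z ~= x ==> insb (Inr z) [Lg e] k (lmap (lsub i x s) u) = insb (Inr z) [Lg e] (%v. k (lmap (lsub i x s) v)) u" by (rule insb_lmap) (auto simp: lsub_def split: if_splits)

lemma insb_swap:
 assumes "x ~= y"
 shows "insb x [Lg a] (insb y [Lg b] k) u = insb y [Lg b] (insb x [Lg a] k) u" using assms by (induction u arbitrary: k) (auto simp: insb_add insb_uminus insb_diff)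

text \<open>The Leibniz rule for the insertion of a leg into a composite.\<close>

lemma vs_insb:
 "vs i B (insb x [Lg e] G) u =
  insb x [Lg e] (%B'. vs i B' G u) B + insb (Inr x) [Lg e] (vs i B G) u"
proof (induction B arbitrary: i u)
 case Nil
 have "insb x [Lg e] G (lmap lstrip u) = insb (Inr x) [Lg e] (%v. G (lmap lstrip v)) u" for G
 proof (induction u arbitrary: G)
  case (Cons y u)
  show ?case
  proof (cases y)
   case (Lt z t)
   thus ?thesis using Cons by (cases z; cases t) auto
  qed (use Cons in auto)
 qed simp
 thus ?case by simp
next
 case (Cons y B)
 show ?case
 proof (cases y)
  case (Lg l)
  hence "vs i (y # B) (insb x [Lg e] G) u
   = insb (Inl i) [Lg l] (%u. insb x [Lg e] (%B'. vs i B' G u) B) u + insb (Inl i) [Lg l] (insb (Inr x) [Lg e] (vs i B G)) u"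
   using ext[of "vs i B (insb x [Lg e] G)" "%u. insb x [Lg e] (%B'. vs i B' G u) B + insb (Inr x) [Lg e] (vs i B G) u", OF Cons.IH] by (simp add: insb_add)
  also have "insb (Inl i) [Lg l] (%u. insb x [Lg e] (%B'. vs i B' G u) B) u
   = insb x [Lg e] (%B'. insb (Inl i) [Lg l] (vs i B' G) u) B"
  proof -
   have "insb (Inl i) [Lg l] (%u. insb x [Lg e] (%B'. F B' u) B) u = insb x [Lg e] (%B'. insb (Inl i) [Lg l] (F B') u) B" for F
   by (induction B arbitrary: F) (auto simp: insb_add insb_uminus)
   thus ?thesis .
  qed
  also have "insb (Inl i) [Lg l] (insb (Inr x) [Lg e] (vs i B G)) u = insb (Inr x) [Lg e] (insb (Inl i) [Lg l] (vs i B G)) u" by (rule insb_swap) simp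
  finally show ?thesis by (simp add: Lg)
 next
  case (Lt a s)
  show ?thesis using Lt Cons.IH by (cases "a = x") (auto simp: insb_lsub_Leibniz insb_lsub_other)
 next
  case Sp
  thus ?thesis using Cons.IH by simp
 qed
qed

definition emb2 :: "nat + (nat + 'a) => ((nat + 'a) * bool) list" where
 "emb2 = case_sum (%i. [(Inl i, True)]) (case_sum (%_. []) (%a. [(Inr a, True)]))"

lemma insb_free: "(!!s. Lt x s ~: set u) ==> insb x B k u = 0" by (induction u arbitrary: k) auto

text \<open>Associativity with two layers of slots, by induction over the innermost diagram
  \<open>A\<close>. Moving a leg of \<open>A\<close> is governed by the Leibniz rule
  \<open>vs_insb\<close>; its second term, insertion at letters of the second layer in
  \<open>u\<close>, vanishes because \<open>u\<close> contains none.\<close>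

lemma vs_vs:
 assumes "!!j s. Lt (Inr (Inl j)) s ~: set u"
 shows "vs i B (vs j A g) u = vs j A (%B'. vs i B' g (lmap emb2 u)) B"
proof (induction A arbitrary: j B)
 case Nil
 have "lmap (emb lstrip) u = lmap emb2 u"
 proof (rule lmap_cong)
  fix z s
  show "emb lstrip z = emb2 z" by (cases z; cases "projr z") (auto simp: emb2_def lstrip_def split: sum.splits)
 qed
 thus ?case using vs_lmap[of i B g lstrip u] by simp
next
 case (Cons y A)
 show ?case
 proof (cases y)
  case (Lg e)
  have "insb (Inr (Inl j)) [Lg e] (vs i B (vs j A g)) u = 0" by (rule insb_free) (rule assms)
  thus ?thesis using Cons.IH by (simp add: Lg vs_insb)
 next
  case (Lt a s)
  have "lmap (emb (lsub j a s)) u = lmap (%z. [(z, True)]) u"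
  proof (rule lmap_cong)
   fix z t
   assume "Lt z t : set u"
   thus "emb (lsub j a s) z = [(z, True)]" using assms by (cases z; cases "projr z") (auto simp: lsub_def)
  qed
  thus ?thesis using Cons.IH vs_lmap[of i B "vs j A g" "lsub j a s" u] by (simp add: Lt lmap_ident)
 next
  case Sp
  thus ?thesis using Cons.IH by simp
 qed
qed

definition inl :: "nat sym list => (nat + 'a) sym list" where
 "inl u = lmap (%j. [(Inl j, True)]) u"

lemma inl_simps [simp]: "inl [] = []" "inl (u @ v) = inl u @ inl v"
 "inl (Lg e # u) = Lg e # inl u" "inl (Lt j s # u) = Lt (Inl j) s # inl u" "inl (Sp # u) = Sp # inl u"
 "legs (inl u) = legs u" by (auto simp: inl_def)

lemma inl_no: "Lt (Inr z) s ~: set (inl u)" by (induction u rule: legs.induct) auto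

lemma map_rl_inl: "map (rl sg) (inl u) = inl (map (rl sg) u)" by (simp add: inl_def map_rl_lmap)

lemma vs_assoc:
 "vs i B (%w. vs j A g (inl w)) (inl u) = vs j A (%B'. vs i B' g (inl u)) (inl B)"
proof -
 have "vs i B (%w. vs j A g (inl w)) (inl u) = vs i (inl B) (vs j A g) (inl u)" unfolding inl_def vs_lmap by (simp add: lmap_lmap)
 also have "... = vs j A (%B'. vs i B' g (lmap emb2 (inl u))) (inl B)" by (rule vs_vs) (rule inl_no)
 also have "lmap emb2 (inl u) = inl u" by (simp add: inl_def lmap_lmap emb2_def)
 finally show ?thesis .
qed

text \<open>\<open>vs\<close> without the final deletion of the slots, so that the arcs of the inner
  diagram can be processed separately and the results combined.\<close>

fun vm :: "nat => 'a sym list => ((nat + 'a) sym list => 'k::field) => (nat + 'a) sym list => 'k" where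
 "vm j [] k u = k u"
| "vm j (Sp # A) k u = vm (Suc j) A k u"
| "vm j (Lt a s # A) k u = vm j A k (lmap (lsub j a s) u)"
| "vm j (Lg e # A) k u = insb (Inl j) [Lg e] (vm j A k) u"

lemma vm_fun_simps [simp]:
 "vm j [] k = k"
 "vm j (Sp # A) k = vm (Suc j) A k"
 "vm j (Lt a s # A) k = (%u. vm j A k (lmap (lsub j a s) u))"
 "vm j (Lg e # A) k = insb (Inl j) [Lg e] (vm j A k)" by (rule ext, simp)+

abbreviation inr :: "'a sym list => (nat + 'a) sym list" where
 "inr u == lmap (%a. [(Inr a, True)]) u"

lemma vs_eq_vm: "vs j A g = vm j A (%u. g (lmap lstrip u))" by (induction A arbitrary: j rule: legs.induct) auto

text \<open>Words without separators, that is, single arcs.\<close>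

definition arc :: "'a sym list => bool" where
 "arc L <-> Sp ~: set L"

definition fa :: "'a sym list list => 'a sym list" where
 "fa As = concat (map (%L. L @ [Sp]) As)"

lemma fa_simps [simp]: "fa [] = []" "fa (L # As) = L @ Sp # fa As" "fa (As @ Bs) = fa As @ fa Bs" by (auto simp: fa_def)

lemma arc_simps [simp]: "arc []" "arc (Lg e # L) = arc L" "arc (Lt a s # L) = arc L" "~ arc (Sp # L)"
 "arc (L @ M) <-> arc L & arc M" by (auto simp: arc_def)

lemma vm_arc_append: "arc L ==> vm j (L @ A) k u = vm j L (vm j A k) u"
proof (induction L arbitrary: u)
 case (Cons y L)
 hence "vm j (L @ A) k = vm j L (vm j A k)" if "arc L" using that by blast
 with Cons show ?case by (cases y) auto
qed simp

lemma vm_fa_append: "ALL L:set As. arc L ==> vm j (fa As @ A) k u = vm j (fa As) (vm (j + length As) A k) u"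
proof (induction As arbitrary: j u)
 case (Cons L As)
 hence "vm (Suc j) (fa As @ A) k = vm (Suc j) (fa As) (vm (Suc (j + length As)) A k)" by auto
 thus ?case using Cons.prems by (simp add: vm_arc_append)
qed simp

definition free_of :: "'a => 'a sym list => bool" where
 "free_of x u <-> (ALL s. Lt x s ~: set u)"

lemma free_of_simps [simp]: "free_of x []" "free_of x (Lg e # u) = free_of x u" "free_of x (Sp # u) = free_of x u"
 "free_of x (Lt y s # u) <-> x ~= y & free_of x u" "free_of x (u @ v) <-> free_of x u & free_of x v" by (auto simp: free_of_def)

lemma lmap_lsub_free: "free_of (Inl j) u ==> lmap (lsub j a s) u = u"
proof (induction u rule: legs.induct)
 case ("3_1" z t u)
 thus ?case by (auto simp: lsub_def)
qed auto

lemma vm_arc_context: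
 assumes "arc L" "free_of (Inl j) p" "free_of (Inl j) q"
 shows "vm j L k (p @ u @ q) = vm j L (%v. k (p @ v @ q)) u" using assms(1)
proof (induction L arbitrary: u)
 case (Cons y L)
 hence IH: "vm j L k (p @ u @ q) = vm j L (%v. k (p @ v @ q)) u" for u by (cases y) auto
 have "insb (Inl j) [Lg e] h p = 0" "insb (Inl j) [Lg e] h q = 0" for h :: "(nat + 'a) sym list => 'b" and e using assms(2,3) by (auto simp: free_of_def insb_free)
 with Cons.prems IH assms(2,3) show ?case by (cases y) (auto simp: insb_append lmap_lsub_free)
qed simp

lemma vm_fa_context:
 assumes "ALL L:set As. arc L" "!!i. j <= i ==> i < j + length As ==> free_of (Inl i) p & free_of (Inl i) q"
 shows "vm j (fa As) k (p @ u @ q) = vm j (fa As) (%v. k (p @ v @ q)) u" using assms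
proof (induction As arbitrary: j u)
 case (Cons L As)
 have "vm (Suc j) (fa As) k (p @ v @ q) = vm (Suc j) (fa As) (%v. k (p @ v @ q)) v" for v using Cons.prems by (intro Cons.IH) auto
 hence "(%v. vm (Suc j) (fa As) k (p @ v @ q)) = vm (Suc j) (fa As) (%v. k (p @ v @ q))" by blast
 moreover have "vm j L (vm (Suc j) (fa As) k) (p @ u @ q) = vm j L (%v. vm (Suc j) (fa As) k (p @ v @ q)) u" using Cons.prems by (intro vm_arc_context) auto
 ultimately show ?case using Cons.prems by (simp add: vm_arc_append)
qed simp

lemma vm_single:
 assumes "arc L" "free_of (Inl j) w"
 shows "vm j L k (w @ [Lt (Inl j) True]) = k (w @ inr L @ [Lt (Inl j) True])" using assms
proof (induction L arbitrary: w)
 case (Cons y L)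
 have 0: "insb (Inl j) [Lg e] h w = 0" for h :: "(nat + 'a) sym list => 'b" and e using Cons.prems by (auto simp: free_of_def insb_free)
 show ?case
 proof (cases y)
  case (Lg e)
  have "free_of (Inl j) (w @ [Lg e])" using Cons.prems by simp
  thus ?thesis using Cons.IH[of "w @ [Lg e]"] Cons.prems Lg by (simp add: insb_append 0)
 next
  case (Lt a s)
  have "free_of (Inl j) (w @ [Lt (Inr a) s])" using Cons.prems by simp
  thus ?thesis using Cons.IH[of "w @ [Lt (Inr a) s]"] Cons.prems Lt by (simp add: lmap_lsub_free)
 next
  case Sp
  thus ?thesis using Cons.prems by simp
 qed
qed simp

lemma vm_fa_blocks:
 assumes "ALL L:set As. arc L"
 shows "vm j (fa As) k (inl (fa (map (%i. [Lt i True]) [j..<j + length As]))) =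
  k (fa (map (%(i, L). inr L @ [Lt (Inl i) True]) (zip [j..<j + length As] As)))" using assms
proof (induction As arbitrary: j k)
 case (Cons L As)
 let ?B = "inl (fa (map (%i. [Lt i True]) [Suc j..<Suc j + length As])) :: (nat + 'a) sym list"
 have fr: "free_of (Inl i) (inl (fa (map (%i. [Lt i True]) xs)))" if "i ~: set xs" for i xs using that by (induction xs) auto
 have upt: "[j..<j + length (L # As)] = j # [Suc j..<Suc j + length As]" by (simp add: upt_conv_Cons del: upt_Suc)
 have "vm j (fa (L # As)) k (inl (fa (map (%i. [Lt i True]) [j..<j + length (L # As)])))
   = vm j L (vm (Suc j) (fa As) k) ([] @ [Lt (Inl j) True] @ Sp # ?B)" unfolding upt using Cons.prems by (simp add: vm_arc_append del: upt_Suc)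
 also have "... = vm j L (%v. vm (Suc j) (fa As) k ([] @ v @ Sp # ?B)) ([] @ [Lt (Inl j) True])" using Cons.prems by (subst vm_arc_context) (auto intro: fr)
 also have "... = vm (Suc j) (fa As) k ((inr L @ [Lt (Inl j) True, Sp]) @ ?B @ [])" using Cons.prems by (subst vm_single) auto
 also have "... = vm (Suc j) (fa As) (%v. k ((inr L @ [Lt (Inl j) True, Sp]) @ v @ [])) ?B"
 proof (rule vm_fa_context)
  have "free_of (Inl i) (inr M)" for i and M :: "'a sym list" by (induction M rule: legs.induct) auto
  thus "free_of (Inl i) (inr L @ [Lt (Inl j) True, Sp]) & free_of (Inl i) []"
   if "Suc j <= i" for i using that by simp
 qed (use Cons.prems in auto)
 also have "... = k (fa (map (%(i, L). inr L @ [Lt (Inl i) True]) (zip [j..<j + length (L # As)] (L # As))))" unfolding upt using Cons.IH[of "Suc j"] Cons.prems by (simp del: upt_Suc)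
 finally show ?case .
qed simp

lemma lstrip_inr [simp]: "lmap lstrip (inr u) = u" by (simp add: lmap_lmap lmap_ident)

text \<open>The word of the identity has one slot on each arc, in order; the symbols of each arc
  pile up in front of its slot, and deleting the slots returns the diagram. This is the left unit
  law of composition.\<close>

lemma vs_fa_blocks:
 assumes "ALL L:set As. arc L"
 shows "vs j (fa As) g (inl (fa (map (%i. [Lt i True]) [j..<j + length As]))) = g (fa As)"
proof -
 have "lmap lstrip (fa (map (%(i, L). inr L @ [Lt (Inl i) True]) (zip xs As))) = fa As"
  if "length xs = length As" for xs :: "nat list" using that by (induction xs As rule: list_induct2) auto
 thus ?thesis by (simp add: vs_eq_vm vm_fa_blocks[OF assms])
qed

text \<open>An inner diagram without legs acts by substitution alone. Composition with bead diagrams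
  is thereby a computation with words.\<close>

lemma vs_beads:
 "vs j (fa (map lts ws)) g u =
  g (lmap (case_sum (%i. if j <= i & i < j + length ws then ws ! (i - j) else []) (%a. [(a, True)])) u)"
proof (induction ws arbitrary: j u)
 case Nil
 show ?case by simp (rule arg_cong[of _ _ g], rule lmap_cong, auto simp: lstrip_def split: sum.splits)
next
 case (Cons w ws)
 have 1: "concat (map (%(z, s). spow s (case_sum h (%a. [(a, True)]) z)) (map (%(b, s). (Inr b, s)) w)) = w" for h by (induction w) auto
 show ?case unfolding fa_simps list.map append_assoc vs_lts append_Cons vs.simps Cons.IH lmap_lmap by (rule arg_cong[of _ _ g], rule lmap_cong)
   (auto simp: wsub_def 1 simp del: map_map split: sum.splits if_splits)
qed

section \<open>Separation of a vector from a span by a functional\<close>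

section \<open>Functionals on formal series\<close>

definition pr :: "('b => 'k::field) => ('b => 'k) => 'k" where
 "pr h f = (\<Sum>x | f x ~= 0. f x * h x)"

definition fsupp :: "('b => 'k::field) => bool" where
 "fsupp f <-> finite {x. f x ~= 0}"

lemma pr_superset: "finite S ==> {x. f x ~= 0} <= S ==> pr h f = (SUM x:S. f x * h x)" unfolding pr_def by (rule sum.mono_neutral_left) auto

lemma fsupp_single [simp]: "fsupp (single b)" by (simp add: fsupp_def single_def)

lemma fsupp_0 [simp]: "fsupp 0" "fsupp (%x. 0)" by (auto simp: fsupp_def)

lemma fsupp_add: "fsupp f ==> fsupp g ==> fsupp (f + g)" unfolding fsupp_def by (rule finite_subset[of _ "{x. f x ~= 0} Un {x. g x ~= 0}"]) auto

lemma fsupp_diff: "fsupp f ==> fsupp g ==> fsupp (f - g)" unfolding fsupp_def by (rule finite_subset[of _ "{x. f x ~= 0} Un {x. g x ~= 0}"]) auto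

lemma fsupp_scale: "fsupp f ==> fsupp (%x. c * f x)" unfolding fsupp_def by (rule finite_subset[of _ "{x. f x ~= 0}"]) auto

lemma pr_add: "fsupp f ==> fsupp g ==> pr h (f + g) = pr h f + pr h g" unfolding fsupp_def
 by (subst (1 2 3) pr_superset[of "{x. f x ~= 0} Un {x. g x ~= 0}"]) (auto simp: algebra_simps sum.distrib)

lemma pr_diff: "fsupp f ==> fsupp g ==> pr h (f - g) = pr h f - pr h g" unfolding fsupp_def
 by (subst (1 2 3) pr_superset[of "{x. f x ~= 0} Un {x. g x ~= 0}"]) (auto simp: algebra_simps sum_subtractf)

lemmas pr_diff' = pr_diff[unfolded fun_diff_def]
lemmas fsupp_diff' = fsupp_diff[unfolded fun_diff_def]

lemma pr_scale: "fsupp f ==> pr h (%x. c * f x) = c * pr h f" unfolding fsupp_def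
 by (subst (1 2) pr_superset[of "{x. f x ~= 0}"]) (auto simp: sum_distrib_left algebra_simps)

lemma pr_0 [simp]: "pr h 0 = 0" "pr h (%x. 0) = 0" by (auto simp: pr_def)

lemma pr_single [simp]: "pr h (single b) = h b" by (subst pr_superset[of "{b}"]) (auto simp: single_def)

lemma span_pr_zero:
 assumes "f : coeff_fun.span R" "!!r. r : R ==> fsupp r & pr h r = 0"
 shows "fsupp f & pr h f = 0" using assms(1)
proof (induction rule: coeff_fun.span_induct_alt)
 case base
 thus ?case by (simp add: zero_fun_def)
next
 case (step c x y)
 thus ?case using assms(2)[of x] pr_add[of "%z. c * x z" y h] fsupp_add[of "%z. c * x z" y] fsupp_scale[of x c] pr_scale[of x h c] by (simp add: plus_fun_def)
qed

interpretation coeff_pair: vector_space_pair "%(c :: 'k::field) (f :: 'b => 'k) x. c * f x" "(*) :: 'k => 'k => 'k"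
 by unfold_locales (auto simp: algebra_simps)

lemma fun_sum_apply: "(SUM i:I. F i) x = (SUM i:I. F i x)" by (induction I rule: infinite_finite_induct) auto

lemma fsupp_as_span: "fsupp f ==> f = (SUM b:{x. f x ~= 0}. (%x. f b * single b x))"
 unfolding fsupp_def by (rule ext) (simp add: fun_sum_apply single_def if_distrib[of "(*) _"] cong: if_cong)

text \<open>A basis of the span together with the outside vector is independent, so there is a
  linear functional that is 1 on this vector and 0 on the basis. On finitely supported functions a
  functional is the pairing with its values on the basis vectors \<open>single b\<close>, which is
  the form used for diagrams.\<close>

lemma not_in_span_functional:
 assumes "f ~: coeff_fun.span R" "fsupp f" "!!r. r : R ==> fsupp r"
 obtains h where "!!r. r : R ==> pr h r = 0" "pr h f ~= 0"
proof -
 obtain B where B: "B <= coeff_fun.span R" "coeff_fun.independent B" "coeff_fun.span R <= coeff_fun.span B" by (rule coeff_fun.basis_exists[of "coeff_fun.span R"]) blast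
 hence "f ~: coeff_fun.span B" using assms(1) coeff_fun.span_mono[OF B(1)] coeff_fun.span_span by blast
 hence ind: "coeff_fun.independent (insert f B)" using B(2) by (simp add: coeff_fun.independent_insert)
 obtain \<phi> :: "('a => 'b) => 'b" where \<phi>: "Vector_Spaces.linear (%c f x. c * f x) (*) \<phi>"
  "ALL x:insert f B. \<phi> x = (if x = f then 1 else 0)" using coeff_pair.linear_independent_extend[OF ind, of "%x. if x = f then 1 else 0"] by blast
 interpret l: Vector_Spaces.linear "%c f x. c * f x" "(*)" \<phi> by (rule \<phi>(1))
 have "f ~: B" using \<open>f ~: coeff_fun.span B\<close> coeff_fun.span_base by blast
 hence "\<phi> x = 0" if "x : B" for x using \<phi>(2) that by auto
 hence z: "\<phi> x = 0" if "x : coeff_fun.span B" for x using that by (rule l.eq_0_on_span)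
 have ev: "\<phi> x = pr (%b. \<phi> (single b)) x" if "fsupp x" for x
 proof -
  have "\<phi> x = \<phi> (SUM b:{y. x y ~= 0}. (%y. x b * single b y))" using fsupp_as_span[OF that] by simp
  thus ?thesis by (simp add: l.sum l.scale pr_def)
 qed
 show ?thesis
 proof
  show "pr (%b. \<phi> (single b)) r = 0" if "r : R" for r using ev[OF assms(3)[OF that]] z[of r] B(3) that coeff_fun.span_base[OF that] by auto
  show "pr (%b. \<phi> (single b)) f ~= 0" using ev[OF assms(2)] \<phi>(2) by simp
 qed
qed

section \<open>Duality between the relators and the functions that satisfy the relations\<close>

section \<open>Jacobi functions are the functionals that vanish on the relators\<close>

fun item_word :: "fword item => nat sym list" where
 "item_word (Leg e) = [Lg e]"
| "item_word (Bead w) = lts w"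

definition arc_word :: "fword item list => nat sym list" where
 "arc_word L = concat (map item_word L)"

definition fl :: "fword item list list => nat sym list" where
 "fl A = fa (map arc_word A)"

definition fd :: "fword jdiag => dword" where
 "fd D = (fl (arcs D), verts D)"

lemma arc_word_simps [simp]: "arc_word [] = []" "arc_word (t # L) = item_word t @ arc_word L"
 "arc_word (L @ M) = arc_word L @ arc_word M" by (auto simp: arc_word_def)

lemma fl_simps [simp]: "fl [] = []" "fl (L # A) = arc_word L @ Sp # fl A" "fl (A @ B) = fl A @ fl B" by (auto simp: fl_def)

lemma arc_lts [simp]: "arc (lts w)" by (induction w) auto

lemma arc_arc_word [simp]: "arc (arc_word L)"
proof (induction L)
 case (Cons t L)
 thus ?case by (cases t) auto
qed simp

lemma legs_item_word [simp]: "legs (item_word t) = item_labels t" by (cases t) auto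

lemma legs_arc_word: "legs (arc_word L) = concat (map item_labels L)" by (induction L) auto

lemma legs_fl: "legs (fl A) = concat (map item_labels (concat A))" by (induction A) (auto simp: legs_arc_word)

lemma leg_labels_fl: "leg_labels D = legs (fl (arcs D))" by (simp add: leg_labels_def legs_fl)

lemma half_edges_fl: "half_edges D = mset (legs (fl (arcs D))) + vlabs (verts D)" by (simp add: half_edges_def leg_labels_fl vlabs_def)

definition adjV :: "vset => nat rel" where
 "adjV V = {(a, b). \<exists>v\<in>#V. a \<in># vert_labels v & b \<in># vert_labels v}"

lemma edge_adj_adjV: "edge_adj D = adjV (verts D)" by (simp add: edge_adj_def adjV_def)

definition okV :: "nat list => vset => bool" where
 "okV ls V <-> (\<forall>e\<in>#mset ls + vlabs V. count (mset ls + vlabs V) e = 2) &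
  (\<forall>e\<in>#mset ls + vlabs V. EX e':set ls. (e, e') : (adjV V)\<^sup>*)"

lemma jdiags_iff:
 "D : jdiags G n <-> length (arcs D) = n & set (beads D) <= carrier G & okV (legs (fl (arcs D))) (verts D)"
 by (simp add: jdiags_def okV_def half_edges_fl leg_labels_fl edge_adj_adjV)

lemma jdeg_fl: "jdeg D = wt (fd D) div 2" by (simp add: jdeg_def wt_def fd_def leg_labels_fl)

lemma okV_mset: "mset ls = mset ls' ==> okV ls V = okV ls' V" unfolding okV_def using mset_eq_setD[of ls ls'] by simp

lemma adjV_add: "adjV (add_mset v V) = {(a, b). a \<in># vert_labels v & b \<in># vert_labels v} Un adjV V" by (auto simp: adjV_def)

lemma in_vlabs: "e \<in># vlabs V <-> (\<exists>v\<in>#V. e \<in># vert_labels v)" by (auto simp: vlabs_def)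

lemma adjV_vlabs: "(a, b) : adjV V ==> a \<in># vlabs V & b \<in># vlabs V" by (auto simp: adjV_def in_vlabs)

lemma count_two_add:
 assumes "e ~:# H"
 shows "(\<forall>x\<in>#add_mset e (add_mset e H). count (add_mset e (add_mset e H)) x = 2) <-> (\<forall>x\<in>#H. count H x = 2)"
proof -
 have "count (add_mset e (add_mset e H)) x = (if x = e then 2 else count H x)" for x using assms by (simp add: not_in_iff)
 thus ?thesis using assms by auto
qed

text \<open>STU keeps the combinatorial conditions on a diagram in both directions. A path to a leg
  that passes through the removed vertex visits \<open>a\<close> or \<open>b\<close>, which are legs
  after the resolution; conversely a path that ends at one of these new legs is prolonged to
  \<open>e\<close>.\<close>

lemma okV_stu:
 assumes "e ~: set ls" "e ~:# vlabs V" "e ~= a" "e ~= b"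
 shows "okV (e # ls) (add_mset (e, a, b) V) <-> okV (a # b # ls) V"
proof -
 let ?V = "add_mset (e, a, b) V"
 let ?H = "mset (a # b # ls) + vlabs V"
 have H: "mset (e # ls) + vlabs ?V = add_mset e (add_mset e ?H)" by simp
 have eH: "e ~:# ?H" using assms by simp
 have cnt: "(\<forall>x\<in>#mset (e # ls) + vlabs ?V. count (mset (e # ls) + vlabs ?V) x = 2) <-> (\<forall>x\<in>#?H. count ?H x = 2)" unfolding H by (rule count_two_add[OF eH])
 have "(\<forall>x\<in>#mset (e # ls) + vlabs ?V. EX e':set (e # ls). (x, e') : (adjV ?V)\<^sup>*) <->
   (\<forall>x\<in>#?H. EX e':set (a # b # ls). (x, e') : (adjV V)\<^sup>*)"
 proof (intro iffI ballI)
  fix x assume L: "\<forall>x\<in>#mset (e # ls) + vlabs ?V. EX e':set (e # ls). (x, e') : (adjV ?V)\<^sup>*" and x: "x \<in># ?H"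
  then obtain e1 where e1: "e1 : set (e # ls)" "(x, e1) : (adjV ?V)\<^sup>*" unfolding H by auto
  have "x ~= e" using x eH by blast
  with e1(2) show "EX e':set (a # b # ls). (x, e') : (adjV V)\<^sup>*"
  proof (induction rule: converse_rtrancl_induct)
   case base
   thus ?case using e1(1) by auto
  next
   case (step y z)
   show ?case
   proof (cases "y = a \<or> y = b")
   case True
   thus ?thesis by auto
   next
   case False
   hence yz: "(y, z) : adjV V" using step by (auto simp: adjV_add)
   hence "z ~= e" using adjV_vlabs assms(2) by blast
   then obtain e' where "e' : set (a # b # ls)" "(z, e') : (adjV V)\<^sup>*" using step by blast
   thus ?thesis using yz by (meson converse_rtrancl_into_rtrancl)
   qed
  qed
 next
  fix x assume R: "\<forall>x\<in>#?H. EX e':set (a # b # ls). (x, e') : (adjV V)\<^sup>*" and x: "x \<in># mset (e # ls) + vlabs ?V"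
  have sub: "(adjV V)\<^sup>* <= (adjV ?V)\<^sup>*" by (rule rtrancl_mono) (auto simp: adjV_add)
  show "EX e':set (e # ls). (x, e') : (adjV ?V)\<^sup>*"
  proof (cases "x = e")
   case False
   hence "x \<in># ?H" using x unfolding H by simp
   then obtain e' where e': "e' : set (a # b # ls)" "(x, e') : (adjV ?V)\<^sup>*" using R sub by blast
   show ?thesis
   proof (cases "e' : set ls")
   case False
   hence "(e', e) : adjV ?V" using e' by (auto simp: adjV_add)
   thus ?thesis using e' by (meson list.set_intros(1) rtrancl.rtrancl_into_rtrancl)
   qed (use e' in auto)
  qed auto
 qed
 thus ?thesis using cnt by (simp add: okV_def)
qed

lemma split_leg_once:
 assumes "count (mset (legs u)) e = 1"
 obtains u1 u2 where "u = u1 @ Lg e # u2" "e ~: set (legs u1)" "e ~: set (legs u2)"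
proof -
 have "e : set (legs u)" using assms by (metis count_greater_zero_iff less_numeral_extra(1) set_mset_mset)
 then obtain u1 u2 where 1: "u = u1 @ Lg e # u2" "e ~: set (legs u1)" using split_leg by blast
 hence "count (mset (legs u2)) e = 0" using assms by simp
 thus ?thesis using that 1 by (simp add: count_eq_zero_iff)
qed

definition cz :: "nat set => ('a * bool) list => 'a sym list => 'a sym list" where
 "cz Z w u = concat (map (%x. case x of Lg a => if a : Z then lts w @ [Lg a] @ lts (winv w) else [Lg a]
  | _ => [x]) u)"

lemma cz_simps [simp]: "cz Z w [] = []"
 "cz Z w (Lg a # u) = (if a : Z then lts w @ [Lg a] @ lts (winv w) else [Lg a]) @ cz Z w u"
 "cz Z w (Lt b s # u) = Lt b s # cz Z w u" "cz Z w (Sp # u) = Sp # cz Z w u"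
 "cz Z w (u @ v) = cz Z w u @ cz Z w v" by (auto simp: cz_def)

lemma legs_cz [simp]: "legs (cz Z w u) = legs u" by (induction u rule: legs.induct) auto

lemma cz_id: "set (legs u) Int Z = {} ==> cz Z w u = u" by (induction u rule: legs.induct) auto

lemma cz_lts [simp]: "cz Z w (lts v) = lts v" by (rule cz_id) simp

lemma cz_cong: "(!!e. e : set (legs u) ==> e : Z <-> e : Z') ==> cz Z w u = cz Z' w u" by (induction u rule: legs.induct) auto

lemma cz_insert: "e ~: Z ==> cz (insert e Z) w u = cz {e} w (cz Z w u)" by (induction u rule: legs.induct) auto

lemma jac_cz_chord:
 assumes g: "jac N g" and "e ~: N" "e ~:# vlabs V" "count (mset (legs v)) e = 2"
 shows "g (cz {e} w v, V) = g (v, V)"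
proof -
 have "e : set (legs v)" using assms(4) by (metis count_greater_zero_iff pos2 set_mset_mset)
 then obtain v1 v' where 1: "v = v1 @ Lg e # v'" "e ~: set (legs v1)" using split_leg by blast
 hence "count (mset (legs v')) e = 1" using assms(4) by (simp add: count_eq_zero_iff[THEN iffD2] not_in_iff)
 then obtain v2 v3 where 2: "v' = v2 @ Lg e # v3" "e ~: set (legs v2)" "e ~: set (legs v3)" by (rule split_leg_once)
 show ?thesis using jac_conj_word[OF g, of e v1 v2 v3 V w] 1 2 assms by (simp add: cz_id)
qed

lemma jac_cz_chords:
 assumes g: "jac N g" and "finite F" "!!e. e : F ==> e ~: N & e ~:# vlabs V & count (mset (legs v)) e = 2"
 shows "g (cz F w v, V) = g (v, V)" using assms(2,3)
proof (induction F)
 case empty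
 thus ?case by (simp add: cz_id)
next
 case (insert e F)
 have "g (cz {e} w (cz F w v), V) = g (cz F w v, V)" using insert.prems[of e] by (intro jac_cz_chord[OF g]) auto
 also have "... = g (v, V)" using insert.prems by (intro insert.IH) auto
 finally show ?case unfolding cz_insert[OF insert.hyps(2)] .
qed

text \<open>
 By STU, the conjugation relation for arbitrary components follows from the one for chords.
\<close>

lemma jac_cz:
 assumes g: "jac {} g" and "okV (legs u) V"
  and "!!v. v \<in># V ==> set_mset (vert_labels v) <= Z \<or> set_mset (vert_labels v) Int Z = {}"
 shows "g (cz Z w u, V) = g (u, V)" using assms(2,3)
proof (induction "size V" arbitrary: u V rule: less_induct)
 case less
 show ?case
 proof (cases "\<exists>v\<in>#V. set_mset (vert_labels v) <= Z")
  case False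
  have "cz Z w u = cz (Z Int set (legs u)) w u" by (rule cz_cong) auto
  also have "g (..., V) = g (u, V)"
  proof (rule jac_cz_chords[OF g])
   fix e assume e: "e : Z Int set (legs u)"
   hence "e ~:# vlabs V" using False less.prems(2) unfolding in_vlabs by blast
   moreover have "e \<in># mset (legs u) + vlabs V" using e by simp
   hence "count (mset (legs u) + vlabs V) e = 2" using less.prems(1) unfolding okV_def by blast
   ultimately show "e ~: {} & e ~:# vlabs V & count (mset (legs u)) e = 2" by (simp add: not_in_iff)
  qed simp
  finally show ?thesis .
 next
  case True
  then obtain v where v: "v \<in># V" "set_mset (vert_labels v) <= Z" by blast
  \<comment> \<open>From a vertex in \<open>Z\<close> a path leads to a leg, since every component
    has one. The path stays in \<open>Z\<close>, so it produces a leg \<open>e\<close> of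
    \<open>Z\<close> that is attached to a trivalent vertex, and STU can be applied there.\<close>
  obtain p where p: "p \<in># vert_labels v" by (cases v) auto
  hence "p \<in># vlabs V" using v in_vlabs by blast
  then obtain e where e: "e : set (legs u)" "(p, e) : (adjV V)\<^sup>*" using less.prems(1) by (auto simp: okV_def)
  from e(2) have "e : Z & e \<in># vlabs V"
  proof (induction rule: rtrancl_induct)
   case base
   thus ?case using p v \<open>p \<in># vlabs V\<close> by blast
  next
   case (step y z)
   then obtain v' where v': "v' \<in># V" "y \<in># vert_labels v'" "z \<in># vert_labels v'" by (auto simp: adjV_def)
   thus ?case using step.IH less.prems(2)[OF v'(1)] in_vlabs by blast
  qed
  then obtain v' where v': "v' \<in># V" "e \<in># vert_labels v'" "e : Z" unfolding in_vlabs by blast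
  hence v'Z: "set_mset (vert_labels v') <= Z" using less.prems(2)[OF v'(1)] by blast
  obtain V0 where V0: "V = add_mset v' V0" using v'(1) by (metis mset_add)
  obtain a b where ab: "vert_labels v' = {#e, a, b#}" "!!y. g (y, add_mset v' V0) = g (y, add_mset (e, a, b) V0)"
  proof -
   obtain x y z where xyz: "v' = (x, y, z)" by (rule prod_cases3)
   then consider "e = x" | "e = y" | "e = z" using v'(2) by auto
   thus ?thesis
   proof cases
   case 1
   thus ?thesis using that[of y z] xyz by simp
   next
   case 2
   thus ?thesis using that[of z x] xyz jac_rotate[OF g, of _ x y z V0] by (simp add: add_mset_commute)
   next
   case 3
   thus ?thesis using that[of x y] xyz jac_rotate[OF g, of _ z x y V0] by (simp add: add_mset_commute)
   qed
  qed
  have vl: "vlabs V = vlabs (add_mset (e, a, b) V0)" using ab(1) by (simp add: V0 vlabs_def)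
  have "adjV V = adjV (add_mset (e, a, b) V0)" using ab(1) by (simp add: V0 adjV_add)
  hence ok: "okV (legs u) (add_mset (e, a, b) V0)" using less.prems(1) vl by (simp add: okV_def)
  have "e \<in># mset (legs u) + vlabs V" using e(1) by simp
  hence "count (mset (legs u) + vlabs V) e = 2" using less.prems(1) unfolding okV_def by blast
  hence "count (mset (legs u)) e + (1 + (if e = a then 1 else 0) + (if e = b then 1 else 0) + count (vlabs V0) e) = 2" unfolding vl by auto
  moreover have "count (mset (legs u)) e >= 1" using e(1) by (simp add: Suc_leI count_greater_zero_iff)
  moreover have "x = 1 & e ~= a & e ~= b & y = 0"
   if "x + (1 + (if e = a then 1 else 0) + (if e = b then 1 else 0) + y) = 2" "x >= 1" for x y :: nat using that by (auto split: if_splits)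
  ultimately have "count (mset (legs u)) e = 1 & e ~= a & e ~= b & count (vlabs V0) e = 0" by blast
  \<comment> \<open>The label \<open>e\<close> occurs twice in all, once on the arc and once at the
    vertex; it occurs nowhere else, which is the freshness condition of STU.\<close>
  hence c: "count (mset (legs u)) e = 1" "e ~= a" "e ~= b" "e ~:# vlabs V0" by (auto simp: not_in_iff)
  obtain u1 u2 where u: "u = u1 @ Lg e # u2" "e ~: set (legs u1)" "e ~: set (legs u2)" using split_leg_once[OF c(1)] .
  have "okV (e # legs u1 @ legs u2) (add_mset (e, a, b) V0)" using ok okV_mset[of "legs u" "e # legs u1 @ legs u2"] by (simp add: u)
  hence "okV (a # b # legs u1 @ legs u2) V0" using okV_stu[of e "legs u1 @ legs u2" V0 a b] c u by simp
  hence ok': "okV (legs (u1 @ Lg a # Lg b # u2)) V0" "okV (legs (u1 @ Lg b # Lg a # u2)) V0" by (simp_all add: okV_mset[of "legs u1 @ a # b # legs u2" "a # b # legs u1 @ legs u2"]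
   okV_mset[of "legs u1 @ b # a # legs u2" "a # b # legs u1 @ legs u2"])
  have IH: "g (cz Z w y, V0) = g (y, V0)" if "okV (legs y) V0" for y using less.hyps[of V0 y] that less.prems(2) by (simp add: V0)
  have Z: "a : Z" "b : Z" "e : Z" using v'Z ab(1) by auto
  \<comment> \<open>After STU both new legs lie between \<open>w\<close> and its inverse.
    Conjugating each of them separately adds only a cancelling pair between the two legs, so the
    induction hypothesis for the smaller vertex set applies to both terms.\<close>
  note cw = cancelling_word'[OF jac_cancelling[OF g], of _ w _ V0]
  have "g (cz Z w u, V) = g ((cz Z w u1 @ lts w) @ Lg e # (lts (winv w) @ cz Z w u2), add_mset (e, a, b) V0)" using Z by (simp add: u V0 ab(2))
  also have "... = g ((cz Z w u1 @ lts w) @ Lg b # Lg a # (lts (winv w) @ cz Z w u2), V0)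
   - g ((cz Z w u1 @ lts w) @ Lg a # Lg b # (lts (winv w) @ cz Z w u2), V0)" by (rule jac_stu[OF g]) (use c u in auto)
  also have "... = g (cz Z w (u1 @ Lg b # Lg a # u2), V0) - g (cz Z w (u1 @ Lg a # Lg b # u2), V0)" using cw[of "cz Z w u1 @ lts w @ [Lg b]" "Lg a # lts (winv w) @ cz Z w u2"]
   cw[of "cz Z w u1 @ lts w @ [Lg a]" "Lg b # lts (winv w) @ cz Z w u2"] Z by simp
  also have "... = g (u1 @ Lg b # Lg a # u2, V0) - g (u1 @ Lg a # Lg b # u2, V0)" by (simp only: IH[OF ok'(1)] IH[OF ok'(2)])
  also have "... = g (u, V)" unfolding u V0 ab(2) by (rule jac_stu[OF g, symmetric]) (use c u in auto)
  finally show ?thesis .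
 qed
qed

lemma jac_reduce:
 assumes "cancel k"
 shows "k (p @ lts (foldr reduce_cons x y) @ q) = k (p @ lts x @ lts y @ q)"
proof (induction x arbitrary: p)
 case (Cons a x)
 obtain i s where a: "a = (i, s)" by fastforce
 have 1: "k (p @ lts (reduce_cons a z) @ q) = k (p @ lts [a] @ lts z @ q)" for z p
 proof (cases z)
  case (Cons b z')
  show ?thesis
  proof (cases "b = letter_inv a")
   case True
   thus ?thesis using assms[unfolded cancel_def, rule_format, of p i s "lts z' @ q"] Cons by (simp add: a letter_inv_def)
  next
   case False
   thus ?thesis using Cons by (cases b) (simp add: a)
  qed
 qed (simp add: a)
 show ?case using 1[of p "foldr reduce_cons x y"] Cons[of "p @ lts [a]"] by (simp add: a)
qed simp

lemma word_inv_winv: "word_inv w = winv w" by (simp add: word_inv_def winv_def letter_inv_def case_prod_beta)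

lemma letter_inv_simps [simp]: "letter_inv (i, s) = (i, ~ s)" "letter_inv (letter_inv a) = a" "letter_inv a ~= a" by (auto simp: letter_inv_def prod_eq_iff)

lemma reduced_simps [simp]: "reduced []" "reduced [a]"
 "reduced (a # b # w) <-> b ~= letter_inv a & reduced (b # w)" by (auto simp: reduced_def)

lemma reduced_tl: "reduced (a # w) ==> reduced w" by (cases w) auto

lemma reduced_reduce_cons: "reduced w ==> reduced (reduce_cons a w)" by (cases w) (auto dest: reduced_tl)

lemma reduce_cons_inv: "reduced w ==> reduce_cons a (reduce_cons (letter_inv a) w) = w"
proof (cases w)
 case (Cons b v)
 assume "reduced w"
 thus ?thesis using Cons by (cases v) auto
qed simp

lemma foldr_reduced: "reduced (x @ y) ==> foldr reduce_cons x y = x @ y"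
proof (induction x)
 case (Cons a x)
 hence "reduced (x @ y)" using reduced_tl[of a "x @ y"] by simp
 thus ?case using Cons by (cases "x @ y") auto
qed simp

lemma reduced_foldr: "reduced y ==> reduced (foldr reduce_cons x y)" by (induction x) (auto intro: reduced_reduce_cons)

lemma reduced_word_inv: "reduced w ==> reduced (word_inv w)" unfolding reduced_def word_inv_def successively_rev successively_map
 by (erule successively_mono) (auto simp: letter_inv_def prod_eq_iff)

lemma foldr_word_inv: "reduced y ==> foldr reduce_cons (word_inv x) (foldr reduce_cons x y) = y"
proof (induction x arbitrary: y)
 case (Cons a x)
 have r: "reduced (foldr reduce_cons x y)" using Cons.prems by (rule reduced_foldr)
 show ?case using Cons reduce_cons_inv[OF r, of "letter_inv a"] by (simp add: word_inv_def)
qed (simp add: word_inv_def)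

lemma word_inv_word_inv [simp]: "word_inv (word_inv x) = x" by (simp add: word_inv_winv)

lemma inv_free_group:
 assumes "x : carrier (free_group m)"
 shows "inv\<^bsub>free_group m\<^esub> x = word_inv x" unfolding m_inv_def
proof (rule the_equality)
 have x: "reduced x" "fst ` set x <= {1..m}" using assms by (auto simp: free_group_def)
 have "fst ` set (word_inv x) <= {1..m}" using x(2) by (auto simp: word_inv_def letter_inv_def)
 moreover have 1: "foldr reduce_cons (word_inv x) x = []" using foldr_word_inv[of "[]" x] foldr_reduced[of x "[]"] x(1) by simp
 moreover have 2: "foldr reduce_cons x (word_inv x) = []" using foldr_word_inv[of "[]" "word_inv x"] foldr_reduced[of "word_inv x" "[]"] reduced_word_inv[OF x(1)] by simp
 ultimately show "word_inv x : carrier (free_group m) & x \<otimes>\<^bsub>free_group m\<^esub> word_inv x = \<one>\<^bsub>free_group m\<^esub> &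
   word_inv x \<otimes>\<^bsub>free_group m\<^esub> x = \<one>\<^bsub>free_group m\<^esub>" using reduced_word_inv[OF x(1)] by (simp add: free_group_def)
 fix y assume y: "y : carrier (free_group m) & x \<otimes>\<^bsub>free_group m\<^esub> y = \<one>\<^bsub>free_group m\<^esub> &
   y \<otimes>\<^bsub>free_group m\<^esub> x = \<one>\<^bsub>free_group m\<^esub>"
 hence y': "reduced y" "foldr reduce_cons x y = []" by (auto simp: free_group_def)
 show "y = word_inv x" using foldr_word_inv[OF y'(1), of x] y'(2) foldr_reduced[of "word_inv x" "[]"] reduced_word_inv[OF x(1)] by simp
qed

lemma fsupp_jrel: "r : jrel G n ==> fsupp r" by (induction rule: jrel.induct) (intro fsupp_diff fsupp_single)+

lemma arc_word_relabel: "arc_word (map (relabel_item sg) L) = map (rl sg) (arc_word L)"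
proof (induction L)
 case (Cons t L)
 thus ?case by (cases t) auto
qed simp

lemma fl_relabel: "fl (map (map (relabel_item sg)) A) = map (rl sg) (fl A)" by (induction A) (auto simp: arc_word_relabel)

lemma fd_relabel: "fd (relabel sg D) = (map (rl sg) (fst (fd D)), rv sg (snd (fd D)))" by (simp add: fd_def relabel_def fl_relabel)

lemma fl_conj_component:
 assumes "inv\<^bsub>G\<^esub> x = winv x"
 shows "fl (arcs (conj_component G e x D)) = cz {a. (e, a) : (adjV (verts D))\<^sup>*} x (fl (arcs D))"
proof -
 let ?f = "%t. case t of Leg a => if (e, a) : (edge_adj D)\<^sup>* then [Bead x, Leg a, Bead (inv\<^bsub>G\<^esub> x)] else [Leg a]
   | Bead g => [Bead g]"
 have 1: "arc_word (concat (map ?f L)) = cz {a. (e, a) : (adjV (verts D))\<^sup>*} x (arc_word L)" for L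
 proof (induction L)
  case (Cons t L)
  thus ?case by (cases t) (auto simp: edge_adj_adjV assms)
 qed simp
 have "fl (map (%L. concat (map ?f L)) A) = cz {a. (e, a) : (adjV (verts D))\<^sup>*} x (fl A)" for A by (induction A) (auto simp: 1)
 thus ?thesis by (simp add: conj_component_def)
qed

text \<open>The easy half of the duality. The conjugation relators are covered by
  \<open>jac_cz\<close>, with \<open>Z\<close> the set of edges reachable from \<open>e\<close>;
  each vertex has either all or none of its edges in this set.\<close>

lemma jac_jrel:
 assumes g: "jac {} g" and r: "r : jrel (free_group m) n"
 shows "pr (%D. g (fd D)) r = 0" using r
proof (induction rule: jrel.induct)
 case (relabel D sg)
 thus ?case using jac_relabel[OF g, of sg "fst (fd D)" "snd (fd D)"] by (simp add: pr_diff' fd_relabel)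
next
 case (rotate A a b c V)
 thus ?case using jac_rotate[OF g, of "fl A" a b c V] by (simp add: pr_diff' fd_def)
next
 case (stu A L e M B a b V)
 let ?u = "fl A @ arc_word L" and ?v = "arc_word M @ Sp # fl B"
 have "\<forall>x\<in>#mset (legs (?u @ Lg e # ?v)) + vlabs (add_mset (e, a, b) V).
  count (mset (legs (?u @ Lg e # ?v)) + vlabs (add_mset (e, a, b) V)) x = 2" using stu unfolding jdiags_iff okV_def by simp
 hence "count (mset (legs (?u @ Lg e # ?v)) + vlabs (add_mset (e, a, b) V)) e = 2" by simp
 hence "count (mset (legs ?u)) e = 0" "count (mset (legs ?v)) e = 0" "count (vlabs V) e = 0" "e ~= a" "e ~= b" by (auto split: if_splits)
 hence "g (?u @ Lg e # ?v, add_mset (e, a, b) V) = g (?u @ Lg b # Lg a # ?v, V) - g (?u @ Lg a # Lg b # ?v, V)" by (intro jac_stu[OF g]) (auto simp: count_eq_zero_iff)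
 thus ?case by (simp add: pr_diff' fsupp_diff' fd_def)
next
 case (merge A L x y M B V)
 thus ?case using jac_reduce[OF jac_cancelling[OF g], of "fl A @ arc_word L" x y "arc_word M @ Sp # fl B" V] by (simp add: pr_diff' fd_def free_group_def)
next
 case (unit A L M B V)
 thus ?case by (simp add: pr_diff' fd_def free_group_def)
next
 case (conj D e x)
 let ?Z = "{a. (e, a) : (adjV (verts D))\<^sup>*}"
 have "g (cz ?Z x (fl (arcs D)), verts D) = g (fl (arcs D), verts D)"
 proof (rule jac_cz[OF g])
  show "okV (legs (fl (arcs D))) (verts D)" using conj by (simp add: jdiags_iff)
  fix v assume v: "v \<in># verts D"
  have "b : ?Z" if "a : ?Z" "a \<in># vert_labels v" "b \<in># vert_labels v" for a b
  proof -
   have "(a, b) : adjV (verts D)" using that v by (auto simp: adjV_def)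
   thus ?thesis using that(1) by (simp add: rtrancl.rtrancl_into_rtrancl)
  qed
  thus "set_mset (vert_labels v) <= ?Z \<or> set_mset (vert_labels v) Int ?Z = {}" by blast
 qed
 thus ?case using fl_conj_component[of "free_group m" x e D] inv_free_group[of x m] conj by (simp add: pr_diff' fd_def word_inv_winv conj_component_def)
qed

text \<open>The value at \<open>Sp\<close> is a dummy: the arcs that are converted back to lists of
  items contain no separator.\<close>

fun sit :: "nat sym => fword item" where
 "sit (Lg e) = Leg e"
| "sit (Lt i s) = Bead [(i, s)]"
| "sit Sp = Leg 0"

text \<open>Deleting the letters outside \<open>1..m\<close> is the projection to the free group on
  m generators that kills the other generators. It allows a functional on diagrams with source m to
  be extended to all words without breaking the relations.\<close>

definition flt :: "nat => nat sym list => nat sym list" where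
 "flt m u = filter (%x. case x of Lt i s => 1 <= i & i <= m | _ => True) u"

fun unfl :: "'a sym list => 'a sym list list * 'a sym list" where
 "unfl [] = ([], [])"
| "unfl (Sp # u) = ([] # fst (unfl u), snd (unfl u))"
| "unfl (x # u) = (case unfl u of ([], t) => ([], x # t) | (a # As, t) => ((x # a) # As, t))"

lemma unfl_arc: "arc t ==> unfl t = ([], t)"
proof (induction t)
 case (Cons x t)
 thus ?case by (cases x) auto
qed simp

lemma unfl_arc_Sp: "arc L ==> unfl (L @ Sp # u) = (L # fst (unfl u), snd (unfl u))"
proof (induction L)
 case (Cons x L)
 thus ?case by (cases x) auto
qed simp

lemma unfl_fa: "ALL L:set As. arc L ==> arc t ==> unfl (fa As @ t) = (As, t)" by (induction As) (auto simp: unfl_arc unfl_arc_Sp)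

lemma word_cases:
 obtains As t where "ALL L:set As. arc L" "arc t" "u = fa As @ t"
proof -
 have "EX As t. (ALL L:set As. arc L) & arc t & u = fa As @ t"
 proof (induction u)
  case Nil
  thus ?case by (intro exI[of _ "[]"]) simp
 next
  case (Cons x u)
  then obtain As t where 1: "ALL L:set As. arc L" "arc t" "u = fa As @ t" by blast
  show ?case
  proof (cases "x = Sp")
   case True
   thus ?thesis using 1 by (intro exI[of _ "[] # As"] exI[of _ t]) simp
  next
   case False
   hence x: "arc (x # L) = arc L" for L by (cases x) auto
   show ?thesis
   proof (cases As)
   case Nil
   thus ?thesis using 1 x by (intro exI[of _ "[]"] exI[of _ "x # t"]) simp
   next
   case (Cons L As')
   thus ?thesis using 1 x by (intro exI[of _ "(x # L) # As'"] exI[of _ t]) simp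
   qed
  qed
 qed
 thus ?thesis using that by blast
qed

lemma context_cases:
 fixes p q :: "'a sym list"
 obtains (inside) A L M B t where "!!L. L : set A Un set B ==> arc L" "arc L" "arc M" "arc t"
   "p = fa A @ L" "q = M @ Sp # fa B @ t"
  | (outside) A L where "!!L. L : set A ==> arc L" "arc L" "arc q" "p = fa A @ L"
proof -
 obtain A L where A: "ALL L:set A. arc L" "arc L" "p = fa A @ L" using word_cases[of p] by metis
 obtain B t where B: "ALL L:set B. arc L" "arc t" "q = fa B @ t" using word_cases[of q] by metis
 show ?thesis
 proof (cases B)
  case Nil
  thus ?thesis using A B by (intro outside[of A L]) auto
 next
  case (Cons M B')
  show ?thesis by (rule inside[of A B' L M t]) (use A B Cons in auto)
 qed
qed

text \<open>The extension of a functional \<open>h\<close> on the diagrams of degree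
  \<open>k\<close> with \<open>n\<close> arcs to a function on all words. It is zero on words that
  do not describe such a diagram. Letters behind the last separator are ignored, but a leg there
  makes the value zero.\<close>

definition jfun :: "nat => nat => nat => (fword jdiag => 'k::field) => 'k jfn" where
 "jfun m n k h x = (case unfl (flt m (fst x)) of (As, t) =>
  if legs t = [] & length As = n & okV (legs (fa As)) (snd x) & (length (legs (fa As)) + size (snd x)) div 2 = k
  then h (JD (map (map sit) As) (snd x)) else 0)"

lemma jfun_eq:
 assumes "ALL L:set As. arc L" "arc t" "flt m u = fa As @ t"
 shows "jfun m n k h (u, V) =
  (if legs t = [] & length As = n & okV (legs (fa As)) V & (length (legs (fa As)) + size V) div 2 = k
  then h (JD (map (map sit) As) V) else 0)" unfolding jfun_def using unfl_fa[OF assms(1,2)] assms(3) by simp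

lemma flt_append [simp]: "flt m (u @ v) = flt m u @ flt m v" by (simp add: flt_def)

lemma flt_simps [simp]: "flt m [] = []" "flt m (Lg e # u) = Lg e # flt m u" "flt m (Sp # u) = Sp # flt m u"
 "flt m (Lt i s # u) = (if 1 <= i & i <= m then [Lt i s] else []) @ flt m u" by (auto simp: flt_def)

lemma legs_flt [simp]: "legs (flt m u) = legs u" by (induction u rule: legs.induct) auto

lemma flt_rl: "flt m (map (rl sg) u) = map (rl sg) (flt m u)" by (induction u rule: legs.induct) auto

definition inrange :: "nat => nat sym list => bool" where
 "inrange m u <-> (ALL i s. Lt i s : set u --> 1 <= i & i <= m)"

lemma inrange_simps [simp]: "inrange m []" "inrange m (Lg e # u) = inrange m u" "inrange m (Sp # u) = inrange m u"
 "inrange m (Lt i s # u) <-> 1 <= i & i <= m & inrange m u" "inrange m (u @ v) <-> inrange m u & inrange m v" by (auto simp: inrange_def)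

lemma inrange_flt [simp]: "inrange m (flt m u)" by (induction u rule: legs.induct) auto

lemma flt_inrange: "inrange m u ==> flt m u = u" by (induction u rule: legs.induct) auto

lemma inrange_fa: "inrange m (fa As) <-> (ALL L:set As. inrange m L)" by (induction As) auto

lemma inrange_lts: "w : carrier (free_group m) ==> inrange m (lts w)" by (auto simp: free_group_def inrange_def lts_def)

lemma single_letter_carrier: "1 <= i ==> i <= m ==> [(i, s)] : carrier (free_group m)" by (simp add: free_group_def)

lemma arc_word_sit: "arc L ==> arc_word (map sit L) = L"
proof (induction L)
 case (Cons x L)
 thus ?case by (cases x) auto
qed simp

lemma fl_sit: "ALL L:set As. arc L ==> fl (map (map sit) As) = fa As" by (induction As) (auto simp: arc_word_sit)

lemma beads_sit: "inrange m u ==> set (concat (map item_beads (map sit u))) <= carrier (free_group m)"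
proof (induction u)
 case (Cons x u)
 thus ?case by (cases x) (auto simp: free_group_def)
qed simp

lemma sit_jdiags:
 assumes "ALL L:set As. arc L" "inrange m (fa As)"
 shows "JD (map (map sit) As) V : jdiags (free_group m) n <-> length As = n & okV (legs (fa As)) V"
proof -
 have "set (beads (JD (map (map sit) As) V)) <= carrier (free_group m)" using assms(2) beads_sit unfolding beads_def inrange_fa by fastforce
 thus ?thesis using fl_sit[OF assms(1)] by (simp add: jdiags_iff)
qed

lemma okV_relabel:
 assumes "inj sg"
 shows "okV (map sg ls) (rv sg V) <-> okV ls V"
proof -
 let ?H = "mset ls + vlabs V"
 have H: "mset (map sg ls) + vlabs (rv sg V) = image_mset sg ?H" by simp
 have c: "count (image_mset sg M) (sg x) = count M x" for M x using assms by (induction M) (auto simp: inj_eq)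
 have adj: "(sg x, sg y) : adjV (rv sg V) <-> (x, y) : adjV V" for x y
 proof -
  have "sg x \<in># vert_labels (relabel_vert sg v) <-> x \<in># vert_labels v" for v x using assms by (cases v) (auto simp: inj_eq)
  thus ?thesis by (auto simp: adjV_def)
 qed
 have ran: "EX y. y' = sg y" if "(x', y') : adjV (rv sg V)" for x' y' using adjV_vlabs[OF that] by auto
 have star: "(sg x, sg y) : (adjV (rv sg V))\<^sup>* <-> (x, y) : (adjV V)\<^sup>*" for x y
 proof
  assume "(sg x, sg y) : (adjV (rv sg V))\<^sup>*"
  moreover have "(sg x, z) : (adjV (rv sg V))\<^sup>* ==> EX y. z = sg y & (x, y) : (adjV V)\<^sup>*" for z
  proof (induction rule: rtrancl_induct)
   case (step y z)
   then obtain y0 z0 where "y = sg y0" "(x, y0) : (adjV V)\<^sup>*" "z = sg z0" using ran by blast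
   moreover have "(y0, z0) : adjV V" using step(2) adj calculation by simp
   ultimately show ?case by (intro exI[of _ z0]) (auto intro: rtrancl.rtrancl_into_rtrancl)
  qed auto
  ultimately obtain y' where "sg y = sg y'" "(x, y') : (adjV V)\<^sup>*" by blast
  thus "(x, y) : (adjV V)\<^sup>*" using assms by (simp add: inj_eq)
 next
  assume "(x, y) : (adjV V)\<^sup>*"
  thus "(sg x, sg y) : (adjV (rv sg V))\<^sup>*" by (induction rule: rtrancl_induct) (auto intro: rtrancl.rtrancl_into_rtrancl simp: adj)
 qed
 show ?thesis unfolding okV_def H by (simp add: c star ball_Un)
qed

lemma free_group_ops [simp]: "x \<otimes>\<^bsub>free_group m\<^esub> y = foldr reduce_cons x y" "\<one>\<^bsub>free_group m\<^esub> = []" by (auto simp: free_group_def)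

context
 fixes m n :: nat and h :: "fword jdiag => 'k::field"
 assumes h: "!!r. r : jrel (free_group m) n ==> pr h r = 0"
begin

lemma h_relabel: "D : jdiags (free_group m) n ==> inj sg ==> h (relabel sg D) = h D"
 using h[OF jrel.relabel[of D "free_group m" n sg]] by (simp add: pr_diff pr_diff')

lemma h_rotate: "JD A (add_mset (a, b, c) V) : jdiags (free_group m) n ==>
  h (JD A (add_mset (a, b, c) V)) = h (JD A (add_mset (b, c, a) V))" using h[OF jrel.rotate[of A a b c V "free_group m" n]] by (simp add: pr_diff pr_diff')

lemma h_stu: "JD (A @ (L @ [Leg e] @ M) # B) (add_mset (e, a, b) V) : jdiags (free_group m) n ==>
  h (JD (A @ (L @ [Leg e] @ M) # B) (add_mset (e, a, b) V)) =
  h (JD (A @ (L @ [Leg b, Leg a] @ M) # B) V) - h (JD (A @ (L @ [Leg a, Leg b] @ M) # B) V)"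
 using h[OF jrel.stu[of A L e M B a b V "free_group m" n]] by (simp add: pr_diff pr_diff' fsupp_diff fsupp_diff')

lemma h_merge: "JD (A @ (L @ [Bead x, Bead y] @ M) # B) V : jdiags (free_group m) n ==>
  h (JD (A @ (L @ [Bead x, Bead y] @ M) # B) V) = h (JD (A @ (L @ [Bead (foldr reduce_cons x y)] @ M) # B) V)"
 using h[OF jrel.merge[of A L x y M B V "free_group m" n]] by (simp add: pr_diff pr_diff' free_group_ops)

lemma h_unit: "JD (A @ (L @ [Bead []] @ M) # B) V : jdiags (free_group m) n ==>
  h (JD (A @ (L @ [Bead []] @ M) # B) V) = h (JD (A @ (L @ M) # B) V)" using h[OF jrel.unit[where G = "free_group m" and n = n, of A L M B V]] by (simp add: pr_diff pr_diff' free_group_ops)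

lemma h_conj: "D : jdiags (free_group m) n ==> e \<in># half_edges D ==> x : carrier (free_group m) ==>
  h (conj_component (free_group m) e x D) = h D" using h[OF jrel.conj[of D "free_group m" n e x]] by (simp add: pr_diff pr_diff')

lemma jfun_relabel:
 assumes "inj sg"
 shows "jfun m n k h (map (rl sg) u, rv sg V) = jfun m n k h (u, V)"
proof -
 obtain As t where As: "ALL L:set As. arc L" "arc t" "flt m u = fa As @ t" by (rule word_cases[of "flt m u"]) blast
 have r: "map (rl sg) (fa As) = fa (map (map (rl sg)) As)" by (induction As) auto
 have arc: "arc (map (rl sg) L) = arc L" for L :: "nat sym list"
 proof (induction L)
  case (Cons x L)
  thus ?case by (cases x) auto
 qed simp
 have sit: "map sit (map (rl sg) L) = map (relabel_item sg) (map sit L)" if "arc L" for L using that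
 proof (induction L)
  case (Cons x L)
  thus ?case by (cases x) auto
 qed simp
 have "map (map sit) (map (map (rl sg)) As) = map (map (relabel_item sg)) (map (map sit) As)" using As(1) by (induction As) (simp_all add: sit del: map_map)
 hence rel: "JD (map (map sit) (map (map (rl sg)) As)) (rv sg V) = relabel sg (JD (map (map sit) As) V)" by (simp add: relabel_def)
 have lg: "legs (fa (map (map (rl sg)) As)) = map sg (legs (fa As))" using r by (metis legs_rl)
 have inr: "inrange m (fa As)" using inrange_flt[of m u] As(3) by simp
 have 1: "jfun m n k h (map (rl sg) u, rv sg V) =
  (if legs t = [] & length As = n & okV (map sg (legs (fa As))) (rv sg V) & (length (legs (fa As)) + size V) div 2 = k
  then h (relabel sg (JD (map (map sit) As) V)) else 0)" using jfun_eq[of "map (map (rl sg)) As" "map (rl sg) t" m "map (rl sg) u" n k h "rv sg V"] As r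
  by (auto simp: arc flt_rl lg rel[simplified])
 show ?thesis unfolding 1 jfun_eq[OF As] okV_relabel[OF assms] using h_relabel[of "JD (map (map sit) As) V"] sit_jdiags[OF As(1) inr] assms by auto
qed

lemma jfun_rotate: "jfun m n k h (u, add_mset (a, b, c) V) = jfun m n k h (u, add_mset (b, c, a) V)"
proof -
 obtain As t where As: "ALL L:set As. arc L" "arc t" "flt m u = fa As @ t" by (rule word_cases[of "flt m u"]) blast
 have inr: "inrange m (fa As)" using inrange_flt[of m u] As(3) by simp
 have "adjV (add_mset (a, b, c) V) = adjV (add_mset (b, c, a) V)" by (auto simp: adjV_add)
 moreover have "vlabs (add_mset (a, b, c) V) = vlabs (add_mset (b, c, a) V)" by simp
 ultimately have "okV ls (add_mset (a, b, c) V) = okV ls (add_mset (b, c, a) V)" for ls unfolding okV_def by (simp only:)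
 thus ?thesis unfolding jfun_eq[OF As] using h_rotate[of "map (map sit) As" a b c V] sit_jdiags[OF As(1) inr] by auto
qed

lemma jfun_stu:
 assumes "e ~: set (legs p)" "e ~: set (legs q)" "e ~:# vlabs V" "e ~= a" "e ~= b"
 shows "jfun m n k h (p @ Lg e # q, add_mset (e, a, b) V) =
  jfun m n k h (p @ Lg b # Lg a # q, V) - jfun m n k h (p @ Lg a # Lg b # q, V)"
proof (cases rule: context_cases[of "flt m p" "flt m q"])
 case (inside A L M B t)
 let ?As = "%mid. A @ (L @ mid @ M) # B"
 have j: "jfun m n k h (p @ mid @ q, V) =
  (if legs t = [] & length (?As mid) = n & okV (legs (fa (?As mid))) V & (length (legs (fa (?As mid))) + size V) div 2 = k
  then h (JD (map (map sit) (?As mid)) V) else 0)" if "arc mid" "flt m mid = mid" for mid V using inside that by (intro jfun_eq) auto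
 have inr: "inrange m (flt m p @ flt m q)" by simp
 have mem: "JD (map (map sit) (?As mid)) V : jdiags (free_group m) n <-> length (?As mid) = n & okV (legs (fa (?As mid))) V"
  if "arc mid" "inrange m mid" for mid V using inside that inr by (intro sit_jdiags) auto
 let ?ls = "legs (fa A @ L) @ legs (M @ Sp # fa B)"
 have e: "e ~: set ?ls" using assms inside legs_flt[of m p] legs_flt[of m q] by (metis (no_types, opaque_lifting) Un_iff append.assoc append_Cons legs_append set_append)
 have ok: "okV (legs (fa (?As [Lg e]))) (add_mset (e, a, b) V) = okV (legs (fa (?As [Lg b, Lg a]))) V"
  "okV (legs (fa (?As [Lg a, Lg b]))) V = okV (legs (fa (?As [Lg b, Lg a]))) V" using okV_stu[OF e assms(3-5)]
   okV_mset[of "legs (fa (?As [Lg e]))" "e # ?ls"] okV_mset[of "legs (fa (?As [Lg b, Lg a]))" "a # b # ?ls"]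
   okV_mset[of "legs (fa (?As [Lg a, Lg b]))" "a # b # ?ls"] by simp_all
 show ?thesis using j[of "[Lg e]" "add_mset (e, a, b) V"] j[of "[Lg b, Lg a]" V] j[of "[Lg a, Lg b]" V]
   h_stu[of "map (map sit) A" "map sit L" e "map sit M" "map (map sit) B" a b V]
   mem[of "[Lg e]" "add_mset (e, a, b) V"] ok by auto
next
 case (outside A L)
 have j: "jfun m n k h (p @ mid @ q, V) = 0" if "arc mid" "flt m mid = mid" "legs mid ~= []" for mid V using jfun_eq[of A "L @ mid @ flt m q" m "p @ mid @ q" n k h V] outside that by auto
 show ?thesis using j[of "[Lg e]"] j[of "[Lg b, Lg a]"] j[of "[Lg a, Lg b]"] by simp
qed

lemma jfun_cancel: "jfun m n k h (p @ Lt i s # Lt i (~ s) # q, V) = jfun m n k h (p @ q, V)"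
proof (cases "1 <= i & i <= m")
 case False
 hence "flt m (p @ Lt i s # Lt i (~ s) # q) = flt m (p @ q)" by auto
 thus ?thesis unfolding jfun_def fst_conv snd_conv by simp
next
 case i: True
 show ?thesis
 proof (cases rule: context_cases[of "flt m p" "flt m q"])
  case (inside A L M B t)
  let ?As = "%mid. A @ (L @ mid @ M) # B"
  have j: "jfun m n k h (p @ mid @ q, V) =
   (if legs t = [] & length (?As mid) = n & okV (legs (fa (?As mid))) V & (length (legs (fa (?As mid))) + size V) div 2 = k
   then h (JD (map (map sit) (?As mid)) V) else 0)" if "arc mid" "flt m mid = mid" for mid V using inside that by (intro jfun_eq) auto
  have inr: "inrange m (flt m p @ flt m q)" by simp
  let ?mid = "[Lt i s, Lt i (~ s)]"
  have mem: "JD (map (map sit) (?As mid)) V : jdiags (free_group m) n <-> length (?As mid) = n & okV (legs (fa (?As mid))) V"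
   if "arc mid" "inrange m mid" for mid V using inside that inr by (intro sit_jdiags) auto
  have red: "foldr reduce_cons [(i, s)] [(i, ~ s)] = []" by simp
  have 1: "h (JD (map (map sit) (?As ?mid)) V) = h (JD (map (map sit) A @ (map sit L @ [Bead []] @ map sit M) # map (map sit) B) V)"
   if "JD (map (map sit) (?As ?mid)) V : jdiags (free_group m) n" using h_merge[of "map (map sit) A" "map sit L" "[(i, s)]" "[(i, ~ s)]" "map sit M" "map (map sit) B" V] that red by simp
  have 2: "JD (map (map sit) A @ (map sit L @ [Bead []] @ map sit M) # map (map sit) B) V : jdiags (free_group m) n"
   if "JD (map (map sit) (?As ?mid)) V : jdiags (free_group m) n" using that by (auto simp: jdiags_iff beads_def free_group_def)
  show ?thesis using j[of ?mid V] j[of "[]" V] 1 h_unit[OF 2] mem[of ?mid V] i by auto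
 next
  case (outside A L)
  show ?thesis using jfun_eq[of A "L @ [Lt i s, Lt i (~ s)] @ flt m q" m "p @ Lt i s # Lt i (~ s) # q" n k h V]
   jfun_eq[of A "L @ flt m q" m "p @ q" n k h V] outside i by simp
 qed
qed

lemma jfun_cz:
 assumes "e ~:# vlabs V"
 shows "jfun m n k h (cz {e} [(i, s)] u, V) = jfun m n k h (u, V)"
proof (cases "1 <= i & i <= m")
 case False
 have "flt m (cz {e} [(i, s)] u) = flt m u" using False by (induction u rule: legs.induct) auto
 thus ?thesis unfolding jfun_def fst_conv snd_conv by simp
next
 case i: True
 obtain As t where As: "ALL L:set As. arc L" "arc t" "flt m u = fa As @ t" by (rule word_cases[of "flt m u"]) blast
 let ?c = "cz {e} [(i, s)] :: nat sym list => nat sym list"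
 have inr: "inrange m (fa As)" using inrange_flt[of m u] As(3) by simp
 have f: "flt m (?c u) = ?c (flt m u)" using i by (induction u rule: legs.induct) auto
 have cfa: "?c (fa As) = fa (map ?c As)" by (induction As) auto
 have arc: "arc (?c L) = arc L" for L by (induction L rule: legs.induct) auto
 have lg: "legs (fa (map ?c As)) = legs (fa As)" using cfa by (metis legs_cz)
 have 1: "jfun m n k h (?c u, V) =
  (if legs t = [] & length As = n & okV (legs (fa As)) V & (length (legs (fa As)) + size V) div 2 = k
  then h (JD (map (map sit) (map ?c As)) V) else 0)"
 proof -
  have "ALL L:set (map ?c As). arc L" "arc (?c t)" "flt m (?c u) = fa (map ?c As) @ ?c t" using As arc cfa f by auto
  from jfun_eq[OF this, of n k h V] show ?thesis unfolding lg by simp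
 qed
 let ?D = "JD (map (map sit) As) V"
 have "(e, a) : (adjV V)\<^sup>* <-> a = e" for a using assms adjV_vlabs by (metis converse_rtranclE rtrancl.rtrancl_refl)
 hence comp: "(e, a) : (edge_adj ?D)\<^sup>* <-> a = e" for a by (simp add: edge_adj_adjV)
 have inv: "inv\<^bsub>free_group m\<^esub> [(i, s)] = [(i, ~ s)]" using inv_free_group[OF single_letter_carrier[of i m s]] i by (simp add: word_inv_def)
 have "map sit (?c L) = concat (map (%t. case t of
   Leg a => if (e, a) : (edge_adj ?D)\<^sup>* then [Bead [(i, s)], Leg a, Bead (inv\<^bsub>free_group m\<^esub> [(i, s)])] else [Leg a]
   | Bead g => [Bead g]) (map sit L))" if "arc L" for L using that by (induction L rule: legs.induct) (auto simp: comp inv)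
 hence cc: "JD (map (map sit) (map ?c As)) V = conj_component (free_group m) e [(i, s)] ?D" using As(1) by (simp add: conj_component_def)
 have "h (JD (map (map sit) (map ?c As)) V) = h ?D" if "?D : jdiags (free_group m) n"
 proof (cases "e : set (legs (fa As))")
  case True
  hence "e \<in># half_edges ?D" using fl_sit[OF As(1)] by (simp add: half_edges_fl)
  thus ?thesis unfolding cc using h_conj[OF that _ single_letter_carrier] i by blast
 next
  case False
  hence "fa (map ?c As) = fa As" using cfa by (metis cz_id disjoint_insert(2) inf_bot_right)
  hence "map ?c As = As" using unfl_fa[of As "[]"] unfl_fa[of "map ?c As" "[]"] As(1) arc by auto
  thus ?thesis by simp
 qed
 thus ?thesis unfolding 1 jfun_eq[OF As] using sit_jdiags[OF As(1) inr, of V n] by auto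
qed

text \<open>If \<open>h\<close> kills the relators, its extension satisfies the relations. On words
  that describe diagrams each relation is that of \<open>h\<close>; and the two sides of a relation
  either all describe diagrams of degree \<open>k\<close> or none does, by
  \<open>okV_relabel\<close>, \<open>okV_stu\<close> and the like, so extending by zero is
  consistent.\<close>

lemma jac_jfun: "jac {} (jfun m n k h)"
 apply (rule jacI)
 subgoal by simp
 subgoal by (rule jfun_relabel)
 subgoal by (rule jfun_rotate)
 subgoal by (rule jfun_stu)
 subgoal unfolding cancel_def by (simp add: jfun_cancel)
 subgoal for u v w e i s V using jfun_cz[of e V k i s "u @ Lg e # v @ Lg e # w"] by (simp add: cz_id)
 done

definition sp1 :: "fword item => fword item list" where
 "sp1 t = (case t of Leg e => [Leg e] | Bead w => map (%l. Bead [l]) w)"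

lemma h_spell_bead:
 assumes "w : carrier (free_group m)" "JD (A @ (L @ [Bead w] @ M) # B) V : jdiags (free_group m) n"
 shows "h (JD (A @ (L @ map (%l. Bead [l]) w @ M) # B) V) = h (JD (A @ (L @ [Bead w] @ M) # B) V)" using assms
proof (induction w arbitrary: L)
 case Nil
 thus ?case using h_unit[of A L M B V] by simp
next
 case (Cons l w)
 have w: "w : carrier (free_group m)" "[l] : carrier (free_group m)" using Cons.prems(1) reduced_tl[of l w] by (auto simp: free_group_def)
 have mem: "JD (A @ (L @ [Bead [l], Bead w] @ M) # B) V : jdiags (free_group m) n" using Cons.prems(2) w by (auto simp: jdiags_iff beads_def case_prod_beta lts_def)
 have "foldr reduce_cons [l] w = l # w" using foldr_reduced[of "[l]" w] Cons.prems(1) by (simp add: free_group_def)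
 thus ?case using h_merge[OF mem] Cons.IH[of "L @ [Bead [l]]"] w mem by simp
qed

lemma h_spell_arc:
 assumes "JD (A @ (K @ L) # B) V : jdiags (free_group m) n"
 shows "h (JD (A @ (K @ concat (map sp1 L)) # B) V) = h (JD (A @ (K @ L) # B) V)" using assms
proof (induction L arbitrary: K)
 case (Cons t L)
 show ?case
 proof (cases t)
  case (Leg e)
  thus ?thesis using Cons.IH[of "K @ [t]"] Cons.prems by (simp add: sp1_def)
 next
  case (Bead w)
  have w: "w : carrier (free_group m)" using Cons.prems by (auto simp: jdiags_iff beads_def Bead)
  have bc: "concat (map item_beads (map (%l. Bead [l]) w)) = map (%l. [l]) w" by (induction w) auto
  have "set (map (%l. [l]) w) <= carrier (free_group m)" using w by (auto simp: free_group_def)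
  moreover have "arc_word (map (%l. Bead [l]) w) = lts w" by (induction w) auto
  ultimately have "JD (A @ ((K @ map (%l. Bead [l]) w) @ L) # B) V : jdiags (free_group m) n" using Cons.prems bc by (auto simp: jdiags_iff beads_def Bead)
  thus ?thesis using Cons.IH[of "K @ map (%l. Bead [l]) w"] h_spell_bead[OF w, of A K L B V] Cons.prems by (simp add: sp1_def Bead)
 qed
qed (simp add: sp1_def)

lemma sp1_arc_word: "concat (map sp1 L) = map sit (arc_word L)"
proof (induction L)
 case (Cons t L)
 have "map (%l. Bead [l]) w = map sit (lts w)" for w by (induction w) auto
 thus ?case using Cons by (cases t) (auto simp: sp1_def)
qed simp

lemma h_spell:
 assumes "JD (A @ B) V : jdiags (free_group m) n"
 shows "h (JD (A @ map (%L. map sit (arc_word L)) B) V) = h (JD (A @ B) V)" using assms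
proof (induction B arbitrary: A)
 case (Cons L B)
 have c: "inrange m (arc_word L)" if "set (concat (map item_beads L)) <= carrier (free_group m)" using that
 proof (induction L)
  case (Cons t L)
  thus ?case by (cases t) (auto simp: inrange_lts)
 qed simp
 have "JD ((A @ [map sit (arc_word L)]) @ B) V : jdiags (free_group m) n" using Cons.prems beads_sit[OF c] by (auto simp: jdiags_iff beads_def arc_word_sit)
 thus ?case using Cons.IH[of "A @ [map sit (arc_word L)]"] h_spell_arc[of A "[]" L B V] Cons.prems by (simp add: sp1_arc_word)
qed simp

text \<open>A word only records single letters, whereas a diagram may carry arbitrary group elements
  as beads. The merge and unit relations split each bead into its letters without changing
  \<open>h\<close>.\<close>

lemma jfun_fd:
 assumes D: "D : jdiags (free_group m) n" "jdeg D = k"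
 shows "jfun m n k h (fd D) = h D"
proof -
 obtain A V where DV: "D = JD A V" by (cases D)
 have inr: "inrange m (arc_word L)" if "set (concat (map item_beads L)) <= carrier (free_group m)" for L using that
 proof (induction L)
  case (Cons t L)
  thus ?case by (cases t) (auto simp: inrange_lts)
 qed simp
 have "inrange m (fl A)" using D(1) inr unfolding fl_def inrange_fa by (fastforce simp: jdiags_iff beads_def DV)
 hence f: "flt m (fl A) = fa (map arc_word A) @ []" by (simp add: flt_inrange fl_def)
 have arcs: "ALL L:set (map arc_word A). arc L" by auto
 have "jfun m n k h (fd D) = h (JD (map (map sit) (map arc_word A)) V)" using D jfun_eq[OF arcs arc_simps(1) f, of n k h V] by (simp add: DV jdiags_iff fl_def jdeg_fl wt_def fd_def del: map_map)
 also have "... = h D" using h_spell[of "[]" A V] D by (simp add: DV comp_def)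
 finally show ?thesis .
qed

end

text \<open>Vanishing in large weight makes the evaluation on an infinite series a finite
  sum.\<close>

definition jacb :: "('k::field jfn) => bool" where
 "jacb g <-> jac {} g & (EX d. ALL x. wt x > d --> g x = 0)"

lemma jacb_jfun:
 assumes "!!r. r : jrel (free_group m) n ==> pr h r = 0"
 shows "jacb (jfun m n k h)" unfolding jacb_def
proof (intro conjI exI[of _ "2 * k + 1"] allI impI)
 show "jac {} (jfun m n k h)" using assms by (rule jac_jfun)
 fix x :: "dword"
 assume x: "wt x > 2 * k + 1"
 obtain u V where xu: "x = (u, V)" by (cases x)
 obtain As t where As: "ALL L:set As. arc L" "arc t" "flt m u = fa As @ t" by (rule word_cases[of "flt m u"]) blast
 have "legs u = legs (fa As) @ legs t" using As(3) by (metis legs_append legs_flt)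
 thus "jfun m n k h x = 0" using x jfun_eq[OF As, of n k h V] unfolding xu by (auto simp: wt_def)
qed

text \<open>If \<open>f\<close> is outside the span, a functional separates it from the relators,
  and the extension of this functional by \<open>jfun\<close> is a function of bounded weight that
  satisfies the relations and has the same value on \<open>f\<close>.\<close>

theorem span_jrel_iff:
 assumes f: "fsupp f" "!!D. f D ~= 0 ==> D : jdiags (free_group m) n & jdeg D = k"
 shows "f : coeff_fun.span (jrel (free_group m) n) <-> (ALL g. jacb g --> pr (%D. g (fd D)) f = 0)"
proof
 assume "f : coeff_fun.span (jrel (free_group m) n)"
 thus "ALL g. jacb g --> pr (%D. g (fd D)) f = 0" using span_pr_zero jac_jrel fsupp_jrel unfolding jacb_def by blast
next
 assume R: "ALL g. jacb g --> pr (%D. g (fd D)) f = 0"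
 show "f : coeff_fun.span (jrel (free_group m) n)"
 proof (rule ccontr)
  assume "f ~: coeff_fun.span (jrel (free_group m) n)"
  then obtain h where h: "!!r. r : jrel (free_group m) n ==> pr h r = 0" "pr h f ~= 0" using not_in_span_functional[OF _ f(1)] fsupp_jrel by blast
  have "pr (%D. jfun m n k h (fd D)) f = pr h f" unfolding pr_def using f(2) jfun_fd[OF h(1)] by (intro sum.cong) auto
  thus False using R jacb_jfun[OF h(1)] h(2) by metis
 qed
qed

section \<open>The sum over distributions as an iterated insertion\<close>

section \<open>Composition of diagrams in terms of words\<close>

fun inv_sym :: "'a sym => 'a sym" where
 "inv_sym (Lg e) = Lg e"
| "inv_sym (Lt a s) = Lt a (~ s)"
| "inv_sym Sp = Sp"

definition rinv :: "'a sym list => 'a sym list" where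
 "rinv w = rev (map inv_sym w)"

lemma rinv_simps [simp]: "rinv [] = []" "rinv (x # w) = rinv w @ [inv_sym x]" "rinv (v @ w) = rinv w @ rinv v" by (auto simp: rinv_def)

lemma rinv_lts [simp]: "rinv (lts w) = lts (winv w)" by (induction w) auto

type_synonym occ = "nat * nat"

text \<open>An intermediate stage of \<open>vs\<close>: \<open>c\<close> gives for each position of
  the outer diagram the part of its copy that has already been moved there. It stands before a
  letter; for an inverse letter it stands behind it, reversed and with inverted beads.\<close>

fun blk :: "(occ => 'a sym list) => occ * nat sym => (nat + 'a) sym list" where
 "blk c (o', Lg e) = [Lg e]"
| "blk c (o', Sp) = [Sp]"
| "blk c (o', Lt j s) = (if s then inr (c o') @ [Lt (Inl j) True] else [Lt (Inl j) False] @ inr (rinv (c o')))"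

definition occs :: "(occ * nat sym) list => nat => occ set" where
 "occs ps j = {o'. EX s. (o', Lt j s) : set ps}"

definition osg :: "(occ * nat sym) list => occ => 'k::field" where
 "osg ps o' = (if EX j. (o', Lt j False) : set ps then -1 else 1)"

definition wordc :: "(occ * nat sym) list => (occ => 'a sym list) => (nat + 'a) sym list" where
 "wordc ps c = concat (map (blk c) ps)"

lemma wordc_simps [simp]: "wordc [] c = []" "wordc (p # ps) c = blk c p @ wordc ps c" by (auto simp: wordc_def)

lemma wordc_cong: "(!!o' x. (o', x) : set ps ==> c o' = d o') ==> wordc ps c = wordc ps d"
proof (induction ps)
 case (Cons p ps)
 obtain o' x where p: "p = (o', x)" by fastforce
 have "wordc ps c = wordc ps d" by (rule Cons.IH) (auto intro: Cons.prems)
 moreover have "c o' = d o'" using Cons.prems[of o' x] p by simp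
 hence "blk c p = blk d p" by (cases x) (auto simp: p)
 ultimately show ?case by simp
qed simp

lemma finite_occs: "finite (occs ps j)"
proof (rule finite_subset)
 show "occs ps j <= fst ` set ps" by (force simp: occs_def)
qed simp

lemma insb_inr [simp]: "insb (Inl j) B k (inr u) = 0"
proof (rule insb_free)
 show "Lt (Inl j) s ~: set (inr u)" for s by (induction u rule: legs.induct) auto
qed

text \<open>Inserting a leg at one occurrence of the slot extends the copy at that occurrence. For
  an inverse letter the leg is put directly behind it, which is the end of the copy before reversal,
  and the sign is that of the reversal.\<close>

lemma insb_wordc:
 assumes "distinct (map fst ps)"
 shows "insb (Inl j) [Lg e] k (wordc ps c) = (SUM o':occs ps j. osg ps o' * k (wordc ps (c(o' := c o' @ [Lg e]))))" using assms
proof (induction ps arbitrary: k)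
 case Nil
 thus ?case by (simp add: occs_def)
next
 case (Cons p ps)
 obtain q x where p: "p = (q, x)" by fastforce
 have q: "(q, y) ~: set ps" for y using Cons.prems p by force
 have oc: "q ~: occs ps j" for j using q by (auto simp: occs_def)
 have os: "osg (p # ps) o' = osg ps o'" if "o' ~= q" for o' using that by (auto simp: osg_def p)
 have IH: "insb (Inl j) [Lg e] (%v. k (blk c p @ v)) (wordc ps c)
   = (SUM o':occs ps j. osg (p # ps) o' * k (wordc (p # ps) (c(o' := c o' @ [Lg e]))))"
 proof -
  have b1: "blk (c(o' := c o' @ [Lg e])) p = blk c p" if "o' : occs ps j" for o'
  proof -
   have "o' ~= q" using that oc by blast
   thus ?thesis by (cases x) (auto simp: p)
  qed
  have b2: "osg (p # ps) o' = osg ps o'" if "o' : occs ps j" for o'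
  proof -
   have "o' ~= q" using that oc[of j] by blast
   thus ?thesis by (rule os)
  qed
  have "insb (Inl j) [Lg e] (%v. k (blk c p @ v)) (wordc ps c)
   = (SUM o':occs ps j. osg ps o' * k (blk c p @ wordc ps (c(o' := c o' @ [Lg e]))))" using Cons.prems by (intro Cons.IH) simp
  also have "... = (SUM o':occs ps j. osg (p # ps) o' * k (wordc (p # ps) (c(o' := c o' @ [Lg e]))))" by (rule sum.cong) (simp_all only: b1 b2 wordc_simps)
  finally show ?thesis .
 qed
 show ?case
 proof (cases "EX s. x = Lt j s")
  case True
  then obtain s where x: "x = Lt j s" by blast
  have occ: "occs (p # ps) j = insert q (occs ps j)" by (auto simp: occs_def p x)
  have same: "wordc ps (c(q := c q @ [Lg e])) = wordc ps c" by (rule wordc_cong) (use q in auto)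
  have 2: "insb (Inl j) [Lg e] (%v. k (v @ wordc ps c)) (blk c p) = osg (p # ps) q * k (wordc (p # ps) (c(q := c q @ [Lg e])))" using q by (cases s) (auto simp: p x osg_def insb_append same)
  show ?thesis unfolding wordc_simps(2)[of p ps c] insb_append 2 IH occ sum.insert[OF finite_occs oc] ..
 next
  case False
  have occ: "occs (p # ps) j = occs ps j" using False by (auto simp: occs_def p)
  have z: "insb (Inl j) [Lg e] (%v. k (v @ wordc ps c)) (blk c p) = 0" using False by (cases x) (auto simp: p insb_append)
  show ?thesis unfolding wordc_simps(2)[of p ps c] insb_append z IH occ add_0_left ..
 qed
qed

lemma lmap_wsub_inr: "lmap (wsub j w) (inr u) = inr u" unfolding lmap_lmap by (rule lmap_cong) (simp add: wsub_def)

lemma lts_inr: "lts (map (%(b, s). (Inr b, s)) w) = inr (lts w)" by (induction w) auto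

lemma winv_map: "winv (map (%(b, s). (h b, s)) w) = map (%(b, s). (h b, s)) (winv w)" using spow_map[of False h w] by simp

lemma lmap_wsub_wordc:
 assumes "distinct (map fst ps)"
 shows "lmap (wsub j w) (wordc ps c) = wordc ps (%o'. if o' : occs ps j then c o' @ lts w else c o')" using assms
proof (induction ps)
 case (Cons p ps)
 obtain q x where p: "p = (q, x)" by fastforce
 have q: "(q, y) ~: set ps" for y using Cons.prems p by force
 let ?d = "%ps o'. if o' : occs ps j then c o' @ lts w else c o'"
 have "wordc ps (?d (p # ps)) = wordc ps (?d ps)" by (rule wordc_cong) (use q in "auto simp: occs_def p")
 moreover have "lmap (wsub j w) (blk c p) = blk (?d (p # ps)) p"
 proof (cases x)
  case (Lt i s)
  show ?thesis
  proof (cases "i = j")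
   case True
   hence "q : occs (p # ps) j" by (auto simp: occs_def p Lt)
   thus ?thesis using True by (cases s) (auto simp: p Lt lmap_wsub_inr wsub_def lts_inr winv_map simp del: lts_append_map)
  next
   case False
   hence "q ~: occs (p # ps) j" using q by (auto simp: occs_def p Lt)
   thus ?thesis using False by (cases s) (auto simp: p Lt lmap_wsub_inr wsub_def)
  qed
 qed (auto simp: p)
 ultimately show ?case using Cons by simp
qed simp

fun fblk :: "(occ => 'a sym list) => occ * nat sym => 'a sym list" where
 "fblk c (o', Lg e) = [Lg e]"
| "fblk c (o', Sp) = [Sp]"
| "fblk c (o', Lt j s) = (if s then c o' else rinv (c o'))"

lemma lstrip_wordc: "lmap lstrip (wordc ps c) = concat (map (fblk c) ps)"
proof (induction ps)
 case (Cons p ps)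
 obtain q x where "p = (q, x)" by fastforce
 thus ?case using Cons by (cases x) auto
qed simp

text \<open>\<open>vs\<close> once more, with every symbol of the inner diagram accompanied by its
  arc number and its place on the arc, because distributions are functions of these positions. The
  slots are numbered from 1, the arcs from 0.\<close>

fun vp :: "((nat * nat) * fword item) list => (nat sym list => 'k::field) => (nat + nat) sym list => 'k" where
 "vp [] g u = g (lmap lstrip u)"
| "vp ((p, Leg e) # R) g u = insb (Inl (Suc (fst p))) [Lg e] (vp R g) u"
| "vp ((p, Bead w) # R) g u = vp R g (lmap (wsub (Suc (fst p)) w) u)"

definition LP :: "((nat * nat) * fword item) list => (nat * nat) set" where
 "LP R = {p. EX e. (p, Leg e) : set R}"

definition cpR :: "(occ * nat sym) list => ((nat * nat) * fword item) list => (nat * nat => occ) => occ => nat sym list" where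
 "cpR ps R kp o' = concat (map (%(p, t). if o' : occs ps (Suc (fst p)) then
   (case t of Leg e => if kp p = o' then [Lg e] else [] | Bead w => lts w) else []) R)"

lemma finite_LP: "finite (LP R)"
proof (rule finite_subset)
 show "LP R <= fst ` set R" by (force simp: LP_def)
qed simp

lemma sum_PiE_insert:
 assumes "x ~: S" "finite S"
 shows "(SUM kp:Pi\<^sub>E (insert x S) T. F kp) = (SUM y:T x. SUM kp:Pi\<^sub>E S T. F (kp(x := y)))"
proof -
 have "(SUM kp:Pi\<^sub>E (insert x S) T. F kp) = (\<Sum>(y, kp)\<in>T x \<times> Pi\<^sub>E S T. F (kp(x := y)))" unfolding PiE_insert_eq
  by (subst sum.reindex[OF inj_combinator[OF assms(1)]]) (auto simp: case_prod_beta comp_def intro!: sum.cong)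
 also have "... = (SUM y:T x. SUM kp:Pi\<^sub>E S T. F (kp(x := y)))" by (simp add: sum.cartesian_product)
 finally show ?thesis .
qed

text \<open>Each leg contributes one coordinate of the distribution and one sign; each bead is
  appended to all copies of its arc. Induction over the symbols of the inner diagram expands the
  iterated insertion into a sum over all distributions.\<close>

lemma vp_wordc:
 fixes g :: "nat sym list => 'k::field"
 assumes "distinct (map fst ps)" "distinct (map fst R)"
 shows "vp R g (wordc ps c) = (SUM kp:Pi\<^sub>E (LP R) (%p. occs ps (Suc (fst p))).
  (PROD p:LP R. osg ps (kp p)) * g (concat (map (fblk (%o'. c o' @ cpR ps R kp o')) ps)))" using assms(2)
proof (induction R arbitrary: c)
 case Nil
 thus ?case by (simp add: LP_def cpR_def lstrip_wordc)
next
 case (Cons r R)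
 obtain p t where r: "r = (p, t)" by fastforce
 have pR: "(p, t') ~: set R" for t' using Cons.prems r by force
 have cp_upd: "cpR ps R (kp(p := y)) = cpR ps R kp" for kp y unfolding cpR_def using pR by (intro ext arg_cong[of _ _ concat] map_cong) (auto split: item.splits)
 show ?case
 proof (cases t)
  case (Leg e)
  have LP: "LP (r # R) = insert p (LP R)" by (auto simp: LP_def r Leg)
  have pLP: "p ~: LP R" using pR by (auto simp: LP_def)
  have cp: "(c(y := c y @ [Lg e])) o' @ cpR ps R kp o' = c o' @ cpR ps (r # R) (kp(p := y)) o'"
   if "y : occs ps (Suc (fst p))" for y kp o'
  proof -
   have "cpR ps (r # R) kp' o' = (if o' : occs ps (Suc (fst p)) then (if kp' p = o' then [Lg e] else []) else []) @ cpR ps R kp' o'" for kp' by (simp add: cpR_def r Leg)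
   thus ?thesis using that by (auto simp: cp_upd simp del: fun_upd_apply) auto
  qed
  have pr: "osg ps y * (PROD p':LP R. osg ps (kp p')) = (PROD p':LP (r # R). (osg ps ((kp(p := y)) p') :: 'k))" for kp y
  proof -
   have "(PROD p':LP R. (osg ps ((kp(p := y)) p') :: 'k)) = (PROD p':LP R. osg ps (kp p'))" using pLP by (intro prod.cong) auto
   thus ?thesis using pLP by (simp add: LP finite_LP)
  qed
  have "vp (r # R) g (wordc ps c) = (SUM y:occs ps (Suc (fst p)). osg ps y * vp R g (wordc ps (c(y := c y @ [Lg e]))))" using insb_wordc[OF assms(1)] by (simp only: r Leg vp.simps)
  also have "... = (SUM y:occs ps (Suc (fst p)). SUM kp:Pi\<^sub>E (LP R) (%p. occs ps (Suc (fst p))).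
   (PROD p':LP (r # R). osg ps ((kp(p := y)) p')) * g (concat (map (fblk (%o'. c o' @ cpR ps (r # R) (kp(p := y)) o')) ps)))"
  proof (rule sum.cong[OF refl])
   fix y assume y: "y : occs ps (Suc (fst p))"
   have "vp R g (wordc ps (c(y := c y @ [Lg e]))) = (SUM kp:Pi\<^sub>E (LP R) (%p. occs ps (Suc (fst p))).
   (PROD p:LP R. osg ps (kp p)) * g (concat (map (fblk (%o'. (c(y := c y @ [Lg e])) o' @ cpR ps R kp o')) ps)))" by (rule Cons.IH) (use Cons.prems in simp)
   thus "osg ps y * vp R g (wordc ps (c(y := c y @ [Lg e]))) = (SUM kp:Pi\<^sub>E (LP R) (%p. occs ps (Suc (fst p))).
   (PROD p':LP (r # R). osg ps ((kp(p := y)) p')) * g (concat (map (fblk (%o'. c o' @ cpR ps (r # R) (kp(p := y)) o')) ps)))"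
   by (simp only: cp[OF y] sum_distrib_left mult.assoc[symmetric] pr)
  qed
  finally show ?thesis unfolding LP sum_PiE_insert[OF pLP finite_LP] .
 next
  case (Bead w)
  have LP: "LP (r # R) = LP R" by (auto simp: LP_def r Bead)
  have cp: "(if o' : occs ps (Suc (fst p)) then c o' @ lts w else c o') @ cpR ps R kp o' = c o' @ cpR ps (r # R) kp o'" for kp o' by (simp add: cpR_def r Bead)
  have "vp (r # R) g (wordc ps c) = vp R g (wordc ps (%o'. if o' : occs ps (Suc (fst p)) then c o' @ lts w else c o'))" by (simp only: r Bead vp.simps lmap_wsub_wordc[OF assms(1)])
  also have "... = (SUM kp:Pi\<^sub>E (LP R) (%p. occs ps (Suc (fst p))). (PROD p:LP R. osg ps (kp p)) *
   g (concat (map (fblk (%o'. (if o' : occs ps (Suc (fst p)) then c o' @ lts w else c o') @ cpR ps R kp o')) ps)))" by (rule Cons.IH) (use Cons.prems in simp)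
  finally show ?thesis unfolding LP cp .
 qed
qed

definition entries :: "nat => fword item list list => ((nat * nat) * fword item) list" where
 "entries k As = concat (map (%(j, L). map (%(i, t). ((j, i), t)) (List.enumerate 0 L)) (List.enumerate k As))"

lemma vp_arc: "vp (map (%(i, t). ((j, i), t)) (List.enumerate i0 L) @ R) g u = vs (Suc j) (arc_word L @ A) g u"
 if "!!u. vp R g u = vs (Suc j) A g u"
proof (induction L arbitrary: i0 u)
 case Nil
 thus ?case using that by simp
next
 case (Cons t L)
 have "vp (map (%(i, t). ((j, i), t)) (List.enumerate (Suc i0) L) @ R) g = vs (Suc j) (arc_word L @ A) g" using Cons.IH by blast
 thus ?case by (cases t) (auto simp: vs_lts)
qed

lemma vp_entries: "vp (entries k As) g u = vs (Suc k) (fl As) g u" by (induction As arbitrary: k u) (auto simp: entries_def fl_simps vp_arc)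

lemma set_entries: "((j, i), t) : set (entries 0 As) <-> j < length As & i < length (As ! j) & As ! j ! i = t" by (force simp: entries_def in_set_enumerate_eq)

lemma distinct_entries: "distinct (map fst (entries k As))" by (induction As arbitrary: k) (auto simp: entries_def in_set_enumerate_eq nth_enumerate_eq distinct_map inj_on_def)

fun sy :: "nat + letter => nat sym" where
 "sy (Inl e) = Lg e"
| "sy (Inr (j, s)) = Lt j s"

text \<open>The separator of an arc receives the position behind the last symbol of the arc, so that
  all positions are distinct.\<close>

definition epos :: "fword item list list => (occ * nat sym) list" where
 "epos As = concat (map (%(a, L). map (%(q, t). ((a, q), sy t)) (List.enumerate 0 (spell L)) @ [((a, length (spell L)), Sp)])
  (List.enumerate 0 As))"

lemma arc_word_spell: "arc_word L = map sy (spell L)"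
proof (induction L)
 case (Cons t L)
 have "map sy (map Inr w) = lts w" for w by (induction w) auto
 thus ?case using Cons by (cases t) (auto simp: spell_def simp del: map_map)
qed (simp add: spell_def)

lemma wordc_epos: "wordc (epos As) (%_. []) = inl (fl As)"
proof -
 have 1: "wordc (map (%(q, t). ((a, q), sy t)) (List.enumerate k S) @ R) (%_. []) = inl (map sy S) @ wordc R (%_. [])" for a k S R
 proof (induction S arbitrary: k)
  case (Cons t S)
  thus ?case by (cases t rule: sy.cases) auto
 qed simp
 have "wordc (concat (map (%(a, L). map (%(q, t). ((a, q), sy t)) (List.enumerate 0 (spell L)) @ [((a, length (spell L)), Sp)])
  (List.enumerate k As))) (%_. []) = inl (fl As)" for k by (induction As arbitrary: k) (auto simp: 1 arc_word_spell)
 thus ?thesis by (simp add: epos_def)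
qed

lemma set_epos: "((a, q), Lt j s) : set (epos As) <-> a < length As & q < length (spell (As ! a)) & spell (As ! a) ! q = Inr (j, s)"
proof -
 have 1: "Lt j s = sy t <-> t = Inr (j, s)" for t by (cases t rule: sy.cases) auto
 have "((a, q), Lt j s) : set (epos As) <->
   (EX L. (a, L) : set (List.enumerate 0 As) & (EX t. (q, t) : set (List.enumerate 0 (spell L)) & Lt j s = sy t))"
  unfolding epos_def by (auto simp: image_iff case_prod_beta) force+
 thus ?thesis unfolding 1 by (auto simp: in_set_enumerate_eq)
qed

lemma distinct_epos: "distinct (map fst (epos As))"
proof -
 let ?F = "%(a, L). map (%(q, t). ((a, q), sy t)) (List.enumerate 0 (spell L)) @ [((a, length (spell L)), Sp)]"
 have "distinct (map fst (concat (map ?F (List.enumerate k As))))" for k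
 by (induction As arbitrary: k) (auto simp: nth_enumerate_eq nth_append less_Suc_eq in_set_enumerate_eq distinct_map inj_on_def map_append distinct_append)
 thus ?thesis by (simp only: epos_def)
qed

lemma occs_epos: "occs (epos (arcs D')) (Suc j) = occurrences D' j" by (auto simp: occs_def occurrences_def set_epos)

lemma LP_entries: "LP (entries 0 (arcs D)) = leg_positions D" by (auto simp: LP_def leg_positions_def set_entries)

lemma osg_epos:
 assumes "o' : occurrences D' j"
 shows "osg (epos (arcs D')) o' = (if is_negative D' o' then -1 else 1)" using assms by (cases o') (auto simp: osg_def is_negative_def set_epos occurrences_def)

lemma arc_word_arc_copy:
 "arc_word (arc_copy D kp j o') = concat (map (%(i, t). case t of Leg e => if kp (j, i) = o' then [Lg e] else [] | Bead w => lts w) (List.enumerate 0 (arcs D ! j)))"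
proof -
 have "arc_word (concat (map (%(i, t). case t of Leg e => if kp (j, i) = o' then [Leg e] else [] | Bead w => [Bead w]) xs))
  = concat (map (%(i, t). case t of Leg e => if kp (j, i) = o' then [Lg e] else [] | Bead w => lts w) xs)" for xs by (induction xs) (auto split: item.splits)
 thus ?thesis by (simp add: arc_copy_def)
qed

lemma arc_word_rev: "arc_word (rev (map invert_item X)) = rinv (arc_word X)"
proof (induction X)
 case (Cons t X)
 thus ?case by (cases t) (auto simp: word_inv_winv)
qed simp

lemma cpR_entries:
 assumes "o' : occurrences D' j" "j < length (arcs D)"
 shows "cpR (epos (arcs D')) (entries 0 (arcs D)) kp o' = arc_word (arc_copy D kp j o')"
proof -
 have uniq: "i = j" if "o' : occurrences D' i" for i using that assms(1) by (auto simp: occurrences_def)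
 let ?F = "%i. concat (map (%(q, t). case t of Leg e => if kp (i, q) = o' then [Lg e] else [] | Bead w => lts w) (List.enumerate 0 (arcs D ! i)))"
 have 1: "cpR (epos (arcs D')) (concat xs) kp o' = concat (map (%x. cpR (epos (arcs D')) x kp o') xs)" for xs by (induction xs) (auto simp: cpR_def)
 have 2: "cpR (epos (arcs D')) (map (%(q, t). ((i, q), t)) (List.enumerate 0 L)) kp o' =
   (if i = j then concat (map (%(q, t). case t of Leg e => if kp (i, q) = o' then [Lg e] else [] | Bead w => lts w) (List.enumerate 0 L)) else [])" for i L
 proof -
  have iff: "o' : occs (epos (arcs D')) (Suc i) <-> i = j" unfolding occs_epos using uniq[of i] assms(1) by blast
  have nil: "concat (map (%x. []) xs) = []" for xs :: "(nat * fword item) list" by (induction xs) auto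
  show ?thesis
  proof (cases "i = j")
   case True
   thus ?thesis using iff by (auto simp: cpR_def comp_def intro!: arg_cong[of _ _ concat] map_cong split: item.splits prod.splits)
  next
   case False
   thus ?thesis using iff by (simp add: cpR_def comp_def case_prod_beta nil)
  qed
 qed
 have 3: "concat (map (%(i, L). if i = j then G L else []) (List.enumerate k As)) = G (As ! (j - k))"
  if "k <= j" "j < k + length As" for k As and G :: "fword item list => nat sym list" using that
 proof (induction As arbitrary: k)
  case (Cons L As)
  have z: "concat (map (%(i, L). if i = j then G L else []) (List.enumerate (Suc k) As)) = []" if "k = j" using that by (auto simp: in_set_enumerate_eq)
  show ?case using z Cons.IH Cons.prems by (cases "k = j") (auto simp: nth_Cons' Suc_diff_Suc)
 qed simp
 have "cpR (epos (arcs D')) (entries 0 (arcs D)) kp o' =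
  concat (map (%(i, L). if i = j then concat (map (%(q, t). case t of Leg e => if kp (j, q) = o' then [Lg e] else [] | Bead w => lts w) (List.enumerate 0 L)) else []) (List.enumerate 0 (arcs D)))"
  unfolding entries_def 1 map_map by (intro arg_cong[of _ _ concat] map_cong refl) (auto simp: 2)
 also have "... = ?F j" using 3[of 0 "arcs D"] assms(2) by simp
 finally show ?thesis by (simp add: arc_word_arc_copy)
qed

lemma fl_glue:
 assumes kp: "!!a q j s. a < length (arcs D') ==> q < length (spell (arcs D' ! a)) ==> spell (arcs D' ! a) ! q = Inr (j, s) ==>
   1 <= j & j <= length (arcs D)"
 shows "fl (arcs (glue D' D kp)) = concat (map (fblk (%o'. [] @ cpR (epos (arcs D')) (entries 0 (arcs D)) kp o')) (epos (arcs D')))"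
proof -
 let ?c = "%o'. [] @ cpR (epos (arcs D')) (entries 0 (arcs D)) kp o'"
 let ?G = "%a (q, t). case t of Inl e => [Leg e] | Inr (j, s) => (if s then arc_copy D kp (j - 1) (a, q)
   else rev (map invert_item (arc_copy D kp (j - 1) (a, q))))"
 have b: "arc_word (?G a (q, t)) = fblk ?c ((a, q), sy t)" if "a < length (arcs D')" "q < length (spell (arcs D' ! a))" "spell (arcs D' ! a) ! q = t" for a q t
 proof (cases t rule: sy.cases)
  case (2 j s)
  hence "1 <= j" "j <= length (arcs D)" using kp that by auto
  hence "(a, q) : occurrences D' (j - 1)" "j - 1 < length (arcs D)" using that 2 by (auto simp: occurrences_def)
  thus ?thesis using cpR_entries 2 by (simp add: arc_word_rev)
 qed simp
 have aw: "arc_word (concat (map f xs)) = concat (map (%x. arc_word (f x)) xs)" for f :: "nat * (nat + letter) => fword item list" and xs by (induction xs) auto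
 have flm: "fl (map F xs) = concat (map (%x. arc_word (F x) @ [Sp]) xs)" for F :: "nat * fword item list => fword item list" and xs by (induction xs) auto
 have L: "arc_word (concat (map (?G a) (List.enumerate 0 (spell (arcs D' ! a))))) @ [Sp]
  = concat (map (fblk ?c) (map (%(q, t). ((a, q), sy t)) (List.enumerate 0 (spell (arcs D' ! a))) @ [((a, length (spell (arcs D' ! a))), Sp)]))"
  if "a < length (arcs D')" for a
 proof -
  have e: "map (%x. arc_word (?G a x)) (List.enumerate 0 (spell (arcs D' ! a)))
   = map (%x. fblk ?c ((%(q, t). ((a, q), sy t)) x)) (List.enumerate 0 (spell (arcs D' ! a)))"
  proof (rule map_cong[OF refl])
   fix x assume x: "x : set (List.enumerate 0 (spell (arcs D' ! a)))"
   obtain q t where qt: "x = (q, t)" by fastforce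
   show "arc_word (?G a x) = fblk ?c ((%(q, t). ((a, q), sy t)) x)" unfolding qt prod.case using b[of a q t] that x by (simp add: in_set_enumerate_eq qt)
  qed
  show ?thesis unfolding aw e by (simp add: comp_def)
 qed
 have concat_concat_map: "concat (map f (concat xss)) = concat (map (%xs. concat (map f xs)) xss)" for f :: "occ * nat sym => nat sym list" and xss by (induction xss) auto
 have "fl (map (%(a, L). concat (map (?G a) (List.enumerate 0 (spell L)))) (List.enumerate 0 (arcs D')))
  = concat (map (fblk ?c) (epos (arcs D')))" unfolding flm epos_def concat_concat_map map_map
  apply (rule arg_cong[of _ _ concat], rule map_cong[OF refl])
  subgoal premises x for x
  proof -
   obtain a M where "x = (a, M)" by fastforce
   hence xa: "x = (a, arcs D' ! a)" "a < length (arcs D')" using x by (auto simp: in_set_enumerate_eq)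
   show ?thesis unfolding xa(1) prod.case comp_apply by (rule L[unfolded epos_def, OF xa(2)])
  qed
  done
 thus ?thesis by (simp add: glue_def)
qed

lemma prod_sign: "finite S ==> (PROD p:S. if P p then - 1 else (1 :: 'k::field)) = (- 1) ^ card {p : S. P p}" by (simp add: prod.If_cases Int_def)

text \<open>The link between diagrams and words: the signed sum over all ways of gluing is the value
  of \<open>vs\<close>. All later statements about composition use only \<open>vs\<close>.\<close>

lemma sum_glue:
 fixes g :: "nat sym list => 'k::field"
 assumes "!!a q j s. a < length (arcs D') ==> q < length (spell (arcs D' ! a)) ==> spell (arcs D' ! a) ! q = Inr (j, s) ==>
   1 <= j & j <= length (arcs D)"
 shows "(SUM kp:distributions D' D. (- 1) ^ card {p : leg_positions D. is_negative D' (kp p)} * g (fl (arcs (glue D' D kp))))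
  = vs 1 (fl (arcs D)) g (inl (fl (arcs D')))"
proof -
 let ?ps = "epos (arcs D')" and ?R = "entries 0 (arcs D)"
 have "vs 1 (fl (arcs D)) g (inl (fl (arcs D'))) = vp ?R g (wordc ?ps (%_. []))" by (simp add: vp_entries wordc_epos)
 also have "... = (SUM kp:Pi\<^sub>E (LP ?R) (%p. occs ?ps (Suc (fst p))).
  (PROD p:LP ?R. osg ?ps (kp p)) * g (concat (map (fblk (%o'. [] @ cpR ?ps ?R kp o')) ?ps)))" by (rule vp_wordc[OF distinct_epos distinct_entries])
 also have "... = (SUM kp:distributions D' D. (- 1) ^ card {p : leg_positions D. is_negative D' (kp p)} * g (fl (arcs (glue D' D kp))))"
 proof (rule sum.cong)
  show "Pi\<^sub>E (LP ?R) (%p. occs ?ps (Suc (fst p))) = distributions D' D" by (simp add: distributions_def LP_entries occs_epos)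
  fix kp assume k: "kp : distributions D' D"
  have "(PROD p:LP ?R. osg ?ps (kp p)) = (PROD p:leg_positions D. if is_negative D' (kp p) then - 1 else (1 :: 'k))" unfolding LP_entries
  proof (rule prod.cong)
   fix p assume "p : leg_positions D"
   hence "kp p : occurrences D' (fst p)" using k by (auto simp: distributions_def)
   thus "osg ?ps (kp p) = (if is_negative D' (kp p) then - 1 else (1 :: 'k))" by (rule osg_epos)
  qed simp
  also have "... = (- 1) ^ card {p : leg_positions D. is_negative D' (kp p)}" using finite_LP[of ?R] by (intro prod_sign) (simp add: LP_entries)
  finally show "(PROD p:LP ?R. osg ?ps (kp p)) * g (concat (map (fblk (%o'. [] @ cpR ?ps ?R kp o')) ?ps))
   = (- 1) ^ card {p : leg_positions D. is_negative D' (kp p)} * g (fl (arcs (glue D' D kp)))" using fl_glue[OF assms] by simp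
 qed
 finally show ?thesis by simp
qed

section \<open>Evaluation of series and of their classes\<close>

section \<open>Evaluation of morphisms\<close>

text \<open>Summing only where both factors are nonzero keeps the sum finite when \<open>f\<close>
  has finitely many terms in each degree and \<open>g\<close> is bounded.\<close>

definition evs :: "(fword jdiag => 'k::field) => ('k jfn) => 'k" where
 "evs f g = (\<Sum>D | f D ~= 0 & g (fd D) ~= 0. f D * g (fd D))"

lemma evs_superset:
 "finite S ==> (!!D. f D ~= 0 ==> g (fd D) ~= 0 ==> D : S) ==> evs f g = (SUM D:S. f D * g (fd D))"
 unfolding evs_def by (rule sum.mono_neutral_left) auto

definition bdd :: "nat => ('k::field jfn) => bool" where
 "bdd d g <-> (ALL x. wt x > d --> g x = 0)"

lemma jacb_iff: "jacb g <-> jac {} g & (EX d. bdd d g)" by (simp add: jacb_def bdd_def)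

lemma bdd_jdeg: "bdd d g ==> g (fd D) ~= 0 ==> jdeg D <= d" unfolding bdd_def jdeg_fl by (meson div_le_dividend le_trans not_le)

lemma finite_jseries: "f : jseries m n ==> finite {D. f D ~= 0 & jdeg D <= d}"
proof -
 assume "f : jseries m n"
 hence "finite (\<Union>k\<in>{..d}. {D. f D ~= 0 & jdeg D = k})" by (auto simp: jseries_def)
 thus ?thesis by (rule rev_finite_subset) auto
qed

lemma evs_bdd:
 "f : jseries m n ==> bdd d g ==> evs f g = (\<Sum>D | f D ~= 0 & jdeg D <= d. f D * g (fd D))"
 by (rule evs_superset[OF finite_jseries]) (auto dest: bdd_jdeg)

lemma bdd_mono: "bdd d g ==> d <= d' ==> bdd d' g" by (auto simp: bdd_def)

lemma fsupp_homog: "f : jseries m n ==> fsupp (homog_part jdeg k f)" unfolding fsupp_def by (rule finite_subset[OF _ finite_jseries[of f m n k]]) (auto simp: homog_part_def)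

lemma homog_diff: "homog_part deg k (f - g) = homog_part deg k f - homog_part deg k g" by (auto simp: homog_part_def)

lemma evs_homog:
 assumes "f : jseries m n" "bdd d g"
 shows "evs f g = (SUM k<=d. pr (%D. g (fd D)) (homog_part jdeg k f))"
proof -
 have "(SUM k<=d. pr (%D. g (fd D)) (homog_part jdeg k f)) =
   (SUM k<=d. \<Sum>D | f D ~= 0 & jdeg D <= d. if jdeg D = k then f D * g (fd D) else 0)"
 proof (rule sum.cong[OF refl])
  fix k assume "k : {..d}"
  hence "{D. homog_part jdeg k f D ~= 0} <= {D. f D ~= 0 & jdeg D <= d}" by (auto simp: homog_part_def)
  hence "pr (%D. g (fd D)) (homog_part jdeg k f) = (\<Sum>D | f D ~= 0 & jdeg D <= d. homog_part jdeg k f D * g (fd D))" by (rule pr_superset[OF finite_jseries[OF assms(1)]])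
  thus "pr (%D. g (fd D)) (homog_part jdeg k f) = (\<Sum>D | f D ~= 0 & jdeg D <= d. if jdeg D = k then f D * g (fd D) else 0)"
   by (simp add: homog_part_def if_distrib[of "%x. x * _"] cong: if_cong)
 qed
 also have "... = (\<Sum>D | f D ~= 0 & jdeg D <= d. SUM k<=d. if jdeg D = k then f D * g (fd D) else 0)" by (rule sum.swap)
 also have "... = (\<Sum>D | f D ~= 0 & jdeg D <= d. f D * g (fd D))" by (rule sum.cong) auto
 finally show ?thesis using evs_bdd[OF assms] by simp
qed

text \<open>The relations are homogeneous: STU replaces a leg and a vertex by two legs, and the
  others preserve both numbers. So the part of \<open>g\<close> in one degree again satisfies
  them.\<close>

lemma jac_trunc:
 assumes g: "jac N g"
 shows "jac N (%x. if wt x div 2 = k then g x else 0)"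
 apply (rule jacI)
 subgoal using g by (rule jac_finite)
 subgoal for sg u V using jac_relabel[OF g, of sg u V] by (simp add: wt_def)
 subgoal for u a b c V using jac_rotate[OF g, of u a b c V] by (simp add: wt_def)
 subgoal for u v e a b V using jac_stu[OF g, of e u v V a b] by (simp add: wt_def)
 subgoal for V unfolding cancel_def by (simp add: wt_def jac_cancel[OF g])
 subgoal for u v w e j s V using jac_conj[OF g, of e u v w V j s] by (simp add: wt_def)
 done

lemma jacb_trunc: "jacb g ==> jacb (%x. if wt x div 2 = k then g x else 0)" using jac_trunc[of "{}" g k] by (auto simp: jacb_def)

text \<open>The congruence asks that the difference lie in the span in each degree separately.
  Evaluation with a bounded function is a finite sum of pairings in single degrees, and conversely
  truncating a function to degree \<open>k\<close> isolates the pairing in that degree.\<close>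

theorem deg_cong_iff:
 assumes "f : jseries m n" "f' : jseries m n"
 shows "deg_cong jdeg (jrel (free_group m) n) f f' <-> (ALL g. jacb g --> evs f g = evs f' g)"
proof -
 have sp: "homog_part jdeg k (f - f') : coeff_fun.span (jrel (free_group m) n) <->
   (ALL g. jacb g --> pr (%D. g (fd D)) (homog_part jdeg k f) = pr (%D. g (fd D)) (homog_part jdeg k f'))" for k
 proof -
  have "fsupp (homog_part jdeg k (f - f'))" unfolding homog_diff using assms by (intro fsupp_diff fsupp_homog)
  moreover have "D : jdiags (free_group m) n & jdeg D = k" if "homog_part jdeg k (f - f') D ~= 0" for D
  proof -
   have "jdeg D = k" "f D ~= 0 \<or> f' D ~= 0" using that by (auto simp: homog_part_def split: if_splits)
   thus ?thesis using assms by (auto simp: jseries_def)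
  qed
  ultimately have "homog_part jdeg k (f - f') : coeff_fun.span (jrel (free_group m) n) <->
   (ALL g. jacb g --> pr (%D. g (fd D)) (homog_part jdeg k (f - f')) = 0)" by (rule span_jrel_iff)
  moreover have "pr h (homog_part jdeg k (f - f')) = pr h (homog_part jdeg k f) - pr h (homog_part jdeg k f')" for h unfolding homog_diff using assms by (intro pr_diff fsupp_homog)
  ultimately show ?thesis by simp
 qed
 show ?thesis
 proof
  assume L: "deg_cong jdeg (jrel (free_group m) n) f f'"
  show "ALL g. jacb g --> evs f g = evs f' g"
  proof (intro allI impI)
   fix g :: "'a jfn"
   assume g: "jacb g"
   then obtain d where "bdd d g" by (auto simp: jacb_iff)
   thus "evs f g = evs f' g" using L g sp evs_homog[OF assms(1)] evs_homog[OF assms(2)] unfolding deg_cong_def by simp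
  qed
 next
  assume R: "ALL g. jacb g --> evs f g = evs f' g"
  show "deg_cong jdeg (jrel (free_group m) n) f f'" unfolding deg_cong_def sp
  proof (intro allI impI)
   fix k and g :: "'a jfn"
   assume g: "jacb g"
   let ?g = "%x. if wt x div 2 = k then g x else 0"
   \<comment> \<open>The largest weight whose half, rounded down, is \<open>k\<close>.\<close>
   have b: "bdd (2 * k + 1) ?g" by (auto simp: bdd_def)
   have H: "evs h ?g = pr (%D. g (fd D)) (homog_part jdeg k h)" if h: "h : jseries m n" for h
   proof -
   have "pr (%D. ?g (fd D)) (homog_part jdeg i h) = (if i = k then pr (%D. g (fd D)) (homog_part jdeg k h) else 0)" for i
   unfolding pr_def by (auto simp: homog_part_def jdeg_fl intro!: sum.cong sum.neutral)
   thus ?thesis using evs_homog[OF h b] by simp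
   qed
   have "evs f ?g = evs f' ?g" using R jacb_trunc[OF g] by blast
   thus "pr (%D. g (fd D)) (homog_part jdeg k f) = pr (%D. g (fd D)) (homog_part jdeg k f')" by (simp only: H[OF assms(1)] H[OF assms(2)])
  qed
 qed
qed

lemma jcoset_self: "f : jseries m n ==> f : jcoset m n f" by (simp add: jcoset_def deg_cong_iff)

lemma in_jcoset_iff: "f : jseries m n ==>
  f' : jcoset m n f <-> f' : jseries m n & (ALL g. jacb g --> evs f' g = evs f g)" by (auto simp: jcoset_def deg_cong_iff)

lemma jcoset_eq_iff:
 assumes "f : jseries m n" "f' : jseries m n"
 shows "jcoset m n f = jcoset m n f' <-> (ALL g. jacb g --> evs f g = evs f' g)"
proof
 assume "jcoset m n f = jcoset m n f'"
 hence "f : jcoset m n f'" using jcoset_self[OF assms(1)] by simp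
 thus "ALL g. jacb g --> evs f g = evs f' g" unfolding in_jcoset_iff[OF assms(2)] by blast
next
 assume L: "ALL g. jacb g --> evs f g = evs f' g"
 have "x : jcoset m n f <-> x : jcoset m n f'" for x unfolding in_jcoset_iff[OF assms(1)] in_jcoset_iff[OF assms(2)] using L by simp
 thus "jcoset m n f = jcoset m n f'" by blast
qed

text \<open>A representative is chosen once for each morphism. For functions in \<open>jacb\<close>
  the value does not depend on the choice; for other functions it is still linear and depends only
  on the values at diagrams with the right source and target.\<close>

definition EV :: "'k::field jmor => ('k jfn) => 'k" where
 "EV F g = evs (SOME f. f : jclass F) g"

lemma jmor_of_simps [simp]: "src (jmor_of m n f) = m" "tgt (jmor_of m n f) = n" "jclass (jmor_of m n f) = jcoset m n f" by (auto simp: jmor_of_def)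

lemma EV_jmor_of: "f : jseries m n ==> jacb g ==> EV (jmor_of m n f) g = evs f g"
 using in_jcoset_iff[of f m n] someI[of "%f'. f' : jcoset m n f", OF jcoset_self] by (simp add: EV_def)

lemma jhomE:
 assumes "F : jhom m n"
 obtains f where "f : jseries m n" "F = jmor_of m n f" using assms by (auto simp: jhom_def)

lemma jhomI: "f : jseries m n ==> jmor_of m n f : jhom m n" by (simp add: jhom_def)

lemma jhom_src: "F : jhom m n ==> src F = m & tgt F = n" by (auto simp: jhom_def)

text \<open>The principle behind the later equalities of morphisms: the relations never have to be
  applied to series, only to the values of a test function.\<close>

lemma jhom_ext:
 assumes "F : jhom m n" "G : jhom m n" "!!g. jacb g ==> EV F g = EV G g"
 shows "F = G"
proof -
 obtain f f' where f: "f : jseries m n" "F = jmor_of m n f" "f' : jseries m n" "G = jmor_of m n f'" using assms(1,2) by (auto elim!: jhomE)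
 have "jcoset m n f = jcoset m n f'" unfolding jcoset_eq_iff[OF f(1,3)] using assms(3) f by (simp add: EV_jmor_of)
 thus ?thesis by (simp add: f jmor_of_def)
qed

lemma EV_rep:
 assumes "F : jhom m n"
 obtains f where "f : jseries m n" "EV F = evs f"
proof -
 obtain f0 where f0: "f0 : jseries m n" "F = jmor_of m n f0" using assms by (rule jhomE)
 define f where "f = (SOME f. f : jclass F)"
 have f: "f : jcoset m n f0" unfolding f_def using f0 someI[of "%f'. f' : jcoset m n f0", OF jcoset_self] by simp
 hence fs: "f : jseries m n" by (simp add: jcoset_def)
 thus ?thesis by (rule that) (rule ext, simp only: EV_def f_def)
qed

lemma EV_cong:
 assumes "F : jhom m n" "!!D. D : jdiags (free_group m) n ==> g (fd D) = g' (fd D)"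
 shows "EV F g = EV F g'"
proof -
 obtain f where f: "f : jseries m n" "EV F = evs f" by (rule EV_rep[OF assms(1)])
 have "f D ~= 0 ==> g (fd D) = g' (fd D)" for D using f(1) assms(2) by (auto simp: jseries_def)
 thus ?thesis unfolding f evs_def by (intro sum.cong) auto
qed

lemma EV_sum:
 assumes "F : jhom m n" "finite I" "!!i. i : I ==> bdd d (g i)"
 shows "EV F (%x. SUM i:I. c i * g i x) = (SUM i:I. c i * EV F (g i))"
proof -
 obtain f where f: "f : jseries m n" "EV F = evs f" by (rule EV_rep[OF assms(1)])
 have b: "bdd d (%x. SUM i:I. c i * g i x)" using assms(3) by (auto simp: bdd_def intro!: sum.neutral)
 have "(SUM i:I. c i * evs f (g i)) = (SUM i:I. \<Sum>D | f D ~= 0 & jdeg D <= d. c i * (f D * g i (fd D)))" using evs_bdd[OF f(1) assms(3)] by (simp add: sum_distrib_left)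
 also have "... = (\<Sum>D | f D ~= 0 & jdeg D <= d. SUM i:I. c i * (f D * g i (fd D)))" by (rule sum.swap)
 also have "... = (\<Sum>D | f D ~= 0 & jdeg D <= d. f D * (SUM i:I. c i * g i (fd D)))" by (rule sum.cong[OF refl]) (simp only: sum_distrib_left mult.left_commute)
 finally show ?thesis unfolding f(2) evs_bdd[OF f(1) b] by (rule sym)
qed

text \<open>\<open>EV F\<close> is a finite linear combination of evaluations at diagrams.\<close>

lemma EV_finite:
 assumes "F : jhom m n"
 obtains S c where "finite S" "ALL D:S. D : jdiags (free_group m) n" "ALL g. bdd d g --> EV F g = (SUM D:S. c D * g (fd D))"
proof -
 obtain f where f: "f : jseries m n" "EV F = evs f" by (rule EV_rep[OF assms(1)])
 show ?thesis
 proof (rule that[of "{D. f D ~= 0 & jdeg D <= d}" f])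
  show "finite {D. f D ~= 0 & jdeg D <= d}" by (rule finite_jseries[OF f(1)])
  show "ALL D:{D. f D ~= 0 & jdeg D <= d}. D : jdiags (free_group m) n" using f(1) by (auto simp: jseries_def)
  show "ALL g. bdd d g --> EV F g = (\<Sum>D | f D ~= 0 & jdeg D <= d. f D * g (fd D))" unfolding f(2) using evs_bdd[OF f(1)] by blast
 qed
qed

text \<open>Test functions of two diagrams: the relations hold in each variable, and the bound is on
  the total weight, as it arises from a bound on the composite.\<close>

definition bijac :: "(dword => 'k::field jfn) => bool" where
 "bijac B <-> (ALL y. jac {} (%x. B x y)) & (ALL x. jac {} (B x)) & (EX d. ALL x y. wt x + wt y > d --> B x y = 0)"

lemma bijac_right: "bijac B ==> jacb (B x)" unfolding bijac_def jacb_def by (meson trans_less_add2)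

lemma bijac_left: "bijac B ==> jacb (%x. B x y)" unfolding bijac_def jacb_def by (meson trans_less_add1)

lemma bijac_bdd:
 assumes "bijac B"
 obtains d where "ALL x. bdd d (B x)" "ALL y. bdd d (%x. B x y)" "ALL x y. wt x + wt y > d --> B x y = 0" using assms that by (auto simp: bijac_def bdd_def)

lemma EV_zero: "F : jhom m n ==> EV F (%x. 0) = 0" by (simp add: EV_def evs_def)

lemma jacb_EV:
 assumes F: "F : jhom m n" and B: "bijac B"
 shows "jacb (%x. EV F (B x))"
proof -
 obtain d where d: "ALL x. bdd d (B x)" "ALL y. bdd d (%x. B x y)" "ALL x y. wt x + wt y > d --> B x y = 0" by (rule bijac_bdd[OF B])
 obtain S c where S: "finite S" "ALL D:S. D : jdiags (free_group m) n" "ALL g. bdd d g --> EV F g = (SUM D:S. c D * g (fd D))" by (rule EV_finite[OF F, of d])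
 have "(%x. EV F (B x)) = (%x. SUM D:S. c D * B x (fd D))" using S(3) d(1) by auto
 moreover have "jac {} (%x. SUM D:S. c D * B x (fd D))"
 proof -
  have "jac {} (%x. B x y)" for y using B unfolding bijac_def by blast
  thus ?thesis by (intro jac_lin) auto
 qed
 ultimately have j: "jac {} (%x. EV F (B x))" by simp
 have "EV F (B x) = 0" if "wt x > d" for x
 proof -
  have "B x (fd D) = 0" for D using d(3)[rule_format, of x "fd D"] that by (simp add: trans_less_add1)
  thus ?thesis using S(3)[rule_format, OF d(1)[rule_format, of x]] by simp
 qed
 with j show ?thesis unfolding jacb_def by blast
qed

text \<open>
 A bilinear operation on diagrams that is dual to an operation \<open>B\<close> on functions.
\<close>

definition dual_op ::
  "(fword jdiag => fword jdiag => fword jdiag => 'k::field) =>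
  (('k jfn) => dword => 'k jfn) =>
  nat * nat => nat * nat => nat * nat => bool" where
 "dual_op b B mn1 mn2 mn <->
  (ALL D D'. D : jdiags (free_group (fst mn1)) (snd mn1) --> D' : jdiags (free_group (fst mn2)) (snd mn2) -->
   fsupp (b D D') & (ALL E. b D D' E ~= 0 --> E : jdiags (free_group (fst mn)) (snd mn) & jdeg E = jdeg D + jdeg D') &
   (ALL g. pr (%E. g (fd E)) (b D D') = B g (fd D) (fd D'))) &
  (ALL g. jacb g --> bijac (B g))"

lemma dual_opD:
 assumes "dual_op b B (m1, n1) (m2, n2) (m, n)" "D : jdiags (free_group m1) n1" "D' : jdiags (free_group m2) n2"
 shows "fsupp (b D D')" "b D D' E ~= 0 ==> E : jdiags (free_group m) n" "b D D' E ~= 0 ==> jdeg E = jdeg D + jdeg D'"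
  "pr (%E. g (fd E)) (b D D') = B g (fd D) (fd D')" using assms unfolding dual_op_def fst_conv snd_conv by blast+

lemma bilinear_ext_nonzero:
 "bilinear_ext b f f' E ~= 0 ==> EX D D'. f D ~= 0 & f' D' ~= 0 & jdeg D + jdeg D' = jdeg E & b D D' E ~= 0"
proof (rule ccontr)
 assume "bilinear_ext b f f' E ~= 0" and n: "\<nexists>D D'. f D ~= 0 & f' D' ~= 0 & jdeg D + jdeg D' = jdeg E & b D D' E ~= 0"
 have "bilinear_ext b f f' E = 0" unfolding bilinear_ext_def using n by (intro sum.neutral) auto
 thus False using \<open>bilinear_ext b f f' E ~= 0\<close> by simp
qed

lemma bilinear_ext_jseries:
 assumes op: "dual_op b B (m1, n1) (m2, n2) (m, n)" and f: "f : jseries m1 n1" "f' : jseries m2 n2"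
 shows "bilinear_ext b f f' : jseries m n" unfolding jseries_def
proof (intro CollectI conjI allI impI)
 fix E assume "bilinear_ext b f f' E ~= 0"
 then obtain D D' where "f D ~= 0" "f' D' ~= 0" "b D D' E ~= 0" using bilinear_ext_nonzero by blast
 thus "E : jdiags (free_group m) n" using f dual_opD(2)[OF op, of D D' E] by (auto simp: jseries_def)
next
 fix d
 let ?S = "{D. f D ~= 0 & jdeg D <= d}" and ?S' = "{D. f' D ~= 0 & jdeg D <= d}"
 have "finite (\<Union>D\<in>?S. \<Union>D'\<in>?S'. {E. b D D' E ~= 0})"
 proof (intro finite_UN_I)
  show "finite ?S" "finite ?S'" using f finite_jseries by auto
  fix D D' assume "D : ?S" "D' : ?S'"
  thus "finite {E. b D D' E ~= 0}" using f dual_opD(1)[OF op, of D D'] by (auto simp: jseries_def fsupp_def)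
 qed
 moreover have "{E. bilinear_ext b f f' E ~= 0 & jdeg E = d} <= (\<Union>D\<in>?S. \<Union>D'\<in>?S'. {E. b D D' E ~= 0})"
  using bilinear_ext_nonzero[of b f f'] by fastforce
 ultimately show "finite {E. bilinear_ext b f f' E ~= 0 & jdeg E = d}" by (rule rev_finite_subset)
qed

lemma evs_bilinear_ext:
 assumes op: "dual_op b B (m1, n1) (m2, n2) (m, n)" and f: "f : jseries m1 n1" "f' : jseries m2 n2" and g: "jacb g"
 shows "evs (bilinear_ext b f f') g = evs f (%x. evs f' (B g x))"
proof -
 have Bj: "bijac (B g)" using op g by (simp add: dual_op_def)
 obtain d1 where d1: "ALL x. bdd d1 (B g x)" "ALL y. bdd d1 (%x. B g x y)" "ALL x y. wt x + wt y > d1 --> B g x y = 0" by (rule bijac_bdd[OF Bj])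
 obtain d2 where d2: "bdd d2 g" using g by (auto simp: jacb_iff)
 \<comment> \<open>A common bound for \<open>g\<close> and for \<open>B g\<close>, so that both
   sides become sums over the same finite sets of diagrams.\<close>
 define d where "d = max d1 d2"
 have dg: "bdd d g" using bdd_mono[OF d2, of d] by (simp add: d_def)
 have dB: "bdd d (B g x)" for x using bdd_mono[OF d1(1)[rule_format], of d] by (simp add: d_def)
 let ?S = "{D. f D ~= 0 & jdeg D <= d}" and ?S' = "{D. f' D ~= 0 & jdeg D <= d}"
 have fin: "finite ?S" "finite ?S'" using f finite_jseries by auto
 have opD: "fsupp (b D D')" "!!E. b D D' E ~= 0 ==> jdeg E = jdeg D + jdeg D'" "!!g. pr (%E. g (fd E)) (b D D') = B g (fd D) (fd D')"
  if "f D ~= 0" "f' D' ~= 0" for D D' using that f unfolding jseries_def by (blast intro: dual_opD[OF op])+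
 define T where "T = (\<Union>D\<in>?S. \<Union>D'\<in>?S'. {E. b D D' E ~= 0})"
 have finT: "finite T" unfolding T_def using fin opD by (intro finite_UN_I) (auto simp: fsupp_def)
 have "evs (bilinear_ext b f f') g = (SUM E:T. bilinear_ext b f f' E * g (fd E))"
 proof (rule evs_superset[OF finT])
  fix E assume E: "bilinear_ext b f f' E ~= 0" "g (fd E) ~= 0"
  have "jdeg E <= d" using bdd_jdeg[OF dg E(2)] .
  thus "E : T" using bilinear_ext_nonzero[OF E(1)] unfolding T_def by fastforce
 qed
 also have "... = (SUM E:T. (\<Sum>(D, D')\<in>?S \<times> ?S'. f D * f' D' * b D D' E) * g (fd E))"
 proof (rule sum.cong[OF refl])
  fix E
  show "bilinear_ext b f f' E * g (fd E) = (\<Sum>(D, D')\<in>?S \<times> ?S'. f D * f' D' * b D D' E) * g (fd E)"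
  proof (cases "g (fd E) = 0")
   case False
   hence E: "jdeg E <= d" using bdd_jdeg[OF dg] by blast
   have "bilinear_ext b f f' E = (\<Sum>(D, D')\<in>?S \<times> ?S'. f D * f' D' * b D D' E)" unfolding bilinear_ext_def
   proof (rule sum.mono_neutral_left)
   show "finite (?S \<times> ?S')" using fin by simp
   show "{(D, D'). f D ~= 0 & f' D' ~= 0 & jdeg D + jdeg D' = jdeg E} <= ?S \<times> ?S'" using E by auto
   show "ALL i:?S \<times> ?S' - {(D, D'). f D ~= 0 & f' D' ~= 0 & jdeg D + jdeg D' = jdeg E}.
   (case i of (D, D') => f D * f' D' * b D D' E) = 0" using opD(2) by fastforce
   qed
   thus ?thesis by simp
  qed simp
 qed
 also have "... = (\<Sum>(D, D')\<in>?S \<times> ?S'. SUM E:T. f D * f' D' * b D D' E * g (fd E))" unfolding sum_distrib_right case_prod_beta by (rule sum.swap)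
 also have "... = (\<Sum>(D, D')\<in>?S \<times> ?S'. f D * f' D' * B g (fd D) (fd D'))"
 proof (rule sum.cong[OF refl], clarify)
  fix D D' assume D: "f D ~= 0" "jdeg D <= d" "f' D' ~= 0" "jdeg D' <= d"
  have "pr (%E. g (fd E)) (b D D') = (SUM E:T. b D D' E * g (fd E))" by (rule pr_superset[OF finT]) (use D in "auto simp: T_def")
  hence e: "B g (fd D) (fd D') = (SUM E:T. b D D' E * g (fd E))" using opD(3)[OF D(1,3), of g] by simp
  show "(SUM E:T. f D * f' D' * b D D' E * g (fd E)) = f D * f' D' * B g (fd D) (fd D')" unfolding e sum_distrib_left by (simp only: mult.assoc)
 qed
 also have "... = (SUM D:?S. f D * (SUM D':?S'. f' D' * B g (fd D) (fd D')))" unfolding sum.cartesian_product[symmetric] by (simp only: sum_distrib_left mult.assoc)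
 also have "... = (SUM D:?S. f D * evs f' (B g (fd D)))" using evs_bdd[OF f(2) dB] by simp
 also have "... = evs f (%x. evs f' (B g x))"
 proof (rule evs_bdd[OF f(1), symmetric])
  show "bdd d (%x. evs f' (B g x))" unfolding bdd_def
  proof (intro allI impI)
   fix x :: "dword" assume "d < wt x"
   hence "B g x y = 0" for y using d1(3)[rule_format, of x y] by (simp add: d_def)
   thus "evs f' (B g x) = 0" by (simp add: evs_def)
  qed
 qed
 finally show ?thesis .
qed

lemma UN2_const: "(!!h h'. h : A ==> h' : B ==> X h h' = C) ==> a : A ==> b : B ==> (\<Union>h\<in>A. \<Union>h'\<in>B. X h h') = C"
 by blast

text \<open>Independence of the representatives. The second one can be changed because
  \<open>B g\<close> satisfies the relations in its second variable, then the first one because the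
  evaluated function satisfies them in the remaining variable (\<open>jacb_EV\<close>). The union in
  the definition of an operation is thus a single class.\<close>

lemma op_classes:
 assumes op: "dual_op b B (m1, n1) (m2, n2) (m, n)" and f: "f : jseries m1 n1" "f' : jseries m2 n2"
 shows "(\<Union>h\<in>jcoset m1 n1 f. \<Union>h'\<in>jcoset m2 n2 f'. jcoset m n (bilinear_ext b h h')) = jcoset m n (bilinear_ext b f f')"
proof -
 have "jcoset m n (bilinear_ext b h h') = jcoset m n (bilinear_ext b f f')"
  if "h : jcoset m1 n1 f" "h' : jcoset m2 n2 f'" for h h'
 proof -
  have h: "h : jseries m1 n1" "!!g. jacb g ==> evs h g = evs f g"
   and h': "h' : jseries m2 n2" "!!g. jacb g ==> evs h' g = evs f' g" using that unfolding in_jcoset_iff[OF f(1)] in_jcoset_iff[OF f(2)] by auto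
  have "evs (bilinear_ext b h h') g = evs (bilinear_ext b f f') g" if g: "jacb g" for g
  proof -
   have Bj: "bijac (B g)" using op g by (simp add: dual_op_def)
   have "evs (bilinear_ext b h h') g = evs h (%x. evs h' (B g x))" by (rule evs_bilinear_ext[OF op h(1) h'(1) g])
   also have "... = evs h (%x. evs f' (B g x))" using h'(2)[OF bijac_right[OF Bj]] by simp
   also have "... = evs h (%x. EV (jmor_of m2 n2 f') (B g x))" using EV_jmor_of[OF f(2) bijac_right[OF Bj]] by simp
   also have "... = evs f (%x. EV (jmor_of m2 n2 f') (B g x))" by (rule h(2)[OF jacb_EV[OF jhomI[OF f(2)] Bj]])
   also have "... = evs f (%x. evs f' (B g x))" using EV_jmor_of[OF f(2) bijac_right[OF Bj]] by simp
   also have "... = evs (bilinear_ext b f f') g" by (rule evs_bilinear_ext[OF op f g, symmetric])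
   finally show ?thesis .
  qed
  thus ?thesis unfolding jcoset_eq_iff[OF bilinear_ext_jseries[OF op h(1) h'(1)] bilinear_ext_jseries[OF op f]] by blast
 qed
 thus ?thesis by (rule UN2_const) (use jcoset_self f in blast)+
qed

lemma EV_bilinear_ext:
 assumes op: "dual_op b B (m1, n1) (m2, n2) (m, n)" and f: "f : jseries m1 n1" "f' : jseries m2 n2" and g: "jacb g"
 shows "EV (jmor_of m n (bilinear_ext b f f')) g = EV (jmor_of m1 n1 f) (%x. EV (jmor_of m2 n2 f') (B g x))"
proof -
 have Bj: "bijac (B g)" using op g by (simp add: dual_op_def)
 have "EV (jmor_of m1 n1 f) (%x. EV (jmor_of m2 n2 f') (B g x)) = evs f (%x. EV (jmor_of m2 n2 f') (B g x))" by (rule EV_jmor_of[OF f(1) jacb_EV[OF jhomI[OF f(2)] Bj]])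
 also have "... = evs f (%x. evs f' (B g x))" using EV_jmor_of[OF f(2) bijac_right[OF Bj]] by simp
 finally show ?thesis using EV_jmor_of[OF bilinear_ext_jseries[OF op f] g] evs_bilinear_ext[OF op f g] by simp
qed

section \<open>Composition and tensor product as iterated evaluation\<close>

section \<open>Composition and tensor product of morphisms\<close>

declare One_nat_def [simp del]

abbreviation comp_infix :: "'k::field jmor => 'k jmor => 'k jmor" (infixl "oo" 70) where "G oo F == jcomp G F"
abbreviation tens_infix :: "'k::field jmor => 'k jmor => 'k jmor" (infixl "**" 75) where "F ** G == jtens F G"
abbreviation "idA == Ident A_hat"
abbreviation "PA == Symm A_hat"

lemma mset_legs_rinv [simp]: "mset (legs (rinv u)) = mset (legs u)" by (induction u rule: legs.induct) auto

definition labR :: "((nat * nat) * fword item) list => nat list" where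
 "labR R = concat (map (%(p, t). item_labels t) R)"

lemma fblk_legs_update:
 assumes "distinct (map fst ps)" "y : occs ps j"
 shows "mset (legs (concat (map (fblk (%o'. c o' @ (if o' = y then [Lg e] else []))) ps))) =
  add_mset e (mset (legs (concat (map (fblk c) ps))))" using assms
proof (induction ps)
 case Nil
 thus ?case by (simp add: occs_def)
next
 case (Cons p ps)
 obtain q x where p: "p = (q, x)" by fastforce
 have q: "(q, z) ~: set ps" for z using Cons.prems p by force
 show ?case
 proof (cases "q = y")
  case True
  have "map (fblk (%o'. c o' @ (if o' = y then [Lg e] else []))) ps = map (fblk c) ps"
  proof (rule map_cong[OF refl])
   fix z assume z: "z : set ps"
   obtain o' w where zz: "z = (o', w)" by fastforce
   hence "o' ~= y" using z q True by auto
   thus "fblk (%o'. c o' @ (if o' = y then [Lg e] else [])) z = fblk c z" by (cases w) (auto simp: zz)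
  qed
  moreover obtain s where "x = Lt j s" using Cons.prems(2) q True by (auto simp: occs_def p)
  ultimately show ?thesis using True by (simp add: p del: map_eq_conv)
 next
  case False
  hence "y : occs ps j" using Cons.prems(2) by (auto simp: occs_def p)
  thus ?thesis using Cons False by (cases x) (auto simp: p)
 qed
qed

lemma fblk_legs_nil:
 assumes "!!o'. legs (d o') = []"
 shows "mset (legs (concat (map (fblk (%o'. c o' @ d o')) ps))) = mset (legs (concat (map (fblk c) ps)))"
proof (induction ps)
 case (Cons p ps)
 obtain q x where p: "p = (q, x)" by fastforce
 thus ?case using Cons assms by (cases x) auto
qed simp

lemma legs_cpR:
 assumes "distinct (map fst ps)" "!!p. p : LP R ==> kp p : occs ps (Suc (fst p))"
 shows "mset (legs (concat (map (fblk (%o'. c o' @ cpR ps R kp o')) ps))) =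
  mset (legs (concat (map (fblk c) ps))) + mset (labR R)" using assms(2)
proof (induction R arbitrary: c)
 case Nil
 thus ?case by (simp add: cpR_def labR_def)
next
 case (Cons r R)
 obtain p t where r: "r = (p, t)" by fastforce
 have IH: "mset (legs (concat (map (fblk (%o'. c' o' @ cpR ps R kp o')) ps))) =
  mset (legs (concat (map (fblk c') ps))) + mset (labR R)" for c' by (rule Cons.IH) (use Cons.prems in "auto simp: LP_def")
 show ?case
 proof (cases t)
  case (Leg e)
  hence k: "kp p : occs ps (Suc (fst p))" using Cons.prems[of p] by (auto simp: LP_def r)
  have "c o' @ cpR ps (r # R) kp o' = (c o' @ (if o' = kp p then [Lg e] else [])) @ cpR ps R kp o'" for o' using k by (auto simp: cpR_def r Leg)
  thus ?thesis using IH[of "%o'. c o' @ (if o' = kp p then [Lg e] else [])"] fblk_legs_update[OF assms(1) k, of c e] by (simp add: labR_def r Leg)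
 next
  case (Bead w)
  let ?d = "%o'. if o' : occs ps (Suc (fst p)) then lts w else []"
  have "c o' @ cpR ps (r # R) kp o' = (c o' @ ?d o') @ cpR ps R kp o'" for o' by (auto simp: cpR_def r Bead)
  thus ?thesis using IH[of "%o'. c o' @ ?d o'"] fblk_legs_nil[of ?d c ps] by (simp add: labR_def r Bead)
 qed
qed

lemma labR_entries: "labR (entries k As) = legs (fl As)"
proof (induction As arbitrary: k)
 case Nil
 thus ?case by (simp add: labR_def entries_def)
next
 case (Cons L As)
 have 1: "concat (map (%(p, t). item_labels t) (map (%(i, t). ((k, i), t)) (List.enumerate i L))) = concat (map item_labels L)" for i by (induction L arbitrary: i) auto
 have e: "entries k (L # As) = map (%(i, t). ((k, i), t)) (List.enumerate 0 L) @ entries (Suc k) As" by (simp add: entries_def)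
 show ?case using Cons[of "Suc k"] 1[of 0] by (simp add: labR_def e legs_arc_word del: map_map)
qed

definition glueable :: "fword jdiag => fword jdiag => bool" where
 "glueable D' D <-> (ALL a q j s. a < length (arcs D') --> q < length (spell (arcs D' ! a)) -->
  spell (arcs D' ! a) ! q = Inr (j, s) --> 1 <= j & j <= length (arcs D))"

text \<open>A distribution attaches every leg of the inner diagram to exactly one copy of its arc,
  so gluing keeps the multiset of legs.\<close>

lemma legs_glue:
 assumes "glueable D' D" "kp : distributions D' D"
 shows "mset (legs (fl (arcs (glue D' D kp)))) = mset (legs (fl (arcs D'))) + mset (legs (fl (arcs D)))"
proof -
 let ?ps = "epos (arcs D')" and ?R = "entries 0 (arcs D)"
 have "kp p : occs ?ps (Suc (fst p))" if "p : LP ?R" for p using that assms(2) by (auto simp: LP_entries occs_epos distributions_def)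
 hence "mset (legs (concat (map (fblk (%o'. [] @ cpR ?ps ?R kp o')) ?ps) :: nat sym list)) =
  mset (legs (concat (map (fblk (%o'. [])) ?ps) :: nat sym list)) + mset (labR ?R)" by (intro legs_cpR[OF distinct_epos])
 moreover have "concat (map (fblk (%o'. [])) ?ps) = (lmap lstrip (inl (fl (arcs D'))) :: nat sym list)" unfolding wordc_epos[symmetric] lstrip_wordc ..
 moreover have "fl (arcs (glue D' D kp)) = concat (map (fblk (%o'. [] @ cpR ?ps ?R kp o')) ?ps)" by (rule fl_glue) (use assms(1) in "auto simp: glueable_def")
 ultimately show ?thesis by (simp add: labR_entries)
qed

lemma carrier_word_inv: "w : carrier (free_group m) ==> word_inv w : carrier (free_group m)"
 using reduced_word_inv[of w] by (auto simp: free_group_def word_inv_def letter_inv_def)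

lemma beads_iff: "set (beads D) <= S <-> (ALL L:set (arcs D). ALL w. Bead w : set L --> w : S)"
proof -
 have "w : set (item_beads t) <-> t = Bead w" for w :: 'a and t by (cases t) auto
 hence "set (beads D) = {w. EX L:set (arcs D). Bead w : set L}" by (auto simp: beads_def)
 thus ?thesis by auto
qed

lemma beads_glue:
 assumes "glueable D' D" "set (beads D) <= carrier (free_group m)"
 shows "set (beads (glue D' D kp)) <= carrier (free_group m)"
proof -
 have copy: "w : carrier (free_group m)" if j: "j < length (arcs D)" and b: "Bead w : set (arc_copy D kp j o')" for w j o'
 proof -
  obtain i where i: "i < length (arcs D ! j)"
   "Bead w : set (case arcs D ! j ! i of Leg e => if kp (j, i) = o' then [Leg e] else [] | Bead w => [Bead w])"
   using b by (auto simp: arc_copy_def in_set_enumerate_eq)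
  hence "arcs D ! j ! i = Bead w" by (cases "arcs D ! j ! i") (auto split: if_splits)
  hence "Bead w : set (arcs D ! j)" using i(1) by (metis nth_mem)
  thus ?thesis using assms(2) j unfolding beads_iff by auto
 qed
 have invitem: "Bead w : set (map invert_item X) <-> Bead (word_inv w) : set X" for w X
 proof (induction X)
  case (Cons t X)
  thus ?case by (cases t) (auto simp: word_inv_winv)
 qed simp
 show ?thesis unfolding beads_iff
 proof (intro ballI allI impI)
  fix L w
  assume L: "L : set (arcs (glue D' D kp))" "Bead w : set L"
  from L(1) obtain a where a: "a < length (arcs D')"
   "L = concat (map (%(q, t). case t of Inl e => [Leg e] | Inr (j, s) => if s then arc_copy D kp (j - 1) (a, q)
   else rev (map invert_item (arc_copy D kp (j - 1) (a, q)))) (List.enumerate 0 (spell (arcs D' ! a))))" by (auto simp: glue_def in_set_enumerate_eq)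
  from L(2) obtain q where q': "q < length (spell (arcs D' ! a))"
   "Bead w : set (case spell (arcs D' ! a) ! q of Inl e => [Leg e] | Inr (j, s) => if s then arc_copy D kp (j - 1) (a, q)
   else rev (map invert_item (arc_copy D kp (j - 1) (a, q))))" unfolding a(2) by (auto simp: in_set_enumerate_eq)
  obtain j s where js: "spell (arcs D' ! a) ! q = Inr (j, s)" using q'(2) by (cases "spell (arcs D' ! a) ! q") auto
  have q: "q < length (spell (arcs D' ! a))" "spell (arcs D' ! a) ! q = Inr (j, s)"
   "Bead w : set (if s then arc_copy D kp (j - 1) (a, q) else rev (map invert_item (arc_copy D kp (j - 1) (a, q))))" using q' js by simp_all
  have "1 <= j" "j <= length (arcs D)" using assms(1) a(1) q(1,2) unfolding glueable_def by blast+
  hence j: "j - 1 < length (arcs D)" by linarith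
  show "w : carrier (free_group m)"
  proof (cases s)
   case True
   thus ?thesis using copy[OF j] q(3) by simp
  next
   case False
   hence "Bead (word_inv w) : set (arc_copy D kp (j - 1) (a, q))" using q(3) invitem by simp
   thus ?thesis using copy[OF j] carrier_word_inv by fastforce
  qed
 qed
qed

lemma okV_union:
 assumes "okV ls V" "okV ls' V'" "(set ls Un set_mset (vlabs V)) Int (set ls' Un set_mset (vlabs V')) = {}"
 shows "okV (ls @ ls') (V + V')"
proof -
 have "adjV V <= adjV (V + V')" "adjV V' <= adjV (V + V')" by (auto simp: adjV_def)
 note sub = this[THEN rtrancl_mono]
 let ?H = "mset ls + vlabs V" and ?H' = "mset ls' + vlabs V'"
 have H: "mset (ls @ ls') + vlabs (V + V') = ?H + ?H'" by simp
 have dis: "e ~:# ?H'" if "e \<in># ?H" for e using that assms(3) by auto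
 show ?thesis unfolding okV_def H
 proof (intro conjI ballI)
  fix e assume e: "e \<in># ?H + ?H'"
  show "count (?H + ?H') e = 2"
  proof (cases "e \<in># ?H")
   case True
   hence "count ?H' e = 0" "count ?H e = 2" using dis[OF True] assms(1) by (auto simp: not_in_iff okV_def)
   thus ?thesis by (simp only: count_union)
  next
   case False
   hence "e \<in># ?H'" using e by auto
   hence "count ?H e = 0" "count ?H' e = 2" using False assms(2) by (auto simp: not_in_iff okV_def)
   thus ?thesis by (simp only: count_union)
  qed
  show "EX e':set (ls @ ls'). (e, e') : (adjV (V + V'))\<^sup>*"
  proof (cases "e \<in># ?H")
   case True
   then obtain e' where "e' : set ls" "(e, e') : (adjV V)\<^sup>*" using assms(1) unfolding okV_def by blast
   thus ?thesis using sub by auto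
  next
   case False
   hence "e \<in># ?H'" using e by auto
   then obtain e' where "e' : set ls'" "(e, e') : (adjV V')\<^sup>*" using assms(2) unfolding okV_def by blast
   thus ?thesis using sub by auto
  qed
 qed
qed

text \<open>Every edge has two ends, so the number of legs plus three times the number of trivalent
  vertices is even. Hence the degree is exactly half the weight and adds up under gluing.\<close>

lemma okV_even: "okV ls V ==> even (length ls + size V)"
proof -
 assume ok: "okV ls V"
 let ?H = "mset ls + vlabs V"
 have "size (vlabs V) = 3 * size V" by (induction V) auto
 hence "size ?H = length ls + 3 * size V" by simp
 moreover have "size ?H = (SUM x:set_mset ?H. 2)" unfolding size_multiset_overloaded_eq using ok by (intro sum.cong refl) (simp only: okV_def)
 ultimately have "length ls + 3 * size V = 2 * card (set_mset ?H)" by simp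
 thus ?thesis by (metis dvd_triv_left even_add even_mult_iff odd_numeral)
qed

lemma jdiags_wt: "D : jdiags G n ==> wt (fd D) = 2 * jdeg D" using okV_even[of "legs (fl (arcs D))" "verts D"] by (simp add: jdiags_iff jdeg_fl wt_def fd_def)

abbreviation ev :: "nat => nat" where "ev == %e. 2 * e"
abbreviation od :: "nat => nat" where "od == %e. 2 * e + 1"

lemma inj_ev_od: "inj ev" "inj od" by (auto simp: inj_def)

lemma spell_relabel: "spell (map (relabel_item sg) L) = map (map_sum sg id) (spell L)"
proof -
 have "spell_item (relabel_item sg t) = map (map_sum sg id) (spell_item t)" for t by (cases t) auto
 thus ?thesis by (induction L) (auto simp: spell_def)
qed

lemma arcs_relabel: "arcs (relabel sg D) = map (map (relabel_item sg)) (arcs D)" by (simp add: relabel_def)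

lemma leg_positions_relabel: "leg_positions (relabel sg D) = leg_positions D"
proof -
 have "relabel_item sg t = Leg e <-> (EX e'. t = Leg e' & e = sg e')" for e and t :: "'a item" by (cases t) auto
 thus ?thesis by (auto simp: leg_positions_def arcs_relabel)
qed

lemma map_sum_Inr: "map_sum sg id z = Inr x <-> z = Inr x" by (cases z) auto

lemma occurrences_relabel: "occurrences (relabel sg D) j = occurrences D j" by (auto simp: occurrences_def arcs_relabel spell_relabel map_sum_Inr)

lemma distributions_relabel: "distributions (relabel sg D') (relabel ta D) = distributions D' D" by (simp add: distributions_def leg_positions_relabel occurrences_relabel)

lemma is_negative_relabel: "p : occurrences D j ==> is_negative (relabel sg D) p = is_negative D p"
 by (auto simp: is_negative_def occurrences_def arcs_relabel spell_relabel map_sum_Inr)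

lemma relabel_jdiags:
 assumes "D : jdiags G n" "inj sg"
 shows "relabel sg D : jdiags G n"
proof -
 have b: "beads (relabel sg D) = beads D"
 proof -
  have "item_beads (relabel_item sg t) = item_beads t" for t :: "'a item" by (cases t) auto
  hence "map item_beads (concat (map (map (relabel_item sg)) A)) = map item_beads (concat A)" for A :: "'a item list list" by (induction A) auto
  thus ?thesis by (simp add: beads_def arcs_relabel)
 qed
 have l: "leg_labels (relabel sg D) = map sg (leg_labels D)"
 proof -
  have "item_labels (relabel_item sg t) = map sg (item_labels t)" for t :: "'a item" by (cases t) auto
  hence "concat (map item_labels (concat (map (map (relabel_item sg)) A))) = map sg (concat (map item_labels (concat A)))" for A :: "'a item list list"
   by (induction A) (auto simp: map_concat comp_def)
  thus ?thesis by (simp add: leg_labels_def arcs_relabel)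
 qed
 have okl: "D : jdiags G n <-> length (arcs D) = n & set (beads D) <= carrier G & okV (leg_labels D) (verts D)" for D :: "'a jdiag"
  by (simp add: jdiags_def okV_def half_edges_def vlabs_def edge_adj_adjV)
 show ?thesis using assms(1) okV_relabel[OF assms(2), of "leg_labels D" "verts D"] unfolding okl b l by (simp add: relabel_def)
qed

lemma glueable_jdiags:
 assumes "D' : jdiags (free_group n) p" "D : jdiags G n"
 shows "glueable D' D" unfolding glueable_def
proof (intro allI impI)
 fix a q j s
 assume a: "a < length (arcs D')" "q < length (spell (arcs D' ! a))" "spell (arcs D' ! a) ! q = Inr (j, s)"
 hence "Inr (j, s) : set (spell (arcs D' ! a))" by (metis nth_mem)
 then obtain t where t: "t : set (arcs D' ! a)" "Inr (j, s) : set (spell_item t)" by (auto simp: spell_def)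
 then obtain w where w: "t = Bead w" "(j, s) : set w" by (cases t rule: item.exhaust) auto
 have "set (beads D') <= carrier (free_group n)" using assms(1) by (simp add: jdiags_iff)
 hence "w : carrier (free_group n)" using t w a(1) unfolding beads_iff by auto
 thus "1 <= j & j <= length (arcs D)" using w(2) assms(2) by (force simp: free_group_def jdiags_def)
qed

text \<open>The function of two diagrams obtained from \<open>g\<close> by composing them. As in
  \<open>comp_diag\<close>, the outer diagram gets even and the inner diagram odd labels, which
  keeps the two sets of edges apart.\<close>

definition Cg :: "('k::field jfn) => dword => 'k jfn" where
 "Cg g x y = vs 1 (map (rl od) (fst y)) (%v. g (v, rv ev (snd x) + rv od (snd y))) (inl (map (rl ev) (fst x)))"

definition sh :: "nat => nat sym list => nat sym list" where
 "sh m u = lmap (%i. [(m + i, True)]) u"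

definition tp :: "nat => dword => dword => dword" where
 "tp m x y = (map (rl ev) (fst x) @ sh m (map (rl od) (fst y)), rv ev (snd x) + rv od (snd y))"

lemma vs_zero: "(!!v. mset (legs v) = mset (legs A) + mset (legs u) ==> g v = 0) ==> vs j A g u = 0"
 using vs_cong[of A u g "%v. 0" j] vs_sum[of j A "%_. 1" "%_ _. 0" "{}" u] by simp

lemma vimage_ev_od: "ev -` (od ` S) = {}" "od -` (ev ` S) = {}" by (auto, presburger+)

text \<open>With one diagram fixed, its labels are external for the other. They have the other
  parity, so pulling back along the doubling maps removes them from the label set, and the relations
  hold without restriction.\<close>

lemma bijac_Cg:
 assumes g: "jacb g"
 shows "bijac (Cg g)" unfolding bijac_def
proof (intro conjI allI)
 fix y :: "dword"
 have j: "jac {} g" using g by (simp add: jacb_iff)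
 have "jac (set_mset (vlabs (rv od (snd y))) Un set (legs (map (rl od) (fst y))))
  (%(u, V). vs 1 (map (rl od) (fst y)) (%v. g (v, V + rv od (snd y))) u)" using jac_vs[OF jac_verts[OF j, of "rv od (snd y)"], of "map (rl od) (fst y)" 1] by simp
 from jac_pullback[OF jac_lmap[OF this, of "%j. [(Inl j, True)]"] inj_ev_od(1)]
 show "jac {} (%x. Cg g x y)" by (simp add: Cg_def inl_def case_prod_beta' image_Un[symmetric] vimage_ev_od flip: image_Un)
next
 fix x :: "dword"
 have j: "jac {} g" using g by (simp add: jacb_iff)
 have "jac (set_mset (vlabs (rv ev (snd x))) Un set (legs (inl (map (rl ev) (fst x)) :: (nat + nat) sym list)))
  (%(A, V). vs 1 A (%v. g (v, V + rv ev (snd x))) (inl (map (rl ev) (fst x))))" using jac_vs_right[OF jac_verts[OF j, of "rv ev (snd x)"], of "inl (map (rl ev) (fst x))" 1] by simp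
 note j' = jac_pullback[OF this inj_ev_od(2)]
 have c: "rv ev (snd x) + W = W + rv ev (snd x)" for W by (rule add.commute)
 show "jac {} (Cg g x)" using j' by (simp add: Cg_def[abs_def] case_prod_beta' vimage_ev_od c flip: image_Un)
next
 obtain d where d: "!!x. wt x > d ==> g x = 0" using g by (auto simp: jacb_def)
 have "Cg g x y = 0" if "wt x + wt y > d" for x y unfolding Cg_def
 proof (rule vs_zero)
  fix v :: "nat sym list"
  assume "mset (legs v) = mset (legs (map (rl od) (fst y))) + mset (legs (inl (map (rl ev) (fst x)) :: (nat + nat) sym list))"
  hence "size (mset (legs v)) = size (mset (legs (map (rl od) (fst y))) + mset (legs (inl (map (rl ev) (fst x)) :: (nat + nat) sym list)))" by (rule arg_cong)
  hence "length (legs v) = length (legs (fst y)) + length (legs (fst x))" by simp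
  thus "g (v, rv ev (snd x) + rv od (snd y)) = 0" using that by (intro d) (simp add: wt_def)
 qed
 thus "EX d. ALL x y. d < wt x + wt y --> Cg g x y = 0" by blast
qed

lemma legs_sh [simp]: "legs (sh m u) = legs u" by (simp add: sh_def)

lemma bijac_tp:
 assumes g: "jacb g"
 shows "bijac (%x y. g (tp m x y))" unfolding bijac_def
proof (intro conjI allI)
 fix y :: "dword"
 have j: "jac {} g" using g by (simp add: jacb_iff)
 let ?q = "sh m (map (rl od) (fst y))"
 have "jac (set_mset (vlabs (rv od (snd y))) Un set (legs ?q)) (%(u, V). g (u @ ?q, V + rv od (snd y)))" using jac_context[OF jac_verts[OF j, of "rv od (snd y)"], of "[]" ?q] by simp
 from jac_pullback[OF this inj_ev_od(1)]
 show "jac {} (%x. g (tp m x y))" by (simp add: tp_def case_prod_beta' vimage_ev_od flip: image_Un)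
next
 fix x :: "dword"
 have j: "jac {} g" using g by (simp add: jacb_iff)
 let ?p = "map (rl ev) (fst x)"
 have "jac (set_mset (vlabs (rv ev (snd x))) Un set (legs ?p)) (%(u, V). g (?p @ u, V + rv ev (snd x)))" using jac_context[OF jac_verts[OF j, of "rv ev (snd x)"], of ?p "[]"] by simp
 note j' = jac_pullback[OF jac_lmap[OF this, of "%i. [(m + i, True)]"] inj_ev_od(2)]
 have c: "rv ev (snd x) + W = W + rv ev (snd x)" for W by (rule add.commute)
 show "jac {} (%y. g (tp m x y))" using j' by (simp add: tp_def sh_def case_prod_beta' vimage_ev_od c flip: image_Un)
next
 obtain d where d: "!!x. wt x > d ==> g x = 0" using g by (auto simp: jacb_def)
 have "g (tp m x y) = 0" if "wt x + wt y > d" for x y using that by (intro d) (simp add: wt_def tp_def)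
 thus "EX d. ALL x y. d < wt x + wt y --> g (tp m x y) = 0" by blast
qed

lemma pr_sum_single:
 assumes "finite K"
 shows "fsupp (%E. SUM kp:K. s kp * single (b kp) E) & pr h (%E. SUM kp:K. s kp * single (b kp) E) = (SUM kp:K. s kp * h (b kp))"
 using assms
proof (induction K)
 case (insert k K)
 let ?f = "%E. s k * single (b k) E" and ?g = "%E. SUM kp:K. s kp * single (b kp) E"
 have fs: "fsupp ?f" by (rule fsupp_scale) simp
 have e: "(%E. SUM kp:insert k K. s kp * single (b kp) E) = ?f + ?g" using insert by (simp add: plus_fun_def)
 show ?case unfolding e using insert fsupp_add[OF fs, of ?g] pr_add[OF fs, of ?g h] pr_scale[of "single (b k)" h "s k"] by simp
qed (simp add: fsupp_def)

lemma dual_op_comp: "dual_op comp_diag Cg (n, p) (m, n) (m, p)" unfolding dual_op_def fst_conv snd_conv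
proof (intro conjI allI impI)
 fix D' D :: "fword jdiag"
 assume D': "D' : jdiags (free_group n) p" and D: "D : jdiags (free_group m) n"
 let ?D' = "even_labels D'" and ?D = "odd_labels D"
 have E': "?D' : jdiags (free_group n) p" and E: "?D : jdiags (free_group m) n" using relabel_jdiags D D' inj_ev_od by blast+
 note gl = glueable_jdiags[OF E' E]
 have fin: "finite (distributions D' D)" unfolding distributions_def
 proof (rule finite_PiE)
  show "finite (leg_positions D)" using finite_LP[of "entries 0 (arcs D)"] by (simp add: LP_entries)
  show "finite (occurrences D' (fst i))" for i using finite_occs[of "epos (arcs D')" "Suc (fst i)"] by (simp add: occs_epos)
 qed
 show "fsupp (comp_diag D' D :: fword jdiag => 'a)" unfolding comp_diag_def by (rule pr_sum_single[OF fin, THEN conjunct1])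
 have val: "glue ?D' ?D kp : jdiags (free_group m) p & jdeg (glue ?D' ?D kp) = jdeg D' + jdeg D"
  if k: "kp : distributions D' D" for kp
 proof -
  have k': "kp : distributions ?D' ?D" using k by (simp add: distributions_relabel)
  note lg = legs_glue[OF gl k']
  have v: "verts (glue ?D' ?D kp) = verts ?D' + verts ?D" by (simp add: glue_def)
  have "okV (legs (fl (arcs ?D')) @ legs (fl (arcs ?D))) (verts ?D' + verts ?D)"
  proof (rule okV_union)
   show "okV (legs (fl (arcs ?D'))) (verts ?D')" "okV (legs (fl (arcs ?D))) (verts ?D)" using E E' by (auto simp: jdiags_iff)
   have "set (legs (fl (arcs ?D'))) Un set_mset (vlabs (verts ?D')) <= range ev" by (auto simp: arcs_relabel fl_relabel relabel_def)
   moreover have "set (legs (fl (arcs ?D))) Un set_mset (vlabs (verts ?D)) <= range od" by (auto simp: arcs_relabel fl_relabel relabel_def)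
   moreover have "range ev Int range od = {}" by (auto, presburger)
   ultimately show "(set (legs (fl (arcs ?D'))) Un set_mset (vlabs (verts ?D'))) Int
   (set (legs (fl (arcs ?D))) Un set_mset (vlabs (verts ?D))) = {}" by blast
  qed
  hence "okV (legs (fl (arcs (glue ?D' ?D kp)))) (verts (glue ?D' ?D kp))" unfolding v okV_mset[OF lg[folded mset_append]] .
  moreover have "length (arcs (glue ?D' ?D kp)) = p" using E' by (simp add: glue_def jdiags_def)
  moreover have "set (beads (glue ?D' ?D kp)) <= carrier (free_group m)" by (rule beads_glue[OF gl]) (use E in "simp add: jdiags_def")
  ultimately have mem: "glue ?D' ?D kp : jdiags (free_group m) p" by (simp add: jdiags_iff)
  have "length (legs (fl (arcs (glue ?D' ?D kp)))) = length (legs (fl (arcs ?D'))) + length (legs (fl (arcs ?D)))" using arg_cong[OF lg, of size] by simp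
  hence "wt (fd (glue ?D' ?D kp)) = wt (fd D') + wt (fd D)" by (simp add: wt_def fd_def v arcs_relabel fl_relabel) (simp add: relabel_def)
  thus ?thesis using mem jdiags_wt[OF mem] jdiags_wt[OF D] jdiags_wt[OF D'] by simp
 qed
 fix F :: "fword jdiag"
 assume "comp_diag D' D F ~= (0 :: 'a)"
 then obtain kp where k: "kp : distributions D' D" "single (glue ?D' ?D kp) F ~= (0 :: 'a)"
  unfolding comp_diag_def by (metis (no_types, lifting) mult_zero_right sum.neutral)
 hence "F = glue ?D' ?D kp" by (simp add: single_def split: if_splits)
 thus "F : jdiags (free_group m) p" "jdeg F = jdeg D' + jdeg D" using val[OF k(1)] by auto
next
 fix D' D :: "fword jdiag" and g :: "'a jfn"
 assume D': "D' : jdiags (free_group n) p" and D: "D : jdiags (free_group m) n"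
 let ?D' = "even_labels D'" and ?D = "odd_labels D"
 have E': "?D' : jdiags (free_group n) p" and E: "?D : jdiags (free_group m) n" using relabel_jdiags D D' inj_ev_od by blast+
 note gl = glueable_jdiags[OF E' E]
 have fin: "finite (distributions D' D)" unfolding distributions_def
 proof (rule finite_PiE)
  show "finite (leg_positions D)" using finite_LP[of "entries 0 (arcs D)"] by (simp add: LP_entries)
  show "finite (occurrences D' (fst i))" for i using finite_occs[of "epos (arcs D')" "Suc (fst i)"] by (simp add: occs_epos)
 qed
 have v: "verts (glue ?D' ?D kp) = verts ?D' + verts ?D" for kp by (simp add: glue_def)
 have "pr (%E. g (fd E)) (comp_diag D' D) = (SUM kp:distributions D' D.
   (- 1) ^ card {p : leg_positions D. is_negative D' (kp p)} * g (fd (glue ?D' ?D kp)))" unfolding comp_diag_def by (rule pr_sum_single[OF fin, THEN conjunct2])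
 also have "... = (SUM kp:distributions ?D' ?D.
   (- 1) ^ card {p : leg_positions ?D. is_negative ?D' (kp p)} * g (fl (arcs (glue ?D' ?D kp)), verts ?D' + verts ?D))"
 proof (rule sum.cong)
  show "distributions D' D = distributions ?D' ?D" by (simp add: distributions_relabel)
  fix kp assume "kp : distributions ?D' ?D"
  hence "kp p : occurrences D' (fst p)" if "p : leg_positions D" for p using that by (auto simp: distributions_def leg_positions_relabel occurrences_relabel)
  hence "is_negative ?D' (kp p) = is_negative D' (kp p)" if "p : leg_positions D" for p using is_negative_relabel that by blast
  hence "{p : leg_positions D. is_negative D' (kp p)} = {p : leg_positions ?D. is_negative ?D' (kp p)}" by (simp add: leg_positions_relabel cong: conj_cong)
  thus "(- 1) ^ card {p : leg_positions D. is_negative D' (kp p)} * g (fd (glue ?D' ?D kp))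
   = (- 1) ^ card {p : leg_positions ?D. is_negative ?D' (kp p)} * g (fl (arcs (glue ?D' ?D kp)), verts ?D' + verts ?D)" by (simp add: fd_def v)
 qed
 also have "... = vs 1 (fl (arcs ?D)) (%v. g (v, verts ?D' + verts ?D)) (inl (fl (arcs ?D')))" by (rule sum_glue) (use gl in "auto simp: glueable_def")
 also have "... = Cg g (fd D') (fd D)" by (simp add: Cg_def fd_def arcs_relabel fl_relabel) (simp add: relabel_def)
 finally show "pr (%E. g (fd E)) (comp_diag D' D) = Cg g (fd D') (fd D)" .
next
 show "jacb g ==> bijac (Cg g)" for g :: "'a jfn" by (rule bijac_Cg)
qed

lemma lts_word_shift: "lts (word_shift m w) = sh m (lts w)" unfolding sh_def word_shift_def by (induction w) auto

lemma sh_simps [simp]: "sh m [] = []" "sh m (u @ v) = sh m u @ sh m v" "sh m (Sp # u) = Sp # sh m u" "sh m (Lg e # u) = Lg e # sh m u"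
 "sh m (Lt i s # u) = Lt (m + i) s # sh m u" by (auto simp: sh_def)

lemma arc_word_shift: "arc_word (map (shift_item m) L) = sh m (arc_word L)"
proof (induction L)
 case (Cons t L)
 thus ?case by (cases t) (auto simp: lts_word_shift)
qed simp

lemma fl_shift: "fl (map (map (shift_item m)) A) = sh m (fl A)" by (induction A) (auto simp: arc_word_shift)

lemma carrier_word_shift: "w : carrier (free_group m') ==> word_shift m w : carrier (free_group (m + m'))"
proof -
 assume w: "w : carrier (free_group m')"
 have "letter_inv (map_prod ((+) m) id a) = map_prod ((+) m) id (letter_inv a)" for a :: letter by (cases a) auto
 moreover have "map_prod ((+) m) id a = map_prod ((+) m) id b <-> a = b" for a b :: letter by (cases a; cases b) auto
 ultimately have "reduced (word_shift m w)" using w unfolding reduced_def word_shift_def successively_map free_group_def by simp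
 thus ?thesis using w by (auto simp: free_group_def word_shift_def)
qed

lemma carrier_mono: "w : carrier (free_group m) ==> w : carrier (free_group (m + m'))" by (auto simp: free_group_def)

lemma dual_op_tens: "dual_op (tens_diag m) (%g x y. g (tp m x y)) (m, n) (m', n') (m + m', n + n')" unfolding dual_op_def fst_conv snd_conv
proof (intro conjI allI impI)
 fix D D' :: "fword jdiag"
 assume D: "D : jdiags (free_group m) n" and D': "D' : jdiags (free_group m') n'"
 let ?D = "even_labels D" and ?D' = "odd_labels D'"
 let ?T = "JD (arcs ?D @ map (map (shift_item m)) (arcs ?D')) (verts ?D + verts ?D')"
 have E: "?D : jdiags (free_group m) n" and E': "?D' : jdiags (free_group m') n'" using relabel_jdiags D D' inj_ev_od by blast+
 show "fsupp (tens_diag m D D' :: fword jdiag => 'a)" by (simp add: tens_diag_def)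
 have fdT: "fd ?T = tp m (fd D) (fd D')" by (simp add: fd_def tp_def fl_shift arcs_relabel fl_relabel del: map_map) (simp add: relabel_def)
 show "pr (%E. g (fd E)) (tens_diag m D D') = g (tp m (fd D) (fd D'))" for g :: "'a jfn" by (simp add: tens_diag_def fdT)
 have "okV (legs (fl (arcs ?D)) @ legs (fl (arcs ?D'))) (verts ?D + verts ?D')"
 proof (rule okV_union)
  show "okV (legs (fl (arcs ?D'))) (verts ?D')" "okV (legs (fl (arcs ?D))) (verts ?D)" using E E' by (auto simp: jdiags_iff)
  have "set (legs (fl (arcs ?D))) Un set_mset (vlabs (verts ?D)) <= range ev" by (auto simp: arcs_relabel fl_relabel relabel_def)
  moreover have "set (legs (fl (arcs ?D'))) Un set_mset (vlabs (verts ?D')) <= range od" by (auto simp: arcs_relabel fl_relabel relabel_def)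
  moreover have "range ev Int range od = {}" by (auto, presburger)
  ultimately show "(set (legs (fl (arcs ?D))) Un set_mset (vlabs (verts ?D))) Int
   (set (legs (fl (arcs ?D'))) Un set_mset (vlabs (verts ?D'))) = {}" by blast
 qed
 moreover have "set (beads ?T) <= carrier (free_group (m + m'))" unfolding beads_iff
 proof (intro ballI allI impI)
  fix L w assume L: "L : set (arcs ?T)" "Bead w : set L"
  have b: "set (beads ?D) <= carrier (free_group m)" "set (beads ?D') <= carrier (free_group m')" using E E' by (auto simp: jdiags_def)
  show "w : carrier (free_group (m + m'))"
  proof (cases "L : set (arcs ?D)")
   case True
   thus ?thesis using b(1) L(2) carrier_mono unfolding beads_iff by blast
  next
   case False
   then obtain L' where L': "L' : set (arcs ?D')" "L = map (shift_item m) L'" using L(1) by auto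
   then obtain t where t: "t : set L'" "shift_item m t = Bead w" using L(2) by auto
   then obtain w' where "t = Bead w'" "w = word_shift m w'" by (cases t rule: item.exhaust) auto
   thus ?thesis using b(2) L'(1) t(1) carrier_word_shift unfolding beads_iff by blast
  qed
 qed
 ultimately have mem: "?T : jdiags (free_group (m + m')) (n + n')" using E E' by (simp add: jdiags_iff fl_shift)
 have "wt (fd ?T) = wt (fd D) + wt (fd D')" unfolding fdT by (simp add: tp_def wt_def)
 hence dg: "jdeg ?T = jdeg D + jdeg D'" using jdiags_wt[OF mem] jdiags_wt[OF D] jdiags_wt[OF D'] by simp
 fix F assume "tens_diag m D D' F ~= (0 :: 'a)"
 hence "F = ?T" by (simp add: tens_diag_def single_def split: if_splits)
 thus "F : jdiags (free_group (m + m')) (n + n')" "jdeg F = jdeg D + jdeg D'" using mem dg by auto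
next
 show "jacb g ==> bijac (%x y. g (tp m x y))" for g :: "'a jfn" by (rule bijac_tp)
qed

text \<open>Composition turns into iterated evaluation: \<open>EV (G oo F) g\<close> evaluates
  \<open>F\<close> and \<open>G\<close> on the two variables of \<open>Cg g\<close>. This identity
  replaces the definition of composition from here on.\<close>

lemma comp_hom: "G : jhom n p ==> F : jhom m n ==> G oo F : jhom m p"
 and EV_jcomp: "G : jhom n p ==> F : jhom m n ==> jacb g ==> EV (G oo F) g = EV G (%x. EV F (Cg g x))"
proof -
 assume "G : jhom n p" "F : jhom m n"
 then obtain f' f where f': "f' : jseries n p" "G = jmor_of n p f'" and f: "f : jseries m n" "F = jmor_of m n f" by (auto elim!: jhomE)
 have e: "G oo F = jmor_of m p (bilinear_ext comp_diag f' f)" using op_classes[OF dual_op_comp[of n p m] f'(1) f(1)] by (simp add: jcomp_def f f' jmor_of_def)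
 show "G oo F : jhom m p" unfolding e by (rule jhomI[OF bilinear_ext_jseries[OF dual_op_comp f'(1) f(1)]])
 show "EV (G oo F) g = EV G (%x. EV F (Cg g x))" if "jacb g" unfolding e unfolding f(2) f'(2) by (rule EV_bilinear_ext[OF dual_op_comp f'(1) f(1) that])
qed

lemma tens_hom: "F : jhom m n ==> G : jhom m' n' ==> F ** G : jhom (m + m') (n + n')"
 and EV_jtens: "F : jhom m n ==> G : jhom m' n' ==> jacb g ==> EV (F ** G) g = EV F (%x. EV G (%y. g (tp m x y)))"
proof -
 assume "F : jhom m n" "G : jhom m' n'"
 then obtain f f' where f': "f' : jseries m' n'" "G = jmor_of m' n' f'" and f: "f : jseries m n" "F = jmor_of m n f" by (auto elim!: jhomE)
 have e: "F ** G = jmor_of (m + m') (n + n') (bilinear_ext (tens_diag m) f f')" using op_classes[OF dual_op_tens[of m n m' n'] f(1) f'(1)] by (simp add: jtens_def f f' jmor_of_def)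
 show "F ** G : jhom (m + m') (n + n')" unfolding e by (rule jhomI[OF bilinear_ext_jseries[OF dual_op_tens f(1) f'(1)]])
 show "EV (F ** G) g = EV F (%x. EV G (%y. g (tp m x y)))" if "jacb g" unfolding e unfolding f(2) f'(2) by (rule EV_bilinear_ext[OF dual_op_tens f(1) f'(1) that])
qed

section \<open>The axioms of a symmetric strict monoidal category\<close>

section \<open>The symmetric strict monoidal category\<close>

lemma rl_comp [simp]: "rl sg o rl ta = rl (sg o ta)"
proof
 show "(rl sg o rl ta) x = rl (sg o ta) x" for x :: "'a sym" by (cases x) auto
qed

lemma rv_rv [simp]: "rv sg (rv ta V) = rv (sg o ta) V" by (simp add: multiset.map_comp) (simp add: relabel_vert_def comp_def case_prod_beta')

lemma jac_rel: "jac {} g ==> inj sg ==> g (map (rl sg) u, rv sg V) = g (u, V)" by (rule jac_relabel) auto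

lemma jacb_rel: "jacb g ==> inj sg ==> g (map (rl sg) u, rv sg V) = g (u, V)" using jac_rel[of g sg u V] by (simp add: jacb_iff)

lemma EV_Fubini:
 assumes F: "F : jhom m n" and G: "G : jhom m' n'" and B: "ALL x y. wt x + wt y > d --> B x y = 0"
 shows "EV F (%x. EV G (B x)) = EV G (%y. EV F (%x. B x y))"
proof -
 obtain S c where S: "finite S" "ALL D:S. D : jdiags (free_group m) n" "ALL g. bdd d g --> EV F g = (SUM D:S. c D * g (fd D))" by (rule EV_finite[OF F])
 obtain T e where T: "finite T" "ALL D:T. D : jdiags (free_group m') n'" "ALL g. bdd d g --> EV G g = (SUM D:T. e D * g (fd D))" by (rule EV_finite[OF G])
 have B': "B x y = 0" if "wt x > d \<or> wt y > d" for x y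
 proof -
  have "wt x + wt y > d" using that by linarith
  thus ?thesis using B by blast
 qed
 have 1: "bdd d (B x)" "bdd d (%x. B x y)" for x y using B' by (auto simp: bdd_def)
 have "B x = (%y. 0)" if "wt x > d" for x using that B' by blast
 hence 3: "bdd d (%x. EV G (B x))" using EV_zero[OF G] by (simp add: bdd_def)
 have "(%x. B x y) = (%x. 0)" if "wt y > d" for y using that B' by blast
 hence 4: "bdd d (%y. EV F (%x. B x y))" using EV_zero[OF F] by (simp add: bdd_def)
 have "EV F (%x. EV G (B x)) = (SUM D:S. c D * EV G (B (fd D)))" using S(3)[rule_format, OF 3] .
 also have "... = (SUM D:S. SUM E:T. c D * (e E * B (fd D) (fd E)))" by (simp add: T(3)[rule_format, OF 1(1)] sum_distrib_left)
 also have "... = (SUM E:T. SUM D:S. c D * (e E * B (fd D) (fd E)))" by (rule sum.swap)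
 also have "... = (SUM E:T. e E * (SUM D:S. c D * B (fd D) (fd E)))" unfolding sum_distrib_left by (intro sum.cong refl mult.left_commute)
 also have "... = (SUM E:T. e E * EV F (%x. B x (fd E)))" by (simp only: S(3)[rule_format, OF 1(2)])
 also have "... = EV G (%y. EV F (%x. B x y))" using T(3)[rule_format, OF 4] by simp
 finally show ?thesis .
qed

lemma vs_EV:
 assumes F: "F : jhom m n" and B: "ALL x y. wt x + wt y > d --> B x y = 0"
 shows "vs j A (%v. EV F (B (v, V))) u = EV F (%z. vs j A (%v. B (v, V) z) u)"
proof -
 obtain S c where S: "finite S" "ALL D:S. D : jdiags (free_group m) n" "ALL g. bdd d g --> EV F g = (SUM D:S. c D * g (fd D))" by (rule EV_finite[OF F])
 have B': "B x y = 0" if "wt y > d" for x y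
 proof -
  have "wt x + wt y > d" using that by linarith
  thus ?thesis using B by blast
 qed
 have 1: "bdd d (B x)" for x using B' by (auto simp: bdd_def)
 have 2: "bdd d (%z. vs j A (%v. B (v, V) z) u)" unfolding bdd_def by (intro allI impI vs_zero B')
 show ?thesis unfolding S(3)[rule_format, OF 1] S(3)[rule_format, OF 2] by (rule vs_sum)
qed

lemma Cg_EV:
 assumes "F : jhom m n" "ALL x y. wt x + wt y > d --> B x y = 0"
 shows "Cg (%w. EV F (B w)) x y = EV F (%z. Cg (%w. B w z) x y)" unfolding Cg_def by (rule vs_EV[OF assms])

lemma Cg_zero:
 assumes "!!w. wt w = wt x + wt y ==> g w = 0"
 shows "Cg g x y = 0" unfolding Cg_def
proof (rule vs_zero)
 fix v :: "nat sym list"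
 assume "mset (legs v) = mset (legs (map (rl od) (fst y))) + mset (legs (inl (map (rl ev) (fst x)) :: (nat + nat) sym list))"
 hence "size (mset (legs v)) = size (mset (legs (map (rl od) (fst y))) + mset (legs (inl (map (rl ev) (fst x)) :: (nat + nat) sym list)))" by (rule arg_cong)
 hence "length (legs v) = length (legs (fst y)) + length (legs (fst x))" by simp
 thus "g (v, rv ev (snd x) + rv od (snd y)) = 0" by (intro assms) (simp add: wt_def)
qed

lemma wt_tp: "wt (tp m x y) = wt x + wt y" by (simp add: tp_def wt_def)

lemma mod4_cases:
 fixes x :: nat
 obtains a where "x = 4 * a" | a where "x = 4 * a + 1" | a where "x = 4 * a + 2" | a where "x = 4 * a + 3"
proof -
 have "x = 4 * (x div 4) + x mod 4" by simp
 moreover have "x mod 4 = 0 \<or> x mod 4 = 1 \<or> x mod 4 = 2 \<or> x mod 4 = 3" by linarith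
 ultimately show ?thesis using that by (metis add.right_neutral)
qed

lemma mod4: "4 * a mod 4 = (0 :: nat)" "(4 * a + 1) mod 4 = (1 :: nat)" "(4 * a + 2) mod 4 = (2 :: nat)"
 "(4 * a + 3) mod 4 = (3 :: nat)" "(4 * a + 3) div 2 = 2 * a + (1 :: nat)" by presburger+

lemma odev4: "2 * (2 * a) = 4 * (a :: nat)" "2 * (2 * a) + 1 = 4 * (a :: nat) + 1" "2 * (2 * a + 1) = 4 * (a :: nat) + 2"
 "4 * a + 2 + 1 = 4 * (a :: nat) + 3" by simp_all

text \<open>The three factors of a product carry labels doubled once or twice, in a way that depends
  on the bracketing. This injection takes the labels for right bracketing to those for left
  bracketing; on residues modulo 4 it is affine, and \<open>r\<close> is its left inverse.\<close>

lemma assoc_relabelling: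
 obtains sg :: "nat => nat" where "inj sg" "sg o ev = ev o ev" "sg o (od o ev) = ev o od" "sg o (od o od) = od"
proof -
 define s :: "nat => nat" where "s = (%e. if e mod 4 = 1 then e + 1 else if e mod 4 = 3 then e div 2 else 2 * e)"
 define r :: "nat => nat" where "r = (%e. if e mod 4 = 0 then e div 2 else if e mod 4 = 2 then e - 1 else 2 * e + 1)"
 have s: "s (4 * a) = 4 * (2 * a)" "s (4 * a + 1) = 4 * a + 2" "s (4 * a + 2) = 4 * (2 * a + 1)" "s (4 * a + 3) = 2 * a + 1" for a unfolding s_def by (simp_all only: mod4, simp_all)
 have r: "r (4 * a) = 2 * a" "r (4 * a + 2) = 4 * a + 1" for a unfolding r_def by (simp_all only: mod4, simp_all)
 have "(2 * a + 1) mod 4 ~= 0 & (2 * a + 1) mod 4 ~= 2" for a :: nat by presburger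
 hence r': "r (2 * a + 1) = 4 * a + 3" for a unfolding r_def by simp
 have "r (s x) = x" for x by (cases x rule: mod4_cases) (simp_all only: s r r', simp_all)
 hence "inj s" by (rule inj_on_inverseI)
 moreover have "s (2 * x) = 2 * (2 * x)" for x
 proof (cases "even x")
  case True
  then obtain y where "x = 2 * y" by (rule evenE)
  thus ?thesis using s(1)[of y] by simp
 next
  case False
  then obtain y where "x = 2 * y + 1" by (rule oddE)
  thus ?thesis using s(3)[of y] by simp
 qed
 hence "s o ev = ev o ev" by (simp add: comp_def)
 moreover have "s o (od o ev) = ev o od" "s o (od o od) = od" by (rule ext, simp only: comp_apply odev4 s)+
 ultimately show ?thesis by (rule that)
qed

lemma Cg_assoc:
 assumes k: "jac {} k"
 shows "Cg (%w. Cg k w z) x y = Cg (Cg k x) y z"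
proof -
 obtain u U v V w W where xyz: "x = (u, U)" "y = (v, V)" "z = (w, W)" by fastforce
 obtain sg :: "nat => nat" where s: "inj sg" "sg o ev = ev o ev" "sg o (od o ev) = ev o od" "sg o (od o od) = od"
  by (rule assoc_relabelling)
 let ?K1 = "%q. k (q, rv (ev o ev) U + rv (ev o od) V + rv od W)"
 let ?K2 = "%q. k (q, rv ev U + (rv (od o ev) V + rv (od o od) W))"
 have "Cg (%w. Cg k w z) x y = vs 1 (map (rl od) v) (%p. (%p'. vs 1 (map (rl od) w) ?K1 (inl p')) (map (rl ev) p)) (inl (map (rl ev) u))" by (simp add: Cg_def xyz)
 also have "... = vs 1 (map (rl ev) (map (rl od) v)) (%p'. vs 1 (map (rl od) w) ?K1 (inl p')) (map (rl ev) (inl (map (rl ev) u)))" by (rule vs_rl[symmetric])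
 also have "... = vs 1 (map (rl (ev o od)) v) (%p'. vs 1 (map (rl od) w) ?K1 (inl p')) (inl (map (rl (ev o ev)) u))" by (simp add: map_rl_inl)
 also have "... = vs 1 (map (rl od) w) (%B'. vs 1 B' ?K1 (inl (map (rl (ev o ev)) u))) (inl (map (rl (ev o od)) v))" by (rule vs_assoc)
 finally have L: "Cg (%w. Cg k w z) x y = ..." .
 have K: "?K2 = (%q. ?K1 (map (rl sg) q))"
 proof
  fix q
  show "?K2 q = ?K1 (map (rl sg) q)" using jac_rel[OF k s(1), of q "rv ev U + (rv (od o ev) V + rv (od o od) W)"] by (simp add: s add.assoc)
 qed
 have in2: "vs 1 C ?K2 (inl (map (rl ev) u)) = vs 1 (map (rl sg) C) ?K1 (map (rl sg) (inl (map (rl ev) u)))" for C unfolding K by (rule vs_rl[symmetric])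
 have "Cg (Cg k x) y z = vs 1 (map (rl od) w) (%B'. (%C. vs 1 C ?K2 (inl (map (rl ev) u))) (map (rl od) B')) (inl (map (rl ev) v))" by (simp add: Cg_def xyz)
 also have "... = vs 1 (map (rl od) (map (rl od) w)) (%C. vs 1 C ?K2 (inl (map (rl ev) u))) (map (rl od) (inl (map (rl ev) v)))" by (rule vs_rl[symmetric])
 also have "... = vs 1 (map (rl (od o od)) w) (%C. (%C'. vs 1 C' ?K1 (map (rl sg) (inl (map (rl ev) u)))) (map (rl sg) C)) (inl (map (rl (od o ev)) v))"
  by (simp add: in2 map_rl_inl)
 also have "... = vs 1 (map (rl sg) (map (rl (od o od)) w)) (%C'. vs 1 C' ?K1 (map (rl sg) (inl (map (rl ev) u)))) (map (rl sg) (inl (map (rl (od o ev)) v)))"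
  by (rule vs_rl[symmetric])
 also have "... = vs 1 (map (rl od) w) (%B'. vs 1 B' ?K1 (inl (map (rl (ev o ev)) u))) (inl (map (rl (ev o od)) v))" by (simp add: map_rl_inl s)
 finally show ?thesis using L by simp
qed

lemma comp_assoc:
 assumes F: "F : jhom m n" and G: "G : jhom n p" and H: "H : jhom p q"
 shows "H oo G oo F = H oo (G oo F)"
proof (rule jhom_ext)
 show "H oo G oo F : jhom m q" "H oo (G oo F) : jhom m q" using assms comp_hom by blast+
 fix k :: "'a jfn" assume k: "jacb k"
 obtain d where d: "ALL x. bdd d (Cg k x)" "ALL y. bdd d (%x. Cg k x y)" "ALL x y. wt x + wt y > d --> Cg k x y = 0" by (rule bijac_bdd[OF bijac_Cg[OF k]])
 have "EV (H oo G oo F) k = EV (H oo G) (%w. EV F (Cg k w))" by (rule EV_jcomp[OF comp_hom[OF H G] F k])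
 also have "... = EV H (%x. EV G (Cg (%w. EV F (Cg k w)) x))" by (rule EV_jcomp[OF H G jacb_EV[OF F bijac_Cg[OF k]]])
 also have "... = EV H (%x. EV G (%y. EV F (%z. Cg (%w. Cg k w z) x y)))"
 proof -
  have "Cg (%w. EV F (Cg k w)) x = (%y. EV F (%z. Cg (%w. Cg k w z) x y))" for x by (rule ext) (rule Cg_EV[OF F d(3)])
  thus ?thesis by (simp only:)
 qed
 also have "... = EV H (%x. EV G (%y. EV F (Cg (Cg k x) y)))" using k by (simp add: Cg_assoc jacb_iff)
 also have "... = EV H (%x. EV (G oo F) (Cg k x))" by (simp add: EV_jcomp[OF G F bijac_right[OF bijac_Cg[OF k]]])
 also have "... = EV (H oo (G oo F)) k" by (rule EV_jcomp[OF H comp_hom[OF G F] k, symmetric])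
 finally show "EV (H oo G oo F) k = EV (H oo (G oo F)) k" .
qed

lemma sh_sh: "sh m (sh n u) = sh (m + n) u" by (simp add: sh_def lmap_lmap add.assoc)

lemma map_rl_sh: "map (rl sg) (sh m u) = sh m (map (rl sg) u)" by (simp add: sh_def map_rl_lmap)

lemma jtens_assoc:
 assumes F: "F : jhom m n" and G: "G : jhom m' n'" and H: "H : jhom m'' n''"
 shows "F ** G ** H = F ** (G ** H)"
proof (rule jhom_ext)
 show "F ** G ** H : jhom (m + m' + m'') (n + n' + n'')" by (intro tens_hom F G H)
 have "F ** (G ** H) : jhom (m + (m' + m'')) (n + (n' + n''))" by (intro tens_hom F G H)
 thus "F ** (G ** H) : jhom (m + m' + m'') (n + n' + n'')" by (simp add: add.assoc)
 fix k :: "'a jfn" assume k: "jacb k"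
 obtain sg :: "nat => nat" where s: "inj sg" "sg o ev = ev o ev" "sg o (od o ev) = ev o od" "sg o (od o od) = od"
  by (rule assoc_relabelling)
 have pt: "k (tp (m + m') (tp m x y) z) = k (tp m x (tp m' y z))" for x y z using jacb_rel[OF k s(1), of "fst (tp m x (tp m' y z))" "snd (tp m x (tp m' y z))"]
  by (simp add: tp_def map_rl_sh sh_sh s add.assoc)
 have "EV (F ** G ** H) k = EV (F ** G) (%w. EV H (%z. k (tp (m + m') w z)))" by (rule EV_jtens[OF tens_hom[OF F G] H k])
 also have "... = EV F (%x. EV G (%y. EV H (%z. k (tp (m + m') (tp m x y) z))))" by (rule EV_jtens[OF F G jacb_EV[OF H bijac_tp[OF k]]])
 also have "... = EV F (%x. EV G (%y. EV H (%z. k (tp m x (tp m' y z)))))" by (simp add: pt)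
 also have "... = EV F (%x. EV (G ** H) (%w. k (tp m x w)))" by (simp add: EV_jtens[OF G H bijac_right[OF bijac_tp[OF k]]])
 also have "... = EV (F ** (G ** H)) k" by (rule EV_jtens[OF F tens_hom[OF G H] k, symmetric])
 finally show "EV (F ** G ** H) k = EV (F ** (G ** H)) k" .
qed

subsection \<open>Morphisms given by one diagram\<close>

definition isx :: "nat => nat => 'k::field jmor => dword => bool" where
 "isx m n F x <-> F : jhom m n & (ALL g. jacb g --> EV F g = g x)"

lemma isx_jhom: "isx m n F x ==> F : jhom m n"
 and isx_EV: "isx m n F x ==> jacb g ==> EV F g = g x" by (auto simp: isx_def)

lemma isx_jmor_of:
 assumes D: "D : jdiags (free_group m) n"
 shows "isx m n (jmor_of m n (single D)) (fd D)"
proof -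
 have "finite {E. single D E ~= (0 :: 'a) & jdeg E = d}" for d by (rule finite_subset[of _ "{D}"]) (auto simp: single_def split: if_splits)
 hence s: "(single D :: _ => 'a) : jseries m n" using D by (auto simp: jseries_def single_def split: if_splits)
 have "evs (single D) g = g (fd D)" for g :: "'a jfn"
 proof -
  have "evs (single D) g = (SUM E:{D}. single D E * g (fd E))" by (rule evs_superset) (auto simp: single_def split: if_splits)
  thus ?thesis by (simp add: single_def)
 qed
 thus ?thesis using s by (simp add: isx_def jhomI EV_jmor_of)
qed

lemma isx_jdiag_mor: "JD A {#} : jdiags (free_group m) n ==> isx m n (jdiag_mor m n A) (fl A, {#})" using isx_jmor_of[of "JD A {#}" m n] by (simp add: jdiag_mor_def fd_def)

lemma EV_comp_left:
 "isx p n G x ==> F : jhom m p ==> jacb g ==> EV (G oo F) g = EV F (Cg g x)" by (simp add: EV_jcomp[OF isx_jhom] isx_EV jacb_EV bijac_Cg)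

lemma EV_comp_right:
 "G : jhom p n ==> isx m p F y ==> jacb g ==> EV (G oo F) g = EV G (%x. Cg g x y)"
 by (simp add: EV_jcomp[OF _ isx_jhom] isx_EV bijac_right bijac_Cg)

lemma EV_comp_isx:
 assumes "isx p n G x" "isx m p F y" "jacb g"
 shows "EV (G oo F) g = Cg g x y" using EV_comp_left[OF assms(1) isx_jhom[OF assms(2)] assms(3)] isx_EV[OF assms(2) bijac_right[OF bijac_Cg[OF assms(3)]]] by simp

lemma isx_tens:
 assumes "isx m n F x" "isx m' n' G y"
 shows "isx (m + m') (n + n') (F ** G) (tp m x y)" unfolding isx_def
proof (intro conjI allI impI)
 show "F ** G : jhom (m + m') (n + n')" using assms by (intro tens_hom isx_jhom)
 fix g :: "'a jfn" assume g: "jacb g"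
 have "EV (F ** G) g = EV F (%x. EV G (%y. g (tp m x y)))" by (rule EV_jtens[OF isx_jhom[OF assms(1)] isx_jhom[OF assms(2)] g])
 also have "... = EV F (%x. g (tp m x y))" by (simp add: isx_EV[OF assms(2) bijac_right[OF bijac_tp[OF g]]])
 also have "... = g (tp m x y)" by (rule isx_EV[OF assms(1) bijac_left[OF bijac_tp[OF g]]])
 finally show "EV (F ** G) g = g (tp m x y)" .
qed

lemma isx_unique:
 fixes F :: "'k::field jmor"
 assumes "isx m n F x" "isx m n G y" "!!g :: 'k jfn. jacb g ==> g x = g y"
 shows "F = G" by (rule jhom_ext[OF assms(1,2)[THEN isx_jhom]]) (simp add: isx_EV[OF assms(1)] isx_EV[OF assms(2)] assms(3))

definition wsb :: "(nat * bool) list list => (nat * bool) list => (nat * bool) list" where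
 "wsb ws w = concat (map (%(i, s). spow s (if 1 <= i & i < 1 + length ws then ws ! (i - 1) else [])) w)"

definition bw :: "(nat * bool) list list => dword" where
 "bw ws = (fa (map lts ws), {#})"

text \<open>The words on the arcs need not be reduced: they describe the morphism by its
  evaluations, and \<open>isb_unique_red\<close> compares them after free reduction.\<close>

definition isb :: "nat => nat => 'k::field jmor => (nat * bool) list list => bool" where
 "isb m n F ws <-> isx m n F (bw ws) & length ws = n & (ALL w:set ws. fst ` set w <= {1..m})"

lemma isbD: "isb m n F ws ==> isx m n F (bw ws)" "isb m n F ws ==> F : jhom m n" "isb m n F ws ==> length ws = n" by (auto simp: isb_def isx_def)

lemma isb_beads:
 assumes "length B = n" "ALL L:set B. set L <= carrier (free_group m)"
 shows "isb m n (jdiag_mor m n (map (map Bead) B)) (map concat B)"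
proof -
 have a: "arc_word (map Bead L) = lts (concat L)" for L by (induction L) auto
 hence f: "fl (map (map Bead) B) = fa (map lts (map concat B))" by (simp add: fl_def comp_def)
 have l: "legs (fa (map lts ws)) = []" for ws :: "(nat * bool) list list" by (induction ws) auto
 have "JD (map (map Bead) B) {#} : jdiags (free_group m) n" using assms unfolding jdiags_iff beads_iff jdiag.sel f l by (auto simp: okV_def)
 from isx_jdiag_mor[OF this] have "isx m n (jdiag_mor m n (map (map Bead) B)) (bw (map concat B))" unfolding f bw_def .
 thus ?thesis using assms by (fastforce simp: isb_def free_group_def)
qed

lemma map_rl_fa: "map (rl sg) (fa As) = fa (map (map (rl sg)) As)" by (induction As) auto

lemma map_rl_bw [simp]: "map (rl sg) (fa (map lts ws)) = fa (map lts ws)" by (induction ws) auto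

lemma lmap_fa: "lmap h (fa As) = fa (map (lmap h) As)" by (induction As) auto

lemma lmap_inl: "lmap h (inl u) = lmap (%i. h (Inl i)) u" by (simp add: inl_def lmap_lmap)

lemma Cg_beads:
 "Cg g (u, V) (bw ws) = g (lmap (%i. if 1 <= i & i < 1 + length ws then ws ! (i - 1) else []) (map (rl ev) u), rv ev V)" by (simp add: Cg_def bw_def vs_beads lmap_inl)

lemma lmap_wsb: "lmap (%i. if 1 <= i & i < 1 + length ws then ws ! (i - 1) else []) (fa (map lts ws')) = fa (map lts (map (wsb ws) ws'))"
 by (simp add: lmap_fa lmap_lts wsb_def comp_def)

lemma fst_set_spow: "fst ` set (spow s w) = fst ` set w" by (cases s) (simp_all add: winv_def image_image case_prod_beta)

lemma isb_comp:
 assumes G: "isb p n G ws'" and F: "isb m p F ws"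
 shows "isb m n (G oo F) (map (wsb ws) ws')" unfolding isb_def isx_def
proof (intro conjI allI impI ballI)
 show "G oo F : jhom m n" using isbD(2)[OF G] isbD(2)[OF F] by (rule comp_hom)
 fix g :: "'a jfn" assume g: "jacb g"
 have "EV (G oo F) g = Cg g (bw ws') (bw ws)" by (rule EV_comp_isx[OF isbD(1)[OF G] isbD(1)[OF F] g])
 also have "... = g (bw (map (wsb ws) ws'))" unfolding bw_def[of ws'] Cg_beads map_rl_bw lmap_wsb by (simp add: bw_def)
 finally show "EV (G oo F) g = g (bw (map (wsb ws) ws'))" .
next
 show "length (map (wsb ws) ws') = n" using G by (simp add: isb_def)
next
 have "fst ` set (spow s (if 1 <= i & i < 1 + length ws then ws ! (i - 1) else [])) <= {1..m}" for s i
 proof (cases "1 <= i & i < 1 + length ws")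
  case True
  hence "ws ! (i - 1) : set ws" by (intro nth_mem) linarith
  thus ?thesis using F True unfolding fst_set_spow isb_def by simp
 next
  case False
  hence e: "(if 1 <= i & i < 1 + length ws then ws ! (i - 1) else []) = []" by (rule if_not_P)
  show ?thesis unfolding e by (simp add: fst_set_spow)
 qed
 hence "fst ` set (wsb ws w) <= {1..m}" for w by (fastforce simp: wsb_def)
 thus "w : set (map (wsb ws) ws') ==> fst ` set w <= {1..m}" for w by auto
qed

lemma isb_tens:
 assumes F: "isb m n F ws" and G: "isb m' n' G ws'"
 shows "isb (m + m') (n + n') (F ** G) (ws @ map (word_shift m) ws')"
proof -
 have "sh m (fa (map lts ws')) = fa (map lts (map (word_shift m) ws'))" by (simp add: sh_def[of m "fa (map lts ws')"] lmap_fa lts_word_shift comp_def) (simp add: sh_def)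
 hence "tp m (bw ws) (bw ws') = bw (ws @ map (word_shift m) ws')" by (simp add: tp_def bw_def)
 moreover have "fst ` set (word_shift m w) <= {1..m + m'}" if "fst ` set w <= {1..m'}" for w using that by (auto simp: word_shift_def)
 ultimately show ?thesis using isx_tens[OF isbD(1)[OF F] isbD(1)[OF G]] F G by (fastforce simp: isb_def)
qed

lemma isb_unique: "isb m n F ws ==> isb m n G ws ==> F = G" using isx_unique isbD(1) by blast

abbreviation red :: "(nat * bool) list => (nat * bool) list" where
 "red w == foldr reduce_cons w []"

lemma jac_red:
 assumes "cancel k"
 shows "k (p @ fa (map lts (map red ws))) = k (p @ fa (map lts ws))"
proof (induction ws arbitrary: p)
 case (Cons w ws)
 have "k (p @ lts (red w) @ Sp # fa (map lts (map red ws))) = k (p @ lts w @ Sp # fa (map lts (map red ws)))" using jac_reduce[OF assms, of p w "[]"] by simp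
 also have "... = k (p @ lts w @ Sp # fa (map lts ws))" using Cons[of "p @ lts w @ [Sp]"] by simp
 finally show ?case by simp
qed simp

lemma isb_unique_red:
 assumes "isb m n F ws" "isb m n G ws'" "map red ws = map red ws'"
 shows "F = G"
proof (rule isx_unique[OF isbD(1)[OF assms(1)] isbD(1)[OF assms(2)]])
 fix g :: "'a jfn" assume "jacb g"
 hence c: "cancel (%u. g (u, {#}))" using jac_cancelling[of "{}" g] by (simp add: jacb_iff)
 show "g (bw ws) = g (bw ws')" using jac_red[OF c, of "[]" ws] jac_red[OF c, of "[]" ws'] assms(3) unfolding bw_def by simp
qed

definition vr :: "(nat => nat) => nat => (nat * bool) list list" where
 "vr f n = map (%i. [(f i, True)]) [1..<n+1]"

text \<open>One positive letter on each arc. Identities and symmetries are of this kind, and they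
  compose like maps between sets of indices, in the opposite order.\<close>

definition isr :: "nat => nat => 'k::field jmor => (nat => nat) => bool" where
 "isr m n F f <-> isb m n F (vr f n)"

lemma length_vr [simp]: "length (vr f n) = n" by (simp add: vr_def)

lemma nth_vr [simp]: "i < n ==> vr f n ! i = [(f (i + 1), True)]" by (simp add: vr_def add.commute)

lemma wsb_single [simp]: "wsb ws [(i, s)] = spow s (if 1 <= i & i < 1 + length ws then ws ! (i - 1) else [])" by (simp add: wsb_def)

lemma isr_range: "isr m n F f ==> 1 <= i ==> i <= n ==> 1 <= f i & f i <= m" by (auto simp: isr_def isb_def vr_def)

lemma isr_comp:
 assumes G: "isr p n G f'" and F: "isr m p F f"
 shows "isr m n (G oo F) (%i. f (f' i))"
proof -
 have "map (wsb (vr f p)) (vr f' n) = vr (%i. f (f' i)) n"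
 proof (rule nth_equalityI)
  fix i assume i: "i < length (map (wsb (vr f p)) (vr f' n))"
  hence "1 <= f' (i + 1)" "f' (i + 1) <= p" using isr_range[OF G, of "i + 1"] by auto
  thus "map (wsb (vr f p)) (vr f' n) ! i = vr (%i. f (f' i)) n ! i" using i by simp
 qed simp
 thus ?thesis using isb_comp[of p n G "vr f' n" m F "vr f p"] assms by (simp add: isr_def)
qed

lemma isr_tens:
 assumes "isr m n F f" "isr m' n' G f'"
 shows "isr (m + m') (n + n') (F ** G) (%i. if i <= n then f i else m + f' (i - n))"
proof -
 have "vr f n @ map (word_shift m) (vr f' n') = vr (%i. if i <= n then f i else m + f' (i - n)) (n + n')"
  by (rule nth_equalityI) (auto simp: nth_append word_shift_def Suc_diff_le not_less)
 thus ?thesis using isb_tens[of m n F "vr f n" m' n' G "vr f' n'"] assms by (simp add: isr_def)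
qed

lemma isr_unique:
 assumes "isr m n F f" "isr m n G f'" "!!i. 1 <= i ==> i <= n ==> f i = f' i"
 shows "F = G"
proof -
 have "vr f n = vr f' n" by (rule nth_equalityI) (auto simp: assms(3))
 thus ?thesis using isb_unique assms unfolding isr_def by metis
qed

lemma A_hat_simps [simp]: "Ob A_hat = UNIV" "Hom A_hat = jhom" "Comp A_hat = jcomp" "TObj A_hat = (+)"
 "UnitOb A_hat = 0" "Tens A_hat = jtens" by (simp_all add: A_hat_def)

lemma isr_jdiag_mor:
 assumes "!!i. 1 <= i ==> i <= n ==> 1 <= f i & f i <= m"
 shows "isr m n (jdiag_mor m n (map (%i. [gen_bead (f i)]) [1..<n+1])) f"
proof -
 let ?B = "map (%i. [[(f i, True)]]) [1..<n+1]"
 have "isb m n (jdiag_mor m n (map (map Bead) ?B)) (map concat ?B)" by (rule isb_beads) (use assms in "auto intro!: single_letter_carrier")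
 thus ?thesis by (simp add: isr_def vr_def comp_def)
qed

lemma isr_Ident [simp]: "isr n n (idA n) (%i. i)" using isr_jdiag_mor[of n "%i. i" n] by (simp add: A_hat_def)

lemma isr_Symm [simp]: "isr (m + n) (n + m) (PA m n) (%i. if i <= n then m + i else i - n)"
proof -
 have "map (%i. [gen_bead (if i <= n then m + i else i - n)]) [1..<n + m + 1]
  = map (%j. [gen_bead (m + j)]) [1..<n+1] @ map (%i. [gen_bead i]) [1..<m+1]" by (rule nth_equalityI) (auto simp: nth_append)
 moreover have "1 <= i ==> i <= n + m ==> 1 <= (if i <= n then m + i else i - n) & (if i <= n then m + i else i - n) <= m + n" for i by auto
 note isr_jdiag_mor[of "n + m" "%i. if i <= n then m + i else i - n" "m + n", OF this]
 ultimately show ?thesis by (simp add: A_hat_def)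
qed

lemma isb_Ident: "isb n n (idA n) (vr (%i. i) n)" using isr_Ident by (simp add: isr_def)

lemma isb_Symm: "isb (m + n) (n + m) (PA m n) (vr (%i. if i <= n then m + i else i - n) (n + m))" using isr_Symm by (simp add: isr_def)

subsection \<open>Category axioms\<close>

lemma jdiags_inrange:
 assumes "D : jdiags (free_group m) n"
 shows "inrange m (fl (arcs D))"
proof -
 have "inrange m (arc_word L)" if "ALL w. Bead w : set L --> w : carrier (free_group m)" for L using that
 proof (induction L)
  case (Cons t L)
  thus ?case by (cases t) (auto simp: inrange_lts)
 qed simp
 moreover have "set (beads D) <= carrier (free_group m)" using assms by (simp add: jdiags_iff)
 ultimately show ?thesis unfolding fl_def inrange_fa beads_iff by auto
qed

lemma inrange_rl [simp]: "inrange m (map (rl sg) u) = inrange m u"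
proof (induction u)
 case (Cons x u)
 thus ?case by (cases x) auto
qed simp

lemma lmap_inrange:
 assumes "inrange m u" "!!i. 1 <= i ==> i <= m ==> f i = h i"
 shows "lmap f u = lmap h u" by (rule lmap_cong) (use assms in "auto simp: inrange_def")

lemma jcomp_Ident_right:
 assumes F: "F : jhom m n"
 shows "F oo idA m = F"
proof (rule jhom_ext)
 show "F oo idA m : jhom m n" using F isbD(2)[OF isb_Ident] by (rule comp_hom)
 show "F : jhom m n" by (rule F)
 fix g :: "'a jfn" assume g: "jacb g"
 have "Cg g (fd D) (bw (vr (%i. i) m)) = g (fd D)" if D: "D : jdiags (free_group m) n" for D
 proof -
  let ?u = "fl (arcs D)"
  have "lmap (%i. if 1 <= i & i < 1 + m then vr (%i. i) m ! (i - 1) else []) (map (rl ev) ?u) = lmap (%i. [(i, True)]) (map (rl ev) ?u)"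
   by (rule lmap_inrange[of m]) (auto simp: jdiags_inrange[OF D])
  thus ?thesis using jacb_rel[OF g inj_ev_od(1), of ?u "verts D"] by (simp add: fd_def Cg_beads lmap_ident)
 qed
 thus "EV (F oo idA m) g = EV F g" unfolding EV_comp_right[OF F isbD(1)[OF isb_Ident] g] by (intro EV_cong[OF F])
qed

lemma map_rl_fl: "map (rl sg) (fl A) = fa (map (%L. map (rl sg) (arc_word L)) A)" by (simp add: fl_def map_rl_fa comp_def)

lemma arc_rl [simp]: "arc (map (rl sg) L) = arc L"
proof (induction L)
 case (Cons x L)
 thus ?case by (cases x) auto
qed simp

lemma map_lts_vr: "map lts (vr f n) = map (%i. [Lt (f i) True]) [1..<1 + n]" by (simp add: vr_def add.commute)

lemma jcomp_Ident_left:
 assumes F: "F : jhom m n"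
 shows "idA n oo F = F"
proof (rule jhom_ext)
 show "idA n oo F : jhom m n" using isbD(2)[OF isb_Ident] F by (rule comp_hom)
 show "F : jhom m n" by (rule F)
 fix g :: "'a jfn" assume g: "jacb g"
 have "Cg g (bw (vr (%i. i) n)) (fd D) = g (fd D)" if D: "D : jdiags (free_group m) n" for D
 proof -
  let ?As = "map (%L. map (rl od) (arc_word L)) (arcs D)"
  have n: "length ?As = n" using D by (simp add: jdiags_iff)
  have "vs 1 (fa ?As) (%v. g (v, rv od (verts D))) (inl (fa (map (%i. [Lt i True]) [1..<1 + length ?As]))) = g (fa ?As, rv od (verts D))" by (rule vs_fa_blocks) auto
  thus ?thesis using jacb_rel[OF g inj_ev_od(2), of "fl (arcs D)" "verts D"] unfolding n by (simp add: fd_def Cg_def bw_def map_rl_fl map_lts_vr[symmetric])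
 qed
 thus "EV (idA n oo F) g = EV F g" unfolding EV_comp_left[OF isbD(1)[OF isb_Ident] F g] by (intro EV_cong[OF F])
qed

lemma sh_0 [simp]: "sh 0 u = u" by (simp add: sh_def lmap_ident)

lemma bw_Nil: "bw [] = ([], {#})" by (simp add: bw_def)

lemma isx_Ident_0: "isx 0 0 (idA 0) ([], {#})" using isbD(1)[OF isb_Ident[of 0]] by (simp add: vr_def bw_Nil)

lemma jtens_unit_left:
 assumes F: "F : jhom m n"
 shows "idA 0 ** F = F"
proof (rule jhom_ext)
 show "idA 0 ** F : jhom m n" using tens_hom[OF isx_jhom[OF isx_Ident_0] F] by simp
 show "F : jhom m n" by (rule F)
 fix g :: "'a jfn" assume g: "jacb g"
 have "EV (idA 0 ** F) g = EV F (%y. g (tp 0 ([], {#}) y))" by (simp add: EV_jtens[OF isx_jhom[OF isx_Ident_0] F g] isx_EV[OF isx_Ident_0 jacb_EV[OF F bijac_tp[OF g]]])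
 also have "... = EV F g" using jacb_rel[OF g inj_ev_od(2)] by (intro EV_cong[OF F]) (simp add: tp_def fd_def)
 finally show "EV (idA 0 ** F) g = EV F g" .
qed

lemma jtens_unit_right:
 assumes F: "F : jhom m n"
 shows "F ** idA 0 = F"
proof (rule jhom_ext)
 show "F ** idA 0 : jhom m n" using tens_hom[OF F isx_jhom[OF isx_Ident_0]] by simp
 show "F : jhom m n" by (rule F)
 fix g :: "'a jfn" assume g: "jacb g"
 have "EV (F ** idA 0) g = EV F (%x. g (tp m x ([], {#})))" by (simp add: EV_jtens[OF F isx_jhom[OF isx_Ident_0] g] isx_EV[OF isx_Ident_0 bijac_right[OF bijac_tp[OF g]]])
 also have "... = EV F g" using jacb_rel[OF g inj_ev_od(1)] by (intro EV_cong[OF F]) (simp add: tp_def fd_def)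
 finally show "EV (F ** idA 0) g = EV F g" .
qed

lemma free_of_lsub: "free_of (Inl i) u ==> free_of (Inl i) (lmap (lsub j a s) u)"
proof (induction u)
 case (Cons x u)
 show ?case
 proof (cases x)
  case (Lt z t)
  thus ?thesis using Cons by (cases "z = Inl j"; cases t; cases s; cases z) (auto simp: lsub_def)
 qed (use Cons in auto)
qed simp

lemma insb_cong_free:
 fixes g h :: "(nat + 'a) sym list => 'k::field"
 assumes "!!v. ALL i>=k. free_of (Inl i) v ==> g v = h v" "ALL i>=k. free_of (Inl i) u"
 shows "insb x [Lg e] g u = insb x [Lg e] h u" using assms
proof (induction u arbitrary: g h)
 case (Cons y u)
 have y: "ALL i>=k. free_of (Inl i) [y]" "ALL i>=k. free_of (Inl i) u" using Cons.prems(2) by (auto simp: free_of_def)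
 have "insb x [Lg e] (%v. g (y # v)) u = insb x [Lg e] (%v. h (y # v)) u"
 proof (rule Cons.IH)
  fix v :: "(nat + 'a) sym list" assume "ALL i>=k. free_of (Inl i) v"
  hence "ALL i>=k. free_of (Inl i) (y # v)" using y(1) by (auto simp: free_of_def)
  thus "g (y # v) = h (y # v)" by (rule Cons.prems(1))
 qed (rule y(2))
 moreover have "g ([Lg e] @ y # u) = h ([Lg e] @ y # u)" "g (y # [Lg e] @ u) = h (y # [Lg e] @ u)" using y by (auto intro!: Cons.prems(1) simp: free_of_def)
 ultimately show ?case by auto
qed simp

lemma vm_cong_free:
 assumes K: "!!v. ALL i>=k. free_of (Inl i) v ==> K v = K' v" and "ALL i>=k. free_of (Inl i) u"
 shows "vm j A K u = vm j A K' u" using assms(2)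
proof (induction A arbitrary: j u)
 case Nil
 thus ?case by (simp add: K)
next
 case (Cons x A)
 show ?case
 proof (cases x)
  case (Lg e)
  thus ?thesis using Cons by (auto intro!: insb_cong_free[of k])
 next
  case (Lt a s)
  thus ?thesis using Cons by (simp add: free_of_lsub)
 next
  case Sp
  thus ?thesis using Cons by simp
 qed
qed

lemma vm_append_context:
 "ALL i>=j. free_of (Inl i) p ==> vm j A K (p @ u) = vm j A (%v. K (p @ v)) u"
proof (induction A arbitrary: j u)
 case (Cons x A)
 have p: "free_of (Inl j) p" using Cons.prems by simp
 show ?case using Cons p by (cases x) (auto simp: free_of_def insb_append lmap_lsub_free insb_free)
qed simp

definition shl :: "nat => nat + 'a => ((nat + 'a) * bool) list" where
 "shl n = case_sum (%i. [(Inl (i + n), True)]) (%a. [(Inr a, True)])"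

lemma vs_shl:
 fixes A :: "'a sym list"
 shows "vs (j + n) A g (lmap (shl n) u) = vs j A g u"
proof (induction A arbitrary: j u)
 case Nil
 have "lmap lstrip (lmap (shl n) u) = lmap lstrip u" unfolding lmap_lmap
 proof (rule lmap_cong)
  show "concat (map (%(z, s). spow s (lstrip z)) (shl n z)) = lstrip z" for z :: "nat + 'a" by (cases z) (auto simp: shl_def)
 qed
 thus ?case by simp
next
 case (Cons x A)
 show ?case
 proof (cases x)
  case (Lg e)
  have "insb (Inl (j + n)) [Lg e] (vs (j + n) A g) (lmap (shl n) u) = insb (Inl j) [Lg e] (%v. vs (j + n) A g (lmap (shl n) v)) u"
  proof (rule insb_lmap)
   show "z ~= Inl j ==> (Inl (j + n), True) ~: set (shl n z) & (Inl (j + n), False) ~: set (shl n z)" for z :: "nat + 'a" by (cases z) (auto simp: shl_def)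
  qed (auto simp: shl_def)
  thus ?thesis using Lg Cons by simp
 next
  case (Lt a s)
  have "lmap (lsub (j + n) a s) (lmap (shl n) u) = lmap (shl n) (lmap (lsub j a s) u)" unfolding lmap_lmap
  proof (rule lmap_cong)
   show "concat (map (%(z, t). spow t (lsub (j + n) a s z)) (shl n z)) = concat (map (%(z, t). spow t (shl n z)) (lsub j a s z))" for z by (cases z) (auto simp: shl_def lsub_def)
  qed
  thus ?thesis using Lt Cons by simp
 next
  case Sp
  thus ?thesis using Cons[of "Suc j"] by simp
 qed
qed

lemma vs_shift:
 fixes A :: "'a sym list"
 shows "vs (1 + n) A g (inl (sh n x)) = vs 1 A g (inl x)"
proof -
 have "lmap (shl n) (inl x) = (inl (sh n x) :: (nat + 'a) sym list)" by (simp add: inl_def sh_def lmap_lmap shl_def add.commute)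
 thus ?thesis using vs_shl[of 1 n A g "inl x"] by (simp only:)
qed

text \<open>The core of the interchange law. The left word uses only the slots 1 to \<open>n\<close>
  and the right word only those above, so the arcs of the first inner diagram act on the left word
  alone and those of the second on the right word alone.\<close>

lemma vs_tens:
 assumes arcs: "ALL L:set As. arc L" and u: "inrange n u" and u': "inrange n' u'" and n: "length As = n"
 shows "vs 1 (fa As @ sh m A') K (inl u @ inl (sh n u')) = vs 1 (fa As) (%v. vs 1 A' (%v'. K (v @ sh m v')) (inl u')) (inl u)"
proof -
 let ?K = "%w. K (lmap lstrip w)" and ?U = "inl u :: (nat + nat) sym list" and ?U' = "inl (sh n u') :: (nat + nat) sym list"
 have free: "free_of (Inl i) ?U'" if "i < 1 + n" "1 <= i" for i using u'
 proof (induction u')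
  case (Cons x u')
  thus ?case using that by (cases x) auto
 qed simp
 have freeU: "ALL i>=1 + n. free_of (Inl i) ?U"
 proof (intro allI impI)
  fix i assume "1 + n <= i"
  thus "free_of (Inl i) ?U" using u
  proof (induction u)
   case (Cons x u)
   thus ?case by (cases x) auto
  qed simp
 qed
 have "vs 1 (fa As @ sh m A') K (?U @ ?U') = vm 1 (fa As) (vm (1 + n) (sh m A') ?K) (?U @ ?U')" unfolding vs_eq_vm vm_fa_append[OF arcs] n ..
 also have "... = vm 1 (fa As) (%v. vm (1 + n) (sh m A') ?K (v @ ?U')) ?U" using vm_fa_context[OF arcs, of 1 "[]" ?U' "vm (1 + n) (sh m A') ?K" ?U] free n by simp
 also have "... = vm 1 (fa As) (%v. vm (1 + n) (sh m A') (%v'. ?K (v @ v')) ?U') ?U" by (rule vm_cong_free[of "1 + n"], erule vm_append_context, rule freeU)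
 also have "... = vm 1 (fa As) (%v. vs (1 + n) (sh m A') (%w'. K (lmap lstrip v @ w')) ?U') ?U" unfolding vs_eq_vm by simp
 also have "... = vm 1 (fa As) (%v. vs 1 A' (%v'. K (lmap lstrip v @ sh m v')) (inl u')) ?U"
 proof -
  have "lmap (emb f) (inl w) = inl w" for f :: "nat => (nat * bool) list" and w unfolding lmap_inl by (simp add: inl_def)
  hence "vs 1 (sh m A') G (inl u') = vs 1 A' (%v'. G (sh m v')) (inl u')" for G :: "nat sym list => 'a"
   using vs_lmap[of 1 A' G "%i. [(m + i, True)]" "inl u'"] by (simp add: sh_def)
  thus ?thesis by (simp add: vs_shift)
 qed
 finally show ?thesis unfolding vs_eq_vm[of 1 "fa As"] .
qed

text \<open>The two sides of the interchange law label the two middle factors differently;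
  exchanging the residues 1 and 2 modulo 4 reconciles them.\<close>

lemma middle_relabelling:
 obtains sg :: "nat => nat" where "inj sg" "sg o (ev o ev) = ev o ev" "sg o (ev o od) = od o ev"
  "sg o (od o ev) = ev o od" "sg o (od o od) = od o od"
proof -
 define s :: "nat => nat" where "s = (%e::nat. if e mod 4 = 1 then e + 1 else if e mod 4 = 2 then e - 1 else e)"
 have s: "s (4 * a) = 4 * a" "s (4 * a + 1) = 4 * a + 2" "s (4 * a + 2) = 4 * a + 1" "s (4 * a + 3) = 4 * a + 3" for a unfolding s_def by (simp_all only: mod4, simp_all)
 have "s (s x) = x" for x by (cases x rule: mod4_cases) (simp_all only: s)
 hence "inj s" by (rule inj_on_inverseI)
 thus ?thesis by (rule that) (rule ext, simp only: comp_apply odev4 s)+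
qed

lemma inl_append: "inl (u @ v) = inl u @ inl v" by simp

lemma jtens_comp_point_aux:
 assumes k: "jac {} k" and D: "D : jdiags (free_group Y) Z" and E: "E : jdiags (free_group X) Y"
  and D': "D' : jdiags (free_group Y') Z'" and x': "x' = fd D'"
 shows "Cg (%z. Cg (%z'. k (tp m z z')) x' y') (fd D) (fd E) = Cg k (tp Y (fd D) x') (tp m (fd E) y')"
proof -
 obtain sg :: "nat => nat" where s: "inj sg" "sg o (ev o ev) = ev o ev" "sg o (ev o od) = od o ev"
  "sg o (od o ev) = ev o od" "sg o (od o od) = od o od" by (rule middle_relabelling)
 obtain u' U' v' V' where xy: "x' = (u', U')" "y' = (v', V')" by fastforce
 let ?u = "fl (arcs D)" and ?U = "verts D" and ?v = "fl (arcs E)" and ?V = "verts E"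
 define K where "K = (%W w. k (w, W))"
 let ?W = "rv (ev o ev) ?U + rv (ev o od) U' + (rv (od o ev) ?V + rv (od o od) V')"
 let ?W' = "rv (ev o ev) ?U + rv (od o ev) U' + (rv (ev o od) ?V + rv (od o od) V')"
 let ?As = "%ta. map (%L. map (rl ta) (arc_word L)) (arcs E)"
 have n: "length (?As ta) = Y" for ta using E by (simp add: jdiags_iff)
 have u: "inrange Y (map (rl (ev o ev)) ?u)" using jdiags_inrange[OF D] by simp
 have u': "inrange Y' (map (rl (ev o od)) u')" using jdiags_inrange[OF D'] x' xy by (simp add: fd_def)
 have R: "Cg k (tp Y (fd D) x') (tp m (fd E) y') =
  vs 1 (map (rl (od o ev)) ?v) (%v. vs 1 (map (rl (od o od)) v') (%w. K ?W (v @ sh m w)) (inl (map (rl (ev o od)) u'))) (inl (map (rl (ev o ev)) ?u))"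
 proof -
  have a: "map (rl od) (fst (tp m (fd E) y')) = fa (?As (od o ev)) @ sh m (map (rl (od o od)) v')" by (simp add: tp_def fd_def xy map_rl_sh map_rl_fl[of "od o ev"])
  have b: "inl (map (rl ev) (fst (tp Y (fd D) x'))) = inl (map (rl (ev o ev)) ?u) @ inl (sh Y (map (rl (ev o od)) u'))" by (simp add: tp_def fd_def xy map_rl_sh)
  have c: "rv ev (snd (tp Y (fd D) x')) + rv od (snd (tp m (fd E) y')) = ?W" by (simp add: tp_def fd_def xy)
  show ?thesis unfolding Cg_def a b c K_def map_rl_fl[of "od o ev"] by (rule vs_tens[OF _ u u' n]) auto
 qed
 have KW: "K ?W' = (%w. K ?W (map (rl sg) w))"
 proof
  fix w
  show "K ?W' w = K ?W (map (rl sg) w)"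
  proof -
   have "rv sg ?W' = ?W" by (simp add: s)
   thus ?thesis using jac_rel[OF k s(1), of w ?W'] unfolding K_def by simp
  qed
 qed
 have "Cg (%z. Cg (%z'. k (tp m z z')) x' y') (fd D) (fd E) =
  vs 1 (map (rl od) ?v) (%v. vs 1 (map (rl od) v') (%w. K ?W' (map (rl ev) v @ sh m (map (rl od) w))) (inl (map (rl ev) u'))) (inl (map (rl ev) ?u))"
  by (simp add: Cg_def tp_def fd_def xy K_def ac_simps)
 also have "... = vs 1 (map (rl od) ?v) (%v. vs 1 (map (rl (od o od)) v') (%w. K ?W' (map (rl ev) v @ sh m w)) (inl (map (rl (od o ev)) u'))) (inl (map (rl ev) ?u))"
 proof -
  have "vs 1 (map (rl od) v') (%w. G (map (rl od) w)) (inl (map (rl ev) u')) =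
   vs 1 (map (rl (od o od)) v') G (inl (map (rl (od o ev)) u'))" for G :: "nat sym list => 'a"
   using vs_rl[of 1 od "map (rl od) v'" G "inl (map (rl ev) u')"] by (simp add: map_rl_inl)
  from this[of "%w. K ?W' (_ @ sh m w)"] show ?thesis by simp
 qed
 also have "... = vs 1 (map (rl (ev o od)) ?v) (%v. vs 1 (map (rl (od o od)) v') (%w. K ?W' (v @ sh m w)) (inl (map (rl (od o ev)) u'))) (inl (map (rl (ev o ev)) ?u))"
  using vs_rl[of 1 ev "map (rl od) ?v" "%v. vs 1 (map (rl (od o od)) v') (%w. K ?W' (v @ sh m w)) (inl (map (rl (od o ev)) u'))" "inl (map (rl ev) ?u)"]
  by (simp add: map_rl_inl)
 also have "... = vs 1 (map (rl (ev o od)) ?v) (%v. vs 1 (map (rl (od o od)) v') (%w. K ?W (map (rl sg) v @ sh m w)) (inl (map (rl (ev o od)) u'))) (inl (map (rl (ev o ev)) ?u))"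
 proof -
  have "vs 1 (map (rl (od o od)) v') (%w. G (map (rl sg) w)) (inl (map (rl (od o ev)) u')) =
   vs 1 (map (rl (od o od)) v') G (inl (map (rl (ev o od)) u'))" for G :: "nat sym list => 'a"
   using vs_rl[of 1 sg "map (rl (od o od)) v'" G "inl (map (rl (od o ev)) u')"] by (simp add: map_rl_inl s)
  from this[of "%w. K ?W (map (rl sg) _ @ sh m w)"] show ?thesis by (simp add: KW map_rl_sh)
 qed
 also have "... = vs 1 (map (rl (od o ev)) ?v) (%v. vs 1 (map (rl (od o od)) v') (%w. K ?W (v @ sh m w)) (inl (map (rl (ev o od)) u'))) (inl (map (rl (ev o ev)) ?u))"
  using vs_rl[of 1 sg "map (rl (ev o od)) ?v" "%v. vs 1 (map (rl (od o od)) v') (%w. K ?W (v @ sh m w)) (inl (map (rl (ev o od)) u'))" "inl (map (rl (ev o ev)) ?u)"]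
  by (simp add: map_rl_inl s)
 finally show ?thesis unfolding R .
qed

lemmas jtens_comp_point = jtens_comp_point_aux[OF _ _ _ _ refl]

lemma tens_comp:
 assumes f: "f : jhom X Y" and g: "g : jhom Y Z" and f': "f' : jhom X' Y'" and g': "g' : jhom Y' Z'"
 shows "(g oo f) ** (g' oo f') = g ** g' oo f ** f'"
proof (rule jhom_ext)
 note gf = comp_hom[OF g f] and gf' = comp_hom[OF g' f'] and gg = tens_hom[OF g g'] and ff = tens_hom[OF f f']
 show "(g oo f) ** (g' oo f') : jhom (X + X') (Z + Z')" by (rule tens_hom[OF gf gf'])
 show "g ** g' oo f ** f' : jhom (X + X') (Z + Z')" by (rule comp_hom[OF gg ff])
 fix k :: "'a jfn" assume k: "jacb k"
 obtain d where "bdd d k" using k by (auto simp: jacb_iff)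
 hence d: "k x = 0" if "wt x > d" for x using that unfolding bdd_def by blast
 define T where "T z z' = k (tp X z z')" for z z'
 have T: "bijac T" unfolding T_def by (rule bijac_tp[OF k])
 have T0: "T z z' = 0" if "wt z + wt z' > d" for z z' using that by (simp add: T_def d wt_tp)
 have C0: "Cg (T z) x' y' = 0" if "wt z + wt x' + wt y' > d" for z x' y' by (rule Cg_zero) (use that in "auto intro: T0")
 define H where "H z x' = EV f' (Cg (T z) x')" for z x'
 have H0: "H z x' = 0" if "wt z + wt x' > d" for z x'
 proof -
  have "Cg (T z) x' = (%y'. 0)" using that by (intro ext C0) simp
  thus ?thesis unfolding H_def by (simp add: EV_zero[OF f'])
 qed
 have L0: "Cg (%z. Cg (T z) x' y') x y = 0" if "wt x + wt y + wt x' + wt y' > d" for x y x' y' by (rule Cg_zero) (use that in "auto intro: C0")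
 have 1: "Cg (%z. EV g' (H z)) x y = EV g' (%x'. EV f' (%y'. Cg (%z. Cg (T z) x' y') x y))" for x y
 proof -
  have "Cg (%z. EV g' (H z)) x y = EV g' (%x'. Cg (%z. H z x') x y)" by (rule Cg_EV[OF g', of d]) (use H0 in auto)
  also have "... = EV g' (%x'. EV f' (%y'. Cg (%z. Cg (T z) x' y') x y))" unfolding H_def by (subst Cg_EV[OF f', of d "%z. Cg (T z) _"]) (use C0 in auto)
  finally show ?thesis .
 qed
 have "EV ((g oo f) ** (g' oo f')) k = EV (g oo f) (%z. EV (g' oo f') (T z))" unfolding T_def by (rule EV_jtens[OF gf gf' k])
 also have "... = EV g (%x. EV f (Cg (%z. EV (g' oo f') (T z)) x))" by (rule EV_jcomp[OF g f jacb_EV[OF gf' T]])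
 also have "... = EV g (%x. EV f (%y. EV g' (%x'. EV f' (%y'. Cg (%z. Cg (T z) x' y') x y))))"
 proof -
  have "Cg (%z. EV g' (H z)) x = (%y. EV g' (%x'. EV f' (%y'. Cg (%z. Cg (T z) x' y') x y)))" for x by (rule ext) (rule 1)
  moreover have "EV (g' oo f') (T z) = EV g' (H z)" for z unfolding H_def by (rule EV_jcomp[OF g' f' bijac_right[OF T]])
  ultimately show ?thesis by simp
 qed
 \<comment> \<open>The diagrams of \<open>f\<close> and \<open>g'\<close> are evaluated
   independently, so their order can be exchanged; afterwards the outer factors \<open>g\<close>,
   \<open>g'\<close> stand together, and so do the inner factors \<open>f\<close>,
   \<open>f'\<close>.\<close>
 also have "... = EV g (%x. EV g' (%x'. EV f (%y. EV f' (%y'. Cg (%z. Cg (T z) x' y') x y))))"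
 proof -
  have "EV f (%y. EV g' (%x'. EV f' (%y'. Cg (%z. Cg (T z) x' y') x y))) =
   EV g' (%x'. EV f (%y. EV f' (%y'. Cg (%z. Cg (T z) x' y') x y)))" for x
  proof (rule EV_Fubini[OF f g', of d], intro allI impI)
   fix y x' :: "dword" assume "d < wt y + wt x'"
   hence "(%y'. Cg (%z. Cg (T z) x' y') x y) = (%y'. 0)" by (intro ext L0) simp
   thus "EV f' (%y'. Cg (%z. Cg (T z) x' y') x y) = 0" by (simp add: EV_zero[OF f'])
  qed
  thus ?thesis by simp
 qed
 also have "... = EV g (%x. EV g' (%x'. EV f (%y. EV f' (%y'. Cg k (tp Y x x') (tp X y y')))))"
  unfolding T_def using k by (intro EV_cong[OF g] EV_cong[OF g'] EV_cong[OF f] EV_cong[OF f'] jtens_comp_point)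
   (simp_all add: jacb_iff)
 also have "... = EV g (%x. EV g' (%x'. EV (f ** f') (Cg k (tp Y x x'))))" by (simp add: EV_jtens[OF f f' bijac_right[OF bijac_Cg[OF k]]])
 also have "... = EV (g ** g') (%w. EV (f ** f') (Cg k w))" by (rule EV_jtens[OF g g' jacb_EV[OF ff bijac_Cg[OF k]], symmetric])
 also have "... = EV (g ** g' oo f ** f') k" by (rule EV_jcomp[OF gg ff k, symmetric])
 finally show "EV ((g oo f) ** (g' oo f')) k = EV (g ** g' oo f ** f') k" .
qed

lemma free_of_inr [simp]: "free_of (Inl i) (inr L)"
proof (induction L)
 case (Cons x L)
 thus ?case by (cases x) auto
qed simp

lemma free_of_blocks:
 "i ~: set is ==> free_of (Inl i) (fa (map (%(i, L). inr L @ [Lt (Inl i) True]) (zip is As)))"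
proof (induction As arbitrary: "is")
 case (Cons L As)
 thus ?case by (cases "is") auto
qed simp

lemma free_of_vars: "i ~: set is ==> free_of (Inl i) (inl (fa (map (%i. [Lt i True]) is)))" by (induction "is") auto

lemma lstrip_blocks:
 "length is = length As ==> lmap lstrip (fa (map (%(i, L). inr L @ [Lt (Inl i) True]) (zip is As))) = fa As" by (induction "is" As rule: list_induct2) auto

text \<open>Composition with the symmetry on the outside. The slots appear in exchanged order, so
  the arcs accumulated at them do too; each group of arcs leaves the other part of the word
  untouched.\<close>

lemma vs_swap_blocks:
 assumes As: "ALL L:set As. arc L" and Bs: "ALL L:set Bs. arc L"
 shows "vs 1 (fa As @ fa Bs) K (inl (fa (map (%i. [Lt i True]) [1 + length As..<1 + length As + length Bs]))
   @ inl (fa (map (%i. [Lt i True]) [1..<1 + length As]))) = K (fa Bs @ fa As)"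
proof -
 let ?a = "length As" and ?b = "length Bs"
 let ?U2 = "inl (fa (map (%i. [Lt i True]) [1 + ?a..<1 + ?a + ?b])) :: (nat + 'a) sym list"
 let ?U1 = "inl (fa (map (%i. [Lt i True]) [1..<1 + ?a])) :: (nat + 'a) sym list"
 let ?K = "%w. K (lmap lstrip w)"
 let ?R = "%is As. fa (map (%(i, L). inr L @ [Lt (Inl i) True]) (zip is As))"
 have "vs 1 (fa As @ fa Bs) K (?U2 @ ?U1) = vm 1 (fa As) (vm (1 + ?a) (fa Bs) ?K) (?U2 @ ?U1)" unfolding vs_eq_vm vm_fa_append[OF As] ..
 also have "... = vm 1 (fa As) (%v. vm (1 + ?a) (fa Bs) ?K (?U2 @ v)) ?U1" using vm_fa_context[OF As, of 1 ?U2 "[]" "vm (1 + ?a) (fa Bs) ?K" ?U1] by (simp add: free_of_vars)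
 also have "... = vm (1 + ?a) (fa Bs) ?K (?U2 @ ?R [1..<1 + ?a] As)" by (rule vm_fa_blocks[OF As])
 also have "... = vm (1 + ?a) (fa Bs) (%v. ?K (v @ ?R [1..<1 + ?a] As)) ?U2" using vm_fa_context[OF Bs, of "1 + ?a" "[]" "?R [1..<1 + ?a] As" ?K ?U2] by (simp add: free_of_blocks)
 also have "... = ?K (?R [1 + ?a..<1 + ?a + ?b] Bs @ ?R [1..<1 + ?a] As)" by (rule vm_fa_blocks[OF Bs])
 also have "... = K (fa Bs @ fa As)" by (simp add: lstrip_blocks)
 finally show ?thesis .
qed

lemma arc_sh [simp]: "arc (sh m L) = arc L"
proof (induction L)
 case (Cons x L)
 thus ?case by (cases x) auto
qed simp

lemma swap_relabelling:
 obtains sg :: "nat => nat" where "inj sg" "sg o (ev o ev) = od o od" "sg o (ev o od) = od o ev"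
proof -
 define s :: "nat => nat" where "s = (%e::nat. if e mod 4 = 0 then e + 3 else if e mod 4 = 1 then e + 1 else if e mod 4 = 2 then e - 1 else e - 3)"
 have s: "s (4 * a) = 4 * a + 3" "s (4 * a + 1) = 4 * a + 2" "s (4 * a + 2) = 4 * a + 1" "s (4 * a + 3) = 4 * a" for a unfolding s_def by (simp_all only: mod4, simp_all)
 have "s (s x) = x" for x by (cases x rule: mod4_cases) (simp_all only: s)
 hence "inj s" by (rule inj_on_inverseI)
 thus ?thesis by (rule that) (rule ext, simp only: comp_apply odev4 s)+
qed

lemma symm_natural_point:
 assumes k: "jac {} k" and D: "D : jdiags (free_group X) Y" and E: "E : jdiags (free_group X') Y'"
 shows "Cg k (bw (vr (%i. if i <= Y' then Y + i else i - Y') (Y' + Y))) (tp X (fd D) (fd E)) =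
  Cg k (tp X' (fd E) (fd D)) (bw (vr (%i. if i <= X' then X + i else i - X') (X' + X)))"
proof -
 obtain sg :: "nat => nat" where s: "inj sg" "sg o (ev o ev) = od o od" "sg o (ev o od) = od o ev" by (rule swap_relabelling)
 let ?As = "map (%L. map (rl (od o ev)) (arc_word L)) (arcs D)"
 let ?Bs = "map (sh X) (map (%L. map (rl (od o od)) (arc_word L)) (arcs E))"
 have Y: "length ?As = Y" "length ?Bs = Y'" using D E by (simp_all add: jdiags_iff)
 have v: "map lts (vr (%i. if i <= Y' then Y + i else i - Y') (Y' + Y)) =
   map (%i. [Lt i True]) [1 + length ?As..<1 + length ?As + length ?Bs] @ map (%i. [Lt i True]) [1..<1 + length ?As]" unfolding Y by (rule nth_equalityI) (auto simp: nth_append)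
 have B: "sh X (map (rl (od o od)) (fl (arcs E))) = fa ?Bs" unfolding map_rl_fl by (simp add: sh_def[abs_def] lmap_fa)
 let ?W = "rv (od o ev) (verts D) + rv (od o od) (verts E)"
 have "Cg k (bw (vr (%i. if i <= Y' then Y + i else i - Y') (Y' + Y))) (tp X (fd D) (fd E)) = k (fa ?Bs @ fa ?As, ?W)"
 proof -
  have "Cg k (bw (vr (%i. if i <= Y' then Y + i else i - Y') (Y' + Y))) (tp X (fd D) (fd E)) =
   vs 1 (fa ?As @ fa ?Bs) (%w. k (w, ?W)) (inl (fa (map lts (vr (%i. if i <= Y' then Y + i else i - Y') (Y' + Y)))))"
   using B by (simp add: Cg_def bw_def tp_def fd_def map_rl_sh map_rl_fl[of "od o ev"])
  also have "... = k (fa ?Bs @ fa ?As, ?W)" unfolding v fa_simps inl_append by (rule vs_swap_blocks) auto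
  finally show ?thesis .
 qed
 also have "... = k (sh X (map (rl (od o od)) (fl (arcs E))) @ map (rl (od o ev)) (fl (arcs D)), ?W)" unfolding B map_rl_fl[of "od o ev"] ..
 also have "... = k (sh X (map (rl (ev o ev)) (fl (arcs E))) @ map (rl (ev o od)) (fl (arcs D)),
   rv (ev o ev) (verts E) + rv (ev o od) (verts D))"
 proof -
  have W: "rv sg (rv (ev o ev) (verts E) + rv (ev o od) (verts D)) = ?W" by (simp add: s add.commute[of "rv (od o od) (verts E)"])
  show ?thesis using jac_rel[OF k s(1), of "sh X (map (rl (ev o ev)) (fl (arcs E))) @ map (rl (ev o od)) (fl (arcs D))"
   "rv (ev o ev) (verts E) + rv (ev o od) (verts D)"] unfolding W by (simp add: s map_rl_sh)
 qed
 also have "... = Cg k (tp X' (fd E) (fd D)) (bw (vr (%i. if i <= X' then X + i else i - X') (X' + X)))"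
 proof -
  let ?h = "%i. if 1 <= i & i < 1 + (X' + X) then vr (%i. if i <= X' then X + i else i - X') (X' + X) ! (i - 1) else []"
  have 1: "lmap ?h (map (rl (ev o ev)) (fl (arcs E))) = sh X (map (rl (ev o ev)) (fl (arcs E)))" unfolding sh_def by (rule lmap_inrange[of X']) (auto simp: jdiags_inrange[OF E])
  have "lmap ?h (sh X' (map (rl (ev o od)) (fl (arcs D)))) = lmap (%i. [(i, True)]) (map (rl (ev o od)) (fl (arcs D)))"
   unfolding sh_def lmap_lmap by (rule lmap_inrange[of X]) (auto simp: jdiags_inrange[OF D])
  hence 2: "lmap ?h (sh X' (map (rl (ev o od)) (fl (arcs D)))) = map (rl (ev o od)) (fl (arcs D))" by (simp add: lmap_ident)
  show ?thesis unfolding tp_def Cg_beads length_vr using 1 2 by (simp add: fd_def map_rl_sh)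
 qed
 finally show ?thesis .
qed

lemma jsymm_natural:
 assumes f: "f : jhom X Y" and g: "g : jhom X' Y'"
 shows "PA Y Y' oo f ** g = g ** f oo PA X X'"
proof (rule jhom_ext)
 note P = isb_Symm[THEN isbD(2)] and P' = isb_Symm[THEN isbD(1)]
 show "PA Y Y' oo f ** g : jhom (X + X') (Y' + Y)" by (rule comp_hom[OF P tens_hom[OF f g]])
 show "g ** f oo PA X X' : jhom (X + X') (Y' + Y)" by (rule comp_hom[OF tens_hom[OF g f] P])
 fix k :: "'a jfn" assume k: "jacb k"
 let ?p = "bw (vr (%i. if i <= Y' then Y + i else i - Y') (Y' + Y))"
 let ?q = "bw (vr (%i. if i <= X' then X + i else i - X') (X' + X))"
 obtain d where "bdd d k" using k by (auto simp: jacb_iff)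
 hence d: "k x = 0" if "wt x > d" for x using that unfolding bdd_def by blast
 have d': "Cg k (tp X' y x) ?q = 0" if "wt x + wt y > d" for x y by (rule Cg_zero) (use that in "auto intro!: d simp: wt_tp")
 have "EV (PA Y Y' oo f ** g) k = EV f (%x. EV g (%y. Cg k ?p (tp X x y)))" unfolding EV_comp_left[OF P' tens_hom[OF f g] k]
  by (rule EV_jtens[OF f g bijac_right[OF bijac_Cg[OF k]]])
 also have "... = EV f (%x. EV g (%y. Cg k (tp X' y x) ?q))" using k by (intro EV_cong[OF f] EV_cong[OF g] symm_natural_point) (simp_all add: jacb_iff)
 also have "... = EV g (%y. EV f (%x. Cg k (tp X' y x) ?q))" by (rule EV_Fubini[OF f g, of d]) (use d' in blast)
 also have "... = EV (g ** f oo PA X X') k" unfolding EV_comp_right[OF tens_hom[OF g f] P' k] by (rule EV_jtens[OF g f bijac_left[OF bijac_Cg[OF k]], symmetric])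
 finally show "EV (PA Y Y' oo f ** g) k = EV (g ** f oo PA X X') k" .
qed

text \<open>The axioms that involve only identities and symmetries are equations between maps of
  indices (\<open>isr_unique\<close>); the others have been verified by evaluation.\<close>

interpretation A: symmetric_strict_monoidal_category "A_hat :: (nat, 'k::field jmor) smc"
proof
 fix X Y Z W X' Y' Z' X'' Y'' :: nat and f g h f' g' :: "'k jmor"
 show "f : Hom A_hat X Y ==> X : Ob A_hat & Y : Ob A_hat" by simp
 show "f : Hom A_hat X Y ==> f : Hom A_hat X' Y' ==> X = X' & Y = Y'" using jhom_src[of f X Y] jhom_src[of f X' Y'] by simp
 show "idA X : Hom A_hat X (X :: nat)" using isbD(2)[OF isb_Ident] by simp
 show "f : Hom A_hat X Y ==> g : Hom A_hat Y Z ==> Comp A_hat g f : Hom A_hat X Z" using comp_hom by simp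
 show "f : Hom A_hat X Y ==> Comp A_hat f (idA X) = f & Comp A_hat (idA Y) f = f" by (simp add: jcomp_Ident_left jcomp_Ident_right)
 show "f : Hom A_hat W X ==> g : Hom A_hat X Y ==> h : Hom A_hat Y Z ==>
   Comp A_hat (Comp A_hat h g) f = Comp A_hat h (Comp A_hat g f)" by (simp add: comp_assoc)
 show "f : Hom A_hat X Y ==> g : Hom A_hat X' Y' ==> Tens A_hat f g : Hom A_hat (TObj A_hat X X') (TObj A_hat Y Y')" using tens_hom by simp
 show "Tens A_hat (idA X) (idA Y) = (idA (TObj A_hat X Y) :: 'k jmor)" unfolding A_hat_simps by (rule isr_unique[OF isr_tens[OF isr_Ident isr_Ident] isr_Ident]) auto
 show "f : Hom A_hat X Y ==> g : Hom A_hat Y Z ==> f' : Hom A_hat X' Y' ==> g' : Hom A_hat Y' Z' ==>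
  Tens A_hat (Comp A_hat g f) (Comp A_hat g' f') = Comp A_hat (Tens A_hat g g') (Tens A_hat f f')" by (simp add: tens_comp)
 show "f : Hom A_hat X Y ==> Tens A_hat (idA (UnitOb A_hat)) f = f & Tens A_hat f (idA (UnitOb A_hat)) = f" by (simp add: jtens_unit_left jtens_unit_right)
 show "f : Hom A_hat X Y ==> g : Hom A_hat X' Y' ==> h : Hom A_hat X'' Y'' ==>
  Tens A_hat (Tens A_hat f g) h = Tens A_hat f (Tens A_hat g h)" by (simp add: jtens_assoc)
 show "(PA X Y :: 'k jmor) : Hom A_hat (TObj A_hat X Y) (TObj A_hat Y X)" using isbD(2)[OF isb_Symm] by simp
 show "f : Hom A_hat X Y ==> g : Hom A_hat X' Y' ==>
  Comp A_hat (PA Y Y') (Tens A_hat f g) = Comp A_hat (Tens A_hat g f) (PA X X')" by (simp add: jsymm_natural)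
 show "Comp A_hat (PA Y X) (PA X Y) = (idA (TObj A_hat X Y) :: 'k jmor)" unfolding A_hat_simps by (rule isr_unique[OF isr_comp[OF isr_Symm isr_Symm] isr_Ident]) auto
 show "PA (TObj A_hat X Y) Z =
  (Comp A_hat (Tens A_hat (PA X Z) (idA Y)) (Tens A_hat (idA X) (PA Y Z)) :: 'k jmor)"
 proof -
  have 1: "isr (X + Z + Y) (Z + X + Y) (PA X Z ** idA Y :: 'k jmor)
   (%i. if i <= Z + X then if i <= Z then X + i else i - Z else X + Z + (i - (Z + X)))" by (rule isr_tens[OF isr_Symm isr_Ident])
  have 2: "isr (X + (Y + Z)) (X + Z + Y) (idA X ** PA Y Z :: 'k jmor)
   (%i. if i <= X then i else X + (if i - X <= Z then Y + (i - X) else i - X - Z))" using isr_tens[OF isr_Ident isr_Symm] by (simp add: add.assoc)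
  have 3: "isr (X + (Y + Z)) (Z + X + Y) (PA (X + Y) Z :: 'k jmor) (%i. if i <= Z then X + Y + i else i - Z)" using isr_Symm[of "X + Y" Z] by (simp add: add.assoc)
  show ?thesis unfolding A_hat_simps by (rule isr_unique[OF 3 isr_comp[OF 1 2]]) auto
 qed
qed auto

section \<open>Convolution, filtration by degree, and power series of morphisms\<close>

section \<open>Convolution algebras\<close>

lemma tpow_A [simp]: "tpow_ob A_hat (Suc 0) n = n" "tpow_ob A_hat 1 n = n"
proof -
 show "tpow_ob A_hat 1 n = n" by (induction n) auto
 thus "tpow_ob A_hat (Suc 0) n = n" by (simp add: One_nat_def)
qed

lemma alg_A_simps [simp]: "Car alg_A = 1" "Mu alg_A = mu_A" "Eta alg_A = eta_A" by (simp_all add: alg_A_def)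

lemma isb_mu: "isb 2 1 mu_A [[(2, True), (1, True)]]" using isb_beads[of "[[[(2, True)], [(1, True)]]]" 1 2] by (simp add: mu_A_def single_letter_carrier)

lemma isb_eta: "isb 0 1 eta_A [[]]" using isb_beads[of "[[]]" 1 0] by (simp add: eta_A_def)

lemma isb_eps: "isb 1 0 eps_A []" using isb_beads[of "[]" 0 1] by (simp add: eps_A_def)

lemma isb_Delta: "isb 1 2 Delta_A [[(1, True)], [(1, True)]]" using isb_beads[of "[[[(1, True)]], [[(1, True)]]]" 2 1] by (simp add: Delta_A_def single_letter_carrier)

lemma isb_S: "isb 1 1 S_A [[(1, False)]]" using isb_beads[of "[[[(1, False)]]]" 1 1] by (simp add: S_A_def single_letter_carrier)

lemma isb_id1: "isb 1 1 (idA 1) [[(1, True)]]" using isb_Ident[of 1] by (simp add: vr_def upt_conv_Cons)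

text \<open>The words of the componentwise multiplication. Arcs are oriented from right to left, so
  along the orientation the letter of the second factor comes first.\<close>

definition muw :: "nat => (nat * bool) list list" where
 "muw n = map (%i. [(n + i, True), (i, True)]) [1..<n+1]"

lemma isr_mono:
 assumes "isr m n F f" "m = m'" "n = n'" "!!i. 1 <= i ==> i <= n ==> f i = f' i"
 shows "isr m' n' F f'"
proof -
 have "vr f n = vr f' n" by (rule nth_equalityI) (auto simp: assms(4))
 thus ?thesis using assms(1-3) by (simp add: isr_def)
qed

lemma isb_mu_pow: "isb (n + n) n (mu_pow A_hat alg_A n :: 'k::field jmor) (muw n)"
proof (induction n)
 case 0
 thus ?case using isb_Ident[of 0] by (simp add: muw_def vr_def)
next
 case (Suc n)
 let ?P = "idA 1 ** PA n 1 ** idA n :: 'k jmor"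
 let ?f = "%i. if i <= 1 then i else if i = 2 then n + 2 else if i <= n + 2 then i - 1 else i"
 have "isr (1 + (n + 1) + n) (1 + (1 + n) + n) ?P
  (%i. if i <= 1 + (1 + n) then if i <= 1 then i else 1 + (if i - 1 <= 1 then n + (i - 1) else i - 1 - 1) else 1 + (n + 1) + (i - (1 + (1 + n))))"
  by (intro isr_tens isr_Ident isr_Symm)
 hence "isr (Suc n + Suc n) (2 + (n + n)) ?P ?f" by (rule isr_mono) auto
 hence P: "isb (Suc n + Suc n) (2 + (n + n)) ?P (vr ?f (2 + (n + n)))" by (simp add: isr_def)
 have "isb (2 + (n + n)) (1 + n) (mu_A ** mu_pow A_hat alg_A n :: 'k jmor) ([[(2, True), (1, True)]] @ map (word_shift 2) (muw n))" by (rule isb_tens[OF isb_mu Suc])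
 note T = this
 have e1: "1 + n = Suc n" by simp
 from isb_comp[OF T P] have
  "isb (Suc n + Suc n) (Suc n) (mu_pow A_hat alg_A (Suc n) :: 'k jmor) (map (wsb (vr ?f (2 + (n + n)))) ([[(2, True), (1, True)]] @ map (word_shift 2) (muw n)))"
  unfolding e1 by (simp del: map_append list.map)
 moreover have "map (wsb (vr ?f (2 + (n + n)))) ([[(2, True), (1, True)]] @ map (word_shift 2) (muw n)) = muw (Suc n)"
 proof (rule nth_equalityI)
  fix i assume "i < length (map (wsb (vr ?f (2 + (n + n)))) ([[(2, True), (1, True)]] @ map (word_shift 2) (muw n)))"
  hence i: "i < Suc n" by (simp add: muw_def)
  show "map (wsb (vr ?f (2 + (n + n)))) ([[(2, True), (1, True)]] @ map (word_shift 2) (muw n)) ! i = muw (Suc n) ! i"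
  proof (cases i)
   case 0
   thus ?thesis by (simp add: muw_def wsb_def nth_append del: upt_Suc)
  next
   case (Suc j)
   hence "j < n" using i by simp
   thus ?thesis using Suc by (simp add: muw_def wsb_def word_shift_def nth_append del: upt_Suc)
  qed
 qed (simp add: muw_def)
 ultimately show ?case by (simp only:)
qed

lemma isb_eta_pow: "isb 0 n (eta_pow A_hat alg_A n) (replicate n [])"
proof (induction n)
 case 0
 thus ?case using isb_Ident[of 0] by (simp add: vr_def)
next
 case (Suc n)
 have e: "1 + n = Suc n" by simp
 show ?case using isb_tens[OF isb_eta Suc] unfolding e by (simp add: map_replicate word_shift_def)
qed

abbreviation cv :: "nat => 'k::field jmor => 'k jmor => 'k jmor" where
 "cv == conv A_hat alg_A"

abbreviation et :: "nat => 'k::field jmor" where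
 "et == eta_pow A_hat alg_A"

abbreviation mun :: "nat => 'k::field jmor" where
 "mun == mu_pow A_hat alg_A"

lemma cv_def: "cv n F G = mun n oo F ** G" by (simp add: conv_def)

lemma et_jhom [simp]: "et n : jhom 0 n" using isb_eta_pow isbD(2) by blast

lemma id_hom [simp]: "idA n : jhom n n" using isb_Ident isbD(2) by blast

lemma mun_jhom [simp]: "mun n : jhom (n + n) n" using isb_mu_pow isbD(2) by blast

lemma cv_jhom: "F : jhom m n ==> G : jhom m' n ==> cv n F G : jhom (m + m') n" unfolding cv_def by (rule comp_hom[OF mun_jhom tens_hom])

lemma cv_jhom0 [simp]: "F : jhom 0 n ==> G : jhom 0 n ==> cv n F G : jhom 0 n" using cv_jhom[of F 0 n G 0] by simp

lemma jtens_split_left: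
 assumes "F : jhom m n" "G : jhom m' n'" "K : jhom n p"
 shows "(K oo F) ** G = K ** idA n' oo F ** G" using tens_comp[OF assms(1,3,2) id_hom] by (simp add: jcomp_Ident_left[OF assms(2)])

lemma jtens_split_right:
 assumes "F : jhom m n" "G : jhom m' n'" "K : jhom n' p"
 shows "F ** (K oo G) = idA n ** K oo F ** G" using tens_comp[OF assms(1) id_hom assms(2,3)] by (simp add: jcomp_Ident_left[OF assms(1)])

lemma muw_nth: "i < n ==> muw n ! i = [(n + (i + 1), True), (i + 1, True)]" by (simp add: muw_def add.commute)

lemma length_muw [simp]: "length (muw n) = n" by (simp add: muw_def)

lemma cv_assoc:
 assumes F: "F : jhom m n" and G: "G : jhom m' n" and H: "H : jhom m'' n"
 shows "cv n (cv n F G) H = cv n F (cv n G H)"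
proof -
 note I = id_hom[of n]
 have "isb (n + n + n) n (mun n oo mun n ** idA n :: 'a jmor)
   (map (wsb (muw n @ map (word_shift (n + n)) (vr (%i. i) n))) (muw n))" by (rule isb_comp[OF isb_mu_pow isb_tens[OF isb_mu_pow isb_Ident]])
 moreover have "isb (n + (n + n)) n (mun n oo idA n ** mun n :: 'a jmor)
   (map (wsb (vr (%i. i) n @ map (word_shift n) (muw n))) (muw n))" by (rule isb_comp[OF isb_mu_pow isb_tens[OF isb_Ident isb_mu_pow]])
 moreover have "map (wsb (muw n @ map (word_shift (n + n)) (vr (%i. i) n))) (muw n) =
   map (wsb (vr (%i. i) n @ map (word_shift n) (muw n))) (muw n)" by (rule nth_equalityI) (auto simp: muw_nth wsb_def nth_append word_shift_def add.assoc)
 ultimately have e: "mun n oo mun n ** idA n = mun n oo (idA n ** mun n :: 'a jmor)" using isb_unique[of "n + n + n" n "mun n oo mun n ** idA n"] by (simp add: add.assoc)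
 have "cv n (cv n F G) H = mun n oo (mun n ** idA n oo F ** G ** H)" unfolding cv_def by (simp add: jtens_split_left[OF tens_hom[OF F G] H mun_jhom])
 also have "... = mun n oo mun n ** idA n oo F ** G ** H" by (rule comp_assoc[symmetric, OF tens_hom[OF tens_hom[OF F G] H] tens_hom[OF mun_jhom I] mun_jhom])
 also have "... = mun n oo idA n ** mun n oo F ** (G ** H)" by (simp add: e jtens_assoc[OF F G H])
 also have "... = mun n oo (idA n ** mun n oo F ** (G ** H))" by (rule comp_assoc[OF tens_hom[OF F tens_hom[OF G H]] tens_hom[OF I mun_jhom] mun_jhom])
 also have "... = cv n F (cv n G H)" unfolding cv_def by (simp add: jtens_split_right[OF F tens_hom[OF G H] mun_jhom])
 finally show ?thesis .
qed

lemma cv_unit_left: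
 assumes F: "F : jhom m n"
 shows "cv n (et n) F = F"
proof -
 have "isb (0 + n) n (mun n oo et n ** idA n :: 'a jmor)
   (map (wsb (replicate n [] @ map (word_shift 0) (vr (%i. i) n))) (muw n))" by (rule isb_comp[OF isb_mu_pow isb_tens[OF isb_eta_pow isb_Ident]])
 moreover have "map (wsb (replicate n [] @ map (word_shift 0) (vr (%i. i) n))) (muw n) = vr (%i. i) n" by (rule nth_equalityI) (auto simp: muw_nth wsb_def nth_append word_shift_def)
 ultimately have "isb n n (mun n oo et n ** idA n :: 'a jmor) (vr (%i. i) n)" by simp
 hence e: "mun n oo et n ** idA n = (idA n :: 'a jmor)" by (rule isb_unique[OF _ isb_Ident])
 have h: "et n ** idA n : (jhom n (n + n) :: 'a jmor set)" using tens_hom[OF et_jhom id_hom, of n n] by simp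
 have "cv n (et n) F = mun n oo (et n oo idA 0) ** (idA n oo F)" by (simp add: cv_def jcomp_Ident_left[OF F] jcomp_Ident_right[OF et_jhom])
 also have "... = mun n oo (et n ** idA n oo idA 0 ** F)" by (simp add: tens_comp[OF id_hom et_jhom F id_hom])
 also have "... = mun n oo et n ** idA n oo F" using comp_assoc[OF F h mun_jhom] by (simp add: jtens_unit_left[OF F])
 also have "... = F" by (simp add: e jcomp_Ident_left[OF F])
 finally show ?thesis .
qed

lemma cv_unit_right:
 assumes F: "F : jhom m n"
 shows "cv n F (et n) = F"
proof -
 have "isb (n + 0) n (mun n oo idA n ** et n :: 'a jmor)
   (map (wsb (vr (%i. i) n @ map (word_shift n) (replicate n []))) (muw n))" by (rule isb_comp[OF isb_mu_pow isb_tens[OF isb_Ident isb_eta_pow]])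
 moreover have "map (wsb (vr (%i. i) n @ map (word_shift n) (replicate n []))) (muw n) = vr (%i. i) n" by (rule nth_equalityI) (auto simp: muw_nth wsb_def nth_append word_shift_def)
 ultimately have "isb n n (mun n oo idA n ** et n :: 'a jmor) (vr (%i. i) n)" by simp
 hence e: "mun n oo idA n ** et n = (idA n :: 'a jmor)" by (rule isb_unique[OF _ isb_Ident])
 have h: "idA n ** et n : (jhom n (n + n) :: 'a jmor set)" using tens_hom[OF id_hom et_jhom, of n n] by simp
 have "cv n F (et n) = mun n oo (idA n oo F) ** (et n oo idA 0)" by (simp add: cv_def jcomp_Ident_left[OF F] jcomp_Ident_right[OF et_jhom])
 also have "... = mun n oo (idA n ** et n oo F ** idA 0)" by (simp add: tens_comp[OF F id_hom id_hom et_jhom])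
 also have "... = mun n oo idA n ** et n oo F" using comp_assoc[OF F h mun_jhom] by (simp add: jtens_unit_right[OF F])
 also have "... = F" by (simp add: e jcomp_Ident_left[OF F])
 finally show ?thesis .
qed

text \<open>Words of at most one positive letter describe morphisms that commute with all products.\<close>

definition alg_words :: "(nat * bool) list list => bool" where
 "alg_words ws <-> (ALL w:set ws. w = [] \<or> (EX i. w = [(i, True)]))"

text \<open>Each arc of \<open>k\<close> copies one input arc or is empty, so \<open>k\<close>
  commutes with the multiplication arc by arc. Coproduct, counit, unit and symmetries, and their
  tensor products with identities, are of this form; antipode and multiplication are not.\<close>

lemma comp_cv:
 assumes k: "isb n p k ws" "alg_words ws" and F: "F : jhom m n" and G: "G : jhom m' n"
 shows "k oo cv n F G = cv p (k oo F) (k oo G)"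
proof -
 note kh = isbD(2)[OF k(1)]
 have l: "length ws = p" using k(1) by (simp add: isb_def)
 have "isb (n + n) p (k oo mun n) (map (wsb (muw n)) ws)" by (rule isb_comp[OF k(1) isb_mu_pow])
 moreover have "isb (n + n) p (mun p oo k ** k) (map (wsb (ws @ map (word_shift n) ws)) (muw p))" by (rule isb_comp[OF isb_mu_pow isb_tens[OF k(1) k(1)]])
 moreover have "map (wsb (muw n)) ws = map (wsb (ws @ map (word_shift n) ws)) (muw p)"
 proof (rule nth_equalityI)
  fix i assume "i < length (map (wsb (muw n)) ws)"
  hence i: "i < p" using l by simp
  hence s: "ws ! i : set ws" using l by simp
  hence r: "fst ` set (ws ! i) <= {1..n}" using k(1) by (auto simp: isb_def)
  have "wsb (muw n) (ws ! i) = word_shift n (ws ! i) @ ws ! i"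
  proof (cases "ws ! i = []")
   case False
   then obtain j where j: "ws ! i = [(j, True)]" using k(2) s by (auto simp: alg_words_def)
   hence "1 <= j" "j - 1 < n" using r by auto
   thus ?thesis using j by (simp add: muw_nth word_shift_def)
  qed (simp add: wsb_def word_shift_def)
  also have "... = wsb (ws @ map (word_shift n) ws) (muw p ! i)" using i l by (simp add: muw_nth wsb_def nth_append)
  finally show "map (wsb (muw n)) ws ! i = map (wsb (ws @ map (word_shift n) ws)) (muw p) ! i" using i l by simp
 qed (simp add: l)
 ultimately have e: "k oo mun n = mun p oo k ** k" using isb_unique by metis
 have "k oo cv n F G = k oo mun n oo F ** G" unfolding cv_def by (rule comp_assoc[symmetric, OF tens_hom[OF F G] mun_jhom kh])
 also have "... = mun p oo (k ** k oo F ** G)" unfolding e by (rule comp_assoc[OF tens_hom[OF F G] tens_hom[OF kh kh] mun_jhom])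
 also have "... = cv p (k oo F) (k oo G)" by (simp add: cv_def tens_comp[OF F kh G kh])
 finally show ?thesis .
qed

lemma comp_et:
 assumes k: "isb n p k ws"
 shows "k oo et n = et p"
proof (rule isb_unique[OF isb_comp[OF k isb_eta_pow]])
 have "wsb (replicate n []) w = []" for w by (induction w) (auto simp: wsb_def spow_def)
 hence "wsb (replicate n []) = (%_. [])" by (rule ext)
 hence "map (wsb (replicate n [])) ws = replicate p []" using k by (simp add: isb_def map_replicate_const)
 thus "isb 0 p (et p) (map (wsb (replicate n [])) ws)" using isb_eta_pow[of p] by simp
qed

subsection \<open>Evaluation of products\<close>

definition Bm :: "nat => nat => ('k::field jfn) => dword => 'k jfn" where
 "Bm n m g x y = Cg g (bw (muw n)) (tp m x y)"

lemma bijac_Bm: "jacb g ==> bijac (Bm n m g)" unfolding Bm_def[abs_def] by (rule bijac_tp[OF bijac_right[OF bijac_Cg]])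

lemma EV_cv:
 assumes F: "F : jhom m n" and G: "G : jhom m' n" and g: "jacb g"
 shows "EV (cv n F G) g = EV F (%x. EV G (Bm n m g x))" unfolding cv_def EV_comp_left[OF isbD(1)[OF isb_mu_pow] tens_hom[OF F G] g] Bm_def[abs_def]
 by (rule EV_jtens[OF F G bijac_right[OF bijac_Cg[OF g]]])

lemma wt_bw: "wt (bw ws) = 0"
proof -
 have "legs (fa (map lts ws)) = []" by (induction ws) auto
 thus ?thesis by (simp add: bw_def wt_def)
qed

lemma Bm_zero:
 assumes "!!w. wt w = wt x + wt y ==> g w = 0"
 shows "Bm n m g x y = 0" unfolding Bm_def by (rule Cg_zero, rule assms) (simp add: wt_tp wt_bw)

text \<open>The degree filtration in dual form: \<open>F\<close> has no part in degrees below
  \<open>d\<close> when it is invisible to test functions that vanish in these higher degrees, that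
  is, in weight at least \<open>2 * d\<close>.\<close>

definition vz :: "nat => 'k::field jmor => bool" where
 "vz d F <-> (ALL g. jacb g --> (ALL x. wt x >= 2 * d --> g x = 0) --> EV F g = 0)"

lemma vzD: "vz d F ==> jacb g ==> (!!x. wt x >= 2 * d ==> g x = 0) ==> EV F g = 0" by (simp add: vz_def)

lemma vz_bdd: "vz d F ==> jacb g ==> bdd e g ==> e < 2 * d ==> EV F g = 0" by (erule (1) vzD) (auto simp: bdd_def)

lemma vz_0: "F : jhom m n ==> vz 0 F"
proof -
 assume F: "F : jhom m n"
 have "EV F g = 0" if "ALL x. wt x >= 2 * 0 --> g x = 0" for g :: "'a jfn"
 proof -
  have "g = (%x. 0)" using that by auto
  thus ?thesis using EV_zero[OF F] by simp
 qed
 thus ?thesis unfolding vz_def by blast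
qed

lemma vz_cv:
 assumes F: "F : jhom m n" "vz a F" and G: "G : jhom m' n" "vz b G"
 shows "vz (a + b) (cv n F G)" unfolding vz_def
proof (intro allI impI)
 fix g :: "'a jfn" assume g: "jacb g" and z: "ALL x. wt x >= 2 * (a + b) --> g x = 0"
 have B: "Bm n m g x y = 0" if "wt x + wt y >= 2 * (a + b)" for x y :: "dword" by (rule Bm_zero) (use z that in auto)
 have "EV F (%x. EV G (Bm n m g x)) = 0"
 proof (rule vzD[OF F(2) jacb_EV[OF G(1) bijac_Bm[OF g]]])
  fix x :: "dword" assume "wt x >= 2 * a"
  thus "EV G (Bm n m g x) = 0" by (intro vzD[OF G(2) bijac_right[OF bijac_Bm[OF g]]] B) simp
 qed
 thus "EV (cv n F G) g = 0" by (simp add: EV_cv[OF F(1) G(1) g])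
qed

text \<open>Discarding the terms of degree below \<open>d\<close> from a representative does not
  change the class: the part of a test function in low weight is again a test function, and it
  evaluates to zero on \<open>F\<close>.\<close>

lemma rep_vz:
 assumes F: "F : jhom m n" and v: "vz d F"
 obtains f where "f : jseries m n" "F = jmor_of m n f" "ALL D. f D ~= 0 --> d <= jdeg D"
proof -
 obtain f0 where f0: "f0 : jseries m n" "F = jmor_of m n f0" by (rule jhomE[OF F])
 define f where "f D = (if jdeg D < d then 0 else f0 D)" for D
 have f: "f : jseries m n" using f0(1) unfolding jseries_def f_def by (auto intro: finite_subset[of _ "{D. f0 D ~= 0 & jdeg D = _}"])
 have "evs f0 g = evs f g" if g: "jacb g" for g
 proof -
  define h where "h x = (if wt x div 2 < d then g x else 0)" for x
  obtain e where e: "bdd e g" using g by (auto simp: jacb_iff)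
  have "h = (%x. \<Sum>k<d. 1 * (if wt x div 2 = k then g x else 0))" by (rule ext) (auto simp: h_def sum.delta)
  hence "jac {} h" using jac_lin[of "{..<d}" "{}" "%k x. if wt x div 2 = k then g x else 0" "%_. 1"] jac_trunc[of "{}" g] g by (simp add: jacb_iff)
  moreover have "bdd e h" using e by (simp add: h_def bdd_def)
  ultimately have h: "jacb h" by (auto simp: jacb_iff)
  have "EV F h = 0"
  proof (rule vzD[OF v h])
   fix x :: "dword" assume "wt x >= 2 * d"
   hence "~ wt x div 2 < d" by linarith
   thus "h x = 0" by (simp add: h_def)
  qed
  hence h0: "evs f0 h = 0" using EV_jmor_of[OF f0(1) h] f0(2) by simp
  let ?S = "{D. f0 D ~= 0 & jdeg D <= e}"
  have S: "finite ?S" by (rule finite_jseries[OF f0(1)])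
  have 1: "evs f0 g = (SUM D:?S. f0 D * g (fd D))" by (rule evs_bdd[OF f0(1) e])
  have 2: "evs f0 h = (SUM D:?S. f0 D * h (fd D))" by (rule evs_bdd[OF f0(1) \<open>bdd e h\<close>])
  have 3: "evs f g = (SUM D:?S. f D * g (fd D))" by (rule evs_superset[OF S]) (use bdd_jdeg[OF e] in "auto simp: f_def split: if_splits")
  have "(SUM D:?S. f0 D * g (fd D)) = (SUM D:?S. f D * g (fd D) + f0 D * h (fd D))" by (rule sum.cong) (auto simp: f_def h_def jdeg_fl)
  thus ?thesis using 1 2 3 h0 by (simp add: sum.distrib)
 qed
 hence "F = jmor_of m n f" unfolding f0(2) jmor_of_def using jcoset_eq_iff[OF f0(1) f] by simp
 thus ?thesis by (rule that[OF f]) (auto simp: f_def)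
qed

lemma scale_hom: "F : jhom m n ==> jscale a F : jhom m n"
 and EV_jscale: "F : jhom m n ==> jacb g ==> EV (jscale a F) g = a * EV F g"
proof -
 assume "F : jhom m n"
 then obtain f where f: "f : jseries m n" "F = jmor_of m n f" by (rule jhomE)
 have s: "(%D. a * h D) : jseries m n" if "h : jseries m n" for h using that unfolding jseries_def by (auto intro: finite_subset[of _ "{D. h D ~= 0 & jdeg D = _}"])
 have e: "evs (%D. a * h D) g = a * evs h g" for h and g :: "'a jfn"
 proof (cases "a = 0")
  case False
  thus ?thesis unfolding evs_def sum_distrib_left by (intro sum.cong) auto
 qed (simp add: evs_def)
 have "jcoset m n (%D. a * h D) = jcoset m n (%D. a * f D)" if "h : jcoset m n f" for h
 proof -
  have h: "h : jseries m n" "ALL g. jacb g --> evs h g = evs f g" using that in_jcoset_iff[OF f(1)] by auto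
  thus ?thesis unfolding jcoset_eq_iff[OF s[OF h(1)] s[OF f(1)]] by (simp add: e)
 qed
 hence "(\<Union>h\<in>jcoset m n f. jcoset m n (%D. a * h D)) = jcoset m n (%D. a * f D)" using jcoset_self[OF f(1)] by blast
 hence j: "jscale a F = jmor_of m n (%D. a * f D)" by (simp add: jscale_def f(2) jmor_of_def)
 show "jscale a F : jhom m n" unfolding j by (rule jhomI[OF s[OF f(1)]])
 show "EV (jscale a F) g = a * EV F g" if "jacb g" unfolding j unfolding f(2) by (simp add: EV_jmor_of[OF s[OF f(1)] that] EV_jmor_of[OF f(1) that] e)
qed

lemma vz_jscale: "F : jhom m n ==> vz d F ==> vz d (jscale a F)" unfolding vz_def by (simp add: EV_jscale)

lemma evs_series_sum:
 assumes r: "!!i. r i : jseries m n" and fin: "!!d. finite {i. EX D. r i D ~= 0 & jdeg D = d}"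
 shows "(%D. \<Sum>i | r i D ~= 0. r i D) : jseries m n"
  and "bdd e g ==> finite I ==> (!!i D. r i D ~= 0 ==> jdeg D <= e ==> i : I) ==>
   evs (%D. \<Sum>i | r i D ~= 0. r i D) g = (SUM i:I. evs (r i) g)"
proof -
 let ?s = "%D. \<Sum>i | r i D ~= 0. r i D"
 have ex: "EX i. r i D ~= 0" if "?s D ~= 0" for D
 proof (rule ccontr)
  assume "\<nexists>i. r i D ~= 0"
  hence "?s D = 0" by simp
  thus False using that by blast
 qed
 have "finite {D. ?s D ~= 0 & jdeg D = d}" for d
 proof (rule finite_subset)
  show "{D. ?s D ~= 0 & jdeg D = d} <= (\<Union>i\<in>{i. EX D. r i D ~= 0 & jdeg D = d}. {D. r i D ~= 0 & jdeg D = d})" using ex by blast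
  show "finite (\<Union>i\<in>{i. EX D. r i D ~= 0 & jdeg D = d}. {D. r i D ~= 0 & jdeg D = d})" using fin r by (intro finite_UN_I) (auto simp: jseries_def)
 qed
 thus "?s : jseries m n" using r ex unfolding jseries_def by blast
 assume e: "bdd e g" and I: "finite I" "!!i D. r i D ~= 0 ==> jdeg D <= e ==> i : I"
 let ?S = "\<Union>i\<in>I. {D. r i D ~= 0 & jdeg D <= e}"
 have S: "finite ?S" using I(1) finite_jseries[OF r] by blast
 have "evs ?s g = (SUM D:?S. ?s D * g (fd D))" using ex I(2) bdd_jdeg[OF e] by (intro evs_superset[OF S]) blast
 also have "... = (SUM D:?S. SUM i:I. r i D * g (fd D))"
 proof (rule sum.cong[OF refl])
  fix D assume "D : ?S"
  hence "?s D = (SUM i:I. r i D)" using I by (intro sum.mono_neutral_left) auto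
  thus "?s D * g (fd D) = (SUM i:I. r i D * g (fd D))" by (simp add: sum_distrib_right)
 qed
 also have "... = (SUM i:I. SUM D:?S. r i D * g (fd D))" by (rule sum.swap)
 also have "... = (SUM i:I. evs (r i) g)" using I(2) bdd_jdeg[OF e] by (intro sum.cong refl evs_superset[OF S, symmetric]) blast
 finally show "evs ?s g = (SUM i:I. evs (r i) g)" .
qed

text \<open>\<open>jsum\<close> needs representatives that are finite in every degree. They exist
  because a summand of order \<open>\<delta> i\<close> has a representative that starts in that
  degree, and only finitely many orders lie below any bound. On a test function the sum is finite;
  the factor 2 compares degree with weight.\<close>

lemma jsum_jhom:
 assumes F: "!!i. F i : jhom m n" "!!i. vz (\<delta> i) (F i)" and fin: "!!d. finite {i. \<delta> i <= d}"
 shows "jsum m n F : jhom m n"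
  and "jacb g ==> bdd e g ==> finite I ==> {i. 2 * \<delta> i <= e} <= I ==> EV (jsum m n F) g = (SUM i:I. EV (F i) g)"
proof -
 have "EX f. f : jseries m n & F i = jmor_of m n f & (ALL D. f D ~= 0 --> \<delta> i <= jdeg D)" for i using rep_vz[OF F] by metis
 then obtain r where r: "!!i. r i : jseries m n" "!!i. F i = jmor_of m n (r i)" "!!i D. r i D ~= 0 ==> \<delta> i <= jdeg D" by metis
 let ?R = "{f. (ALL i. f i : jclass (F i)) & (ALL d. finite {i. EX D. f i D ~= 0 & jdeg D = d})}"
 let ?s = "%f D. \<Sum>i | f i D ~= 0. f i D"
 have "finite {i. EX D. r i D ~= 0 & jdeg D = d}" for d by (rule finite_subset[OF _ fin[of d]]) (use r(3) in blast)
 hence rR: "r : ?R" using r(1,2) by (simp add: jcoset_self)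
 have R: "(ALL i. f i : jseries m n) & (ALL i g. jacb g --> evs (f i) g = EV (F i) g) & (ALL d. finite {i. EX D. f i D ~= 0 & jdeg D = d})"
  if "f : ?R" for f
 proof -
  have "f i : jcoset m n (r i)" for i
  proof -
   have "f i : jclass (F i)" using that by blast
   thus ?thesis unfolding r(2) by simp
  qed
  hence "f i : jseries m n" "ALL g. jacb g --> evs (f i) g = evs (r i) g" for i using in_jcoset_iff[OF r(1)] by blast+
  thus ?thesis using that EV_jmor_of[OF r(1)] r(2) by simp
 qed
 have ev_s: "evs (?s f) g = (SUM i:I. EV (F i) g)"
  if "f : ?R" "jacb g" "bdd e g" "finite I" "{i. 2 * \<delta> i <= e} <= I" for f g e I
 proof -
  note f = R[OF that(1)]
  let ?J = "I Un (\<Union>d\<le>e. {i. EX D. f i D ~= 0 & jdeg D = d})"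
  have J: "finite ?J" using that(4) f by blast
  have "evs (?s f) g = (SUM i:?J. evs (f i) g)" by (rule evs_series_sum(2)[of f m n]) (use f that J in auto)
  also have "... = (SUM i:?J. EV (F i) g)" using f that(2) by simp
  also have "... = (SUM i:I. EV (F i) g)"
  proof (rule sum.mono_neutral_right[OF J])
   show "ALL i:?J - I. EV (F i) g = 0" using that(5) by (intro ballI vz_bdd[OF F(2) that(2,3)]) (auto simp: not_le[symmetric])
  qed auto
  finally show ?thesis .
 qed
 have c: "jcoset m n (?s f) = jcoset m n (?s r)" if f: "f : ?R" for f
 proof -
  have s: "?s h : jseries m n" if "h : ?R" for h by (rule evs_series_sum(1)) (use R[OF that] in auto)
  show ?thesis unfolding jcoset_eq_iff[OF s[OF f] s[OF rR]]
  proof (intro allI impI)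
   fix g :: "'b jfn" assume g: "jacb g"
   then obtain e where e: "bdd e g" by (auto simp: jacb_iff)
   have I: "finite {i. \<delta> i <= e}" "{i. 2 * \<delta> i <= e} <= {i. \<delta> i <= e}" using fin by auto
   show "evs (?s f) g = evs (?s r) g" using ev_s[OF f g e I] ev_s[OF rR g e I] by simp
  qed
 qed
 have "jsum m n F = Jmor m n (\<Union>f\<in>?R. jcoset m n (?s f))" by (simp add: jsum_def)
 also have "(\<Union>f\<in>?R. jcoset m n (?s f)) = jcoset m n (?s r)" using c rR by blast
 finally have j: "jsum m n F = jmor_of m n (?s r)" by (simp add: jmor_of_def)
 have s: "?s r : jseries m n" by (rule evs_series_sum(1)) (use R[OF rR] in auto)
 show "jsum m n F : jhom m n" unfolding j by (rule jhomI[OF s])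
 assume "jacb g" "bdd e g" "finite I" "{i. 2 * \<delta> i <= e} <= I"
 thus "EV (jsum m n F) g = (SUM i:I. EV (F i) g)" unfolding j EV_jmor_of[OF s \<open>jacb g\<close>] by (rule ev_s[OF rR])
qed

section \<open>The algebra of noncommutative power series and its action on morphisms\<close>

subsection \<open>Noncommutative power series\<close>

lemma nc_mult_Nil [simp]: "(f \<star> g) [] = f [] * g []" by (simp add: nc_mult_def)

lemma nc_mult_Cons: "(f \<star> g) (x # w) = f [] * g (x # w) + ((%v. f (x # v)) \<star> g) w" by (simp add: nc_mult_def sum.atMost_Suc_shift del: sum.atMost_Suc)

lemma nc_mult_add_left: "(f + f') \<star> g = f \<star> g + f' \<star> g" by (rule ext) (simp add: nc_mult_def distrib_right sum.distrib)

lemma nc_mult_add_right: "f \<star> (g + g') = f \<star> g + f \<star> g'" by (rule ext) (simp add: nc_mult_def distrib_left sum.distrib)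

lemma nc_mult_diff_left: "(f - f') \<star> g = f \<star> g - f' \<star> g" by (rule ext) (simp add: nc_mult_def left_diff_distrib sum_subtractf)

lemma nc_mult_diff_right: "f \<star> (g - g') = f \<star> g - f \<star> g'" by (rule ext) (simp add: nc_mult_def right_diff_distrib sum_subtractf)

lemma nc_mult_scale: "(%v. c * f v) \<star> g = (%w. c * (f \<star> g) w)" unfolding nc_mult_def sum_distrib_left by (intro ext sum.cong refl mult.assoc)

lemma nc_mult_assoc: "f \<star> g \<star> h = f \<star> (g \<star> h)"
proof
 fix w
 show "(f \<star> g \<star> h) w = (f \<star> (g \<star> h)) w"
 proof (induction w arbitrary: f g h)
  case (Cons x w)
  have "(%v. (f \<star> g) (x # v)) = (%v. f [] * g (x # v)) + (%v. f (x # v)) \<star> g" by (rule ext) (simp add: nc_mult_Cons)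
  hence "(f \<star> g \<star> h) (x # w) = f [] * g [] * h (x # w) + f [] * ((%v. g (x # v)) \<star> h) w + ((%v. f (x # v)) \<star> g \<star> h) w"
   by (simp add: nc_mult_Cons nc_mult_add_left nc_mult_scale)
  thus ?case by (simp only: nc_mult_Cons[of f "g \<star> h"] nc_mult_Cons[of g h] Cons.IH distrib_left mult.assoc add.assoc)
 qed (simp only: nc_mult_Nil mult.assoc)
qed

lemma single_simps [simp]: "single [] (x # w) = 0" "single [] [] = 1" "single (x # w) [] = 0" by (simp_all add: single_def)

lemma nc_mult_zero [simp]: "(%v. 0) \<star> g = (%v. 0)" by (rule ext) (simp add: nc_mult_def)

lemma single_Cons: "(%v. single (x # u) (y # v)) = (if x = y then single u else (%v. 0))" by (rule ext) (simp add: single_def)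

lemma nc_one_left [simp]: "nc_one \<star> f = f"
proof
 show "(nc_one \<star> f) w = f w" for w by (cases w) (simp_all add: nc_mult_Cons)
qed

lemma single_mult: "single u \<star> single v = single (u @ v)"
proof
 fix w
 show "(single u \<star> single v) w = single (u @ v) w"
 proof (induction u arbitrary: w)
  case C: (Cons x u)
  show ?case
  proof (cases w)
   case Nil
   thus ?thesis by simp
  next
   case (Cons y w')
   thus ?thesis using C.IH[of w'] by (cases "x = y") (simp_all add: nc_mult_Cons single_Cons single_def)
  qed
 qed simp
qed

lemma nc_one_right [simp]: "f \<star> nc_one = f"
proof
 fix w
 show "(f \<star> nc_one) w = f w" by (induction w arbitrary: f) (simp_all add: nc_mult_Cons)
qed

fun nc_rinv :: "('x, 'k::field) ncps => 'x list => 'k" where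
 "nc_rinv f w = (if w = [] then 1 else - (\<Sum>i<length w. f (take (Suc i) w) * nc_rinv f (drop (Suc i) w)))"

declare nc_rinv.simps [simp del]

lemma nc_rinv: "f [] = 1 ==> f \<star> nc_rinv f = nc_one"
proof
 fix w assume "f [] = 1"
 thus "(f \<star> nc_rinv f) w = nc_one w"
 proof (cases w)
  case Nil
  thus ?thesis using \<open>f [] = 1\<close> by (simp add: nc_rinv.simps single_def)
 next
  case (Cons x v)
  have "(f \<star> nc_rinv f) w = f [] * nc_rinv f w + (\<Sum>i<length w. f (take (Suc i) w) * nc_rinv f (drop (Suc i) w))"
   unfolding nc_mult_def lessThan_Suc_atMost[symmetric] by (subst sum.lessThan_Suc_shift) simp
  thus ?thesis using Cons \<open>f [] = 1\<close> by (subst (asm) (1) nc_rinv.simps) (simp add: single_def)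
 qed
qed

text \<open>The recursion \<open>nc_rinv\<close> gives a right inverse, which again has constant
  term 1 and so has a right inverse itself. By associativity the latter is \<open>f\<close>, which
  makes the inverse two-sided.\<close>

lemma nc_inverse:
 assumes "f [] = 1"
 shows "f \<star> nc_inverse f = nc_one" "nc_inverse f \<star> f = nc_one"
proof -
 let ?r = "nc_rinv f"
 have r: "f \<star> ?r = nc_one" by (rule nc_rinv[of f, OF assms])
 have r1: "?r [] = 1" by (simp add: nc_rinv.simps)
 have "f = f \<star> (?r \<star> nc_rinv ?r)" by (simp add: nc_rinv[of ?r, OF r1])
 also have "... = nc_rinv ?r" by (simp add: nc_mult_assoc[symmetric] r)
 finally have l: "?r \<star> f = nc_one" using nc_rinv[of ?r, OF r1] by simp
 have "nc_inverse f = ?r" unfolding nc_inverse_def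
 proof (rule the_equality)
  fix g assume g: "f \<star> g = nc_one & g \<star> f = nc_one"
  have "g = g \<star> (f \<star> ?r)" by (simp add: r)
  also have "... = ?r" by (simp add: nc_mult_assoc[symmetric] g)
  finally show "g = ?r" .
 qed (use r l in simp)
 thus "f \<star> nc_inverse f = nc_one" "nc_inverse f \<star> f = nc_one" using r l by simp_all
qed

subsection \<open>Substitution of morphisms into power series\<close>

primrec cw :: "nat => ('x => 'k::field jmor) => 'x list => 'k jmor" where
 "cw n th [] = et n"
| "cw n th (x # w) = cv n (th x) (cw n th w)"

definition subst_ok :: "nat => ('x => 'k::field jmor) => bool" where
 "subst_ok n th <-> (ALL x. th x : jhom 0 n & vz 1 (th x))"

lemma cw_jhom: "subst_ok n th ==> cw n th w : jhom 0 n" by (induction w) (auto simp: subst_ok_def)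

lemma cw_vz: "subst_ok n th ==> vz (length w) (cw n th w)"
proof (induction w)
 case Nil
 thus ?case by (simp add: vz_0[OF et_jhom])
next
 case (Cons x w)
 hence "th x : jhom 0 n" "vz 1 (th x)" by (auto simp: subst_ok_def)
 moreover have e: "1 + length w = Suc (length w)" by simp
 ultimately show ?case using vz_cv[OF _ _ cw_jhom[OF Cons.prems] Cons.IH[OF Cons.prems], of "th x" 0 1, unfolded e] by simp
qed

lemma cw_append: "subst_ok n th ==> cw n th (u @ v) = cv n (cw n th u) (cw n th v)"
proof (induction u)
 case Nil
 thus ?case by (simp add: cv_unit_left[OF cw_jhom])
next
 case (Cons x u)
 hence "th x : jhom 0 n" by (auto simp: subst_ok_def)
 thus ?case using Cons by (simp add: cv_assoc[of _ 0 n _ 0 _ 0] cw_jhom)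
qed

lemma conv_word_cw: "conv_word n th w = cw n th w" by (induction w) auto

text \<open>Over the letters \<open>(i, j)\<close> there are infinitely many words of a given
  length, so finiteness in each length must be required of the series.\<close>

definition sfin :: "('x list => 'k::field) => bool" where
 "sfin f <-> (ALL d. finite {w. f w ~= 0 & length w <= d})"

text \<open>\<open>F\<close> is the image of the series \<open>f\<close> under the substitution \<open>\<theta>\<close>.\<close>

definition isT :: "nat => ('x => 'k::field jmor) => ('x list => 'k) => 'k jmor => bool" where
 "isT n th f F <-> F : jhom 0 n & sfin f & (ALL g e. jacb g --> bdd e g -->
  EV F g = (\<Sum>w | f w ~= 0 & length w <= e. f w * EV (cw n th w) g))"

lemma isT_jhom: "isT n th f F ==> F : jhom 0 n" by (simp add: isT_def)

lemma isT_superset: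
 assumes "isT n th f F" "jacb g" "bdd e g" "finite W" "!!w. f w ~= 0 ==> length w <= e ==> w : W" "subst_ok n th"
 shows "EV F g = (SUM w:W. f w * EV (cw n th w) g)"
proof -
 have "EV F g = (\<Sum>w | f w ~= 0 & length w <= e. f w * EV (cw n th w) g)" using assms(1-3) by (simp add: isT_def)
 also have "... = (SUM w:W. f w * EV (cw n th w) g)"
 proof (rule sum.mono_neutral_left[OF assms(4)])
  show "ALL w:W - {w. f w ~= 0 & length w <= e}. f w * EV (cw n th w) g = 0"
  proof
   fix w assume "w : W - {w. f w ~= 0 & length w <= e}"
   hence "f w = 0 \<or> e < 2 * length w" by auto
   thus "f w * EV (cw n th w) g = 0" using vz_bdd[OF cw_vz[OF assms(6)] assms(2,3), of w] by auto
  qed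
 qed (use assms(5) in auto)
 finally show ?thesis .
qed

lemma isT_unique:
 assumes "isT n th f F" "isT n th f G"
 shows "F = G"
proof (rule jhom_ext[OF isT_jhom[OF assms(1)] isT_jhom[OF assms(2)]])
 fix g :: "'b jfn" assume g: "jacb g"
 then obtain e where "bdd e g" by (auto simp: jacb_iff)
 thus "EV F g = EV G g" using assms g by (simp add: isT_def)
qed

lemma sfin_finite: "sfin f ==> finite {w. f w ~= 0 & length w <= d}" by (simp add: sfin_def)

lemma sfin_single [simp]: "sfin (single u :: 'a list => 'b::field)" by (simp add: single_def if_splits finite_subset sfin_def)

lemma isT_single:
 assumes "subst_ok n th"
 shows "isT n th (single u) (cw n th u)" unfolding isT_def
proof (intro conjI allI impI)
 fix g :: "'b jfn" and e assume g: "jacb g" "bdd e g"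
 show "EV (cw n th u) g = (\<Sum>w | single u w ~= (0::'b) & length w <= e. single u w * EV (cw n th w) g)"
 proof (cases "length u <= e")
  case True
  hence "{w. single u w ~= (0::'b) & length w <= e} = {u}" by (auto simp: single_def split: if_splits)
  thus ?thesis by (simp add: single_def)
 next
  case False
  hence e: "{w. single u w ~= (0::'b) & length w <= e} = {}" by (auto simp: single_def split: if_splits)
  show ?thesis unfolding e using vz_bdd[OF cw_vz[OF assms] g, of u] False by simp
 qed
qed (use assms cw_jhom in auto)

lemma isT_add:
 assumes f: "isT n th f F1" "isT n th f' F2" and F: "F : jhom 0 n" "!!g. jacb g ==> EV F g = EV F1 g + EV F2 g" and ok: "subst_ok n th"
 shows "isT n th (f + f') F" unfolding isT_def
proof (intro conjI allI impI)
 have s: "sfin f" "sfin f'" using f by (auto simp: isT_def)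
 have sub: "{w. (f + f') w ~= 0 & length w <= d} <= {w. f w ~= 0 & length w <= d} Un {w. f' w ~= 0 & length w <= d}" for d by auto
 show "sfin (f + f')" unfolding sfin_def by (intro allI finite_subset[OF sub]) (use s in "auto simp: sfin_def")
 fix g :: "'b jfn" and e assume g: "jacb g" "bdd e g"
 let ?W = "{w. f w ~= 0 & length w <= e} Un {w. f' w ~= 0 & length w <= e}"
 have W: "finite ?W" using s by (auto simp: sfin_def)
 have "EV F g = (SUM w:?W. f w * EV (cw n th w) g) + (SUM w:?W. f' w * EV (cw n th w) g)"
  using isT_superset[OF f(1) g W _ ok] isT_superset[OF f(2) g W _ ok] F(2)[OF g(1)] by auto
 also have "... = (SUM w:?W. (f + f') w * EV (cw n th w) g)" by (simp add: sum.distrib distrib_right)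
 also have "... = (\<Sum>w | (f + f') w ~= 0 & length w <= e. (f + f') w * EV (cw n th w) g)" by (rule sum.mono_neutral_right[OF W sub]) auto
 finally show "EV F g = (\<Sum>w | (f + f') w ~= 0 & length w <= e. (f + f') w * EV (cw n th w) g)" .
qed (rule F(1))

lemma isT_scale:
 assumes f: "isT n th f F" and ok: "subst_ok n th"
 shows "isT n th (%w. a * f w) (jscale a F)" unfolding isT_def
proof (intro conjI allI impI)
 have s: "sfin f" "F : jhom 0 n" using f by (auto simp: isT_def)
 show "jscale a F : jhom 0 n" by (rule scale_hom[OF s(2)])
 have sub: "{w. a * f w ~= 0 & length w <= d} <= {w. f w ~= 0 & length w <= d}" for d by auto
 show "sfin (%w. a * f w)" unfolding sfin_def by (intro allI finite_subset[OF sub]) (use s in "auto simp: sfin_def")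
 fix g :: "'b jfn" and e assume g: "jacb g" "bdd e g"
 have "EV (jscale a F) g = (\<Sum>w | f w ~= 0 & length w <= e. a * f w * EV (cw n th w) g)" using f g by (simp add: EV_jscale[OF s(2)] isT_def sum_distrib_left)
 also have "... = (\<Sum>w | a * f w ~= 0 & length w <= e. a * f w * EV (cw n th w) g)" by (rule sum.mono_neutral_right[OF sfin_finite[OF s(1)] sub]) auto
 finally show "EV (jscale a F) g = (\<Sum>w | a * f w ~= 0 & length w <= e. a * f w * EV (cw n th w) g)" .
qed

text \<open>Substitution is multiplicative: the word of a concatenation is the product of the two
  words (\<open>cw_append\<close>), and collecting the pairs of words by their concatenation gives
  the coefficients of the product series.\<close>

lemma isT_mult:
 assumes f: "isT n th f F" "isT n th f' F'" and ok: "subst_ok n th"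
 shows "isT n th (f \<star> f') (cv n F F')" unfolding isT_def
proof (intro conjI allI impI)
 have s: "sfin f" "sfin f'" "F : jhom 0 n" "F' : jhom 0 n" using f by (auto simp: isT_def)
 show "cv n F F' : jhom 0 n" using s by simp
 define S where "S d = {w. f w ~= 0 & length w <= d}" for d
 define S' where "S' d = {w. f' w ~= 0 & length w <= d}" for d
 have fin: "finite (S d)" "finite (S' d)" for d using s by (auto simp: S_def S'_def sfin_def)
 have sub: "{w. (f \<star> f') w ~= 0 & length w <= d} <= (%(u, v). u @ v) ` (S d \<times> S' d)" for d
 proof
  fix w assume w: "w : {w. (f \<star> f') w ~= 0 & length w <= d}"
  then obtain i where "f (take i w) * f' (drop i w) ~= 0" by (auto simp: nc_mult_def elim: sum.not_neutral_contains_not_neutral)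
  hence "(take i w, drop i w) : S d \<times> S' d" using w by (auto simp: S_def S'_def)
  thus "w : (%(u, v). u @ v) ` (S d \<times> S' d)" by (rule rev_image_eqI) simp
 qed
 show "sfin (f \<star> f')" unfolding sfin_def by (intro allI finite_subset[OF sub] finite_imageI finite_cartesian_product fin)
 fix g :: "'b jfn" and e assume g: "jacb g" "bdd e g"
 define E where "E w = EV (cw n th w) g" for w
 have B: "bijac (Bm n 0 g)" by (rule bijac_Bm[OF g(1)])
 have B0: "Bm n 0 g x y = 0" if "wt x + wt y > e" for x y by (rule Bm_zero) (use g(2) that in "auto simp: bdd_def")
 have b: "bdd e (Bm n 0 g x)" for x using B0 by (auto simp: bdd_def)
 have b': "bdd e (%x. EV G (Bm n 0 g x))" if "G : jhom 0 n" for G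
 proof -
  have "Bm n 0 g x = (%y. 0)" if "wt x > e" for x using B0 that by (intro ext) simp
  thus ?thesis using EV_zero[OF that] by (simp add: bdd_def)
 qed
 have "EV (cv n F F') g = EV F (%x. EV F' (Bm n 0 g x))" by (rule EV_cv[OF s(3,4) g(1)])
 also have "... = (SUM u:S e. f u * EV (cw n th u) (%x. EV F' (Bm n 0 g x)))" using f(1) jacb_EV[OF s(4) B] b'[OF s(4)] by (simp add: isT_def S_def)
 also have "... = (SUM u:S e. SUM v:S' e. f u * (f' v * E (u @ v)))"
 proof (rule sum.cong[OF refl])
  fix u
  have F': "ALL g e. jacb g --> bdd e g --> EV F' g = (SUM v:S' e. f' v * EV (cw n th v) g)" using f(2) by (simp add: isT_def S'_def)
  have "EV (cw n th u) (%x. EV F' (Bm n 0 g x)) = EV (cw n th u) (%x. SUM v:S' e. f' v * EV (cw n th v) (Bm n 0 g x))"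
   by (simp only: F'[rule_format, OF bijac_right[OF B] b])
  also have "... = (SUM v:S' e. f' v * EV (cw n th u) (%x. EV (cw n th v) (Bm n 0 g x)))" by (rule EV_sum[OF cw_jhom[OF ok] fin(2) b'[OF cw_jhom[OF ok]]])
  also have "... = (SUM v:S' e. f' v * E (u @ v))" by (simp add: E_def cw_append[OF ok] EV_cv[OF cw_jhom[OF ok] cw_jhom[OF ok] g(1)])
  finally show "f u * EV (cw n th u) (%x. EV F' (Bm n 0 g x)) = (SUM v:S' e. f u * (f' v * E (u @ v)))" by (simp add: sum_distrib_left)
 qed
 also have "... = (SUM p:S e \<times> S' e. (f (fst p) * f' (snd p)) * E (fst p @ snd p))" by (simp add: sum.cartesian_product case_prod_beta')
 also have "... = (SUM w:(%(u, v). u @ v) ` (S e \<times> S' e). SUM p:{p : S e \<times> S' e. (%(u, v). u @ v) p = w}. (f (fst p) * f' (snd p)) * E (fst p @ snd p))"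
  by (rule sum.group[symmetric]) (use fin in auto)
 also have "... = (SUM w:(%(u, v). u @ v) ` (S e \<times> S' e). (f \<star> f') w * E w)"
 proof (rule sum.cong[OF refl])
  fix w
  show "(SUM p:{p : S e \<times> S' e. (%(u, v). u @ v) p = w}. (f (fst p) * f' (snd p)) * E (fst p @ snd p)) = (f \<star> f') w * E w"
  proof (cases "length w <= e")
   case True
   let ?c = "%i. (take i w, drop i w)"
   have inj: "inj_on ?c {..length w}" by (rule inj_onI) (metis atMost_iff fst_conv length_take min.absorb2)
   have "(f \<star> f') w = (SUM p:?c ` {..length w}. f (fst p) * f' (snd p))" unfolding nc_mult_def by (subst sum.reindex[OF inj]) simp
   also have "... = (SUM p:{p : S e \<times> S' e. (%(u, v). u @ v) p = w}. f (fst p) * f' (snd p))"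
   proof (rule sum.mono_neutral_right)
   show "{p : S e \<times> S' e. (%(u, v). u @ v) p = w} <= ?c ` {..length w}"
   proof
   fix p assume "p : {p : S e \<times> S' e. (%(u, v). u @ v) p = w}"
   hence "fst p @ snd p = w" by auto
   hence "p = ?c (length (fst p))" "length (fst p) <= length w" by auto
   thus "p : ?c ` {..length w}" by blast
   qed
   show "ALL p:?c ` {..length w} - {p : S e \<times> S' e. (%(u, v). u @ v) p = w}. f (fst p) * f' (snd p) = 0" using True by (auto simp: S_def S'_def)
   qed simp
   finally show ?thesis by (simp add: sum_distrib_right) (rule sum.cong, auto)
  next
   case False
   hence "E w = 0" unfolding E_def by (intro vz_bdd[OF cw_vz[OF ok] g]) simp
   thus ?thesis by (simp, intro sum.neutral ballI) auto
  qed
 qed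
 also have "... = (\<Sum>w | (f \<star> f') w ~= 0 & length w <= e. (f \<star> f') w * E w)"
 proof (rule sum.mono_neutral_right)
  have "E w = 0" if "~ length w <= e" for w unfolding E_def by (intro vz_bdd[OF cw_vz[OF ok] g]) (use that in simp)
  thus "ALL w:(%(u, v). u @ v) ` (S e \<times> S' e) - {w. (f \<star> f') w ~= 0 & length w <= e}. (f \<star> f') w * E w = 0" by auto
 qed (use fin sub in auto)
 finally show "EV (cv n F F') g = (\<Sum>w | (f \<star> f') w ~= 0 & length w <= e. (f \<star> f') w * EV (cw n th w) g)" by (simp add: E_def)
qed

lemma isT_series:
 assumes G: "!!i. isT n th (G i) (M i)" "!!i w. G i w ~= 0 ==> \<delta> i <= length w" "!!i. vz (\<delta> i) (M i)"
  and fin: "!!d. finite {i. \<delta> i <= d}" and ok: "subst_ok n th"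
 shows "isT n th (%w. \<Sum>i | \<delta> i <= length w. a i * G i w) (jsum 0 n (%i. jscale (a i) (M i)))"
proof -
 let ?f = "%w. \<Sum>i | \<delta> i <= length w. a i * G i w"
 have M: "M i : jhom 0 n" for i using isT_jhom[OF G(1)] .
 note js = jsum_jhom[of "%i. jscale (a i) (M i)" 0 n \<delta>, OF scale_hom[OF M] vz_jscale[OF M G(3)] fin]
 have sub: "{w. ?f w ~= 0 & length w <= d} <= (\<Union>i\<in>{i. \<delta> i <= d}. {w. G i w ~= 0 & length w <= d})" for d
 proof
  fix w assume w: "w : {w. ?f w ~= 0 & length w <= d}"
  then obtain i where "i : {i. \<delta> i <= length w}" "a i * G i w ~= 0" using sum.not_neutral_contains_not_neutral by force
  hence "\<delta> i <= d" "G i w ~= 0" using w by auto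
  thus "w : (\<Union>i\<in>{i. \<delta> i <= d}. {w. G i w ~= 0 & length w <= d})" using w by blast
 qed
 have finU: "finite (\<Union>i\<in>{i. \<delta> i <= d}. {w. G i w ~= 0 & length w <= d})" for d using G(1) fin by (auto simp: isT_def sfin_def)
 have val: "EV (jsum 0 n (%i. jscale (a i) (M i))) g = (\<Sum>w | ?f w ~= 0 & length w <= e. ?f w * EV (cw n th w) g)"
  if g: "jacb g" "bdd e g" for g e
 proof -
  let ?W = "\<Union>i\<in>{i. \<delta> i <= e}. {w. G i w ~= 0 & length w <= e}"
  have I: "{i. 2 * \<delta> i <= e} <= {i. \<delta> i <= e}" by auto
  have "EV (jsum 0 n (%i. jscale (a i) (M i))) g = (\<Sum>i | \<delta> i <= e. EV (jscale (a i) (M i)) g)" by (rule js(2)[OF g fin I])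
  also have "... = (\<Sum>i | \<delta> i <= e. SUM w:?W. a i * G i w * EV (cw n th w) g)"
  proof (rule sum.cong[OF refl])
   fix i assume "i : {i. \<delta> i <= e}"
   hence "EV (M i) g = (SUM w:?W. G i w * EV (cw n th w) g)" by (intro isT_superset[OF G(1) g finU _ ok]) auto
   thus "EV (jscale (a i) (M i)) g = (SUM w:?W. a i * G i w * EV (cw n th w) g)" by (simp add: EV_jscale[OF M g(1)] sum_distrib_left)
  qed
  also have "... = (SUM w:?W. \<Sum>i | \<delta> i <= e. a i * G i w * EV (cw n th w) g)" by (rule sum.swap)
  also have "... = (SUM w:?W. ?f w * EV (cw n th w) g)"
  proof (rule sum.cong[OF refl])
   fix w assume w: "w : ?W"
   have "(\<Sum>i | \<delta> i <= e. a i * G i w) = ?f w"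
   proof (rule sum.mono_neutral_right[OF fin])
   show "ALL i:{i. \<delta> i <= e} - {i. \<delta> i <= length w}. a i * G i w = 0" using G(2) by auto
   qed (use w in auto)
   thus "(\<Sum>i | \<delta> i <= e. a i * G i w * EV (cw n th w) g) = ?f w * EV (cw n th w) g" by (simp flip: sum_distrib_right)
  qed
  also have "... = (\<Sum>w | ?f w ~= 0 & length w <= e. ?f w * EV (cw n th w) g)" by (rule sum.mono_neutral_right[OF finU sub]) auto
  finally show ?thesis .
 qed
 have "sfin ?f" unfolding sfin_def using finite_subset[OF sub finU] by blast
 thus ?thesis using js(1) val unfolding isT_def by blast
qed

lemma UNIV_xy: "(UNIV :: xy set) = {X_gen, Y_gen}" using xy.exhaust by blast

lemma finite_xy_words: "finite {u :: xy list. length u <= d}"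
proof -
 have "finite (UNIV :: xy set)" by (simp add: UNIV_xy)
 from finite_lists_length_le[OF this, of d] show ?thesis by simp
qed

lemma subst_ok_xy: "subst_ok n (case_xy a b) <-> a : jhom 0 n & vz 1 a & b : jhom 0 n & vz 1 b"
 unfolding subst_ok_def by (metis (full_types) xy.exhaust xy.simps(3,4))

lemma isT_conv_subst_xy:
 assumes "subst_ok n (case_xy a b)"
 shows "isT n (case_xy a b) \<phi> (conv_subst n \<phi> a b)"
proof -
 have "isT n (case_xy a b) (%w. \<Sum>u | length u \<le> length w. \<phi> u * single u w) (jsum 0 n (%u. jscale (\<phi> u) (cw n (case_xy a b) u)))"
  by (rule isT_series[OF isT_single[OF assms] _ cw_vz[OF assms] finite_xy_words assms])
   (auto simp: single_def split: if_splits)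
 moreover have "(\<Sum>u | length u \<le> length w. \<phi> u * single u w) = \<phi> w" for w
 proof -
  have "(\<Sum>u | length u \<le> length w. \<phi> u * single u w) = (\<Sum>u | length u \<le> length w. if u = w then \<phi> u else 0)" by (rule sum.cong) (auto simp: single_def)
  thus ?thesis by (simp add: finite_xy_words)
 qed
 ultimately show ?thesis by (simp add: conv_subst_def conv_word_cw)
qed

lemma isT_vz:
 assumes "isT n th f F" "subst_ok n th" "f [] = 0"
 shows "vz 1 F" unfolding vz_def
proof (intro allI impI)
 fix g :: "'b jfn" assume g: "jacb g" "ALL x. wt x >= 2 * 1 --> g x = 0"
 hence b: "bdd 1 g" by (auto simp: bdd_def)
 have z: "f w * EV (cw n th w) g = 0" for w
 proof (cases w)
  case (Cons x v)
  hence "EV (cw n th w) g = 0" by (intro vz_bdd[OF cw_vz[OF assms(2)] g(1) b]) simp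
  thus ?thesis by simp
 qed (simp add: assms(3))
 have "EV F g = (\<Sum>w | f w ~= 0 & length w <= 1. f w * EV (cw n th w) g)" using assms(1) g(1) b by (simp add: isT_def)
 also have "... = 0" by (rule sum.neutral) (use z in blast)
 finally show "EV F g = 0" .
qed

lemma nc_word_length:
 assumes "!!x. th x [] = 0"
 shows "nc_word th u w ~= 0 ==> length u <= length w"
proof (induction u arbitrary: w)
 case (Cons x u)
 then obtain i where i: "i <= length w" "th x (take i w) * nc_word th u (drop i w) ~= 0" by (auto simp: nc_mult_def elim: sum.not_neutral_contains_not_neutral)
 hence "i ~= 0" using assms by (cases i) auto
 moreover have "nc_word th u (drop i w) ~= 0" using i(2) by auto
 from Cons.IH[OF this] have "length u <= length (drop i w)" .
 ultimately show ?case using i(1) by simp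
qed simp

text \<open>Substitution in two stages. Series without constant term have images of order at least
  1, so they can in turn be substituted into \<open>\<phi>\<close>; a word of length k in them
  involves only words of length at least k, which makes the family of images convergent.\<close>

lemma isT_subst:
 assumes A: "isT n th A FA" "A [] = 0" and B: "isT n th B FB" "B [] = 0" and ok: "subst_ok n th"
 shows "isT n th (nc_subst \<phi> A B) (conv_subst n \<phi> FA FB)"
proof -
 have ok': "subst_ok n (case_xy FA FB)" using A B isT_vz[OF _ ok] isT_jhom by (auto simp: subst_ok_xy)
 have w: "isT n th (nc_word (case_xy A B) u) (cw n (case_xy FA FB) u)" for u
 proof (induction u)
  case Nil
  thus ?case using isT_single[OF ok, of "[]"] by simp
 next
  case (Cons x u)
  thus ?case using A B by (cases x) (auto intro: isT_mult[OF _ _ ok])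
 qed
 have "isT n th (%w. \<Sum>u | length u \<le> length w. \<phi> u * nc_word (case_xy A B) u w) (jsum 0 n (%u. jscale (\<phi> u) (cw n (case_xy FA FB) u)))"
 proof (rule isT_series[OF w _ cw_vz[OF ok'] finite_xy_words ok])
  have "case_xy A B x [] = 0" for x using A(2) B(2) by (cases x) auto
  thus "nc_word (case_xy A B) u w ~= 0 ==> length u <= length w" for u w by (rule nc_word_length)
 qed
 thus ?thesis by (simp add: nc_subst_def conv_subst_def conv_word_cw)
qed

lemma nc_power_length: "f [] = 0 ==> nc_power f k w ~= 0 ==> k <= length w"
proof (induction k arbitrary: w)
 case (Suc k)
 then obtain i where i: "i <= length w" "f (take i w) * nc_power f k (drop i w) ~= 0" by (auto simp: nc_mult_def elim: sum.not_neutral_contains_not_neutral)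
 hence "i ~= 0" using Suc.prems by (cases i) auto
 moreover have "nc_power f k (drop i w) ~= 0" using i(2) by auto
 from Suc.IH[OF Suc.prems(1) this] have "k <= length (drop i w)" .
 ultimately show ?case using i(1) by simp
qed simp

lemma power_hom: "F : jhom 0 n ==> conv_power A_hat alg_A n F k : jhom 0 n" by (induction k) auto

lemma conv_power_vz: "F : jhom 0 n ==> vz 1 F ==> vz k (conv_power A_hat alg_A n F k)"
proof (induction k)
 case 0
 thus ?case by (simp add: vz_0[OF et_jhom])
next
 case (Suc k)
 have e: "1 + k = Suc k" by simp
 show ?case using vz_cv[OF Suc.prems(1,2) power_hom[OF Suc.prems(1)] Suc.IH[OF Suc.prems], unfolded e] by simp
qed

lemma isT_exp:
 assumes f: "isT n th f F" "f [] = 0" and ok: "subst_ok n th"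
 shows "isT n th (nc_exp f) (exp_conv n F)"
proof -
 have p: "isT n th (nc_power f k) (conv_power A_hat alg_A n F k)" for k
 proof (induction k)
  case 0
  thus ?case using isT_single[OF ok, of "[]"] by simp
 next
  case (Suc k)
  thus ?case by (auto intro: isT_mult[OF f(1) _ ok])
 qed
 have "isT n th (%w. \<Sum>k | k \<le> length w. 1 / fact k * nc_power f k w) (jsum 0 n (%k. jscale (1 / fact k) (conv_power A_hat alg_A n F k)))"
  by (rule isT_series[OF p _ conv_power_vz[OF isT_jhom[OF f(1)] isT_vz[OF f(1) ok f(2)]] _ ok])
   (auto simp: nc_power_length[of f, OF f(2)])
 moreover have "(\<Sum>k | k \<le> length w. 1 / fact k * nc_power f k w) = nc_exp f w" for w by (simp add: nc_exp_def atMost_def)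
 ultimately show ?thesis by (simp add: exp_conv_def)
qed

section \<open>Products of chord diagrams and their four-term relations\<close>

section \<open>Products of chords\<close>

definition lin :: "nat => 'a sym list list => (nat + 'a) sym list => 'a sym list" where
 "lin j As u = concat (map (%x. case x of Lg e => [Lg e] | Sp => [Sp] | Lt z s =>
  (case z of Inr a => [Lt a s] | Inl i => if j <= i & i < j + length As then As ! (i - j) else [])) u)"

lemma lin_simps [simp]: "lin j As [] = []" "lin j As (u @ v) = lin j As u @ lin j As v"
 "lin j As (Lg e # u) = Lg e # lin j As u" "lin j As (Sp # u) = Sp # lin j As u"
 "lin j As (Lt (Inr a) s # u) = Lt a s # lin j As u"
 "lin j As (Lt (Inl i) s # u) = (if j <= i & i < j + length As then As ! (i - j) else []) @ lin j As u" by (simp_all add: lin_def)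

abbreviation isvar :: "nat => (nat + 'a) sym => bool" where
 "isvar i == %x. EX s. x = Lt (Inl i) s"

lemma filter_isvar_free: "filter (isvar i) u = [] <-> free_of (Inl i) u" by (auto simp: filter_empty_conv free_of_def)

lemma lin_Nil: "lin j [] u = lmap lstrip u"
proof (induction u)
 case (Cons x u)
 show ?case
 proof (cases x)
  case (Lt z s)
  thus ?thesis using Cons by (cases z; cases s) auto
 qed (use Cons in auto)
qed simp

lemma lin_Cons_free: "free_of (Inl j) u ==> lin j (L # As) u = lin (Suc j) As u"
proof (induction u)
 case (Cons x u)
 show ?case
 proof (cases x)
  case (Lt z s)
  show ?thesis
  proof (cases z)
   case (Inl i)
   hence "i ~= j" using Cons.prems Lt by (auto simp: free_of_def)
   thus ?thesis using Cons Lt Inl by (auto simp: nth_Cons' Suc_le_eq) (simp_all only: Suc_eq_plus1)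
  qed (use Cons Lt in auto)
 qed (use Cons in auto)
qed simp

lemma lin_inr: "lin j As (inr L) = L"
proof (induction L)
 case (Cons x L)
 thus ?case by (cases x) auto
qed simp

text \<open>Substituting arcs for letters that occur exactly once.\<close>

lemma vm_linear:
 assumes "ALL L:set As. arc L" "ALL i. j <= i & i < j + length As --> filter (isvar i) u = [Lt (Inl i) True]"
 shows "vm j (fa As) (%w. g (lmap lstrip w)) u = g (lin j As u)" using assms
proof (induction As arbitrary: j u)
 case Nil
 thus ?case by (simp add: lin_Nil)
next
 case (Cons L As)
 have "filter (isvar j) u = [Lt (Inl j) True]" using Cons.prems(2) by simp
 from filter_eq_ConsD[OF this] obtain p q where
  pq0: "u = p @ Lt (Inl j) True # q" "ALL x:set p. ~ isvar j x" "[] = filter (isvar j) q" by blast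
 have "free_of (Inl j) p" using pq0(2) by (auto simp: free_of_def)
 moreover have "free_of (Inl j) q" using filter_isvar_free[of j q] pq0(3) by simp
 ultimately have pq: "u = p @ Lt (Inl j) True # q" "free_of (Inl j) p" "free_of (Inl j) q" using pq0(1) by simp_all
 let ?K = "%w. g (lmap lstrip w)"
 have L: "arc L" using Cons.prems(1) by simp
 have "vm j (fa (L # As)) ?K u = vm j L (vm (Suc j) (fa As) ?K) (p @ [Lt (Inl j) True] @ q)" using vm_arc_append[OF L, of j "Sp # fa As" ?K u] pq(1) by simp
 also have "... = vm (Suc j) (fa As) ?K (p @ inr L @ [Lt (Inl j) True] @ q)" using vm_arc_context[OF L pq(2,3), of "vm (Suc j) (fa As) ?K" "[Lt (Inl j) True]"]
   vm_single[OF L, of j "[]" "%v. vm (Suc j) (fa As) ?K (p @ v @ q)"] by simp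
 also have "... = g (lin (Suc j) As (p @ inr L @ [Lt (Inl j) True] @ q))"
 proof (rule Cons.IH)
  show "ALL i. Suc j <= i & i < Suc j + length As --> filter (isvar i) (p @ inr L @ [Lt (Inl j) True] @ q) = [Lt (Inl i) True]"
  proof (intro allI impI)
   fix i assume i: "Suc j <= i & i < Suc j + length As"
   have "filter (isvar i) u = [Lt (Inl i) True]" using Cons.prems(2) i by simp
   moreover have "filter (isvar i) (inr L) = []" unfolding filter_isvar_free by simp
   ultimately show "filter (isvar i) (p @ inr L @ [Lt (Inl j) True] @ q) = [Lt (Inl i) True]" using pq(1) i by auto
  qed
 qed (use Cons.prems(1) in simp)
 also have "lin (Suc j) As (p @ inr L @ [Lt (Inl j) True] @ q) = lin j (L # As) u" using pq by (simp add: lin_Cons_free lin_inr)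
 finally show ?case .
qed

lemma vs_linear:
 assumes "ALL L:set As. arc L" "ALL i. j <= i & i < j + length As --> filter (isvar i) u = [Lt (Inl i) True]"
 shows "vs j (fa As) g u = g (lin j As u)" unfolding vs_eq_vm by (rule vm_linear[OF assms])

lemma concat_single: "a <= k ==> k < b ==> concat (map (%i. if i = k then x else []) [a..<b]) = x"
proof -
 assume k: "a <= k" "k < b"
 have u: "[a..<b] = [a..<k] @ k # [Suc k..<b]" using k upt_add_eq_append[of a k "b - k"] upt_conv_Cons[of k b] by simp
 have e: "concat (map (%i. if i = k then x else []) [a..<k]) = []" "concat (map (%i. if i = k then x else []) [Suc k..<b]) = []" by auto
 show ?thesis unfolding u map_append concat_append list.map concat.simps e by simp
qed

lemma lin_concat: "lin j As (concat us) = concat (map (lin j As) us)" by (induction us) auto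

lemma vs_mu:
 assumes arcs: "ALL L:set As. arc L" "ALL L:set Bs. arc L" and n: "length As = n" "length Bs = n"
 shows "vs 1 (fa As @ fa Bs) G (inl (fa (map lts (muw n)))) = G (fa (map (%k. Bs ! (k - 1) @ As ! (k - 1)) [1..<n+1]))"
proof -
 let ?u = "inl (fa (map lts (muw n))) :: (nat + 'a) sym list"
 have u: "?u = concat (map (%k. [Lt (Inl (n + k)) True, Lt (Inl k) True, Sp]) [1..<n+1])"
 proof -
  have "inl (fa (map lts (map (%k. [(n + k, True), (k, True)]) ks))) = concat (map (%k. [Lt (Inl (n + k)) True, Lt (Inl k) True, Sp]) ks)" for ks by (induction ks) auto
  thus ?thesis by (simp add: muw_def)
 qed
 have "vs 1 (fa (As @ Bs)) G ?u = G (lin 1 (As @ Bs) ?u)"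
 proof (rule vs_linear)
  show "ALL i. 1 <= i & i < 1 + length (As @ Bs) --> filter (isvar i) ?u = [Lt (Inl i) True]"
  proof (intro allI impI)
   fix i assume i: "1 <= i & i < 1 + length (As @ Bs)"
   define k0 where "k0 = (if i <= n then i else i - n)"
   have k0: "1 <= k0" "k0 < n + 1" using i n by (auto simp: k0_def)
   have "filter (isvar i) ?u = concat (map (%k. filter (isvar i) [Lt (Inl (n + k)) True, Lt (Inl k) True, Sp]) [1..<n+1])" unfolding u filter_concat by (simp add: comp_def)
   also have "... = concat (map (%k. if k = k0 then [Lt (Inl i) True] else []) [1..<n+1])"
   proof (rule arg_cong[where f = concat], rule map_cong[OF refl])
   fix k assume "k : set [1..<n+1]"
   hence "1 <= k" "k <= n" by auto
   thus "filter (isvar i) [Lt (Inl (n + k)) True, Lt (Inl k) True, Sp] = (if k = k0 then [Lt (Inl i) True] else [])" using i n by (auto simp: k0_def)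
   qed
   also have "... = [Lt (Inl i) True]" by (rule concat_single[OF k0])
   finally show "filter (isvar i) ?u = [Lt (Inl i) True]" .
  qed
 qed (use arcs in auto)
 also have "lin 1 (As @ Bs) ?u = concat (map (%k. lin 1 (As @ Bs) [Lt (Inl (n + k)) True, Lt (Inl k) True, Sp]) [1..<n+1])" unfolding u lin_concat by (simp only: map_map comp_def)
 also have "... = concat (map (%k. Bs ! (k - 1) @ As ! (k - 1) @ [Sp]) [1..<n+1])"
 proof (rule arg_cong[where f = concat], rule map_cong[OF refl])
  fix k assume "k : set [1..<n+1]"
  hence k: "1 <= k" "k <= n" by auto
  hence "~ n + k - 1 < n" "k - 1 < n" "n + k - 1 - n = k - 1" by linarith+
  thus "lin 1 (As @ Bs) [Lt (Inl (n + k)) True, Lt (Inl k) True, Sp] = Bs ! (k - 1) @ As ! (k - 1) @ [Sp]" using k n by (simp add: nth_append)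
 qed
 finally show ?thesis by (simp add: fa_def comp_def)
qed

lemma Bm_arcs:
 assumes arcs: "ALL L:set As. arc L" "ALL L:set Bs. arc L" and n: "length As = n" "length Bs = n"
 shows "Bm n m g (fa As, V) (fa Bs, W) =
  g (fa (map (%k. sh m (map (rl (od o od)) (Bs ! (k - 1))) @ map (rl (od o ev)) (As ! (k - 1))) [1..<n+1]),
   rv (od o ev) V + rv (od o od) W)"
proof -
 have t: "map (rl od) (fst (tp m (fa As, V) (fa Bs, W))) = fa (map (map (rl (od o ev))) As) @ fa (map (%L. sh m (map (rl (od o od)) L)) Bs)"
  by (simp add: tp_def map_rl_sh map_rl_fa) (simp add: sh_def lmap_fa comp_def)
 have "Bm n m g (fa As, V) (fa Bs, W) = vs 1 (fa (map (map (rl (od o ev))) As) @ fa (map (%L. sh m (map (rl (od o od)) L)) Bs))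
  (%v. g (v, rv (od o ev) V + rv (od o od) W)) (inl (fa (map lts (muw n))))" unfolding Bm_def Cg_def t by (simp add: bw_def) (simp add: tp_def)
 also have "... = g (fa (map (%k. map (%L. sh m (map (rl (od o od)) L)) Bs ! (k - 1) @ map (map (rl (od o ev))) As ! (k - 1)) [1..<n+1]),
   rv (od o ev) V + rv (od o od) W)" by (rule vs_mu) (use arcs n in auto)
 also have "map (%k. map (%L. sh m (map (rl (od o od)) L)) Bs ! (k - 1) @ map (map (rl (od o ev))) As ! (k - 1)) [1..<n+1] =
  map (%k. sh m (map (rl (od o od)) (Bs ! (k - 1))) @ map (rl (od o ev)) (As ! (k - 1))) [1..<n+1]" by (rule map_cong[OF refl]) (use n in auto)
 finally show ?thesis .
qed

definition lw :: "nat => (nat => nat sym list) => dword" where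
 "lw n L = (fa (map L [1..<n+1]), {#})"

definition lgs :: "nat sym list => bool" where
 "lgs u <-> (EX ls. u = map Lg ls)"

lemma lgs_simps [simp]: "lgs []" "lgs (Lg e # u) = lgs u" "lgs (u @ v) <-> lgs u & lgs v" "~ lgs (Sp # u)" "~ lgs (Lt i s # u)"
 "lgs (map (rl sg) u) = lgs u"
proof -
 have lgs: "lgs u <-> (ALL x:set u. EX e. x = Lg e)" for u unfolding lgs_def by (induction u) (auto simp: Cons_eq_map_conv)
 have "(EX e. rl sg x = Lg e) <-> (EX e. x = Lg e)" for x :: "nat sym" by (cases x) auto
 thus "lgs (map (rl sg) u) = lgs u" unfolding lgs by simp
 show "lgs []" "lgs (Lg e # u) = lgs u" "lgs (u @ v) <-> lgs u & lgs v" "~ lgs (Sp # u)" "~ lgs (Lt i s # u)" unfolding lgs by auto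
qed

lemma lgs_arc: "lgs u ==> arc u" by (auto simp: lgs_def arc_def)

lemma lgs_lmap [simp]: "lgs u ==> sh m u = u" by (auto simp: lgs_def sh_def) (induct_tac ls, auto)

lemma lw_rl: "jacb g ==> inj sg ==> g (lw n (%k. map (rl sg) (L k))) = g (lw n L)"
 using jacb_rel[of g sg "fa (map L [1..<n+1])" "{#}"] by (simp add: lw_def map_rl_fa comp_def)

lemma lw_cong: "(!!k. 1 <= k ==> k <= n ==> L k = M k) ==> lw n L = lw n M" unfolding lw_def by (auto intro!: arg_cong[where f = fa] map_cong)

definition isl :: "nat => 'k::field jmor => (nat => nat sym list) => bool" where
 "isl n F L <-> isx 0 n F (lw n L) & (ALL k. lgs (L k))"

lemma EV_cv_isl:
 assumes F: "isl n F L" and G: "isl n G M" and g: "jacb g"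
 shows "EV (cv n F G) g = g (lw n (%k. map (rl (od o od)) (M k) @ map (rl (od o ev)) (L k)))"
proof -
 have x: "isx 0 n F (lw n L)" "isx 0 n G (lw n M)" and l: "!!k. lgs (L k)" "!!k. lgs (M k)" using F G by (auto simp: isl_def)
 have "EV (cv n F G) g = EV F (%x. EV G (Bm n 0 g x))" by (rule EV_cv[OF isx_jhom[OF x(1)] isx_jhom[OF x(2)] g])
 also have "... = Bm n 0 g (lw n L) (lw n M)" by (simp add: isx_EV[OF x(2) bijac_right[OF bijac_Bm[OF g]]] isx_EV[OF x(1) bijac_left[OF bijac_Bm[OF g]]])
 also have "... = g (fa (map (%k. sh 0 (map (rl (od o od)) (map M [1..<n+1] ! (k - 1))) @ map (rl (od o ev)) (map L [1..<n+1] ! (k - 1))) [1..<n+1]), {#})"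
  unfolding lw_def by (subst Bm_arcs) (use l lgs_arc in auto)
 also have "... = g (lw n (%k. map (rl (od o od)) (M k) @ map (rl (od o ev)) (L k)))"
  unfolding lw_def by (intro arg_cong[where f = g] arg_cong[where f = "%z. (fa z, {#})"] map_cong refl) auto
 finally show ?thesis .
qed

text \<open>The arcs of a diagram with one chord. For \<open>i = j\<close> both ends lie on the same
  arc, which describes the loop used for the ribbon element.\<close>

definition cl :: "nat => nat => nat => nat => nat sym list" where
 "cl i j l k = (if k = i then [Lg l] else []) @ (if k = j then [Lg l] else [])"

lemma lgs_cl [simp]: "lgs (cl i j l k)" by (simp add: cl_def)

lemma rl_cl [simp]: "map (rl sg) (cl i j l k) = cl i j (sg l) k" by (simp add: cl_def)

lemma legs_fa: "legs (fa As) = concat (map legs As)" by (induction As) auto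

lemma isl_chord:
 assumes "{i, j} <= {1..n}" "i ~= j"
 shows "isl n (chord_A n i j) (cl i j 0)"
proof -
 let ?A = "map (%k. if k = i \<or> k = j then [Leg 0] else []) [1..<n+1] :: fword item list list"
 have f: "fl ?A = fa (map (cl i j 0) [1..<n+1])" unfolding fl_def using assms by (auto simp: cl_def intro!: arg_cong[where f = fa])
 have cnt: "mset (concat (map (%k. if k = i then [l] else []) [1..<n+1])) = {#l#}" if "i : {1..n}" for i l :: nat using concat_single[of 1 i "n + 1" "[l]"] that by simp
 have "mset (concat (map (%k. legs (cl i j 0 k)) ks)) = mset (concat (map (%k. if k = i then [0] else []) ks)) + mset (concat (map (%k. if k = j then [0] else []) ks))" for ks
  by (induction ks) (auto simp: cl_def)
 hence "mset (legs (fl ?A)) = {#0, 0#}" unfolding f legs_fa using cnt assms by (simp add: comp_def)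
 hence "okV (legs (fl ?A)) {#} = okV [0, 0] {#}" by (intro okV_mset) simp
 moreover have "okV [0, 0] {#}" by (auto simp: okV_def)
 moreover have "set (beads (JD ?A {#})) <= carrier (free_group 0)" unfolding beads_iff by (auto split: if_splits)
 ultimately have "JD ?A {#} : jdiags (free_group 0) n" by (simp add: jdiags_iff)
 hence "isx 0 n (jdiag_mor 0 n ?A) (fl ?A, {#})" by (rule isx_jdiag_mor)
 thus ?thesis unfolding f isl_def lw_def chord_A_def by simp
qed

lemma lw_split2:
 assumes "1 <= i" "i < j" "j <= n"
 shows "lw n L = (fa (map L [1..<i]) @ L i @ Sp # fa (map L [Suc i..<j]) @ L j @ Sp # fa (map L [Suc j..<n+1]), {#})"
proof -
 have "[1..<n+1] = [1..<i] @ i # [Suc i..<j] @ j # [Suc j..<n+1]" using assms upt_add_eq_append[of 1 i "n + 1 - i"] upt_conv_Cons[of i "n + 1"]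
   upt_add_eq_append[of "Suc i" j "n + 1 - j"] upt_conv_Cons[of j "n + 1"] by (simp add: Suc_le_eq)
 thus ?thesis by (simp add: lw_def del: upt_Suc)
qed

lemma lw_split1:
 assumes "1 <= i" "i <= n"
 shows "lw n L = (fa (map L [1..<i]) @ L i @ Sp # fa (map L [Suc i..<n+1]), {#})"
proof -
 have "[1..<n+1] = [1..<i] @ i # [Suc i..<n+1]" using assms upt_add_eq_append[of 1 i "n + 1 - i"] upt_conv_Cons[of i "n + 1"] by simp
 thus ?thesis by (simp add: lw_def del: upt_Suc)
qed

lemma legs_fa_free: "(!!k. k : set ks ==> e ~: set (legs (B k))) ==> e ~: set (legs (fa (map B ks)))" by (auto simp: legs_fa)

lemma lw_four_term:
 assumes g: "jac {} g" and ij: "1 <= i" "i < j" "j <= n" and k: "k ~= i" "k ~= j" and l: "l ~= e"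
 shows "g (lw n (%p. cl i k l p @ cl i j e p)) + g (lw n (%p. cl j k l p @ cl i j e p)) =
  g (lw n (%p. cl i j e p @ cl i k l p)) + g (lw n (%p. cl i j e p @ cl j k l p))"
proof -
 define B where "B p = (if p = k then [Lg l :: nat sym] else [])" for p
 let ?u = "fa (map B [1..<i])" and ?v = "Sp # fa (map B [Suc i..<j])" and ?w = "Sp # fa (map B [Suc j..<n+1])"
 have m: "map X [1..<i] = map B [1..<i] & map X [Suc i..<j] = map B [Suc i..<j] & map X [Suc j..<n+1] = map B [Suc j..<n+1]"
  if "ALL p. p ~= i --> p ~= j --> X p = B p" for X using that ij by auto
 have X: "lw n X = (?u @ X i @ ?v @ X j @ ?w, {#})" if "ALL p. p ~= i --> p ~= j --> X p = B p" for X
  unfolding lw_split2[OF ij] using m[OF that] by (simp del: map_eq_conv)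
 have 1: "lw n (%p. cl i k l p @ cl i j e p) = (?u @ Lg l # Lg e # ?v @ Lg e # ?w, {#})" by (subst X) (use ij k in "auto simp: cl_def B_def")
 have 2: "lw n (%p. cl j k l p @ cl i j e p) = (?u @ Lg e # ?v @ Lg l # Lg e # ?w, {#})" by (subst X) (use ij k in "auto simp: cl_def B_def")
 have 3: "lw n (%p. cl i j e p @ cl i k l p) = (?u @ Lg e # Lg l # ?v @ Lg e # ?w, {#})" by (subst X) (use ij k in "auto simp: cl_def B_def")
 have 4: "lw n (%p. cl i j e p @ cl j k l p) = (?u @ Lg e # ?v @ Lg e # Lg l # ?w, {#})" by (subst X) (use ij k in "auto simp: cl_def B_def")
 have e: "e ~: set (legs (B p))" for p using l by (simp add: B_def)
 have "g (?u @ Lg l # Lg e # ?v @ Lg e # ?w, {#}) - g (?u @ Lg e # Lg l # ?v @ Lg e # ?w, {#})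
   + g (?u @ Lg e # ?v @ Lg l # Lg e # ?w, {#}) - g (?u @ Lg e # ?v @ Lg e # Lg l # ?w, {#}) = 0" by (rule jac_four_term[OF g]) (use l legs_fa_free[of _ e B] e in auto)
 thus ?thesis unfolding 1 2 3 4 by (simp add: algebra_simps)
qed

text \<open>The four-term relation for a chord whose ends are adjacent: the two terms with the leg
  between these ends cancel, so a leg can be moved past the whole chord.\<close>

lemma lw_isolated:
 assumes g: "jac {} g" and i: "1 <= i" "i <= n" and k: "k ~= i" and l: "l ~= e"
 shows "g (lw n (%p. cl i k l p @ cl i i e p)) = g (lw n (%p. cl i i e p @ cl i k l p))"
proof -
 define B where "B p = (if p = k then [Lg l :: nat sym] else [])" for p
 let ?u = "fa (map B [1..<i])" and ?w = "Sp # fa (map B [Suc i..<n+1])"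
 have X: "lw n X = (?u @ X i @ ?w, {#})" if "ALL p. p ~= i --> X p = B p" for X
 proof -
  have "map X [1..<i] = map B [1..<i]" "map X [Suc i..<n+1] = map B [Suc i..<n+1]" using that by auto
  thus ?thesis unfolding lw_split1[OF i] by (simp del: map_eq_conv)
 qed
 have 1: "lw n (%p. cl i k l p @ cl i i e p) = (?u @ Lg l # Lg e # [] @ Lg e # ?w, {#})" by (subst X) (use i k in "auto simp: cl_def B_def")
 have 2: "lw n (%p. cl i i e p @ cl i k l p) = (?u @ Lg e # [] @ Lg e # Lg l # ?w, {#})" by (subst X) (use i k in "auto simp: cl_def B_def")
 have e: "e ~: set (legs (B p))" for p using l by (simp add: B_def)
 have "g (?u @ Lg l # Lg e # [] @ Lg e # ?w, {#}) - g (?u @ Lg e # Lg l # [] @ Lg e # ?w, {#})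
   + g (?u @ Lg e # [] @ Lg l # Lg e # ?w, {#}) - g (?u @ Lg e # [] @ Lg e # Lg l # ?w, {#}) = 0" by (rule jac_four_term[OF g]) (use l legs_fa_free[of _ e B] e in auto)
 thus ?thesis unfolding 1 2 by simp
qed

text \<open>The labels 1 and 3 are what label 0 becomes in the first and in the second factor of a
  product. Exchanging them lets the products in the two orders be written with the same
  labels.\<close>

definition swp :: "nat => nat" where "swp e = (if e = 1 then 3 else if e = 3 then 1 else e)"

lemma swp [simp]: "inj swp" "swp 1 = 3" "swp 3 = 1" by (auto simp: swp_def inj_def)

lemma EV_cv_cl:
 assumes F: "isl n F (cl i j 0)" and G: "isl n G (cl k l 0)" and g: "jacb g"
 shows "EV (cv n F G) g = g (lw n (%p. cl k l 3 p @ cl i j 1 p))"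
  and "EV (cv n F G) g = g (lw n (%p. cl k l 1 p @ cl i j 3 p))"
proof -
 show 1: "EV (cv n F G) g = g (lw n (%p. cl k l 3 p @ cl i j 1 p))" unfolding EV_cv_isl[OF F G g] by simp
 show "EV (cv n F G) g = g (lw n (%p. cl k l 1 p @ cl i j 3 p))" unfolding 1 using lw_rl[OF g swp(1), of n "%p. cl k l 3 p @ cl i j 1 p"] by simp
qed

lemma cl_commute: "cl i j l = cl j i l" by (rule ext) (simp add: cl_def)

lemma chord_four_term:
 assumes F: "isl n F (cl i j 0)" and G: "isl n G (cl i k 0)" and H: "isl n H (cl j k 0)"
  and r: "{i, j, k} <= {1..n}" "distinct [i, j, k]" and g: "jacb g"
 shows "EV (cv n F G) g + EV (cv n F H) g = EV (cv n G F) g + EV (cv n H F) g"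
proof -
 have j: "jac {} g" using g by (simp add: jacb_iff)
 show ?thesis
 proof (cases "i < j")
  case True
  thus ?thesis unfolding EV_cv_cl(1)[OF F G g] EV_cv_cl(1)[OF F H g] EV_cv_cl(2)[OF G F g] EV_cv_cl(2)[OF H F g] using lw_four_term[OF j, of i j n k 3 1] r by simp
 next
  case False
  thus ?thesis unfolding EV_cv_cl(1)[OF F G g] EV_cv_cl(1)[OF F H g] EV_cv_cl(2)[OF G F g] EV_cv_cl(2)[OF H F g]
   using lw_four_term[OF j, of j i n k 3 1] r by (simp add: cl_commute[of j i] add.commute)
 qed
qed

lemma chord_locality:
 assumes F: "isl n F (cl i j 0)" and G: "isl n G (cl k l 0)" and r: "{i, j} Int {k, l} = {}"
 shows "cv n F G = cv n G F"
proof (rule jhom_ext)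
 have h: "F : jhom 0 n" "G : jhom 0 n" using F G by (auto simp: isl_def isx_def)
 thus "cv n F G : jhom 0 n" "cv n G F : jhom 0 n" by simp_all
 fix g :: "'a jfn" assume g: "jacb g"
 have "lw n (%p. cl k l 3 p @ cl i j 1 p) = lw n (%p. cl i j 1 p @ cl k l 3 p)" by (rule lw_cong) (use r in "auto simp: cl_def")
 thus "EV (cv n F G) g = EV (cv n G F) g" unfolding EV_cv_cl(1)[OF F G g] EV_cv_cl(2)[OF G F g] by simp
qed

lemma chord_isolated:
 assumes F: "isl n F (cl i i 0)" and G: "isl n G (cl i k 0)" and r: "i : {1..n}" "k ~= i"
 shows "cv n F G = cv n G F"
proof (rule jhom_ext)
 have h: "F : jhom 0 n" "G : jhom 0 n" using F G by (auto simp: isl_def isx_def)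
 thus "cv n F G : jhom 0 n" "cv n G F : jhom 0 n" by simp_all
 fix g :: "'a jfn" assume g: "jacb g"
 hence j: "jac {} g" by (simp add: jacb_iff)
 show "EV (cv n F G) g = EV (cv n G F) g" unfolding EV_cv_cl(1)[OF F G g] EV_cv_cl(2)[OF G F g] using lw_isolated[OF j, of i n k 3 1] r by simp
qed

section \<open>Chords as images of the generators of the infinitesimal braid Lie algebra\<close>

subsection \<open>Relations of the Drinfeld-Kohno algebra\<close>

text \<open>The value at a pair that is not a generator is arbitrary; some chord is chosen, so that
  every letter has an image of order at least 1, as substitution requires.\<close>

definition ch :: "nat => nat * nat => 'k::field jmor" where
 "ch n p = (if {fst p, snd p} <= {1..n} & fst p ~= snd p then chord_A n (fst p) (snd p) else chord_A n 1 2)"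

lemma isl_ch: "{i, j} <= {1..n} ==> i ~= j ==> isl n (ch n (i, j)) (cl i j 0)" using isl_chord by (simp add: ch_def)

lemma vz_isx: "isx m n F x ==> wt x >= 2 * d ==> vz d F"
proof -
 assume x: "isx m n F x" "wt x >= 2 * d"
 show ?thesis unfolding vz_def
 proof (intro allI impI)
  fix g :: "'a jfn" assume g: "jacb g" "ALL x. wt x >= 2 * d --> g x = 0"
  hence "g x = 0" using x(2) by blast
  thus "EV F g = 0" using isx_EV[OF x(1) g(1)] by simp
 qed
qed

lemma chord_vz:
 assumes "isl n F (cl i j 0)" "{i, j} <= {1..n}"
 shows "F : jhom 0 n & vz 1 F"
proof -
 have x: "isx 0 n F (lw n (cl i j 0))" using assms(1) by (simp add: isl_def)
 have "mset (concat (map (%k. legs (cl i j 0 k)) ks)) = mset (concat (map (%k. if k = i then [0] else []) ks)) + mset (concat (map (%k. if k = j then [0] else []) ks))" for ks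
  by (induction ks) (auto simp: cl_def)
 moreover have "concat (map (%k. if k = i then [0] else []) [1..<n+1]) = [0::nat]" if "i : {1..n}" for i by (rule concat_single) (use that in auto)
 ultimately have "mset (legs (fst (lw n (cl i j 0)))) = {#0, 0#}" using assms(2) by (simp add: lw_def legs_fa comp_def)
 hence "length (legs (fst (lw n (cl i j 0)))) = 2" by (metis size_mset size_add_mset size_empty numeral_2_eq_2)
 hence "wt (lw n (cl i j 0)) >= 2 * 1" by (simp add: wt_def)
 thus ?thesis using vz_isx[OF x] isx_jhom[OF x] by blast
qed

lemma subst_ok_ch: "n >= 2 ==> subst_ok n (ch n)" unfolding subst_ok_def ch_def using chord_vz[OF isl_chord] by auto

lemma bijac_flip: "bijac B ==> bijac (%x y. B y x)" unfolding bijac_def by (metis add.commute)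

text \<open>The outer factors of a product can be absorbed into the test function. A relation in the
  middle of a product thus only has to be checked by itself.\<close>

lemma cv_context:
 assumes F: "F : jhom 0 n" and H: "H : jhom 0 n" and g: "jacb g"
 obtains g' where "jacb g'" "ALL X:jhom 0 n. EV (cv n F (cv n X H)) g = EV X g'"
proof -
 define g1 where "g1 = (%y. EV F (%x. Bm n 0 g x y))"
 have g1: "jacb g1" unfolding g1_def by (rule jacb_EV[OF F bijac_flip[OF bijac_Bm[OF g]]])
 obtain e where e: "bdd e g" using g by (auto simp: jacb_iff)
 have 1: "EV (cv n F Y) g = EV Y g1" if Y: "Y : jhom 0 n" for Y unfolding EV_cv[OF F Y g] g1_def by (rule EV_Fubini[OF F Y, of e]) (use e in "auto intro!: Bm_zero simp: bdd_def")
 show ?thesis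
 proof (rule that)
  show "jacb (%x. EV H (Bm n 0 g1 x))" by (rule jacb_EV[OF H bijac_Bm[OF g1]])
  show "ALL X:jhom 0 n. EV (cv n F (cv n X H)) g = EV X (%x. EV H (Bm n 0 g1 x))" using 1 H by (simp add: EV_cv[OF _ H g1])
 qed
qed

text \<open>After the surrounding words have been absorbed by \<open>cv_context\<close>, each kind
  of relator is a statement about one or two chords: symmetry of a chord, the four-term relation, or
  commutation of chords on disjoint arcs.\<close>

lemma t_rel_vanish:
 fixes g :: "'k::field jfn"
 assumes r: "r : t_rel n" and n: "n >= 2" and g: "jacb g"
 shows "fsupp (single u \<star> r \<star> single v) & pr (%w. EV (cw n (ch n) w) g) (single u \<star> r \<star> single v) = 0"
proof -
 have ok: "subst_ok n (ch n :: _ => 'k jmor)" by (rule subst_ok_ch[OF n])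
 let ?h = "%w. EV (cw n (ch n) w) g"
 obtain g' where g': "jacb g'" "ALL X:jhom 0 n. EV (cv n (cw n (ch n) u) (cv n X (cw n (ch n) v))) g = EV X g'" by (rule cv_context[OF cw_jhom[OF ok] cw_jhom[OF ok] g])
 have h: "?h (u @ w @ v) = EV (cw n (ch n) w) g'" for w using g'(2) cw_jhom[OF ok] by (simp add: cw_append[OF ok])
 have c: "(ch n p :: 'k jmor) : jhom 0 n" for p using ok unfolding subst_ok_def by blast
 have h2: "?h (u @ [p, q] @ v) = EV (cv n (ch n p) (ch n q)) g'" for p q unfolding h by (simp add: cv_unit_right[OF c])
 have s: "single u \<star> single w \<star> single v = (single (u @ w @ v) :: _ => 'k)" for w by (simp add: single_mult)
 show ?thesis using r
 proof cases
  case (symm i j)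
  have "ch n (i, j) = (ch n (j, i) :: 'k jmor)" unfolding ch_def chord_A_def by (auto intro!: arg_cong2[where f = "jdiag_mor 0"])
  hence "?h (u @ [(i, j)] @ v) = ?h (u @ [(j, i)] @ v)" unfolding h by simp
  thus ?thesis unfolding symm(1) nc_mult_diff_left nc_mult_diff_right s by (simp add: pr_diff fsupp_diff del: fun_diff_def)
 next
  case (four_term i j k)
  let ?s = "%p q. single (u @ [p, q] @ v) :: _ => 'k"
  have "single u \<star> r \<star> single v = (?s (i, j) (i, k) + ?s (i, j) (j, k)) - (?s (i, k) (i, j) + ?s (j, k) (i, j))" unfolding four_term(1) nc_bracket_def
   by (simp only: nc_mult_diff_left nc_mult_diff_right nc_mult_add_left nc_mult_add_right single_mult append.simps append_assoc)
  moreover have "EV (cv n (ch n (i, j)) (ch n (i, k))) g' + EV (cv n (ch n (i, j)) (ch n (j, k))) g' =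
   EV (cv n (ch n (i, k)) (ch n (i, j))) g' + EV (cv n (ch n (j, k)) (ch n (i, j))) g'" by (rule chord_four_term[OF isl_ch isl_ch isl_ch four_term(2,3) g'(1)]) (use four_term in auto)
  ultimately show ?thesis using h2 by (simp add: pr_diff pr_add fsupp_diff fsupp_add del: fun_diff_def plus_fun_apply)
 next
  case (locality i j k l)
  have "single u \<star> r \<star> single v = single (u @ [(i, j), (k, l)] @ v) - single (u @ [(k, l), (i, j)] @ v)" unfolding locality(1) nc_bracket_def
   by (simp only: nc_mult_diff_left nc_mult_diff_right single_mult append.simps append_assoc)
  moreover have "cv n (ch n (i, j)) (ch n (k, l)) = cv n (ch n (k, l)) (ch n (i, j) :: 'k jmor)" by (rule chord_locality[OF isl_ch isl_ch]) (use locality in auto)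
  ultimately show ?thesis using h2 by (simp add: pr_diff fsupp_diff del: fun_diff_def)
 qed
qed

text \<open>Congruent series have equal images, so substitution of chords is defined on the
  completed enveloping algebra. Only finitely many lengths matter for a bounded test function, and
  in each length the difference is in the span of the ideal, on which the test function
  vanishes.\<close>

lemma isT_t_eq:
 assumes f: "isT n (ch n) f F" and f': "isT n (ch n) f' F'" and n: "n >= 2" and t: "t_eq n f f'"
 shows "F = F'"
proof (rule jhom_ext[OF isT_jhom[OF f] isT_jhom[OF f']])
 fix g :: "'a jfn" assume g: "jacb g"
 have ok: "subst_ok n (ch n :: _ => 'a jmor)" by (rule subst_ok_ch[OF n])
 obtain e where e: "bdd e g" using g by (auto simp: jacb_iff)
 let ?h = "%w. EV (cw n (ch n) w) g"
 let ?W = "{w. f w ~= 0 & length w <= e} Un {w. f' w ~= 0 & length w <= e}"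
 have W: "finite ?W" using f f' by (auto simp: isT_def sfin_def)
 have "EV F g - EV F' g = (SUM w:?W. (f - f') w * ?h w)" using isT_superset[OF f g e W _ ok] isT_superset[OF f' g e W _ ok] by (simp add: sum_subtractf left_diff_distrib)
 also have "... = (SUM d<=e. \<Sum>w | w : ?W & length w = d. (f - f') w * ?h w)" by (rule sum.group[symmetric, OF W]) auto
 also have "... = 0"
 proof (rule sum.neutral, intro ballI)
  fix d assume d: "d : {..e}"
  have sp: "homog_part length d (f - f') : coeff_fun.span (t_ideal n)" using t by (simp add: t_eq_def deg_cong_def)
  have "fsupp (homog_part length d (f - f')) & pr ?h (homog_part length d (f - f')) = 0" by (rule span_pr_zero[OF sp]) (use t_rel_vanish[OF _ n g] in "auto simp: t_ideal_def")
  moreover have "pr ?h (homog_part length d (f - f')) = (\<Sum>w | w : ?W & length w = d. homog_part length d (f - f') w * ?h w)"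
   by (rule pr_superset) (use W d in "auto simp: homog_part_def")
  moreover have "... = (\<Sum>w | w : ?W & length w = d. (f - f') w * ?h w)" by (rule sum.cong) (auto simp: homog_part_def)
  ultimately show "(\<Sum>w | w : ?W & length w = d. (f - f') w * ?h w) = 0" by simp
 qed
 finally show "EV F g = EV F' g" by simp
qed

section \<open>Inverses, exponentials and invariance\<close>

subsection \<open>Inverses, exponentials and base change\<close>

definition cinv :: "nat => 'k::field jmor => 'k jmor => bool" where
 "cinv n F G <-> F : jhom 0 n & G : jhom 0 n & cv n F G = et n & cv n G F = et n"

lemma cinv_sym: "cinv n F G ==> cinv n G F" by (simp add: cinv_def)

lemma cinv_unique: "cinv n F G ==> cinv n F G' ==> G = G'"
proof -
 assume a: "cinv n F G" "cinv n F G'"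
 have "G = cv n G (cv n F G')" using a by (simp add: cinv_def cv_unit_right[of _ 0])
 also have "... = cv n (cv n G F) G'" using a by (intro cv_assoc[symmetric]) (auto simp: cinv_def)
 also have "... = G'" using a by (simp add: cinv_def cv_unit_left[of _ 0])
 finally show ?thesis .
qed

lemma conv_inverse_eq: "cinv n F G ==> conv_inverse A_hat alg_A n F = G" unfolding conv_inverse_def is_conv_inverse_def
 by (rule the_equality) (auto simp: cinv_def intro: cinv_unique[of n F] dest: cinv_unique[of n F G])

lemma conv_invertible_iff: "conv_invertible A_hat alg_A n F <-> (EX G. cinv n F G)" by (auto simp: conv_invertible_def is_conv_inverse_def cinv_def)

lemma cinv_cv: "cinv n F F' ==> cinv n G G' ==> cinv n (cv n F G) (cv n G' F')"
proof -
 assume a: "cinv n F F'" "cinv n G G'"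
 have "cv n (cv n F G) (cv n G' F') = et n" if "cinv n F F'" "cinv n G G'" for F F' G G' :: "'a jmor"
 proof -
  have "cv n G (cv n G' F') = F'" using that cv_assoc[of G 0 n G' 0 F' 0] by (simp add: cinv_def cv_unit_left[of _ 0])
  thus ?thesis using that cv_assoc[of F 0 n G 0 "cv n G' F'" 0] by (simp add: cinv_def)
 qed
 from this[OF a] this[OF cinv_sym[OF a(2)] cinv_sym[OF a(1)]] show ?thesis using a by (simp add: cinv_def)
qed

lemma cinv_comp:
 assumes k: "isb n p k ws" "alg_words ws" and F: "cinv n F G"
 shows "cinv p (k oo F) (k oo G)" using F comp_cv[OF k, of F 0 G 0, symmetric] comp_cv[OF k, of G 0 F 0, symmetric] comp_et[OF k(1)]
  comp_hom[OF isbD(2)[OF k(1)], of F 0] comp_hom[OF isbD(2)[OF k(1)], of G 0] by (simp add: cinv_def)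

lemma vz_comp:
 assumes k: "isx n p k x" and F: "F : jhom m n" "vz d F"
 shows "vz d (k oo F)" unfolding vz_def
proof (intro allI impI)
 fix g :: "'a jfn" assume g: "jacb g" "ALL x. wt x >= 2 * d --> g x = 0"
 show "EV (k oo F) g = 0" unfolding EV_comp_left[OF k F(1) g(1)] by (rule vzD[OF F(2) bijac_right[OF bijac_Cg[OF g(1)]]]) (use g(2) in "auto intro!: Cg_zero")
qed

lemma comp_jsum:
 assumes k: "isx n p k x" and F: "!!i. F i : jhom m n" "!!i. vz (\<delta> i) (F i)" and fin: "!!d. finite {i. \<delta> i <= d}"
 shows "k oo jsum m n F = jsum m p (%i. k oo F i)"
proof (rule jhom_ext)
 note js = jsum_jhom[of F m n \<delta>, OF F fin]
 have kF: "k oo F i : jhom m p" "vz (\<delta> i) (k oo F i)" for i using comp_hom[OF isx_jhom[OF k] F(1)] vz_comp[OF k F] by auto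
 note js' = jsum_jhom[of "%i. k oo F i" m p \<delta>, OF kF fin]
 show "k oo jsum m n F : jhom m p" by (rule comp_hom[OF isx_jhom[OF k] js(1)])
 show "jsum m p (%i. k oo F i) : jhom m p" by (rule js'(1))
 fix g :: "'a jfn" assume g: "jacb g"
 then obtain e where e: "bdd e g" by (auto simp: jacb_iff)
 have b: "bdd e (Cg g x)" unfolding bdd_def by (intro allI impI Cg_zero) (use e in "auto simp: bdd_def")
 have I: "{i. 2 * \<delta> i <= e} <= {i. \<delta> i <= e}" by auto
 show "EV (k oo jsum m n F) g = EV (jsum m p (%i. k oo F i)) g" unfolding EV_comp_left[OF k js(1) g] js(2)[OF bijac_right[OF bijac_Cg[OF g]] b fin I] js'(2)[OF g e fin I]
  by (simp add: EV_comp_left[OF k F(1) g])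
qed

lemma comp_jscale:
 assumes k: "isx n p k x" and F: "F : jhom m n"
 shows "k oo jscale a F = jscale a (k oo F)"
proof (rule jhom_ext)
 show "k oo jscale a F : jhom m p" "jscale a (k oo F) : jhom m p" using comp_hom[OF isx_jhom[OF k]] scale_hom F by blast+
 fix g :: "'a jfn" assume g: "jacb g"
 show "EV (k oo jscale a F) g = EV (jscale a (k oo F)) g" by (simp add: EV_comp_left[OF k scale_hom[OF F] g] EV_comp_left[OF k F g] EV_jscale[OF F bijac_right[OF bijac_Cg[OF g]]]
   EV_jscale[OF comp_hom[OF isx_jhom[OF k] F] g])
qed

lemma comp_conv_subst:
 assumes k: "isb n p k ws" "alg_words ws" and ok: "subst_ok n (case_xy a b)"
 shows "k oo conv_subst n \<phi> a b = conv_subst p \<phi> (k oo a) (k oo b)"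
proof -
 have w: "k oo cw n (case_xy a b) u = cw p (case_xy (k oo a) (k oo b)) u" for u
 proof (induction u)
  case Nil
  thus ?case by (simp add: comp_et[OF k(1)])
 next
  case (Cons x u)
  have "case_xy a b x : jhom 0 n" using ok by (simp add: subst_ok_def)
  thus ?case using Cons comp_cv[OF k, of "case_xy a b x" 0 "cw n (case_xy a b) u" 0] cw_jhom[OF ok] by (cases x) auto
 qed
 show ?thesis unfolding conv_subst_def conv_word_cw by (subst comp_jsum[OF isbD(1)[OF k(1)] scale_hom[OF cw_jhom[OF ok]] vz_jscale[OF cw_jhom[OF ok] cw_vz[OF ok]] finite_xy_words])
   (simp add: comp_jscale[OF isbD(1)[OF k(1)] cw_jhom[OF ok]] w)
qed

lemma comp_exp:
 assumes k: "isb n p k ws" "alg_words ws" and a: "a : jhom 0 n" "vz 1 a"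
 shows "k oo exp_conv n a = exp_conv p (k oo a)"
proof -
 have w: "k oo conv_power A_hat alg_A n a j = conv_power A_hat alg_A p (k oo a) j" for j
 proof (induction j)
  case 0
  thus ?case by (simp add: comp_et[OF k(1)])
 next
  case (Suc j)
  thus ?case using comp_cv[OF k, of a 0 "conv_power A_hat alg_A n a j" 0] power_hom[OF a(1)] a by simp
 qed
 have fin: "finite {i::nat. i <= d}" for d by simp
 show ?thesis unfolding exp_conv_def by (subst comp_jsum[OF isbD(1)[OF k(1)] scale_hom[OF power_hom[OF a(1)]] vz_jscale[OF power_hom[OF a(1)] conv_power_vz[OF a]] fin])
   (simp add: comp_jscale[OF isbD(1)[OF k(1)] power_hom[OF a(1)]] w)
qed

lemma exp_jhom: "a : jhom 0 n ==> vz 1 a ==> exp_conv n a : jhom 0 n"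
 and EV_exp: "a : jhom 0 n ==> vz 1 a ==> jacb g ==> bdd e g ==>
  EV (exp_conv n a) g = (SUM k<=e. 1 / fact k * EV (conv_power A_hat alg_A n a k) g)"
proof -
 assume a: "a : jhom 0 n" "vz 1 a"
 have fin: "finite {i::nat. i <= d}" for d by simp
 note js = jsum_jhom[of "%k. jscale (1 / fact k) (conv_power A_hat alg_A n a k)" 0 n "%k. k",
  OF scale_hom[OF power_hom[OF a(1)]] vz_jscale[OF power_hom[OF a(1)] conv_power_vz[OF a]] fin]
 show "exp_conv n a : jhom 0 n" unfolding exp_conv_def by (rule js(1))
 assume g: "jacb g" "bdd e g"
 have "EV (exp_conv n a) g = (SUM k:{..e}. EV (jscale (1 / fact k) (conv_power A_hat alg_A n a k)) g)" unfolding exp_conv_def by (rule js(2)[OF g]) auto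
 thus "EV (exp_conv n a) g = (SUM k<=e. 1 / fact k * EV (conv_power A_hat alg_A n a k) g)" by (simp add: EV_jscale[OF power_hom[OF a(1)] g(1)])
qed

lemma bddD: "bdd e g ==> wt x > e ==> g x = 0" unfolding bdd_def by blast

lemma power_commute:
 assumes X: "X : jhom 0 n" and Y: "Y : jhom 0 n" and c: "cv n X Y = cv n Y X"
 shows "cv n Y (conv_power A_hat alg_A n X k) = cv n (conv_power A_hat alg_A n X k) Y"
proof (induction k)
 case 0
 thus ?case by (simp add: cv_unit_left[OF Y] cv_unit_right[OF Y])
next
 case (Suc k)
 let ?P = "conv_power A_hat alg_A n X k"
 have P: "?P : jhom 0 n" by (rule power_hom[OF X])
 have "cv n Y (cv n X ?P) = cv n (cv n X Y) ?P" using c by (simp add: cv_assoc[OF Y X P])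
 also have "... = cv n X (cv n ?P Y)" using Suc by (simp add: cv_assoc[OF X Y P])
 also have "... = cv n (cv n X ?P) Y" by (simp add: cv_assoc[OF X P Y])
 finally show ?case by simp
qed

lemma pascal_sum:
 fixes a :: "nat => nat => 'a::comm_ring_1"
 shows "(SUM j<=k. of_nat (k choose j) * a (Suc j) (k - j)) + (SUM j<=k. of_nat (k choose j) * a j (Suc (k - j))) =
  (SUM j<=Suc k. of_nat (Suc k choose j) * a j (Suc k - j))"
proof -
 have "(SUM j<=k. of_nat (k choose j) * a j (Suc (k - j))) = (SUM j<=Suc k. of_nat (k choose j) * a j (Suc k - j))" by (simp add: Suc_diff_le binomial_eq_0)
 also have "... = a 0 (Suc k) + (SUM j<=k. of_nat (k choose Suc j) * a (Suc j) (k - j))" by (subst sum.atMost_Suc_shift) simp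
 finally show ?thesis by (subst sum.atMost_Suc_shift) (simp add: distrib_right sum.distrib add_ac)
qed

text \<open>The usual proof by the binomial theorem. That \<open>Z\<close> is the sum of
  \<open>X\<close> and \<open>Y\<close> is expressed through evaluations, and powers of
  \<open>Z\<close> are expanded by induction with the rule of Pascal's triangle.\<close>

lemma exp_sum:
 assumes X: "X : jhom 0 n" "vz 1 X" and Y: "Y : jhom 0 n" "vz 1 Y" and Z: "Z : jhom 0 n" "vz 1 Z"
  and c: "cv n X Y = cv n Y X" and XYZ: "!!g. jacb g ==> EV Z g = EV X g + EV Y g"
 shows "exp_conv n Z = cv n (exp_conv n X) (exp_conv n Y)"
proof (rule jhom_ext)
 let ?p = "conv_power A_hat alg_A n"
 note pX = power_hom[OF X(1)] and pY = power_hom[OF Y(1)] and pZ = power_hom[OF Z(1)]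
 note eX = exp_jhom[OF X] and eY = exp_jhom[OF Y] and eZ = exp_jhom[OF Z]
 show "exp_conv n Z : jhom 0 n" "cv n (exp_conv n X) (exp_conv n Y) : jhom 0 n" using eX eY eZ by auto
 have bin: "EV (?p Z k) g = (SUM j<=k. of_nat (k choose j) * EV (cv n (?p X j) (?p Y (k - j))) g)" if "jacb g" for g k using that
 proof (induction k arbitrary: g)
  case 0
  thus ?case by (simp add: cv_unit_left[OF et_jhom])
 next
  case (Suc k)
  let ?a = "%i j. EV (cv n (?p X i) (?p Y j)) g"
  obtain e where e: "bdd e g" using Suc.prems by (auto simp: jacb_iff)
  have B: "bijac (Bm n 0 g)" by (rule bijac_Bm[OF Suc.prems])
  have b: "bdd e (%x. EV G (Bm n 0 g x))" if G: "G : jhom 0 n" for G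
  proof -
   have "Bm n 0 g x = (%y. 0)" if "wt x > e" for x using that by (intro ext Bm_zero bddD[OF e]) simp
   thus ?thesis using EV_zero[OF G] by (simp add: bdd_def)
  qed
  have c': "cv n (?p X i) (?p Y j) : jhom 0 n" for i j using pX pY by simp
  have s: "EV W (%x. EV (?p Z k) (Bm n 0 g x)) = (SUM j<=k. of_nat (k choose j) * EV (cv n W (cv n (?p X j) (?p Y (k - j)))) g)"
   if W: "W : jhom 0 n" for W by (simp add: Suc.IH[OF bijac_right[OF B]] EV_sum[OF W finite_atMost b[OF c']] EV_cv[OF W c' Suc.prems])
  have 1: "cv n X (cv n (?p X j) (?p Y i)) = cv n (?p X (Suc j)) (?p Y i)" for i j by (simp add: cv_assoc[OF X(1) pX pY])
  have 2: "cv n Y (cv n (?p X j) (?p Y i)) = cv n (?p X j) (?p Y (Suc i))" for i j using power_commute[OF X(1) Y(1) c, of j] cv_assoc[OF Y(1) pX pY, of j i] cv_assoc[OF pX Y(1) pY, of j i] by simp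
  have "EV (?p Z (Suc k)) g = EV Z (%x. EV (?p Z k) (Bm n 0 g x))" by (simp add: EV_cv[OF Z(1) pZ Suc.prems])
  also have "... = EV X (%x. EV (?p Z k) (Bm n 0 g x)) + EV Y (%x. EV (?p Z k) (Bm n 0 g x))" by (rule XYZ[OF jacb_EV[OF pZ B]])
  also have "... = (SUM j<=k. of_nat (k choose j) * ?a (Suc j) (k - j)) + (SUM j<=k. of_nat (k choose j) * ?a j (Suc (k - j)))" unfolding s[OF X(1)] s[OF Y(1)] 1 2 ..
  also have "... = (SUM j<=Suc k. of_nat (Suc k choose j) * ?a j (Suc k - j))" by (rule pascal_sum)
  finally show ?case .
 qed
 fix g :: "'a jfn" assume g: "jacb g"
 then obtain e where e: "bdd e g" by (auto simp: jacb_iff)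
 let ?a = "%i j. EV (cv n (?p X i) (?p Y j)) g"
 let ?t = "%i j. 1 / (fact i * fact j) * ?a i j"
 have B: "bijac (Bm n 0 g)" by (rule bijac_Bm[OF g])
 have b': "bdd e (Bm n 0 g x)" for x using e by (auto simp: bdd_def intro!: Bm_zero)
 have b: "bdd e (%x. EV G (Bm n 0 g x))" if G: "G : jhom 0 n" for G
 proof -
  have "Bm n 0 g x = (%y. 0)" if "wt x > e" for x using that by (intro ext Bm_zero bddD[OF e]) simp
  thus ?thesis using EV_zero[OF G] by (simp add: bdd_def)
 qed
 have "EV (cv n (exp_conv n X) (exp_conv n Y)) g = EV (exp_conv n X) (%x. EV (exp_conv n Y) (Bm n 0 g x))" by (rule EV_cv[OF eX eY g])
 also have "... = (SUM i<=e. 1 / fact i * EV (?p X i) (%x. EV (exp_conv n Y) (Bm n 0 g x)))" by (rule EV_exp[OF X jacb_EV[OF eY B] b[OF eY]])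
 also have "... = (SUM i<=e. 1 / fact i * EV (?p X i) (%x. SUM j<=e. 1 / fact j * EV (?p Y j) (Bm n 0 g x)))" by (simp add: EV_exp[OF Y bijac_right[OF B] b'])
 also have "... = (SUM i<=e. SUM j<=e. ?t i j)" by (simp only: EV_sum[OF pX finite_atMost b[OF pY]] EV_cv[OF pX pY g] sum_distrib_left) simp
 also have "... = (\<Sum>(i, j)\<in>{..e} \<times> {..e}. ?t i j)" by (rule sum.cartesian_product)
 \<comment> \<open>Products of total order above \<open>e\<close> evaluate to zero on a function
   bounded by \<open>e\<close>, so the square of indices can be cut down to a triangle and summed
   along its diagonals.\<close>
 also have "... = (\<Sum>(i, j)\<in>{(i, j). i + j <= e}. ?t i j)"
 proof (rule sum.mono_neutral_right)
  have z: "?a i j = 0" if "i + j > e" for i j by (rule vz_bdd[OF vz_cv[OF pX conv_power_vz[OF X] pY conv_power_vz[OF Y]] g e]) (use that in simp)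
  show "ALL p:{..e} \<times> {..e} - {(i, j). i + j <= e}. (case p of (i, j) => ?t i j) = 0"
  proof
   fix p :: "nat * nat" assume "p : {..e} \<times> {..e} - {(i, j). i + j <= e}"
   hence "fst p + snd p > e" by auto
   thus "(case p of (i, j) => ?t i j) = 0" by (simp add: z case_prod_beta')
  qed
 qed auto
 also have "... = (SUM k<=e. SUM i<=k. ?t i (k - i))" by (rule sum.triangle_reindex_eq)
 also have "... = (SUM k<=e. 1 / fact k * EV (?p Z k) g)"
 proof (rule sum.cong[OF refl])
  fix k
  have "?t i (k - i) = 1 / fact k * (of_nat (k choose i) * ?a i (k - i))" if "i <= k" for i using binomial_fact[OF that, where ?'a = 'a] by simp
  thus "(SUM i<=k. ?t i (k - i)) = 1 / fact k * EV (?p Z k) g" unfolding bin[OF g] sum_distrib_left by (intro sum.cong) auto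
 qed
 also have "... = EV (exp_conv n Z) g" by (rule EV_exp[OF Z g e, symmetric])
 finally show "EV (exp_conv n Z) g = EV (cv n (exp_conv n X) (exp_conv n Y)) g" by simp
qed

lemma exp_zero:
 assumes Z: "Z : jhom 0 n" "!!g. jacb g ==> EV Z g = 0"
 shows "exp_conv n Z = et n"
proof (rule jhom_ext)
 have v: "vz 1 Z" using Z(2) by (simp add: vz_def)
 show "exp_conv n Z : jhom 0 n" "et n : jhom 0 n" using exp_jhom[OF Z(1) v] by auto
 fix g :: "'a jfn" assume g: "jacb g"
 then obtain e where e: "bdd e g" by (auto simp: jacb_iff)
 have z: "EV (conv_power A_hat alg_A n Z (Suc k)) g = 0" for k by (simp add: EV_cv[OF Z(1) power_hom[OF Z(1)] g] Z(2)[OF jacb_EV[OF power_hom[OF Z(1)] bijac_Bm[OF g]]])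
 have "(SUM k<=e. 1 / fact k * EV (conv_power A_hat alg_A n Z k) g) = (SUM k:{0}. 1 / fact k * EV (conv_power A_hat alg_A n Z k) g)"
 proof (rule sum.mono_neutral_right)
  show "ALL k:{..e} - {0}. 1 / fact k * EV (conv_power A_hat alg_A n Z k) g = 0"
  proof
   fix k assume "k : {..e} - {0}"
   then obtain j where "k = Suc j" using not0_implies_Suc by auto
   thus "1 / fact k * EV (conv_power A_hat alg_A n Z k) g = 0" using z[of j] by (simp del: conv_power.simps)
  qed
 qed auto
 thus "EV (exp_conv n Z) g = EV (et n) g" unfolding EV_exp[OF Z(1) v g e] by simp
qed

lemma conv_subst_zero:
 assumes a: "a : jhom 0 n" "!!g. jacb g ==> EV a g = 0" and b: "b : jhom 0 n" "!!g. jacb g ==> EV b g = 0"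
  and \<phi>: "\<phi> [] = 1"
 shows "conv_subst n \<phi> a b = et n"
proof (rule jhom_ext)
 have ok: "subst_ok n (case_xy a b)" using a b by (simp add: subst_ok_xy vz_def)
 note T = isT_conv_subst_xy[OF ok, of \<phi>]
 show "conv_subst n \<phi> a b : jhom 0 n" "et n : jhom 0 n" using isT_jhom[OF T] by auto
 fix g :: "'a jfn" assume g: "jacb g"
 then obtain e where e: "bdd e g" by (auto simp: jacb_iff)
 have "EV (cw n (case_xy a b) (x # u)) g = 0" for x u
 proof -
  have "case_xy a b x : jhom 0 n & (ALL g. jacb g --> EV (case_xy a b x) g = 0)" using a b by (cases x) auto
  thus ?thesis using EV_cv[OF _ cw_jhom[OF ok] g, of "case_xy a b x" 0 u] jacb_EV[OF cw_jhom[OF ok] bijac_Bm[OF g]] by simp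
 qed
 hence z: "EV (cw n (case_xy a b) w) g = (if w = [] then EV (et n) g else 0)" for w by (cases w) auto
 have "EV (conv_subst n \<phi> a b) g = (\<Sum>w | \<phi> w ~= 0 & length w <= e. \<phi> w * EV (cw n (case_xy a b) w) g)" using T g e by (simp add: isT_def)
 also have "... = (SUM w:{[]}. \<phi> w * EV (cw n (case_xy a b) w) g)" by (rule sum.mono_neutral_right) (use isT_def T \<phi> in "auto simp: z isT_def sfin_def")
 also have "... = EV (et n) g" by (simp add: z \<phi>)
 finally show "EV (conv_subst n \<phi> a b) g = EV (et n) g" .
qed

definition jadd :: "nat => nat => 'k::field jmor => 'k jmor => 'k jmor" where
 "jadd m n F G = jsum m n (%b. if b then F else G)"

lemma add_hom: "F : jhom m n ==> G : jhom m n ==> jadd m n F G : jhom m n"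
 and EV_jadd: "F : jhom m n ==> G : jhom m n ==> jacb g ==> EV (jadd m n F G) g = EV F g + EV G g"
proof -
 assume FG: "F : jhom m n" "G : jhom m n"
 have h: "(if b then F else G) : jhom m n" "vz 0 (if b then F else G)" for b using FG vz_0 by auto
 have fin: "finite {b::bool. (0::nat) <= d}" for d by simp
 note js = jsum_jhom[of "%b. if b then F else G" m n "%b. 0", OF h fin]
 show "jadd m n F G : jhom m n" unfolding jadd_def by (rule js(1))
 assume g: "jacb g"
 then obtain e where e: "bdd e g" by (auto simp: jacb_iff)
 show "EV (jadd m n F G) g = EV F g + EV G g" unfolding jadd_def by (subst js(2)[OF g e, of UNIV]) (auto simp: UNIV_bool)
qed

lemma vz_jadd: "F : jhom m n ==> G : jhom m n ==> vz d F ==> vz d G ==> vz d (jadd m n F G)" unfolding vz_def by (simp add: EV_jadd)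

lemma exp_inverse:
 assumes X: "X : jhom 0 n" "vz 1 X"
 shows "cinv n (exp_conv n X) (exp_conv n (jscale (- 1) X))"
proof -
 let ?Y = "jscale (- 1) X" and ?Z = "jscale 0 X"
 have Y: "?Y : jhom 0 n" "vz 1 ?Y" using scale_hom[OF X(1)] vz_jscale[OF X] by auto
 have Z: "?Z : jhom 0 n" "vz 1 ?Z" using scale_hom[OF X(1)] vz_jscale[OF X] by auto
 have Z0: "EV ?Z g = 0" if "jacb g" for g using that by (simp add: EV_jscale[OF X(1)])
 have c: "cv n X ?Y = cv n ?Y X"
 proof (rule jhom_ext)
  show "cv n X ?Y : jhom 0 n" "cv n ?Y X : jhom 0 n" using X Y by auto
  fix g :: "'a jfn" assume g: "jacb g"
  obtain e where e: "bdd e g" using g by (auto simp: jacb_iff)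
  have b: "bdd e (%x. EV X (Bm n 0 g x))"
  proof -
   have "Bm n 0 g x = (%y. 0)" if "wt x > e" for x using that by (intro ext Bm_zero bddD[OF e]) simp
   thus ?thesis using EV_zero[OF X(1)] by (simp add: bdd_def)
  qed
  have "EV X (%x. - 1 * EV X (Bm n 0 g x)) = - 1 * EV X (%x. EV X (Bm n 0 g x))" using EV_sum[OF X(1), of "{()}" e "%_ x. EV X (Bm n 0 g x)" "%_. - 1"] b by simp
  thus "EV (cv n X ?Y) g = EV (cv n ?Y X) g" by (simp add: EV_cv[OF X(1) Y(1) g] EV_cv[OF Y(1) X(1) g] EV_jscale[OF X(1)] bijac_right[OF bijac_Bm[OF g]]
   jacb_EV[OF X(1) bijac_Bm[OF g]])
 qed
 have "exp_conv n ?Z = cv n (exp_conv n X) (exp_conv n ?Y)" by (rule exp_sum[OF X Y Z c]) (simp add: EV_jscale[OF X(1)])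
 moreover have "exp_conv n ?Z = cv n (exp_conv n ?Y) (exp_conv n X)" by (rule exp_sum[OF Y X Z c[symmetric]]) (simp add: EV_jscale[OF X(1)])
 ultimately show ?thesis using exp_zero[OF Z(1) Z0] exp_jhom[OF X] exp_jhom[OF Y] by (simp add: cinv_def)
qed

lemma conv_subst_inverse:
 assumes ok: "subst_ok n (case_xy a b)" and \<phi>: "\<phi> [] = 1"
 shows "cinv n (conv_subst n \<phi> a b) (conv_subst n (nc_inverse \<phi>) a b)"
proof -
 note T = isT_conv_subst_xy[OF ok]
 have e: "isT n (case_xy a b) nc_one (et n)" using isT_single[OF ok, of "[]"] by simp
 have 1: "isT n (case_xy a b) nc_one (cv n (conv_subst n \<phi> a b) (conv_subst n (nc_inverse \<phi>) a b))"
  using isT_mult[OF T T ok, of \<phi> "nc_inverse \<phi>"] nc_inverse[of \<phi>, OF \<phi>] by simp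
 have 2: "isT n (case_xy a b) nc_one (cv n (conv_subst n (nc_inverse \<phi>) a b) (conv_subst n \<phi> a b))"
  using isT_mult[OF T T ok, of "nc_inverse \<phi>" \<phi>] nc_inverse[of \<phi>, OF \<phi>] by simp
 show ?thesis unfolding cinv_def using isT_jhom[OF T] isT_unique[OF 1 e] isT_unique[OF 2 e] by simp
qed

text \<open>\<open>F\<close> is the unit plus a morphism of order at least 1, hence the image of the
  series with terms 1 and one letter; the inverse series gives the inverse of
  \<open>F\<close>.\<close>

lemma unipotent_inverse:
 fixes F :: "'k::field jmor"
 assumes F: "F : jhom 0 n" and v: "vz 1 (jadd 0 n F (jscale (- 1) (et n)))"
 shows "EX G. cinv n F G"
proof -
 let ?X = "jadd 0 n F (jscale (- 1) (et n)) :: 'k jmor"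
 define f :: "(xy, 'k) ncps" where "f = single [] + single [X_gen]"
 have X: "?X : jhom 0 n" by (intro add_hom F scale_hom et_jhom)
 have ok: "subst_ok n (case_xy ?X ?X)" using X v by (simp add: subst_ok_xy)
 have EX: "EV ?X g = EV F g - EV (et n) g" if "jacb g" for g using that by (simp add: EV_jadd[OF F scale_hom[OF et_jhom]] EV_jscale[OF et_jhom])
 have "isT n (case_xy ?X ?X) f F" unfolding f_def
 proof (rule isT_add[OF isT_single[OF ok] isT_single[OF ok] F _ ok])
  show "EV F g = EV (cw n (case_xy ?X ?X) []) g + EV (cw n (case_xy ?X ?X) [X_gen]) g" if "jacb g" for g using EX[OF that] by (simp add: cv_unit_right[OF X])
 qed
 hence "F = conv_subst n f ?X ?X" by (rule isT_unique[OF _ isT_conv_subst_xy[OF ok]])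
 moreover have "f [] = 1" by (simp add: f_def single_def)
 ultimately show ?thesis using conv_subst_inverse[OF ok, of f] by auto
qed

subsection \<open>Invariance\<close>

lemma inrange_0_lgs: "inrange 0 u ==> arc u ==> lgs u"
proof (induction u)
 case (Cons x u)
 thus ?case by (cases x) auto
qed simp

text \<open>Conjugation of every leg telescopes: the letter in front of the arc is cancelled before
  the first leg and reappears behind it, and so on to the end of the arc.\<close>

lemma conj_arcs:
 assumes "cancel k" "ALL L:set As. lgs L"
 shows "k (p @ cz UNIV [(1, False)] (fa (map (%L. Lt 1 True # L) As))) = k (p @ fa (map (%L. L @ [Lt 1 True]) As))"
proof -
 have c: "k (p @ Lt 1 True # Lt 1 False # q) = k (p @ q)" for p q :: "nat sym list" using assms(1) unfolding cancel_def by (metis (full_types))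
 have one: "k (p @ Lt 1 True # cz UNIV [(1, False)] L @ q) = k (p @ L @ Lt 1 True # q)" if "lgs L" for L p q using that
 proof (induction L arbitrary: p)
  case (Cons x L)
  then obtain e where e: "x = Lg e" by (cases x) auto
  have "k (p @ Lt 1 True # cz UNIV [(1, False)] (x # L) @ q) = k (p @ Lt 1 True # Lt 1 False # (Lg e # Lt 1 True # cz UNIV [(1, False)] L @ q))" by (simp add: e winv_def lts_def)
  also have "... = k ((p @ [Lg e]) @ Lt 1 True # cz UNIV [(1, False)] L @ q)" unfolding c by simp
  also have "... = k ((p @ [Lg e]) @ L @ Lt 1 True # q)" by (rule Cons.IH) (use Cons.prems e in simp)
  finally show ?case by (simp add: e)
 qed simp
 show ?thesis using assms(2)
 proof (induction As arbitrary: p)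
  case (Cons L As)
  have "k (p @ cz UNIV [(1, False)] (fa (map (%L. Lt 1 True # L) (L # As)))) =
   k (p @ L @ Lt 1 True # Sp # cz UNIV [(1, False)] (fa (map (%L. Lt 1 True # L) As)))"
   using one[of L p "Sp # cz UNIV [(1, False)] (fa (map (%L. Lt 1 True # L) As))"] Cons.prems by simp
  also have "... = k ((p @ L @ [Lt 1 True, Sp]) @ fa (map (%L. L @ [Lt 1 True]) As))" using Cons.IH[of "p @ L @ [Lt 1 True, Sp]"] Cons.prems by simp
  finally show ?case by simp
 qed simp
qed

text \<open>A diagram from 0 has no letters on its arcs. Multiplying by the iterated coproduct on
  one side or the other puts the same letter on one or the other end of every arc, and conjugating
  all components at once moves it across (\<open>jac_cz\<close> with all labels,
  \<open>conj_arcs\<close>).\<close>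

lemma invariance:
 assumes F: "F : jhom 0 n" and D: "isb 1 n \<Delta> (replicate n [(1, True)])"
 shows "cv n F \<Delta> = cv n \<Delta> F"
proof (rule jhom_ext)
 note Dh = isbD(2)[OF D] and Dx = isbD(1)[OF D]
 show "cv n F \<Delta> : jhom 1 n" "cv n \<Delta> F : jhom 1 n" using cv_jhom[OF F Dh] cv_jhom[OF Dh F] by simp_all
 fix g :: "'a jfn" assume g: "jacb g"
 have j: "jac {} g" using g by (simp add: jacb_iff)
 let ?\<Delta> = "fa (replicate n [Lt 1 True])"
 have bw: "bw (replicate n [(1, True)]) = (?\<Delta>, {#})" by (simp add: bw_def)
 have "EV (cv n F \<Delta>) g = EV F (%x. Bm n 0 g x (?\<Delta>, {#}))" unfolding EV_cv[OF F Dh g] bw[symmetric] by (simp add: isx_EV[OF Dx bijac_right[OF bijac_Bm[OF g]]])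
 also have "... = EV F (%x. Bm n 1 g (?\<Delta>, {#}) x)"
 proof (rule EV_cong[OF F])
  fix E assume E: "E : jdiags (free_group 0) n"
  define As where "As = map arc_word (arcs E)"
  have fd: "fd E = (fa As, verts E)" by (simp add: fd_def fl_def As_def)
  have n: "length As = n" using E by (simp add: As_def jdiags_iff)
  have "inrange 0 (fa As)" using jdiags_inrange[OF E] by (simp add: fl_def As_def)
  hence "ALL L:set As. inrange 0 L" by (simp add: inrange_fa)
  moreover have arcs: "ALL L:set As. arc L" by (auto simp: As_def)
  ultimately have l: "ALL L:set As. lgs L" using inrange_0_lgs by blast
  have ok: "okV (legs (fa As)) (verts E)" using E by (simp add: jdiags_iff fl_def As_def)
  let ?V = "verts E"
  have inj: "inj (od o ev)" "inj (od o od)" by (auto simp: inj_def)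
  have "Bm n 0 g (fa As, ?V) (?\<Delta>, {#}) = g (fa (map (%k. sh 0 (map (rl (od o od)) (replicate n [Lt 1 True] ! (k - 1))) @ map (rl (od o ev)) (As ! (k - 1))) [1..<n+1]),
   rv (od o ev) ?V + rv (od o od) {#})" by (rule Bm_arcs) (use arcs n in auto)
  also have "map (%k. sh 0 (map (rl (od o od)) (replicate n [Lt 1 True] ! (k - 1))) @ map (rl (od o ev)) (As ! (k - 1))) [1..<n+1]
   = map (map (rl (od o ev))) (map (%L. Lt 1 True # L) As)" by (rule nth_equalityI) (use n in "auto simp: nth_append")
  also have "g (fa (map (map (rl (od o ev))) (map (%L. Lt 1 True # L) As)), rv (od o ev) ?V + rv (od o od) {#}) = g (fa (map (%L. Lt 1 True # L) As), ?V)"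
   using jacb_rel[OF g inj(1), of "fa (map (%L. Lt 1 True # L) As)" ?V] by (simp add: map_rl_fa)
  also have "... = g (cz UNIV [(1, False)] (fa (map (%L. Lt 1 True # L) As)), ?V)"
  proof (rule jac_cz[OF j, symmetric])
   have "legs (fa (map (%L. Lt 1 True # L) As)) = legs (fa As)" by (simp add: legs_fa comp_def)
   thus "okV (legs (fa (map (%L. Lt 1 True # L) As))) ?V" using ok by simp
  qed simp
  also have "... = g (fa (map (%L. L @ [Lt 1 True]) As), ?V)" using conj_arcs[OF jac_cancelling[OF j], of As "[]" ?V] l by simp
  also have "... = g (fa (map (map (rl (od o od))) (map (%L. L @ [Lt 1 True]) As)), rv (od o ev) {#} + rv (od o od) ?V)"
   using jacb_rel[OF g inj(2), of "fa (map (%L. L @ [Lt 1 True]) As)" ?V] by (simp add: map_rl_fa)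
  also have "map (map (rl (od o od))) (map (%L. L @ [Lt 1 True]) As) =
   map (%k. sh 1 (map (rl (od o od)) (As ! (k - 1))) @ map (rl (od o ev)) (replicate n [Lt 1 True] ! (k - 1))) [1..<n+1]"
   by (rule nth_equalityI) (use n l in "auto simp: nth_append")
  also have "g (fa ..., rv (od o ev) {#} + rv (od o od) ?V) = Bm n 1 g (?\<Delta>, {#}) (fa As, ?V)" by (rule Bm_arcs[symmetric]) (use arcs n in auto)
  finally show "Bm n 0 g (fd E) (?\<Delta>, {#}) = Bm n 1 g (?\<Delta>, {#}) (fd E)" unfolding fd .
 qed
 also have "... = EV (cv n \<Delta> F) g" unfolding EV_cv[OF Dh F g] bw[symmetric] by (simp add: isx_EV[OF Dx jacb_EV[OF F bijac_Bm[OF g]]])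
 finally show "EV (cv n F \<Delta>) g = EV (cv n \<Delta> F) g" .
qed

section \<open>Verification of the axioms of a ribbon quasi-Hopf algebra\<close>

section \<open>The ribbon quasi-Hopf algebra\<close>

lemma isb_subst: "isb m n F ws ==> ws = us ==> isb m n F us" by simp

lemma isb_mun: "isb 2 1 (mun 1) [[(2, True), (1, True)]]"
 "isb 4 2 (mun 2) [[(3, True), (1, True)], [(4, True), (2, True)]]"
 "isb 6 3 (mun 3) [[(4, True), (1, True)], [(5, True), (2, True)], [(6, True), (3, True)]]"
 "isb 8 4 (mun 4) [[(5, True), (1, True)], [(6, True), (2, True)], [(7, True), (3, True)], [(8, True), (4, True)]]" using isb_mu_pow[of 1] isb_mu_pow[of 2] isb_mu_pow[of 3] isb_mu_pow[of 4]
 by (simp_all add: muw_def upt_conv_Cons)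

lemma isb_id: "isb 2 2 (idA 2) [[(1, True)], [(2, True)]]"
 "isb 3 3 (idA 3) [[(1, True)], [(2, True)], [(3, True)]]" using isb_Ident[of 2] isb_Ident[of 3] by (simp_all add: vr_def upt_conv_Cons)

lemma isb_et: "isb 0 1 (et 1) [[]]" "isb 0 2 (et 2) [[], []]" "isb 0 3 (et 3) [[], [], []]" using isb_eta_pow[of 1] isb_eta_pow[of 2] isb_eta_pow[of 3] by (simp_all add: numeral_eq_Suc One_nat_def)

lemma isb_P: "isb 2 2 (PA 1 1) [[(2, True)], [(1, True)]]"
 "isb 3 3 (PA 2 1) [[(3, True)], [(1, True)], [(2, True)]]"
 "isb 3 3 (PA 1 2) [[(2, True)], [(3, True)], [(1, True)]]" using isb_Symm[of 1 1] isb_Symm[of 2 1] isb_Symm[of 1 2] by (simp_all add: vr_def upt_conv_Cons flip: One_nat_def)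

lemmas word_simps = wsb_def word_shift_def nth_Cons'

lemma mun_1: "mun 1 = mu_A" by (rule isb_unique[OF isb_mun(1) isb_mu])

lemma et_1: "et 1 = eta_A" by (rule isb_unique[OF isb_et(1) isb_eta])

lemma cv_1: "cv 1 F G = mu_A oo F ** G" by (simp add: cv_def mun_1)

lemmas mor_jhom [simp] = isb_mu[THEN isbD(2)] isb_eta[THEN isbD(2)] isb_eps[THEN isbD(2)] isb_Delta[THEN isbD(2)] isb_S[THEN isbD(2)]

subsection \<open>Strand operations\<close>

abbreviation "I1 == idA (1 :: nat)"

lemma strand2:
 "isb 2 3 (Delta_A ** I1) [[(1, True)], [(1, True)], [(2, True)]]"
 "isb 2 3 (I1 ** Delta_A) [[(1, True)], [(2, True)], [(2, True)]]"
 "isb 2 3 (I1 ** eta_A ** I1) [[(1, True)], [], [(2, True)]]"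
 "isb 2 3 (idA 2 ** eta_A) [[(1, True)], [(2, True)], []]"
 "isb 2 3 (eta_A ** idA 2) [[], [(1, True)], [(2, True)]]" using isb_tens[OF isb_Delta isb_id1]
  isb_tens[OF isb_id1 isb_Delta]
  isb_tens[OF isb_tens[OF isb_id1 isb_eta] isb_id1]
  isb_tens[OF isb_id(1) isb_eta]
  isb_tens[OF isb_eta isb_id(1)] by (simp_all add: word_shift_def numeral_eq_Suc One_nat_def)

lemma strand3:
 "isb 3 3 (I1 ** PA 1 1) [[(1, True)], [(3, True)], [(2, True)]]"
 "isb 3 3 (PA 1 1 ** I1) [[(2, True)], [(1, True)], [(3, True)]]" using isb_tens[OF isb_id1 isb_P(1)]
  isb_tens[OF isb_P(1) isb_id1] by (simp_all add: word_shift_def)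

lemma strand4:
 "isb 3 4 (Delta_A ** I1 ** I1) [[(1, True)], [(1, True)], [(2, True)], [(3, True)]]"
 "isb 3 4 (I1 ** Delta_A ** I1) [[(1, True)], [(2, True)], [(2, True)], [(3, True)]]"
 "isb 3 4 (I1 ** I1 ** Delta_A) [[(1, True)], [(2, True)], [(3, True)], [(3, True)]]"
 "isb 3 4 (eta_A ** idA 3) [[], [(1, True)], [(2, True)], [(3, True)]]"
 "isb 3 4 (idA 3 ** eta_A) [[(1, True)], [(2, True)], [(3, True)], []]" using isb_tens[OF isb_tens[OF isb_Delta isb_id1] isb_id1]
  isb_tens[OF isb_tens[OF isb_id1 isb_Delta] isb_id1]
  isb_tens[OF isb_tens[OF isb_id1 isb_id1] isb_Delta]
  isb_tens[OF isb_eta isb_id(2)]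
  isb_tens[OF isb_id(2) isb_eta] by (simp_all add: word_shift_def numeral_eq_Suc One_nat_def)

lemma strand_eps:
 "isb 3 2 (eps_A ** I1 ** I1) [[(2, True)], [(3, True)]]"
 "isb 3 2 (I1 ** eps_A ** I1) [[(1, True)], [(3, True)]]"
 "isb 3 2 (I1 ** I1 ** eps_A) [[(1, True)], [(2, True)]]"
 "isb 4 3 (I1 ** eps_A ** I1 ** I1) [[(1, True)], [(3, True)], [(4, True)]]"
 "isb 4 3 (I1 ** I1 ** eps_A ** I1) [[(1, True)], [(2, True)], [(4, True)]]" using isb_tens[OF isb_tens[OF isb_eps isb_id1] isb_id1]
  isb_tens[OF isb_tens[OF isb_id1 isb_eps] isb_id1]
  isb_tens[OF isb_tens[OF isb_id1 isb_id1] isb_eps]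
  isb_tens[OF isb_tens[OF isb_tens[OF isb_id1 isb_eps] isb_id1] isb_id1]
  isb_tens[OF isb_tens[OF isb_tens[OF isb_id1 isb_id1] isb_eps] isb_id1] by (simp_all add: word_shift_def)

lemma strand1:
 "isb 1 2 (I1 ** eta_A) [[(1, True)], []]" "isb 1 2 (eta_A ** I1) [[], [(1, True)]]" using isb_tens[OF isb_id1 isb_eta]
  isb_tens[OF isb_eta isb_id1] by (simp_all add: word_shift_def)

lemma alg_words_simps [simp]: "alg_words []" "alg_words ([] # ws) = alg_words ws" "alg_words ([(i, True)] # ws) = alg_words ws" by (auto simp: alg_words_def)

text \<open>A tensor product with the unit is written as a composition, so that it is covered by the
  rules for applying an algebra morphism to a substituted series.\<close>

lemma tens_eta_right: "F : jhom 0 n ==> F ** eta_A = idA n ** eta_A oo F" using tens_comp[of F 0 n "idA n" n "idA 0" 0 0 eta_A 1]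
 by (simp add: jcomp_Ident_left[of F 0 n] jcomp_Ident_right[of eta_A 0 1] jtens_unit_right[of F 0 n])

lemma tens_eta_left: "F : jhom 0 n ==> eta_A ** F = eta_A ** idA n oo F" using tens_comp[of "idA 0" 0 0 eta_A 1 F 0 n "idA n" n]
 by (simp add: jcomp_Ident_left[of F 0 n] jcomp_Ident_right[of eta_A 0 1] jtens_unit_left[of F 0 n])

subsection \<open>Images of chords\<close>

text \<open>Label 1 instead of 0, since the inner diagram of a composition receives odd labels; the
  images of chords computed below come in this form.\<close>

lemma EV_cl: "isl n F (cl i j 0) ==> jacb g ==> EV F g = g (lw n (cl i j 1))" using lw_rl[of g "%e. e + 1" n "cl i j 0"] by (simp add: isl_def isx_def)

lemma isl_I:
 fixes F :: "'k::field jmor"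
 assumes "F : jhom 0 n" "!!g :: 'k jfn. jacb g ==> EV F g = g (lw n (cl i j 1))"
 shows "isl n F (cl i j 0)" unfolding isl_def isx_def
proof (intro conjI allI impI)
 fix g :: "'k jfn" assume g: "jacb g"
 show "EV F g = g (lw n (cl i j 0))" using assms(2)[OF g] lw_rl[OF g, of "%e. e + 1" n "cl i j 0"] by simp
qed (use assms(1) in auto)

lemma EV_comp_isl:
 assumes "isb n p k ws" "isl n F L" "jacb g"
 shows "EV (k oo F) g = Cg g (bw ws) (lw n L)"
proof -
 have "isx 0 n F (lw n L)" using assms(2) by (simp add: isl_def)
 thus ?thesis by (rule EV_comp_isx[OF isbD(1)[OF assms(1)] _ assms(3)])
qed

lemma isl_c: "isl 2 c_A (cl 1 2 0)" using isl_chord[of 1 2 2] by (simp add: c_A_def)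

lemma isl_c12: "isl 3 (chord_A 3 1 2) (cl 1 2 0)" and isl_c23: "isl 3 (chord_A 3 2 3) (cl 2 3 0)" using isl_chord[of 1 2 3] isl_chord[of 2 3 3] by simp_all

lemmas lw_eval = lw_def upt_conv_Cons cl_def Cg_def bw_def

lemma c_jhom [simp]: "c_A : jhom 0 2" "chord_A 3 1 2 : jhom 0 3" "chord_A 3 2 3 : jhom 0 3" using isl_c isl_c12 isl_c23 by (auto simp: isl_def isx_def)

lemma c_vz: "vz 1 c_A" "vz 1 (chord_A 3 1 2)" "vz 1 (chord_A 3 2 3)" using chord_vz[OF isl_c] chord_vz[OF isl_c12] chord_vz[OF isl_c23] by auto

text \<open>Primitivity of c: an end of a chord on a doubled arc is attached to either copy.
  Permutations and units only move the chord to other strands.\<close>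

lemma EV_c2:
 assumes g: "jacb g"
 shows "EV (Delta_A ** I1 oo c_A) g = g (lw 3 (cl 1 3 1)) + g (lw 3 (cl 2 3 1))"
  and "EV (I1 ** Delta_A oo c_A) g = g (lw 3 (cl 1 2 1)) + g (lw 3 (cl 1 3 1))"
  and "EV (I1 ** eta_A ** I1 oo c_A) g = g (lw 3 (cl 1 3 1))"
  and "EV (idA 2 ** eta_A oo c_A) g = g (lw 3 (cl 1 2 1))"
  and "EV (eta_A ** idA 2 oo c_A) g = g (lw 3 (cl 2 3 1))"
  and "EV (PA 1 1 oo c_A) g = g (lw 2 (cl 1 2 1))"
  and "EV (mu_A oo c_A) g = g (lw 1 (cl 1 1 1))" unfolding strand2[THEN EV_comp_isl, OF isl_c g] isb_P(1)[THEN EV_comp_isl, OF isl_c g] isb_mu[THEN EV_comp_isl, OF isl_c g]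
 by (simp_all add: lw_eval)

lemma EV_c3:
 assumes g: "jacb g"
 shows "EV (I1 ** PA 1 1 oo chord_A 3 1 2) g = g (lw 3 (cl 1 3 1))"
  and "EV (I1 ** PA 1 1 oo chord_A 3 2 3) g = g (lw 3 (cl 2 3 1))"
  and "EV (PA 1 1 ** I1 oo chord_A 3 1 2) g = g (lw 3 (cl 1 2 1))"
  and "EV (PA 1 1 ** I1 oo chord_A 3 2 3) g = g (lw 3 (cl 1 3 1))"
  and "EV (PA 2 1 oo chord_A 3 1 2) g = g (lw 3 (cl 2 3 1))"
  and "EV (PA 2 1 oo chord_A 3 2 3) g = g (lw 3 (cl 1 3 1))"
  and "EV (PA 1 2 oo chord_A 3 1 2) g = g (lw 3 (cl 1 3 1))"
  and "EV (PA 1 2 oo chord_A 3 2 3) g = g (lw 3 (cl 1 2 1))"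
  and "EV (I1 ** eps_A ** I1 oo chord_A 3 1 2) g = 0"
  and "EV (I1 ** eps_A ** I1 oo chord_A 3 2 3) g = 0" unfolding strand3[THEN EV_comp_isl, OF isl_c12 g] strand3[THEN EV_comp_isl, OF isl_c23 g]
  isb_P(2,3)[THEN EV_comp_isl, OF isl_c12 g] isb_P(2,3)[THEN EV_comp_isl, OF isl_c23 g]
  strand_eps(1-3)[THEN EV_comp_isl, OF isl_c12 g] strand_eps(1-3)[THEN EV_comp_isl, OF isl_c23 g] by (simp_all add: lw_eval)

lemma EV_c4:
 assumes g: "jacb g"
 shows "EV (Delta_A ** I1 ** I1 oo chord_A 3 1 2) g = g (lw 4 (cl 1 3 1)) + g (lw 4 (cl 2 3 1))"
  and "EV (Delta_A ** I1 ** I1 oo chord_A 3 2 3) g = g (lw 4 (cl 3 4 1))"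
  and "EV (I1 ** Delta_A ** I1 oo chord_A 3 1 2) g = g (lw 4 (cl 1 2 1)) + g (lw 4 (cl 1 3 1))"
  and "EV (I1 ** Delta_A ** I1 oo chord_A 3 2 3) g = g (lw 4 (cl 2 4 1)) + g (lw 4 (cl 3 4 1))"
  and "EV (I1 ** I1 ** Delta_A oo chord_A 3 1 2) g = g (lw 4 (cl 1 2 1))"
  and "EV (I1 ** I1 ** Delta_A oo chord_A 3 2 3) g = g (lw 4 (cl 2 3 1)) + g (lw 4 (cl 2 4 1))"
  and "EV (eta_A ** idA 3 oo chord_A 3 1 2) g = g (lw 4 (cl 2 3 1))"
  and "EV (eta_A ** idA 3 oo chord_A 3 2 3) g = g (lw 4 (cl 3 4 1))"
  and "EV (idA 3 ** eta_A oo chord_A 3 1 2) g = g (lw 4 (cl 1 2 1))"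
  and "EV (idA 3 ** eta_A oo chord_A 3 2 3) g = g (lw 4 (cl 2 3 1))" unfolding strand4[THEN EV_comp_isl, OF isl_c12 g] strand4[THEN EV_comp_isl, OF isl_c23 g] by (simp_all add: lw_eval)

lemma isT_one:
 fixes F :: "'k::field jmor"
 assumes r: "{i, j} <= {1..n}" "i ~= j" "n >= 2" and F: "F : jhom 0 n" "!!g :: 'k jfn. jacb g ==> EV F g = g (lw n (cl i j 1))"
 shows "isT n (ch n) (t_gen i j) F"
proof -
 have ok: "subst_ok n (ch n :: _ => 'k jmor)" by (rule subst_ok_ch[OF r(3)])
 have c: "(ch n (i, j) :: 'k jmor) : jhom 0 n" using ok unfolding subst_ok_def by blast
 have "F = ch n (i, j)" by (rule jhom_ext[OF F(1) c]) (simp add: F(2) EV_cl[OF isl_ch[OF r(1,2)]])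
 thus ?thesis using isT_single[OF ok, of "[(i, j)]"] by (simp add: cv_unit_right[OF c])
qed

lemma isT_two:
 fixes F :: "'k::field jmor"
 assumes r: "{i, j} <= {1..n}" "i ~= j" "{k, l} <= {1..n}" "k ~= l" "n >= 2"
  and F: "F : jhom 0 n" "!!g :: 'k jfn. jacb g ==> EV F g = g (lw n (cl i j 1)) + g (lw n (cl k l 1))"
 shows "isT n (ch n) (t_gen i j + t_gen k l) F"
proof -
 have ok: "subst_ok n (ch n :: _ => 'k jmor)" by (rule subst_ok_ch[OF r(5)])
 have c: "(ch n p :: 'k jmor) : jhom 0 n" for p using ok unfolding subst_ok_def by blast
 show ?thesis
 proof (rule isT_add[OF isT_single[OF ok] isT_single[OF ok] F(1) _ ok])
  fix g :: "'k jfn" assume g: "jacb g"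
  show "EV F g = EV (cw n (ch n) [(i, j)]) g + EV (cw n (ch n) [(k, l)]) g" by (simp add: F(2)[OF g] cv_unit_right[OF c] EV_cl[OF isl_ch[OF r(1,2)] g] EV_cl[OF isl_ch[OF r(3,4)] g])
 qed
qed

lemma t_gen_Nil [simp]: "(t_gen i j :: (nat * nat, 'k::field) ncps) [] = 0" "(f + f') [] = f [] + (f' [] :: 'k::field)" by simp_all

section \<open>The pentagon and the counit conditions\<close>

subsection \<open>The associator\<close>

definition phi' :: "(xy, 'k::field) ncps => 'k jmor" where
 "phi' \<phi> = conv_subst 3 (nc_inverse \<phi>) (chord_A 3 1 2) (chord_A 3 2 3)"

lemma ok_phi: "subst_ok 3 (case_xy (chord_A 3 1 2) (chord_A 3 2 3))" by (simp add: subst_ok_xy c_vz)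

lemma phi_jhom [simp]: "phi_A \<phi> : jhom 0 3" "phi' \<phi> : jhom 0 3" unfolding phi_A_def phi'_def using isT_jhom[OF isT_conv_subst_xy[OF ok_phi]] by blast+

lemma cinv_phi: "\<phi> [] = 1 ==> cinv 3 (phi_A \<phi>) (phi' \<phi>)" unfolding phi_A_def phi'_def by (rule conv_subst_inverse[OF ok_phi])

lemma isT_phi:
 assumes k: "isb 3 p k ws" "alg_words ws" and p: "p >= 2"
  and A: "isT p (ch p) A (k oo chord_A 3 1 2)" "A [] = 0" and B: "isT p (ch p) B (k oo chord_A 3 2 3)" "B [] = 0"
 shows "isT p (ch p) (nc_subst \<phi> A B) (k oo phi_A \<phi>)"
  and "isT p (ch p) (nc_subst (nc_inverse \<phi>) A B) (k oo phi' \<phi>)" unfolding phi_A_def phi'_def comp_conv_subst[OF k ok_phi] by (rule isT_subst[OF A B subst_ok_ch[OF p]])+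

lemma isT_R:
 assumes k: "isb 2 p k ws" "alg_words ws" and p: "p >= 2" and A: "isT p (ch p) A (k oo c_A)" "A [] = 0"
 shows "isT p (ch p) (nc_exp (%w. A w / 2)) (k oo R_A)"
proof -
 have ok: "subst_ok p (ch p :: _ => 'a jmor)" by (rule subst_ok_ch[OF p])
 have "k oo R_A = exp_conv p (jscale (1 / 2) (k oo c_A))" unfolding R_A_def comp_exp[OF k scale_hom[OF c_jhom(1)] vz_jscale[OF c_jhom(1) c_vz(1)]]
  by (simp add: comp_jscale[OF isbD(1)[OF k(1)] c_jhom(1)])
 moreover have "(%w. A w / 2) = (%w. 1 / 2 * A w)" by (rule ext) simp
 ultimately show ?thesis using isT_exp[OF isT_scale[OF A(1) ok, of "1 / 2"] _ ok] A(2) by simp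
qed

lemma k_jhom: "isb m p k ws ==> F : jhom 0 m ==> k oo F : jhom 0 p" using comp_hom isbD(2) by blast

lemma comp_comp: "isb n p k ws ==> isb m n l us ==> F : jhom 0 m ==> k oo (l oo F) = k oo l oo F" using comp_assoc[of F 0 m l n k p] isbD(2) by metis

text \<open>Each of the five factors is the series \<open>\<phi>\<close> with images of two chords
  substituted, hence the image of \<open>\<phi>\<close> at sums of generators; the equation is the
  image of the pentagon for these generators on four strands.\<close>

lemma phi_pentagon:
 assumes \<phi>: "drinfeld_associator \<phi>"
 shows "cv 4 (cv 4 (eta_A ** phi_A \<phi>) (I1 ** Delta_A ** I1 oo phi_A \<phi>)) (phi_A \<phi> ** eta_A) =
  cv 4 (I1 ** I1 ** Delta_A oo phi_A \<phi>) (Delta_A ** I1 ** I1 oo phi_A \<phi>)"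
proof -
 note j12 = strand4[THEN k_jhom, OF c_jhom(2)] and j23 = strand4[THEN k_jhom, OF c_jhom(3)]
 have ok: "subst_ok 4 (ch 4 :: _ => 'a jmor)" by (rule subst_ok_ch) simp
 have d1: "isT 4 (ch 4) (nc_subst \<phi> (t_gen 1 3 + t_gen 2 3) (t_gen 3 4)) (Delta_A ** I1 ** I1 oo phi_A \<phi>)"
  by (rule isT_phi(1)[OF strand4(1)], simp, simp, rule isT_two[OF _ _ _ _ _ j12(1) EV_c4(1)], simp_all)
   (rule isT_one[OF _ _ _ j23(1) EV_c4(2)], simp_all)
 have d2: "isT 4 (ch 4) (nc_subst \<phi> (t_gen 1 2 + t_gen 1 3) (t_gen 2 4 + t_gen 3 4)) (I1 ** Delta_A ** I1 oo phi_A \<phi>)"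
  by (rule isT_phi(1)[OF strand4(2)], simp, simp, rule isT_two[OF _ _ _ _ _ j12(2) EV_c4(3)], simp_all)
   (rule isT_two[OF _ _ _ _ _ j23(2) EV_c4(4)], simp_all)
 have d3: "isT 4 (ch 4) (nc_subst \<phi> (t_gen 1 2) (t_gen 2 3 + t_gen 2 4)) (I1 ** I1 ** Delta_A oo phi_A \<phi>)"
  by (rule isT_phi(1)[OF strand4(3)], simp, simp, rule isT_one[OF _ _ _ j12(3) EV_c4(5)], simp_all)
   (rule isT_two[OF _ _ _ _ _ j23(3) EV_c4(6)], simp_all)
 have d4: "isT 4 (ch 4) (nc_subst \<phi> (t_gen 2 3) (t_gen 3 4)) (eta_A ** phi_A \<phi>)" unfolding tens_eta_left[OF phi_jhom(1)]
  by (rule isT_phi(1)[OF strand4(4)], simp, simp, rule isT_one[OF _ _ _ j12(4) EV_c4(7)], simp_all)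
   (rule isT_one[OF _ _ _ j23(4) EV_c4(8)], simp_all)
 have d5: "isT 4 (ch 4) (nc_subst \<phi> (t_gen 1 2) (t_gen 2 3)) (phi_A \<phi> ** eta_A)" unfolding tens_eta_right[OF phi_jhom(1)]
  by (rule isT_phi(1)[OF strand4(5)], simp, simp, rule isT_one[OF _ _ _ j12(5) EV_c4(9)], simp_all)
   (rule isT_one[OF _ _ _ j23(5) EV_c4(10)], simp_all)
 have "t_eq 4 (nc_subst \<phi> (t_gen 1 2) (t_gen 2 3 + t_gen 2 4) \<star> nc_subst \<phi> (t_gen 1 3 + t_gen 2 3) (t_gen 3 4))
  (nc_subst \<phi> (t_gen 2 3) (t_gen 3 4) \<star> nc_subst \<phi> (t_gen 1 2 + t_gen 1 3) (t_gen 2 4 + t_gen 3 4) \<star> nc_subst \<phi> (t_gen 1 2) (t_gen 2 3))"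
  using \<phi> unfolding drinfeld_associator_def Let_def by blast
 from isT_t_eq[OF isT_mult[OF d3 d1 ok] isT_mult[OF isT_mult[OF d4 d2 ok] d5 ok] _ this]
 show ?thesis by simp
qed

lemma phi_Nil: "drinfeld_associator \<phi> ==> \<phi> [] = 1" by (simp add: drinfeld_associator_def Let_def group_like_def)

lemma cv_cancel_left:
 assumes "cinv n F F'" "G : jhom 0 n" "H : jhom 0 n" "cv n F G = cv n F H"
 shows "G = H"
proof -
 have "cv n F' (cv n F X) = X" if "X : jhom 0 n" for X using that assms(1) cv_assoc[of F' 0 n F 0 X 0] by (simp add: cinv_def cv_unit_left[OF that])
 thus ?thesis using assms by metis
qed

lemma cv_cancel_right:
 assumes "cinv n F F'" "G : jhom 0 n" "H : jhom 0 n" "cv n G F = cv n H F"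
 shows "G = H"
proof -
 have "cv n (cv n X F) F' = X" if "X : jhom 0 n" for X using that assms(1) cv_assoc[of X 0 n F 0 F' 0] by (simp add: cinv_def cv_unit_right[OF that])
 thus ?thesis using assms by metis
qed

lemma phi_eps2:
 assumes "\<phi> [] = 1"
 shows "I1 ** eps_A ** I1 oo phi_A \<phi> = et 2" unfolding phi_A_def by (subst comp_conv_subst[OF strand_eps(2) _ ok_phi])
  (auto intro!: conv_subst_zero assms k_jhom[OF strand_eps(2)] simp: EV_c3)

text \<open>Applying the counit to the second and to the third strand of the pentagon equation.\<close>

lemma phi_eps13:
 assumes \<phi>: "drinfeld_associator \<phi>"
 shows "eps_A ** I1 ** I1 oo phi_A \<phi> = et 2"
  and "I1 ** I1 ** eps_A oo phi_A \<phi> = et 2"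
proof -
 let ?P = "phi_A \<phi>"
 let ?A = "eta_A ** idA 3 oo ?P" and ?B = "I1 ** Delta_A ** I1 oo ?P"
  and ?C = "idA 3 ** eta_A oo ?P" and ?D = "I1 ** I1 ** Delta_A oo ?P"
  and ?E = "Delta_A ** I1 ** I1 oo ?P"
 have pent: "cv 4 (cv 4 ?A ?B) ?C = cv 4 ?D ?E" using phi_pentagon[OF \<phi>] by (simp add: tens_eta_left[OF phi_jhom(1)] tens_eta_right[OF phi_jhom(1)])
 note h = strand4[THEN k_jhom, OF phi_jhom(1), of \<phi>]
 note e2 = phi_eps2[of \<phi>, OF phi_Nil[OF \<phi>]]
 have ci: "cinv 3 ?P (phi' \<phi>)" by (rule cinv_phi[of \<phi>, OF phi_Nil[OF \<phi>]])
 have idP: "idA 3 oo ?P = ?P" by (rule jcomp_Ident_left[OF phi_jhom(1)])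
 have k: "cv 3 (cv 3 (k oo ?A) (k oo ?B)) (k oo ?C) = cv 3 (k oo ?D) (k oo ?E)"
  if "isb 4 3 k ws" "alg_words ws" for k ws using arg_cong[OF pent, of "jcomp k"] h comp_cv[OF that, of _ 0 _ 0] by simp
 have w: "k oo (l oo ?P) = k' oo (l' oo ?P)"
  if "isb 4 3 k ws" "isb 3 4 l us" "isb 2 3 k' ws'" "isb 3 2 l' us'" "map (wsb us) ws = map (wsb us') ws'" for k l k' l' ws us ws' us'
 proof -
  have "k oo l = k' oo l'" using isb_comp[OF that(1,2)] isb_comp[OF that(3,4)] that(5) isb_unique by metis
  thus ?thesis using comp_comp[OF that(1,2) phi_jhom(1)] comp_comp[OF that(3,4) phi_jhom(1)] by metis
 qed
 have w': "k oo (l oo ?P) = ?P"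
  if "isb 4 3 k ws" "isb 3 4 l us" "map (wsb us) ws = [[(1, True)], [(2, True)], [(3, True)]]" for k l ws us
 proof -
  have "k oo l = idA 3" using isb_comp[OF that(1,2)] that(3) isb_unique isb_id(2) by metis
  thus ?thesis using comp_comp[OF that(1,2) phi_jhom(1)] idP by metis
 qed
 note e1h = k_jhom[OF strand_eps(1) phi_jhom(1), of \<phi>] and e3h = k_jhom[OF strand_eps(3) phi_jhom(1), of \<phi>]
 let ?e1 = "eps_A ** I1 ** I1 oo ?P" and ?e3 = "I1 ** I1 ** eps_A oo ?P"
 have 1: "I1 ** eps_A ** I1 ** I1 oo ?A = eta_A ** idA 2 oo ?e1" by (rule w[OF strand_eps(4) strand4(4) strand2(5) strand_eps(1)]) (simp add: word_simps)
 have 2: "I1 ** eps_A ** I1 ** I1 oo ?B = ?P" by (rule w'[OF strand_eps(4) strand4(2)]) (simp add: word_simps)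
 have 3: "I1 ** eps_A ** I1 ** I1 oo ?C = et 3"
 proof -
  have "I1 ** eps_A ** I1 ** I1 oo ?C = idA 2 ** eta_A oo (I1 ** eps_A ** I1 oo ?P)" by (rule w[OF strand_eps(4) strand4(5) strand2(4) strand_eps(2)]) (simp add: word_simps)
  thus ?thesis using e2 comp_et[OF strand2(4)] by simp
 qed
 have 4: "I1 ** eps_A ** I1 ** I1 oo ?D = et 3"
 proof -
  have "I1 ** eps_A ** I1 ** I1 oo ?D = I1 ** Delta_A oo (I1 ** eps_A ** I1 oo ?P)" by (rule w[OF strand_eps(4) strand4(3) strand2(2) strand_eps(2)]) (simp add: word_simps)
  thus ?thesis using e2 comp_et[OF strand2(2)] by simp
 qed
 have 5: "I1 ** eps_A ** I1 ** I1 oo ?E = ?P" by (rule w'[OF strand_eps(4) strand4(1)]) (simp add: word_simps)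
 have x: "eta_A ** idA 2 oo ?e1 : jhom 0 3" "idA 2 ** eta_A oo ?e3 : jhom 0 3" using k_jhom[OF strand2(5) e1h] k_jhom[OF strand2(4) e3h] .
 \<comment> \<open>The counit on the second strand turns the third factor on the left and the first
   on the right into units, and the pentagon says that the remaining first factor is absorbed by
   \<phi>. It is a unit because \<phi> is invertible.\<close>
 have "cv 3 (eta_A ** idA 2 oo ?e1) ?P = cv 3 (et 3) ?P" using k[OF strand_eps(4)] x(1) unfolding 1 2 3 4 5 by (simp add: cv_unit_right[of _ 0])
 from cv_cancel_right[OF ci x(1) et_jhom this]
 have a: "eta_A ** idA 2 oo ?e1 = et 3" .
 have "eps_A ** I1 ** I1 oo (eta_A ** idA 2 oo ?e1) = ?e1"
 proof -
  have "eps_A ** I1 ** I1 oo eta_A ** idA 2 = (idA 2 :: 'a jmor)" by (rule isb_unique[OF isb_subst[OF isb_comp[OF strand_eps(1) strand2(5)]] isb_id(1)]) (simp add: word_simps)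
  thus ?thesis using comp_comp[OF strand_eps(1) strand2(5) e1h] jcomp_Ident_left[OF e1h] by simp
 qed
 thus "?e1 = et 2" unfolding a comp_et[OF strand_eps(1)] by (rule sym)
 have 1: "I1 ** I1 ** eps_A ** I1 oo ?A = et 3"
 proof -
  have "I1 ** I1 ** eps_A ** I1 oo ?A = eta_A ** idA 2 oo (I1 ** eps_A ** I1 oo ?P)" by (rule w[OF strand_eps(5) strand4(4) strand2(5) strand_eps(2)]) (simp add: word_simps)
  thus ?thesis using e2 comp_et[OF strand2(5)] by simp
 qed
 have 2: "I1 ** I1 ** eps_A ** I1 oo ?B = ?P" by (rule w'[OF strand_eps(5) strand4(2)]) (simp add: word_simps)
 have 3: "I1 ** I1 ** eps_A ** I1 oo ?C = idA 2 ** eta_A oo ?e3" by (rule w[OF strand_eps(5) strand4(5) strand2(4) strand_eps(3)]) (simp add: word_simps)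
 have 4: "I1 ** I1 ** eps_A ** I1 oo ?D = ?P" by (rule w'[OF strand_eps(5) strand4(3)]) (simp add: word_simps)
 have 5: "I1 ** I1 ** eps_A ** I1 oo ?E = et 3"
 proof -
  have "I1 ** I1 ** eps_A ** I1 oo ?E = Delta_A ** I1 oo (I1 ** eps_A ** I1 oo ?P)" by (rule w[OF strand_eps(5) strand4(1) strand2(1) strand_eps(2)]) (simp add: word_simps)
  thus ?thesis using e2 comp_et[OF strand2(1)] by simp
 qed
 \<comment> \<open>The counit on the third strand leaves \<phi> times the remaining third factor on
   the left and \<phi> on the right, so this factor is a unit as well.\<close>
 have "cv 3 ?P (idA 2 ** eta_A oo ?e3) = cv 3 ?P (et 3)" using k[OF strand_eps(5)] unfolding 1 2 3 4 5 by (simp add: cv_unit_left[OF phi_jhom(1)])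
 from cv_cancel_left[OF ci x(2) et_jhom this]
 have a: "idA 2 ** eta_A oo ?e3 = et 3" .
 have "I1 ** I1 ** eps_A oo (idA 2 ** eta_A oo ?e3) = ?e3"
 proof -
  have "I1 ** I1 ** eps_A oo idA 2 ** eta_A = (idA 2 :: 'a jmor)" by (rule isb_unique[OF isb_subst[OF isb_comp[OF strand_eps(3) strand2(4)]] isb_id(1)]) (simp add: word_simps)
  thus ?thesis using comp_comp[OF strand_eps(3) strand2(4) e3h] jcomp_Ident_left[OF e3h] by simp
 qed
 thus "?e3 = et 2" unfolding a comp_et[OF strand_eps(3)] by (rule sym)
qed

section \<open>The underlying Hopf algebra and its central elements\<close>

subsection \<open>Identities between bead diagrams\<close>

lemma isb_oo: "isb p n G ws' ==> isb m p' F ws ==> p' = p ==> isb m n (G oo F) (map (wsb ws) ws')" using isb_comp by blast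

lemma isb_eqI:
 "isb m n F ws ==> isb m' n' G ws' ==> m = m' ==> n = n' ==> map red ws = map red ws' ==> F = G" using isb_unique_red by blast

lemmas bead_simps = word_simps word_inv_def letter_inv_def

lemma isb_id0: "isb 0 0 (idA 0) []" using isb_Ident[of 0] by (simp add: vr_def)

lemma Symm_0: "PA 0 0 = idA 0" by (simp add: A_hat_def)

lemma mu_unit_left: "mu_A oo eta_A ** I1 = I1" by (rule isb_eqI[OF isb_oo[OF isb_mu isb_tens[OF isb_eta isb_id1]] isb_id1]) (simp_all add: bead_simps)

lemma mu_unit_right: "mu_A oo I1 ** eta_A = I1" by (rule isb_eqI[OF isb_oo[OF isb_mu isb_tens[OF isb_id1 isb_eta]] isb_id1]) (simp_all add: bead_simps)

lemma mu_assoc: "mu_A oo mu_A ** I1 = mu_A oo I1 ** mu_A" by (rule isb_eqI[OF isb_oo[OF isb_mu isb_tens[OF isb_mu isb_id1]] isb_oo[OF isb_mu isb_tens[OF isb_id1 isb_mu]]])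
  (simp_all add: bead_simps)

lemma delta_mu: "Delta_A oo mu_A = mun 2 oo Delta_A ** Delta_A" by (rule isb_eqI[OF isb_oo[OF isb_Delta isb_mu] isb_oo[OF isb_mun(2) isb_tens[OF isb_Delta isb_Delta]]])
  (simp_all add: bead_simps)

lemma delta_eta: "Delta_A oo eta_A = eta_A ** eta_A" by (rule isb_eqI[OF isb_oo[OF isb_Delta isb_eta] isb_tens[OF isb_eta isb_eta]]) (simp_all add: bead_simps)

lemma eps_mu: "eps_A oo mu_A = eps_A ** eps_A" by (rule isb_eqI[OF isb_oo[OF isb_eps isb_mu] isb_tens[OF isb_eps isb_eps]]) (simp_all add: bead_simps)

lemma eps_eta: "eps_A oo eta_A = idA 0" by (rule isb_eqI[OF isb_oo[OF isb_eps isb_eta] isb_id0]) simp_all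

lemma counit_left: "eps_A ** I1 oo Delta_A = I1" by (rule isb_eqI[OF isb_oo[OF isb_tens[OF isb_eps isb_id1] isb_Delta] isb_id1]) (simp_all add: bead_simps)

lemma counit_right: "I1 ** eps_A oo Delta_A = I1" by (rule isb_eqI[OF isb_oo[OF isb_tens[OF isb_id1 isb_eps] isb_Delta] isb_id1]) (simp_all add: bead_simps)

lemma delta_coassoc: "I1 ** Delta_A oo Delta_A = Delta_A ** I1 oo Delta_A" by (rule isb_eqI[OF isb_oo[OF strand2(2) isb_Delta] isb_oo[OF strand2(1) isb_Delta]]) (simp_all add: bead_simps)

lemma delta_cocommutative: "PA 1 1 oo Delta_A = Delta_A" by (rule isb_eqI[OF isb_oo[OF isb_P(1) isb_Delta] isb_Delta]) (simp_all add: bead_simps)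

lemma antip_square: "S_A oo S_A = I1" by (rule isb_eqI[OF isb_oo[OF isb_S isb_S] isb_id1]) (simp_all add: bead_simps)

lemma antip_mu: "S_A oo mu_A = mu_A oo PA 1 1 oo S_A ** S_A" by (rule isb_eqI[OF isb_oo[OF isb_S isb_mu] isb_oo[OF isb_oo[OF isb_mu isb_P(1)] isb_tens[OF isb_S isb_S]]])
  (simp_all add: bead_simps)

lemma antip_eta: "S_A oo eta_A = eta_A" by (rule isb_eqI[OF isb_oo[OF isb_S isb_eta] isb_eta]) (simp_all add: bead_simps)

lemma antipode_left: "cv 1 S_A I1 oo Delta_A = eta_A oo eps_A" unfolding cv_1
 by (rule isb_eqI[OF isb_oo[OF isb_oo[OF isb_mu isb_tens[OF isb_S isb_id1]] isb_Delta] isb_oo[OF isb_eta isb_eps]])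
  (simp_all add: bead_simps)

lemma antipode_right: "cv 1 I1 S_A oo Delta_A = eta_A oo eps_A" unfolding cv_1
 by (rule isb_eqI[OF isb_oo[OF isb_oo[OF isb_mu isb_tens[OF isb_id1 isb_S]] isb_Delta] isb_oo[OF isb_eta isb_eps]])
  (simp_all add: bead_simps)

subsection \<open>Multiplying by central elements\<close>

lemma cv_comp_left:
 assumes x: "x : jhom 0 1" and K: "K : jhom n 1" and F: "F : jhom m n"
 shows "cv 1 x K oo F = cv 1 x (K oo F)"
proof -
 have "x ** K oo F = x ** (K oo F)" using tens_comp[of "idA 0" 0 0 x 1 F m n K 1] assms by (simp add: jcomp_Ident_right[OF x] jtens_unit_left[OF F])
 thus ?thesis using comp_assoc[of F m n "x ** K" "0 + n" mu_A] comp_assoc[OF F _ isb_mu[THEN isbD(2)], of "x ** K"] tens_hom[OF x K] by (simp add: cv_1)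
qed

lemma cv_comp_right:
 assumes x: "x : jhom 0 1" and K: "K : jhom n 1" and F: "F : jhom m n"
 shows "cv 1 K x oo F = cv 1 (K oo F) x"
proof -
 have "K ** x oo F = (K oo F) ** x" using tens_comp[of F m n K 1 "idA 0" 0 0 x 1] assms by (simp add: jcomp_Ident_right[OF x] jtens_unit_right[OF F])
 thus ?thesis using comp_assoc[OF F _ isb_mu[THEN isbD(2)], of "K ** x"] tens_hom[OF K x] by (simp add: cv_1)
qed

text \<open>Invariance on a single arc, where the iterated coproduct is the identity. It gives
  specialness and allows \<alpha> and \<beta> to be moved out of the antipode equations.\<close>

lemma cv_central:
 assumes x: "x : jhom 0 1" and K: "K : jhom m 1"
 shows "cv 1 K x = cv 1 x K"
proof -
 have "isb 1 1 (I1 :: 'a jmor) (replicate 1 [(1, True)])" using isb_id1 by (simp add: numeral_eq_Suc One_nat_def)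
 from invariance[OF x this] have "cv 1 x I1 = cv 1 I1 x" .
 thus ?thesis using cv_comp_left[OF x id_hom K] cv_comp_right[OF x id_hom K] jcomp_Ident_left[OF K] by simp
qed

lemma cv_scalars:
 assumes a: "a : jhom 0 1" and b: "b : jhom 0 1" and K: "K : jhom k 1" and L: "L : jhom l 1" and M: "M : jhom m 1"
 shows "cv 1 (cv 1 (cv 1 (cv 1 K a) L) b) M = cv 1 a (cv 1 b (cv 1 (cv 1 K L) M))"
proof -
 note KL = cv_jhom[OF K L]
 have "cv 1 (cv 1 K a) L = cv 1 a (cv 1 K L)" using cv_central[OF a K] cv_assoc[OF a K L] by simp
 moreover have "cv 1 (cv 1 a (cv 1 K L)) b = cv 1 a (cv 1 b (cv 1 K L))" using cv_assoc[OF a KL b] cv_central[OF b KL] by simp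
 moreover have "cv 1 (cv 1 a (cv 1 b (cv 1 K L))) M = cv 1 a (cv 1 b (cv 1 (cv 1 K L) M))" using cv_assoc[OF a cv_jhom[OF b KL] M] cv_assoc[OF b KL M] by simp
 ultimately show ?thesis by simp
qed

lemma mu_step:
 assumes K: "K : jhom n 1" and X: "X : jhom m n" and e: "e : jhom l 1"
 shows "mu_A oo K ** I1 oo X ** e = cv 1 (K oo X) e" using comp_assoc[OF tens_hom[OF X e] tens_hom[OF K id_hom[of 1]], of mu_A 1] tens_comp[OF X K e id_hom]
  jcomp_Ident_left[OF e] by (simp add: cv_1)

lemma mu3_A:
 assumes "a : jhom k 1" "b : jhom l 1" "c : jhom m 1"
 shows "mu3 A_hat alg_A oo a ** b ** c = cv 1 (cv 1 a b) c" using mu_step[OF mor_jhom(1) _ assms(3), of "a ** b" "k + l"] tens_hom[OF assms(1,2)] by (simp add: mu3_def cv_1)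

lemma mu3_jhom: "mu3 A_hat alg_A : jhom 3 1" using comp_hom[OF mor_jhom(1), of "mu_A ** I1" 3] tens_hom[OF mor_jhom(1) id_hom[of 1]] by (simp add: mu3_def)

lemma mu5_A:
 assumes "a : jhom k 1" "b : jhom l 1" "c : jhom m 1" "d : jhom p 1" "e : jhom q 1"
 shows "mu5 A_hat alg_A oo a ** b ** c ** d ** e = cv 1 (cv 1 (cv 1 (cv 1 a b) c) d) e"
proof -
 have abc: "a ** b ** c : jhom (k + l + m) 3" using tens_hom[OF tens_hom[OF assms(1,2)] assms(3)] by simp
 have m4: "mu_A oo mu3 A_hat alg_A ** I1 : jhom 4 1" using comp_hom[OF mor_jhom(1), of "mu3 A_hat alg_A ** I1" 4] tens_hom[OF mu3_jhom id_hom[of 1]] by simp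
 have abcd: "a ** b ** c ** d : jhom (k + l + m + p) 4" using tens_hom[OF abc assms(4)] by simp
 show ?thesis using mu_step[OF m4 abcd assms(5)] mu_step[OF mu3_jhom abc assms(4)] mu3_A[OF assms(1-3)] by (simp add: mu5_def)
qed

lemma isb_delta3: "isb 1 3 (Delta_A ** I1 oo Delta_A) (replicate 3 [(1, True)])" by (rule isb_subst[OF isb_oo[OF strand2(1) isb_Delta]]) (simp_all add: bead_simps numeral_eq_Suc One_nat_def)

lemma isb_delta2: "isb 1 2 Delta_A (replicate 2 [(1, True)])" using isb_Delta by (simp add: numeral_eq_Suc One_nat_def)

text \<open>By invariance an invertible element commutes with the iterated coproduct. The
  quasi-coassociativity and the compatibility of R with the coproduct therefore reduce to
  coassociativity and cocommutativity.\<close>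

lemma conjugation_trivial:
 assumes "cinv n F G" "isb 1 n D (replicate n [(1, True)])"
 shows "cv n (cv n F D) G = D"
proof -
 have h: "F : jhom 0 n" "G : jhom 0 n" "D : jhom 1 n" using assms isbD(2) by (auto simp: cinv_def)
 have "cv n (cv n F D) G = cv n D (cv n F G)" using invariance[OF h(1) assms(2)] cv_assoc[OF h(3,1,2)] by simp
 thus ?thesis using assms(1) cv_unit_right[OF h(3)] by (simp add: cinv_def)
qed

section \<open>The hexagon equations and symmetry of R\<close>

subsection \<open>The hexagon equations\<close>

lemma cinv_R: "cinv 2 R_A (exp_conv 2 (jscale (- 1) (jscale (1 / 2) c_A)))" unfolding R_A_def by (rule exp_inverse[OF scale_hom[OF c_jhom(1)] vz_jscale[OF c_jhom(1) c_vz(1)]])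

lemma R_jhom [simp]: "R_A : jhom 0 2" unfolding R_A_def by (rule exp_jhom[OF scale_hom[OF c_jhom(1)] vz_jscale[OF c_jhom(1) c_vz(1)]])

lemma isT_phi_self:
 "isT 3 (ch 3) (nc_subst \<phi> (t_gen 1 2) (t_gen 2 3)) (phi_A \<phi>)"
 "isT 3 (ch 3) (nc_subst (nc_inverse \<phi>) (t_gen 1 2) (t_gen 2 3)) (phi' \<phi>)"
proof -
 have ok: "subst_ok 3 (ch 3 :: _ => 'a jmor)" by (rule subst_ok_ch) simp
 have 1: "isT 3 (ch 3) (t_gen 1 2) (chord_A 3 1 2 :: 'a jmor)" "isT 3 (ch 3) (t_gen 2 3) (chord_A 3 2 3 :: 'a jmor)" by (rule isT_one; simp add: EV_cl[OF isl_c12] EV_cl[OF isl_c23])+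
 show "isT 3 (ch 3) (nc_subst \<phi> (t_gen 1 2) (t_gen 2 3)) (phi_A \<phi>)"
  "isT 3 (ch 3) (nc_subst (nc_inverse \<phi>) (t_gen 1 2) (t_gen 2 3)) (phi' \<phi>)" unfolding phi_A_def phi'_def by (rule isT_subst[OF 1(1) _ 1(2) _ ok]; simp)+
qed

text \<open>The image of the first hexagon for generators on three strands. The left side uses that
  the coproduct on the first strand of c gives two chords; the permuted associators are the same
  series with permuted chords.\<close>

lemma R_hexagon_left:
 assumes \<phi>: "drinfeld_associator \<phi>"
 shows "Delta_A ** I1 oo R_A =
  cv 3 (cv 3 (cv 3 (cv 3 (PA 1 2 oo phi_A \<phi>) (I1 ** eta_A ** I1 oo R_A))
   (I1 ** PA 1 1 oo phi' \<phi>)) (eta_A ** R_A)) (phi_A \<phi>)"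
proof -
 note j = strand2[THEN k_jhom, OF c_jhom(1)] and j12 = strand3[THEN k_jhom, OF c_jhom(2)] and j23 = strand3[THEN k_jhom, OF c_jhom(3)]
  and p12 = isb_P(3)[THEN k_jhom, OF c_jhom(2)] and p23 = isb_P(3)[THEN k_jhom, OF c_jhom(3)]
 have ok: "subst_ok 3 (ch 3 :: _ => 'a jmor)" by (rule subst_ok_ch) simp
 have l: "isT 3 (ch 3) (nc_exp (%w. (t_gen 1 3 + t_gen 2 3) w / 2)) (Delta_A ** I1 oo R_A)" by (rule isT_R[OF strand2(1)], simp, simp, rule isT_two[OF _ _ _ _ _ j(1) EV_c2(1)], simp_all)
 have 1: "isT 3 (ch 3) (nc_subst \<phi> (t_gen 1 3) (t_gen 1 2)) (PA 1 2 oo phi_A \<phi>)" by (rule isT_phi(1)[OF isb_P(3)], simp, simp, rule isT_one[OF _ _ _ p12 EV_c3(7)], simp_all)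
   (rule isT_one[OF _ _ _ p23 EV_c3(8)], simp_all)
 have 2: "isT 3 (ch 3) (nc_exp (%w. t_gen 1 3 w / 2)) (I1 ** eta_A ** I1 oo R_A)" by (rule isT_R[OF strand2(3)], simp, simp, rule isT_one[OF _ _ _ j(3) EV_c2(3)], simp_all)
 have 3: "isT 3 (ch 3) (nc_subst (nc_inverse \<phi>) (t_gen 1 3) (t_gen 2 3)) (I1 ** PA 1 1 oo phi' \<phi>)"
  by (rule isT_phi(2)[OF strand3(1)], simp, simp, rule isT_one[OF _ _ _ j12(1) EV_c3(1)], simp_all)
   (rule isT_one[OF _ _ _ j23(1) EV_c3(2)], simp_all)
 have 4: "isT 3 (ch 3) (nc_exp (%w. t_gen 2 3 w / 2)) (eta_A ** R_A)" unfolding tens_eta_left[OF R_jhom]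
  by (rule isT_R[OF strand2(5)], simp, simp, rule isT_one[OF _ _ _ j(5) EV_c2(5)], simp_all)
 have "t_eq 3 (nc_exp (%w. (t_gen 1 3 + t_gen 2 3) w / 2))
  (nc_subst \<phi> (t_gen 1 3) (t_gen 1 2) \<star> nc_exp (%w. t_gen 1 3 w / 2) \<star> nc_subst (nc_inverse \<phi>) (t_gen 1 3) (t_gen 2 3)
   \<star> nc_exp (%w. t_gen 2 3 w / 2) \<star> nc_subst \<phi> (t_gen 1 2) (t_gen 2 3))" using \<phi> unfolding drinfeld_associator_def Let_def by blast
 from isT_t_eq[OF l isT_mult[OF isT_mult[OF isT_mult[OF isT_mult[OF 1 2 ok] 3 ok] 4 ok] isT_phi_self(1) ok] _ this]
 show ?thesis by simp
qed

lemma R_hexagon_right: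
 assumes \<phi>: "drinfeld_associator \<phi>"
 shows "I1 ** Delta_A oo R_A =
  cv 3 (cv 3 (cv 3 (cv 3 (PA 2 1 oo phi' \<phi>) (I1 ** eta_A ** I1 oo R_A))
   (PA 1 1 ** I1 oo phi_A \<phi>)) (R_A ** eta_A)) (phi' \<phi>)"
proof -
 note j = strand2[THEN k_jhom, OF c_jhom(1)] and j12 = strand3[THEN k_jhom, OF c_jhom(2)] and j23 = strand3[THEN k_jhom, OF c_jhom(3)]
  and p12 = isb_P(2)[THEN k_jhom, OF c_jhom(2)] and p23 = isb_P(2)[THEN k_jhom, OF c_jhom(3)]
 have ok: "subst_ok 3 (ch 3 :: _ => 'a jmor)" by (rule subst_ok_ch) simp
 have l: "isT 3 (ch 3) (nc_exp (%w. (t_gen 1 2 + t_gen 1 3) w / 2)) (I1 ** Delta_A oo R_A)" by (rule isT_R[OF strand2(2)], simp, simp, rule isT_two[OF _ _ _ _ _ j(2) EV_c2(2)], simp_all)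
 have 1: "isT 3 (ch 3) (nc_subst (nc_inverse \<phi>) (t_gen 2 3) (t_gen 1 3)) (PA 2 1 oo phi' \<phi>)" by (rule isT_phi(2)[OF isb_P(2)], simp, simp, rule isT_one[OF _ _ _ p12 EV_c3(5)], simp_all)
   (rule isT_one[OF _ _ _ p23 EV_c3(6)], simp_all)
 have 2: "isT 3 (ch 3) (nc_exp (%w. t_gen 1 3 w / 2)) (I1 ** eta_A ** I1 oo R_A)" by (rule isT_R[OF strand2(3)], simp, simp, rule isT_one[OF _ _ _ j(3) EV_c2(3)], simp_all)
 have 3: "isT 3 (ch 3) (nc_subst \<phi> (t_gen 1 2) (t_gen 1 3)) (PA 1 1 ** I1 oo phi_A \<phi>)" by (rule isT_phi(1)[OF strand3(2)], simp, simp, rule isT_one[OF _ _ _ j12(2) EV_c3(3)], simp_all)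
   (rule isT_one[OF _ _ _ j23(2) EV_c3(4)], simp_all)
 have 4: "isT 3 (ch 3) (nc_exp (%w. t_gen 1 2 w / 2)) (R_A ** eta_A)" unfolding tens_eta_right[OF R_jhom]
  by (rule isT_R[OF strand2(4)], simp, simp, rule isT_one[OF _ _ _ j(4) EV_c2(4)], simp_all)
 have "t_eq 3 (nc_exp (%w. (t_gen 1 2 + t_gen 1 3) w / 2))
  (nc_subst (nc_inverse \<phi>) (t_gen 2 3) (t_gen 1 3) \<star> nc_exp (%w. t_gen 1 3 w / 2) \<star> nc_subst \<phi> (t_gen 1 2) (t_gen 1 3)
   \<star> nc_exp (%w. t_gen 1 2 w / 2) \<star> nc_subst (nc_inverse \<phi>) (t_gen 1 2) (t_gen 2 3))" using \<phi> unfolding drinfeld_associator_def Let_def by blast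
 from isT_t_eq[OF l isT_mult[OF isT_mult[OF isT_mult[OF isT_mult[OF 1 2 ok] 3 ok] 4 ok] isT_phi_self(2) ok] _ this]
 show ?thesis by simp
qed

lemma R_triangular: "PA 1 1 oo R_A = R_A"
proof -
 have c: "PA 1 1 oo c_A = (c_A :: 'a jmor)" by (rule jhom_ext[OF k_jhom[OF isb_P(1) c_jhom(1)] c_jhom(1)]) (simp add: EV_c2 EV_cl[OF isl_c])
 show ?thesis unfolding R_A_def by (subst comp_exp[OF isb_P(1) _ scale_hom[OF c_jhom(1)] vz_jscale[OF c_jhom(1) c_vz(1)]])
   (simp_all add: comp_jscale[OF isbD(1)[OF isb_P(1)] c_jhom(1)] c)
qed

section \<open>The element \<nu> and the antipode equations for the associator\<close>

subsection \<open>The element \<open>\<nu>\<close>\<close>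

text \<open>With sources that are not 0, \<open>cv\<close> multiplies the outputs and places the
  sources side by side. So these are the morphisms from 3 to 1 that multiply three strands after the
  antipode on the middle strand, or on the two outer strands.\<close>

abbreviation "zig == cv 1 (cv 1 I1 S_A) I1"
abbreviation "zag == cv 1 (cv 1 S_A I1) S_A"

lemma isb_zig: "isb 3 1 zig [[(3, True), (2, False), (1, True)]]" unfolding cv_1 by (rule isb_subst, rule isb_oo[OF isb_mu], rule isb_tens[of 2 1 _ _ 1 1, simplified],
   rule isb_oo[OF isb_mu isb_tens[OF isb_id1 isb_S, simplified]], simp, rule isb_id1, simp)
  (simp add: bead_simps)

lemma isb_zag: "isb 3 1 zag [[(3, False), (2, True), (1, False)]]" unfolding cv_1 by (rule isb_subst, rule isb_oo[OF isb_mu], rule isb_tens[of 2 1 _ _ 1 1, simplified],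
   rule isb_oo[OF isb_mu isb_tens[OF isb_S isb_id1, simplified]], simp, rule isb_S, simp)
  (simp add: bead_simps)

lemma comp_jadd:
 assumes k: "isx n p k x" and F: "F : jhom m n" "G : jhom m n"
 shows "k oo jadd m n F G = jadd m p (k oo F) (k oo G)"
proof -
 have "k oo jsum m n (%b. if b then F else G) = jsum m p (%b. k oo (if b then F else G))" by (rule comp_jsum[OF k, of _ _ "%_. 0"]) (auto simp: F vz_0[of _ m n])
 thus ?thesis by (simp add: jadd_def if_distrib[of "jcomp k"])
qed

text \<open>The associator differs from the unit by terms of positive degree, and composition with a
  bead diagram \<open>k\<close> preserves this. That suffices for invertibility although
  \<open>k\<close> need not be multiplicative.\<close>

lemma phi_unipotent:
 fixes \<phi> :: "(xy, 'k::field) ncps"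
 assumes k: "isb 3 1 k ws" and \<phi>: "\<phi> [] = 1"
 shows "EX G. cinv 1 (k oo phi_A \<phi>) G"
proof (rule unipotent_inverse)
 show "k oo phi_A \<phi> : jhom 0 1" by (rule k_jhom[OF k phi_jhom(1)])
 let ?m = "jscale (- 1) (et 3) :: 'k jmor"
 have m: "?m : jhom 0 3" by (rule scale_hom[OF et_jhom])
 have P: "isT 3 (case_xy (chord_A 3 1 2) (chord_A 3 2 3)) \<phi> (phi_A \<phi>)" unfolding phi_A_def by (rule isT_conv_subst_xy[OF ok_phi])
 have one: "isT 3 (case_xy (chord_A 3 1 2) (chord_A 3 2 3)) (single []) (et 3 :: 'k jmor)" using isT_single[OF ok_phi, of "[]"] by simp
 have T: "isT 3 (case_xy (chord_A 3 1 2) (chord_A 3 2 3)) (\<phi> + (%w. - 1 * single [] w)) (jadd 0 3 (phi_A \<phi>) ?m)"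
  by (rule isT_add[OF P isT_scale[OF one ok_phi] add_hom[OF phi_jhom(1) m] EV_jadd[OF phi_jhom(1) m] ok_phi])
 have "vz 1 (jadd 0 3 (phi_A \<phi>) ?m)" by (rule isT_vz[OF T ok_phi]) (simp add: \<phi> single_def)
 hence "vz 1 (k oo jadd 0 3 (phi_A \<phi>) ?m)" by (rule vz_comp[OF isbD(1)[OF k] isT_jhom[OF T]])
 thus "vz 1 (jadd 0 1 (k oo phi_A \<phi>) (jscale (- 1) (et 1)))" by (simp add: comp_jadd[OF isbD(1)[OF k] phi_jhom(1) scale_hom] comp_jscale[OF isbD(1)[OF k] et_jhom] comp_et[OF k])
qed

lemma cinv_nu: "\<phi> [] = 1 ==> cinv 1 (zig oo phi_A \<phi>) (nu_A \<phi>)" using phi_unipotent[OF isb_zig, of \<phi>] conv_inverse_eq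
 by (auto simp: nu_A_def mu3_A[OF id_hom mor_jhom(5) id_hom])

lemma cv_strands:
 assumes k: "isb m n k ws" and l: "isb m' n l us" and F: "F : jhom p m" and G: "G : jhom p' m'"
 shows "cv n (k oo F) (l oo G) = mun n oo k ** l oo F ** G" unfolding cv_def tens_comp[OF F isbD(2)[OF k] G isbD(2)[OF l]]
 by (rule comp_assoc[OF tens_hom[OF F G] tens_hom[OF isbD(2)[OF k] isbD(2)[OF l]] mun_jhom, symmetric])

lemma carrier_alt: "w : carrier (free_group m) <-> reduced w & fst ` set w <= {1..m}" by (simp add: free_group_def)

text \<open>
 Both sides arise from the pentagon equation in the form \<open>(\<Delta> \<otimes> I \<otimes> I)\<phi> * (\<phi> \<otimes> \<eta>)\<^sup>-\<^sup>1 = (I \<otimes> I \<otimes> \<Delta>)\<phi>\<^sup>-\<^sup>1 * (\<eta> \<otimes> \<phi>) * (I \<otimes> \<Delta> \<otimes> I)\<phi>\<close>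
 by multiplying the four factors after applying \<open>S\<close> to the first and the third one.
\<close>

lemma zag_eq_zig:
 fixes \<phi> :: "(xy, 'k::field_char_0) ncps"
 assumes \<phi>: "drinfeld_associator \<phi>"
 shows "zag oo phi' \<phi> = zig oo phi_A \<phi>"
proof -
 let ?P = "phi_A \<phi>" and ?Q = "phi' \<phi>"
 let ?D1 = "Delta_A ** I1 ** I1 :: 'k jmor" and ?D2 = "I1 ** Delta_A ** I1 :: 'k jmor" and ?D3 = "I1 ** I1 ** Delta_A :: 'k jmor"
  and ?F1 = "eta_A ** idA 3 :: 'k jmor" and ?F4 = "idA 3 ** eta_A :: 'k jmor"
  and ?e1 = "eps_A ** I1 ** I1 :: 'k jmor" and ?e2 = "I1 ** eps_A ** I1 :: 'k jmor" and ?e3 = "I1 ** I1 ** eps_A :: 'k jmor"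
  and ?q = "mu_A oo zag ** I1 :: 'k jmor"
 let ?A = "?F1 oo ?P" and ?B = "?D2 oo ?P" and ?C = "?F4 oo ?P" and ?D = "?D3 oo ?P" and ?E = "?D1 oo ?P"
  and ?C' = "?F4 oo ?Q" and ?D' = "?D3 oo ?Q"
 note h = strand4[THEN k_jhom, OF phi_jhom(1), of \<phi>] and h' = strand4[THEN k_jhom, OF phi_jhom(2), of \<phi>]
 have ci: "cinv 3 ?P ?Q" by (rule cinv_phi[of \<phi>, OF phi_Nil[OF \<phi>]])
 have C: "cinv 4 ?C ?C'" by (rule cinv_comp[OF strand4(5) _ ci]) simp
 have D: "cinv 4 ?D ?D'" by (rule cinv_comp[OF strand4(3) _ ci]) simp
 have pent: "cv 4 (cv 4 ?A ?B) ?C = cv 4 ?D ?E" using phi_pentagon[OF \<phi>] by (simp add: tens_eta_left[OF phi_jhom(1)] tens_eta_right[OF phi_jhom(1)])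
 have AB: "cv 4 ?A ?B : jhom 0 4" using h by simp
 have "cv 4 ?D (cv 4 ?E ?C') = cv 4 (cv 4 (cv 4 ?A ?B) ?C) ?C'" using cv_assoc[OF h(3) h(1) h'(5)] pent by simp
 also have "... = cv 4 ?A ?B" using cv_assoc[OF AB h(5) h'(5)] C cv_unit_right[OF AB] by (simp add: cinv_def)
 finally have "cv 4 ?D' (cv 4 ?A ?B) = cv 4 (cv 4 ?D' ?D) (cv 4 ?E ?C')" using cv_assoc[OF h'(3) h(3) cv_jhom0[OF h(1) h'(5)]] by simp
 hence eq: "cv 4 ?E ?C' = cv 4 ?D' (cv 4 ?A ?B)" using D cv_unit_left[OF cv_jhom0[OF h(1) h'(5)]] by (simp add: cinv_def)
 have q: "isb 4 1 ?q [[(4, True), (3, False), (2, True), (1, False)]]" by (rule isb_subst[OF isb_oo[OF isb_mu isb_tens[OF isb_zag isb_id1, simplified]]]) (simp_all add: bead_simps)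
 \<comment> \<open>After multiplication by \<open>?q\<close> the letter 1 cancels on the left side
   of the equation, and the letters 3 and 8 cancel on the right. The remaining words factor through
   counits on these strands, followed by \<open>?K1\<close> and \<open>?K2\<close>. The counits turn
   one associator on the left and two on the right into units; only \<open>zag\<close> of the
   inverse and \<open>zig\<close> of the associator are left.\<close>
 let ?K1 = "jdiag_mor 5 1 [[Bead [(2, True), (1, False), (5, False), (4, True), (3, False)]]] :: 'k jmor"
  and ?K2 = "jdiag_mor 7 1 [[Bead [(7, True), (5, True), (4, False), (3, True), (2, True), (1, False), (6, False)]]] :: 'k jmor"
 have K1: "isb 5 1 ?K1 [[(2, True), (1, False), (5, False), (4, True), (3, False)]]" using isb_beads[of "[[[(2, True), (1, False), (5, False), (4, True), (3, False)]]]" 1 5]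
  by (simp add: carrier_alt reduced_def letter_inv_def)
 have K2: "isb 7 1 ?K2 [[(7, True), (5, True), (4, False), (3, True), (2, True), (1, False), (6, False)]]"
  using isb_beads[of "[[[(7, True), (5, True), (4, False), (3, True), (2, True), (1, False), (6, False)]]]" 1 7] by (simp add: carrier_alt reduced_def letter_inv_def)
 have m1: "isb 6 4 (mun 4 oo ?D1 ** ?F4) [[(4, True), (1, True)], [(5, True), (1, True)], [(6, True), (2, True)], [(3, True)]]"
  by (rule isb_subst[OF isb_oo[OF isb_mun(4) isb_tens[OF strand4(1) strand4(5), simplified]]]) (simp_all add: bead_simps)
 have m2: "isb 6 4 (mun 4 oo ?F1 ** ?D2) [[(4, True)], [(5, True), (1, True)], [(5, True), (2, True)], [(6, True), (3, True)]]"
  by (rule isb_subst[OF isb_oo[OF isb_mun(4) isb_tens[OF strand4(4) strand4(2), simplified]]]) (simp_all add: bead_simps)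
 have m3: "isb 9 4 (mun 4 oo ?D3 ** (mun 4 oo ?F1 ** ?D2))
   [[(7, True), (1, True)], [(8, True), (4, True), (2, True)], [(8, True), (5, True), (3, True)], [(9, True), (6, True), (3, True)]]"
  by (rule isb_subst[OF isb_oo[OF isb_mun(4) isb_tens[OF strand4(3) m2, simplified]]]) (simp_all add: bead_simps)
 have t1: "isb 6 5 (?e1 ** idA 3) [[(2, True)], [(3, True)], [(4, True)], [(5, True)], [(6, True)]]" by (rule isb_subst[OF isb_tens[OF strand_eps(1) isb_id(2), simplified]]) (simp add: bead_simps)
 have t2: "isb 6 5 (idA 3 ** ?e2) [[(1, True)], [(2, True)], [(3, True)], [(4, True)], [(6, True)]]" by (rule isb_subst[OF isb_tens[OF isb_id(2) strand_eps(2), simplified]]) (simp add: bead_simps)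
 have t3: "isb 9 7 (?e3 ** (idA 3 ** ?e2)) [[(1, True)], [(2, True)], [(4, True)], [(5, True)], [(6, True)], [(7, True)], [(9, True)]]"
  by (rule isb_subst[OF isb_tens[OF strand_eps(3) t2, simplified]]) (simp add: bead_simps)
 have EQ1: "?q oo (mun 4 oo ?D1 ** ?F4) = ?K1 oo ?e1 ** idA 3" by (rule isb_eqI[OF isb_oo[OF q m1 refl] isb_oo[OF K1 t1 refl] refl refl]) (simp add: bead_simps)
 have EQ2: "?q oo (mun 4 oo ?D3 ** (mun 4 oo ?F1 ** ?D2)) = ?K2 oo ?e3 ** (idA 3 ** ?e2)" by (rule isb_eqI[OF isb_oo[OF q m3 refl] isb_oo[OF K2 t3 refl] refl refl]) (simp add: bead_simps)
 have u1: "isb 3 5 (et 2 ** idA 3) [[], [], [(1, True)], [(2, True)], [(3, True)]]" by (rule isb_subst[OF isb_tens[OF isb_et(2) isb_id(2), simplified]]) (simp add: bead_simps)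
 have u2: "isb 3 7 (et 2 ** (idA 3 ** et 2)) [[], [], [(1, True)], [(2, True)], [(3, True)], [], []]"
  by (rule isb_subst[OF isb_tens[OF isb_et(2) isb_tens[OF isb_id(2) isb_et(2)], simplified]]) (simp add: bead_simps)
 have EQ3: "?K1 oo et 2 ** idA 3 = zag" by (rule isb_eqI[OF isb_oo[OF K1 u1 refl] isb_zag refl refl]) (simp add: bead_simps)
 have EQ4: "?K2 oo et 2 ** (idA 3 ** et 2) = zig" by (rule isb_eqI[OF isb_oo[OF K2 u2 refl] isb_zig refl refl]) (simp add: bead_simps)
 note hP = phi_jhom(1)[of \<phi>] and hQ = phi_jhom(2)[of \<phi>]
 have PQ: "?P ** ?Q : jhom 0 6" and PP: "?P ** ?P : jhom 0 6" using tens_hom[OF hP hQ] tens_hom[OF hP hP] by simp_all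
 have QPP: "?Q ** (?P ** ?P) : jhom 0 9" using tens_hom[OF hQ PP] by simp
 have L: "?q oo cv 4 ?E ?C' = zag oo ?Q"
 proof -
  have "?q oo cv 4 ?E ?C' = ?K1 oo ?e1 ** idA 3 oo ?P ** ?Q" unfolding cv_strands[OF strand4(1,5) hP hQ] using comp_assoc[OF PQ isbD(2)[OF m1] isbD(2)[OF q]] EQ1 by simp
  also have "... = ?K1 oo (?e1 oo ?P) ** (idA 3 oo ?Q)" using comp_assoc[OF PQ isbD(2)[OF t1] isbD(2)[OF K1]] tens_comp[OF hP isbD(2)[OF strand_eps(1)] hQ isbD(2)[OF isb_id(2)]] by simp
  also have "... = ?K1 oo (et 2 oo idA 0) ** (idA 3 oo ?Q)" by (simp add: phi_eps13(1)[OF \<phi>] jcomp_Ident_right[OF et_jhom])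
  also have "... = ?K1 oo (et 2 ** idA 3 oo ?Q)" using tens_comp[OF isbD(2)[OF isb_id0] et_jhom hQ isbD(2)[OF isb_id(2)], of 2] jtens_unit_left[OF hQ] by simp
  also have "... = zag oo ?Q" using comp_assoc[OF hQ isbD(2)[OF u1] isbD(2)[OF K1]] EQ3 by simp
  finally show ?thesis .
 qed
 have e2: "?e2 oo ?P = et 2" by (rule phi_eps2[of \<phi>, OF phi_Nil[OF \<phi>]])
 have e3: "?e3 oo ?Q = et 2"
 proof (rule cinv_unique)
  show "cinv 2 (et 2) (?e3 oo ?Q)" using cinv_comp[OF strand_eps(3) _ ci] phi_eps13(2)[OF \<phi>] by simp
  show "cinv 2 (et 2) (et 2 :: 'k jmor)" by (simp add: cinv_def cv_unit_left[OF et_jhom])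
 qed
 have R: "?q oo cv 4 ?D' (cv 4 ?A ?B) = zig oo ?P"
 proof -
  have "?q oo cv 4 ?D' (cv 4 ?A ?B) = ?K2 oo ?e3 ** (idA 3 ** ?e2) oo ?Q ** (?P ** ?P)" unfolding cv_strands[OF strand4(4,2) hP hP] cv_strands[OF strand4(3) m2 hQ PP]
   using comp_assoc[OF QPP isbD(2)[OF m3] isbD(2)[OF q]] EQ2 by simp
  also have "... = ?K2 oo (?e3 oo ?Q) ** ((idA 3 oo ?P) ** (?e2 oo ?P))" using comp_assoc[OF QPP isbD(2)[OF t3] isbD(2)[OF K2]] tens_comp[OF hQ isbD(2)[OF strand_eps(3)] PP isbD(2)[OF t2]]
   tens_comp[OF hP isbD(2)[OF isb_id(2)] hP isbD(2)[OF strand_eps(2)]] by simp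
  also have "... = ?K2 oo (et 2 oo idA 0) ** ((idA 3 oo ?P) ** (et 2 oo idA 0))" by (simp add: e2 e3 jcomp_Ident_right[OF et_jhom])
  also have "... = ?K2 oo (et 2 ** (idA 3 ** et 2) oo ?P)"
  proof -
   have "(idA 3 oo ?P) ** (et 2 oo idA 0) = idA 3 ** et 2 oo ?P" using tens_comp[OF hP isbD(2)[OF isb_id(2)] isbD(2)[OF isb_id0] et_jhom, of 2] jtens_unit_right[OF hP] by simp
   moreover have "idA 3 ** et 2 : (jhom 3 5 :: 'k jmor set)" using isbD(2)[OF isb_tens[OF isb_id(2) isb_et(2)]] by simp
   ultimately show ?thesis using tens_comp[OF isbD(2)[OF isb_id0] et_jhom hP, of "idA 3 ** et 2" 5 2] jtens_unit_left[OF hP] by simp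
  qed
  also have "... = zig oo ?P" using comp_assoc[OF hP isbD(2)[OF u2] isbD(2)[OF K2]] EQ4 by simp
  finally show ?thesis .
 qed
 show ?thesis using L R eq by simp
qed

section \<open>The ribbon element\<close>

subsection \<open>The ribbon element\<close>

lemma cv_commute_linear:
 assumes X: "X : jhom 0 n" and Y: "Y : jhom 0 n" and Z: "Z : jhom 0 n" "!!g. jacb g ==> EV Z g = a * EV X g + b * EV Y g"
  and H: "H : jhom 0 n" and c: "cv n X H = cv n H X" "cv n Y H = cv n H Y"
 shows "cv n Z H = cv n H Z"
proof (rule jhom_ext[OF cv_jhom0[OF Z(1) H] cv_jhom0[OF H Z(1)]])
 fix g :: "'a jfn" assume g: "jacb g"
 obtain g1 where g1: "jacb g1" "ALL X:jhom 0 n. EV (cv n (et n) (cv n X H)) g = EV X g1" using cv_context[OF et_jhom H g] .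
 obtain g2 where g2: "jacb g2" "ALL X:jhom 0 n. EV (cv n H (cv n X (et n))) g = EV X g2" using cv_context[OF H et_jhom g] .
 have 1: "EV (cv n W H) g = EV W g1" if "W : jhom 0 n" for W using g1(2) that cv_unit_left[OF cv_jhom0[OF that H]] by metis
 have 2: "EV (cv n H W) g = EV W g2" if "W : jhom 0 n" for W using g2(2) that cv_unit_right[OF that] by metis
 show "EV (cv n Z H) g = EV (cv n H Z) g" using 1[OF X] 2[OF X] 1[OF Y] 2[OF Y] c by (simp add: 1 2 Z g1(1) g2(1))
qed

lemma cv_commute_scale:
 assumes "X : jhom 0 n" "H : jhom 0 n" "cv n X H = cv n H X"
 shows "cv n (jscale a X) H = cv n H (jscale a X)" using cv_commute_linear[OF assms(1,1) scale_hom[OF assms(1)] _ assms(2,3,3), of a a 0] EV_jscale[OF assms(1)] by simp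

lemma cv_commute_scales:
 assumes "X : jhom 0 n" "Y : jhom 0 n" "cv n X Y = cv n Y X"
 shows "cv n (jscale a X) (jscale b Y) = cv n (jscale b Y) (jscale a X)" using cv_commute_scale[OF assms(1) scale_hom[OF assms(2)] cv_commute_scale[OF assms(2,1) assms(3)[symmetric], symmetric]] .

lemma cv_commute_add:
 assumes "X : jhom 0 n" "Y : jhom 0 n" "H : jhom 0 n" "cv n X H = cv n H X" "cv n Y H = cv n H Y"
 shows "cv n (jadd 0 n X Y) H = cv n H (jadd 0 n X Y)" using cv_commute_linear[OF assms(1,2) add_hom[OF assms(1,2)] _ assms(3-5), of 1 1] EV_jadd[OF assms(1,2)] by simp

abbreviation "loop_A == mu_A oo c_A"

lemma isl_loop: "isl 1 loop_A (cl 1 1 0)" by (rule isl_I[OF k_jhom[OF isb_mu c_jhom(1)] EV_c2(7)])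

lemma loop_jhom [simp]: "loop_A : jhom 0 1" and loop_vz: "vz 1 loop_A" using chord_vz[OF isl_loop] by auto

lemma r_jhom [simp]: "r_A : jhom 0 1" unfolding r_A_def by (rule exp_jhom[OF scale_hom[OF loop_jhom] vz_jscale[OF loop_jhom loop_vz]])

lemma cinv_r: "cinv 1 r_A (exp_conv 1 (jscale (- 1) (jscale (1 / 2) loop_A)))" unfolding r_A_def by (rule exp_inverse[OF scale_hom[OF loop_jhom] vz_jscale[OF loop_jhom loop_vz]])

text \<open>The antipode reverses products, but elements with source 0 and target 1 commute, so on
  them it is multiplicative. This compensates for S not being covered by
  \<open>comp_cv\<close>.\<close>

lemma antip_cv:
 assumes F: "F : jhom 0 1" and G: "G : jhom 0 1"
 shows "S_A oo cv 1 F G = cv 1 (S_A oo F) (S_A oo G)"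
proof -
 note SF = comp_hom[OF mor_jhom(5) F] and SG = comp_hom[OF mor_jhom(5) G]
 have FG: "F ** G : jhom 0 2" "(S_A oo F) ** (S_A oo G) : jhom 0 2" "(S_A oo G) ** (S_A oo F) : jhom 0 2" using tens_hom[OF F G] tens_hom[OF SF SG] tens_hom[OF SG SF] by simp_all
 have SS: "S_A ** S_A : (jhom 2 2 :: 'a jmor set)" using tens_hom[OF mor_jhom(5,5)] by simp
 note P = isbD(2)[OF isb_P(1)]
 have "S_A oo cv 1 F G = mu_A oo PA 1 1 oo S_A ** S_A oo F ** G" using comp_assoc[OF FG(1) mor_jhom(1,5)] by (simp add: cv_1 antip_mu)
 also have "... = mu_A oo (PA 1 1 oo (S_A oo F) ** (S_A oo G))" using comp_assoc[OF FG(1) SS comp_hom[OF mor_jhom(1) P]] comp_assoc[OF FG(2) P mor_jhom(1)]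
   tens_comp[OF F mor_jhom(5) G mor_jhom(5)] by simp
 also have "... = cv 1 (S_A oo G) (S_A oo F)" using jsymm_natural[OF SF SG] jcomp_Ident_right[OF FG(3)] by (simp add: Symm_0 cv_1)
 finally show ?thesis using cv_central[OF SF SG] by simp
qed

lemma antip_rib: "S_A oo r_A = (r_A :: 'k::field_char_0 jmor)"
proof -
 \<comment> \<open>The two ends of the loop contribute two signs, which cancel, and reversal only
   exchanges the ends.\<close>
 have loop: "S_A oo loop_A = (loop_A :: 'k jmor)" by (rule jhom_ext[OF k_jhom[OF isb_S loop_jhom] loop_jhom])
   (simp add: EV_cl[OF isl_loop], subst EV_comp_isl[OF isb_S isl_loop], simp_all add: lw_eval)
 let ?a = "jscale (1 / 2) loop_A :: 'k jmor"
 have h: "?a : jhom 0 1" "vz 1 ?a" by (rule scale_hom[OF loop_jhom], rule vz_jscale[OF loop_jhom loop_vz])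
 have a: "S_A oo ?a = ?a" using comp_jscale[OF isbD(1)[OF isb_S] loop_jhom] loop by metis
 have w: "S_A oo conv_power A_hat alg_A 1 ?a j = conv_power A_hat alg_A 1 ?a j" for j
 proof (induction j)
  case 0
  thus ?case by (simp add: comp_et[OF isb_S])
 next
  case (Suc j)
  thus ?case using antip_cv[OF h(1) power_hom[OF h(1)]] a by simp
 qed
 have fin: "finite {i::nat. i <= d}" for d by simp
 show ?thesis unfolding r_A_def exp_conv_def by (subst comp_jsum[OF isbD(1)[OF isb_S] scale_hom[OF power_hom[OF h(1)]] vz_jscale[OF power_hom[OF h(1)] conv_power_vz[OF h]] fin])
   (simp add: comp_jscale[OF isbD(1)[OF isb_S] power_hom[OF h(1)]] w)
qed

lemma tens_rib: "r_A ** r_A = cv 2 (I1 ** eta_A oo r_A) (eta_A ** I1 oo r_A)"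
proof -
 have m: "mun 2 oo I1 ** eta_A ** (eta_A ** I1) = (idA 2 :: 'a jmor)" by (rule isb_eqI[OF isb_oo[OF isb_mun(2) isb_tens[OF strand1]] isb_id(1)]) (simp_all add: bead_simps)
 have "r_A ** r_A : (jhom 0 2 :: 'a jmor set)" using tens_hom[OF r_jhom r_jhom] by simp
 thus ?thesis unfolding cv_strands[OF strand1 r_jhom r_jhom] m by (simp add: jcomp_Ident_left)
qed

text \<open>
 The image of the loop under \<open>\<Delta>\<close> is the sum of the loops on the two strands and of twice the
 chord between them, and these summands commute.
\<close>

lemma delta_rib:
 "Delta_A oo r_A = cv 2 (cv 2 (PA 1 1 oo R_A) R_A) (r_A ** r_A)"
proof -
 let ?C1 = "I1 ** eta_A oo loop_A :: 'a jmor" and ?C2 = "eta_A ** I1 oo loop_A :: 'a jmor"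
  and ?D = "Delta_A oo loop_A :: 'a jmor" and ?c = "c_A :: 'a jmor"
 let ?h = "jscale (1 / 2) :: 'a jmor => 'a jmor"
 have C1: "EV ?C1 g = g (lw 2 (cl 1 1 1))" and C2: "EV ?C2 g = g (lw 2 (cl 2 2 1))"
  and D: "EV ?D g = g (lw 2 (cl 1 1 1)) + g (lw 2 (cl 2 2 1)) + 2 * g (lw 2 (cl 1 2 1))" if "jacb g" for g
  unfolding EV_comp_isl[OF strand1(1) isl_loop that] EV_comp_isl[OF strand1(2) isl_loop that] EV_comp_isl[OF isb_Delta isl_loop that] by (simp_all add: lw_eval)
 have h: "?C1 : jhom 0 2" "?C2 : jhom 0 2" "?D : jhom 0 2" "?c : jhom 0 2" using strand1[THEN k_jhom, OF loop_jhom] isb_Delta[THEN k_jhom, OF loop_jhom] by simp_all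
 have v: "vz 1 ?C1" "vz 1 ?C2" "vz 1 ?D" "vz 1 ?c" using vz_comp[OF isbD(1)[OF strand1(1)] loop_jhom loop_vz] vz_comp[OF isbD(1)[OF strand1(2)] loop_jhom loop_vz]
   vz_comp[OF isbD(1)[OF isb_Delta] loop_jhom loop_vz] c_vz(1) by simp_all
 note hh = h[THEN scale_hom, of "1 / 2"]
 have hv: "vz 1 (?h ?C1)" "vz 1 (?h ?C2)" "vz 1 (?h ?D)" "vz 1 (?h ?c)" by (rule vz_jscale[OF h(1) v(1)], rule vz_jscale[OF h(2) v(2)], rule vz_jscale[OF h(3) v(3)], rule vz_jscale[OF h(4) v(4)])
 have i1: "isl 2 ?C1 (cl 1 1 0)" by (rule isl_I[OF h(1) C1])
 have i2: "isl 2 ?C2 (cl 2 2 0)" by (rule isl_I[OF h(2) C2])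
 have k12: "cv 2 ?C1 ?C2 = cv 2 ?C2 ?C1" by (rule chord_locality[OF i1 i2]) simp
 have k1: "cv 2 ?C1 ?c = cv 2 ?c ?C1" by (rule chord_isolated[OF i1 isl_c]) simp_all
 have k2: "cv 2 ?C2 ?c = cv 2 ?c ?C2"
 proof (rule chord_isolated[OF i2])
  show "isl 2 ?c (cl 2 1 0)" using isl_c cl_commute by metis
 qed simp_all
 have R: "R_A = exp_conv 2 (?h ?c)" by (simp add: R_A_def)
 have r': "k oo r_A = exp_conv 2 (?h (k oo loop_A))" if "isb 1 2 k ws" "alg_words ws" for k ws unfolding r_A_def comp_exp[OF that scale_hom[OF loop_jhom] vz_jscale[OF loop_jhom loop_vz]]
  by (simp add: comp_jscale[OF isbD(1)[OF that(1)] loop_jhom])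
 have r: "I1 ** eta_A oo r_A = exp_conv 2 (?h ?C1)" "eta_A ** I1 oo r_A = exp_conv 2 (?h ?C2)"
  "Delta_A oo r_A = exp_conv 2 (?h ?D)" using r'[OF strand1(1)] r'[OF strand1(2)] r'[OF isb_Delta] by simp_all
 \<comment> \<open>The image of half the loop is split as \<open>?X\<close> plus \<open>?Y\<close>:
   \<open>?X\<close> is twice half the chord and exponentiates to the square of R, while
   \<open>?Y\<close> consists of the halved loops on the two strands and exponentiates to the tensor
   square of the ribbon element.\<close>
 let ?X = "jadd 0 2 (?h ?c) (?h ?c)" and ?Y = "jadd 0 2 (?h ?C1) (?h ?C2)"
 have X: "?X : jhom 0 2" "vz 1 ?X" by (rule add_hom[OF hh(4,4)], rule vz_jadd[OF hh(4,4) hv(4,4)])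
 have Y: "?Y : jhom 0 2" "vz 1 ?Y" by (rule add_hom[OF hh(1,2)], rule vz_jadd[OF hh(1,2) hv(1,2)])
 have Yc: "cv 2 ?Y (?h ?c) = cv 2 (?h ?c) ?Y" by (rule cv_commute_add[OF hh(1,2,4) cv_commute_scales[OF h(1,4) k1] cv_commute_scales[OF h(2,4) k2]])
 have XY: "cv 2 ?X ?Y = cv 2 ?Y ?X" by (rule cv_commute_add[OF hh(4,4) Y(1) Yc[symmetric] Yc[symmetric]])
 have EX: "exp_conv 2 ?X = cv 2 R_A R_A" unfolding R by (rule exp_sum[OF hh(4) hv(4) hh(4) hv(4) X refl EV_jadd[OF hh(4,4)]])
 have EY: "exp_conv 2 ?Y = r_A ** r_A" unfolding tens_rib r by (rule exp_sum[OF hh(1) hv(1) hh(2) hv(2) Y cv_commute_scales[OF h(1,2) k12] EV_jadd[OF hh(1,2)]])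
 have "exp_conv 2 (?h ?D) = cv 2 (exp_conv 2 ?X) (exp_conv 2 ?Y)" by (rule exp_sum[OF X Y hh(3) hv(3) XY])
   (simp add: EV_jadd[OF hh(4,4)] EV_jadd[OF hh(1,2)] EV_jscale[OF h(1)] EV_jscale[OF h(2)] EV_jscale[OF h(3)] EV_jscale[OF h(4)] C1 C2 D EV_cl[OF isl_c] algebra_simps)
 thus ?thesis by (simp add: r R_triangular EX EY)
qed

section \<open>Assembly of the axioms\<close>

subsection \<open>Assembling the axioms\<close>

text \<open>Convolution and its inverses depend only on the underlying algebra, so what has been
  proved for \<open>alg_A\<close> applies to every richer structure on the same algebra.\<close>

lemma conv_H:
 fixes H :: "(nat, 'k::field jmor, 'y) algebra_data_scheme"
 assumes H: "Car H = 1" "Mu H = mu_A" "Eta H = eta_A"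
 shows "mu_pow A_hat H n = mun n" "conv A_hat H n F G = cv n F G"
  "conv_inverse A_hat H n F = conv_inverse A_hat alg_A n F" "conv_invertible A_hat H n F = conv_invertible A_hat alg_A n F"
  "mu3 A_hat H = mu3 A_hat alg_A" "mu5 A_hat H = mu5 A_hat alg_A"
proof -
 have e: "eta_pow A_hat H n = et n" for n by (induction n) (simp_all add: H)
 have m: "mu_pow A_hat H n = mun n" for n by (induction n) (simp_all add: H)
 show "mu_pow A_hat H n = mun n" by (rule m)
 have c: "conv A_hat H n F G = cv n F G" for n F G by (simp add: conv_def m)
 show "conv A_hat H n F G = cv n F G" by (rule c)
 have i: "is_conv_inverse A_hat H n F = is_conv_inverse A_hat alg_A n F" for n F by (rule ext) (simp add: is_conv_inverse_def c e H)
 show "conv_inverse A_hat H n F = conv_inverse A_hat alg_A n F" "conv_invertible A_hat H n F = conv_invertible A_hat alg_A n F" by (simp_all add: conv_inverse_def conv_invertible_def i H)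
 show m3: "mu3 A_hat H = mu3 A_hat alg_A" by (simp add: mu3_def H)
 show "mu5 A_hat H = mu5 A_hat alg_A" by (simp add: mu5_def m3 H)
qed

text \<open>With \<alpha> and \<beta> moved out as central factors, the antipode equations are those
  of S, and the two equations with the associator say that \<alpha> and \<beta> together invert
  \<open>zig oo phi_A \<phi>\<close>. The remaining axioms are the results above, with the
  convolution inverses made explicit.\<close>

lemma H_assoc_beta_ribbon:
 fixes \<phi> :: "(xy, 'k::field_char_0) ncps"
 assumes \<phi>: "drinfeld_associator \<phi>" and \<beta>: "conv_invertible A_hat alg_A 1 \<beta>"
 shows "tcs_ribbon_quasi_Hopf_algebra A_hat (H_assoc_beta \<phi> \<beta>)"
proof -
 define H where "H = H_assoc_beta \<phi> \<beta>"
 obtain \<beta>' where b: "cinv 1 \<beta> \<beta>'" using \<beta> conv_invertible_iff by blast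
 hence bh: "\<beta> : jhom 0 1" "\<beta>' : jhom 0 1" by (auto simp: cinv_def)
 let ?\<nu> = "nu_A \<phi>" and ?P = "phi_A \<phi>" and ?Q = "phi' \<phi>" and ?\<alpha> = "cv 1 (nu_A \<phi>) \<beta>'"
 have n: "cinv 1 (zig oo ?P) ?\<nu>" by (rule cinv_nu[of \<phi>, OF phi_Nil[OF \<phi>]])
 hence nh: "?\<nu> : jhom 0 1" "zig oo ?P : jhom 0 1" by (auto simp: cinv_def)
 note ah = cv_jhom0[OF nh(1) bh(2)]
 have a: "cinv 1 ?\<alpha> (cv 1 \<beta> (zig oo ?P))" by (rule cinv_cv[OF cinv_sym[OF n] cinv_sym[OF b]])
 have F: "Car H = 1" "Mu H = mu_A" "Eta H = eta_A" "Delta H = Delta_A" "Counit H = eps_A" "Phi H = ?P" "Antip H = S_A"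
  "Alpha H = ?\<alpha>" "Beta H = \<beta>" "Rmat H = R_A" "Rib H = r_A" using conv_inverse_eq[OF b] by (simp_all add: H_def H_assoc_beta_def)
 note H_simps = F conv_H[of H, OF F(1-3)] A_hat_simps one_add_one
 have ci: "cinv 3 ?P ?Q" by (rule cinv_phi[of \<phi>, OF phi_Nil[OF \<phi>]])
 have inverses: "conv_inverse A_hat alg_A 3 ?P = ?Q" "conv_inverse A_hat alg_A 2 R_A = exp_conv 2 (jscale (- 1) (jscale (1 / 2) c_A))"
  "conv_inverse A_hat alg_A 3 (I1 ** PA 1 1 oo ?P) = I1 ** PA 1 1 oo ?Q"
  "conv_inverse A_hat alg_A 3 (PA 2 1 oo ?P) = PA 2 1 oo ?Q" by (rule conv_inverse_eq[OF ci], rule conv_inverse_eq[OF cinv_R],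
   (rule conv_inverse_eq[OF cinv_comp[OF strand3(1) _ ci]], simp), (rule conv_inverse_eq[OF cinv_comp[OF isb_P(2) _ ci]], simp))
 have invertibles: "conv_invertible A_hat alg_A 3 ?P" "conv_invertible A_hat alg_A 1 ?\<alpha>" "conv_invertible A_hat alg_A 1 \<beta>"
  "conv_invertible A_hat alg_A 2 R_A" "conv_invertible A_hat alg_A 1 r_A" using ci a b cinv_R cinv_r unfolding conv_invertible_iff by blast+
 have coassoc: "I1 ** Delta_A oo Delta_A = cv 3 (cv 3 ?P (Delta_A ** I1 oo Delta_A)) ?Q" using conjugation_trivial[OF ci isb_delta3] delta_coassoc by metis
 have phi_counit: "I1 ** eps_A ** I1 oo ?P = eta_A ** eta_A" unfolding phi_eps2[of \<phi>, OF phi_Nil[OF \<phi>]]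
  by (rule isb_eqI[OF isb_et(2) isb_tens[OF isb_eta isb_eta]]) (simp_all add: word_shift_def)
 have R_delta: "cv 2 (cv 2 R_A Delta_A) (exp_conv 2 (jscale (- 1) (jscale (1 / 2) c_A))) = PA 1 1 oo (Delta_A :: 'k jmor)" using conjugation_trivial[OF cinv_R isb_delta2] delta_cocommutative by metis
 have antipode_bij: "EX T:jhom 1 1. T oo S_A = I1 & S_A oo T = (I1 :: 'k jmor)" using antip_square mor_jhom(5) by blast
 have eps: "cv 1 x (eta_A oo eps_A) = x oo eps_A" if x: "x : jhom 0 1" for x :: "'k jmor" using cv_comp_left[OF x mor_jhom(2,3)] cv_unit_right[OF x] by (simp add: et_1)
 note cv11 = cv_jhom[OF mor_jhom(5) id_hom[of 1], unfolded one_add_one] cv_jhom[OF id_hom[of 1] mor_jhom(5), unfolded one_add_one]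
 have antip_alpha: "mu3 A_hat alg_A oo S_A ** ?\<alpha> ** I1 oo Delta_A = ?\<alpha> oo eps_A" using cv_assoc[OF ah mor_jhom(5) id_hom[of 1]] cv_comp_left[OF ah cv11(1) mor_jhom(4)]
  by (simp add: mu3_A[OF mor_jhom(5) ah id_hom] cv_central[OF ah mor_jhom(5)] antipode_left eps[OF ah])
 have antip_beta: "mu3 A_hat alg_A oo I1 ** \<beta> ** S_A oo Delta_A = \<beta> oo eps_A" using cv_assoc[OF bh(1) id_hom[of 1] mor_jhom(5)] cv_comp_left[OF bh(1) cv11(2) mor_jhom(4)]
  by (simp add: mu3_A[OF id_hom bh(1) mor_jhom(5)] cv_central[OF bh(1) id_hom] antipode_right eps[OF bh(1)])
 have n1: "cv 1 ?\<nu> (zig oo ?P) = et 1" and b1: "cv 1 \<beta> \<beta>' = et 1" "cv 1 \<beta>' \<beta> = et 1" using n b by (auto simp: cinv_def)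
 \<comment> \<open>As \<alpha> is \<nu> times the inverse of \<beta> and \<nu> is inverse to the
   image of the associator under \<open>zig\<close>, only the inverse of \<beta> is left, and it
   cancels against \<beta>.\<close>
 have 1: "cv 1 \<beta> (cv 1 ?\<alpha> (zig oo ?P)) = eta_A"
 proof -
  have "cv 1 ?\<alpha> (zig oo ?P) = \<beta>'" using cv_assoc[OF bh(2) nh] cv_central[OF bh(2) nh(1)] n1 cv_unit_right[OF bh(2)] by simp
  thus ?thesis using b1 by (simp add: et_1)
 qed
 have 2: "cv 1 ?\<alpha> (cv 1 \<beta> (zig oo ?P)) = eta_A"
 proof -
  have "cv 1 \<beta>' (cv 1 \<beta> (zig oo ?P)) = zig oo ?P" using cv_assoc[OF bh(2,1) nh(2)] b1 cv_unit_left[OF nh(2)] by simp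
  thus ?thesis using cv_assoc[OF nh(1) bh(2) cv_jhom0[OF bh(1) nh(2)]] n1 by (simp add: et_1)
 qed
 note zig_jhom = isbD(2)[OF isb_zig] and zag_jhom = isbD(2)[OF isb_zag]
 have z: "cv 1 x K : jhom 3 1" if "x : jhom 0 1" "K : jhom 3 1" for x K :: "'k jmor" using cv_jhom[OF that] by simp
 have antip_phi: "mu5 A_hat alg_A oo I1 ** \<beta> ** S_A ** ?\<alpha> ** I1 oo ?P = eta_A"
  unfolding mu5_A[OF id_hom bh(1) mor_jhom(5) ah id_hom] cv_scalars[OF bh(1) ah id_hom mor_jhom(5) id_hom]
   cv_comp_left[OF bh(1) z[OF ah zig_jhom] phi_jhom(1)] cv_comp_left[OF ah zig_jhom phi_jhom(1)] by (rule 1)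
 have antip_phi_inverse: "mu5 A_hat alg_A oo S_A ** ?\<alpha> ** I1 ** \<beta> ** S_A oo ?Q = eta_A"
  unfolding mu5_A[OF mor_jhom(5) ah id_hom bh(1) mor_jhom(5)] cv_scalars[OF ah bh(1) mor_jhom(5) id_hom mor_jhom(5)]
   cv_comp_left[OF ah z[OF bh(1) zag_jhom] phi_jhom(2)] cv_comp_left[OF bh(1) zag_jhom phi_jhom(2)] zag_eq_zig[OF \<phi>] by (rule 2)
 have special: "ALL x:jhom 0 1. mu_A oo I1 ** x = mu_A oo (x ** I1 :: 'k jmor)"
 proof
  fix x :: "'k jmor" assume "x : jhom 0 1"
  from cv_central[OF this id_hom[of 1]] show "mu_A oo I1 ** x = mu_A oo x ** I1" by (simp add: cv_1)
 qed
 interpret ribbon_quasi_Hopf_algebra A_hat H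
  apply unfold_locales
  apply (unfold H_simps inverses)
  apply (rule UNIV_I mor_jhom mu_assoc mu_unit_left mu_unit_right delta_mu delta_eta eps_mu eps_eta counit_left counit_right
   invertibles coassoc phi_pentagon[OF \<phi>] phi_counit antipode_bij antip_mu antip_eta antip_alpha antip_beta antip_phi antip_phi_inverse
   R_delta R_hexagon_left[OF \<phi>] R_hexagon_right[OF \<phi>] antip_rib delta_rib)+
  done
 have "ribbon_quasi_Hopf_algebra A_hat H" by unfold_locales
 moreover have "triangular" unfolding triangular_def H_simps by (rule R_triangular)
 moreover have "cocommutative" unfolding cocommutative_def H_simps by (rule delta_cocommutative)
 moreover have "special" unfolding special_def H_simps by (rule special)
 ultimately show ?thesis unfolding tcs_ribbon_quasi_Hopf_algebra_def H_def by blast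
qed

theorem theorem1p8:
  fixes \<phi> :: "(xy, 'k::field_char_0) ncps"
  assumes "drinfeld_associator \<phi>"
  shows "(\<forall>\<beta>. conv_invertible A_hat alg_A 1 \<beta> \<longrightarrow>
             tcs_ribbon_quasi_Hopf_algebra A_hat (H_assoc_beta \<phi> \<beta>)) \<and>
         tcs_ribbon_quasi_Hopf_algebra A_hat (H_assoc \<phi>)"
proof -
 have "cinv 1 eta_A (eta_A :: 'k jmor)" unfolding et_1[symmetric] by (simp add: cinv_def cv_unit_left[OF et_jhom])
 hence "conv_invertible A_hat alg_A 1 (eta_A :: 'k jmor)" using conv_invertible_iff by blast
 thus ?thesis using H_assoc_beta_ribbon[OF assms] by (simp add: H_assoc_def)
qed

end
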